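(* Let $N\ge 1$ be an integer, let $s\in(0,1)$, let $1<p<\infty$, and let $\mathcal{L}=-\Delta+(-\Delta)^s$ on $\mathbb{R}^N$. Set $$\overline{p}=1+\frac{2s}{N},$$ and, for a nonnegative $u_0\in L^\infty(\mathbb{R}^N)$, consider the Cauchy problem $$\begin{cases}\partial_t u+\mathcal{L}u=u^p & \text{in }\mathbb{R}^N\times(0,+\infty),\\ u=u_0 & \text{in }\mathbb{R}^N\times\{0\}.\end{cases}\qquad (P_{u_0})$$ Then the following hold. 1) (Non-existence) If $1<p\le\overline{p}$, then for every $u_0\in L^\infty(\mathbb{R}^N)$ with $u_0\ge 0$ and $u_0\not\equiv 0$ (i.e. $u_0$ is not a.e. equal to $0$), there does not exist any global in time very weak solution of $(P_{u_0})$. 2) (Global existence) If $p>\overline{p}$, then there exist $\delta_0,\tau_0>0$ such that, for every $u_0\in L^\infty(\mathbb{R}^N)$ with $u_0\ge 0$ and $$u_0(x)<\delta_0\,\mathfrak{p}_{\tau_0}(x)\quad\text{for a.e. }x\in\mathbb{R}^N,$$ the problem $(P_{u_0})$ possesses at least one global in time very weak solution. Here $\mathfrak{p}_t$ is the heat kernel of $-\mathcal{L}$.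
   Context: Notation. $S=\mathbb{R}^N\times(0,+\infty)$, $\overline{S}=\mathbb{R}^N\times[0,+\infty)$, and $B_r$ is the open Euclidean ball of radius $r$ centred at $0$ in $\mathbb{R}^N$. Fractional Laplacian. For $s\in(0,1)$, $$(-\Delta)^s v(x)=C_{N,s}\lim_{\varepsilon\to0^+}\int_{\{|x-y|\ge\varepsilon\}}\frac{v(x)-v(y)}{|x-y|^{N+2s}}\,dy,\qquad C_{N,s}=\frac{2^{2s-1}\,2s\,\Gamma((N+2s)/2)}{\pi^{N/2}\,\Gamma(1-s)},$$ whenever the limit exists and is finite. For $v$ in the Schwartz space this is the Fourier multiplier operator with symbol $|\xi|^{2s}$. For a function $\varphi(x,t)$, $\mathcal{L}\varphi=-\Delta\varphi+(-\Delta)^s\varphi$ is computed with respect to $x$ only, for each fixed $t$. Heat kernel of $-\mathcal{L}$. For $t>0$ and $z\in\mathbb{R}^N$, $$\mathfrak{p}_t(z)=\frac{1}{(2\pi)^N}\int_{\mathbb{R}^N}e^{\,i\langle z,\xi\rangle-t(|\xi|^2+|\xi|^{2s})}\,d\xi .$$ Tail space. $L_s(\mathbb{R}^N)$ is the space of functions $f:\mathbb{R}^N\to\mathbb{R}$ with $\|f\|_{1,s}:=\int_{\mathbb{R}^N}\frac{|f(x)|}{1+|x|^{N+2s}}\,dx<+\infty$. For $T>0$, $u\in L^\infty((0,T);L_s(\mathbb{R}^N))$ means that $u(\cdot,t)\in L_s(\mathbb{R}^N)$ and that $t\mapsto\|u(\cdot,t)\|_{1,s}$ belongs to $L^\infty(0,T)$.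 Test functions. $\mathcal{T}_0$ is the vector space of all $\varphi\in C^\infty(\overline{S})$ for which there exist $r,T>0$ (possibly depending on $\varphi$) such that $\varphi\equiv 0$ on $\overline{S}\setminus(B_r\times[0,T))$. Very weak solution. Let $u_0\in L^\infty(\mathbb{R}^N)$, $u_0\ge0$. A function $u:\overline{S}\to[0,+\infty)$ is a (global in time) very weak solution of $(P_{u_0})$ if: (a) $u\in L^p_{\mathrm{loc}}(\overline{S})$; (b) for every $T>0$, $u\in L^\infty((0,T);L_s(\mathbb{R}^N))$; (c) for every $\varphi\in\mathcal{T}_0$, $$\iint_{S}u\,(-\partial_t\varphi+\mathcal{L}\varphi)\,dx\,dt-\int_{\mathbb{R}^N}u_0(x)\varphi(x,0)\,dx=\iint_{S}u^p\varphi\,dx\,dt .$$ *)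

theory Defs
  imports "HOL-Analysis.Analysis"
begin

text \<open>
  \<open>\<real>\<^sup>N\<close> is an arbitrary Euclidean space \<open>'a\<close> with \<open>N = DIM('a)\<close>. Functions on the closed half space
  \<open>closed_half_space\<close> are total functions on \<open>'a \<times> real\<close> whose values at negative times are never used.
  Since \<open>0 powr c = 0\<close>, \<open>powr\<close> is the usual power on nonnegative bases with positive exponent.
\<close>

definition open_half_space :: "('a::euclidean_space \<times> real) set" where
  "open_half_space = UNIV \<times> {0<..}"

definition closed_half_space :: "('a::euclidean_space \<times> real) set" where
  "closed_half_space = UNIV \<times> {0..}"

section \<open>Operators and heat kernel\<close>

definition laplacian :: "('a::euclidean_space \<Rightarrow> real) \<Rightarrow> 'a \<Rightarrow> real" where
  "laplacian v x = (\<Sum>b\<in>Basis. (deriv ^^ 2) (\<lambda>h. v (x + h *\<^sub>R b)) 0)"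

definition frac_laplacian_const :: "nat \<Rightarrow> real \<Rightarrow> real" where
  "frac_laplacian_const N s =
     2 powr (2 * s - 1) * (2 * s) * Gamma ((real N + 2 * s) / 2)
       / (pi powr (real N / 2) * Gamma (1 - s))"

text \<open>The operator \<open>(- \<Delta>)\<^sup>s\<close>, as a principal value.\<close>

definition frac_laplacian :: "real \<Rightarrow> ('a::euclidean_space \<Rightarrow> real) \<Rightarrow> 'a \<Rightarrow> real" where
  "frac_laplacian s v x =
     frac_laplacian_const DIM('a) s *
     Lim (at_right 0) (\<lambda>\<epsilon>. LINT y:{y. norm (x - y) \<ge> \<epsilon>}|lebesgue.
        (v x - v y) / norm (x - y) powr (real DIM('a) + 2 * s))"

definition mixed_op :: "real \<Rightarrow> ('a::euclidean_space \<times> real \<Rightarrow> real) \<Rightarrow> 'a \<times> real \<Rightarrow> real" where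
  "mixed_op s \<phi> = (\<lambda>(x, t).
     - laplacian (\<lambda>y. \<phi> (y, t)) x + frac_laplacian s (\<lambda>y. \<phi> (y, t)) x)"

definition time_deriv :: "('a::euclidean_space \<times> real \<Rightarrow> real) \<Rightarrow> 'a \<times> real \<Rightarrow> real" where
  "time_deriv \<phi> = (\<lambda>(x, t). deriv (\<lambda>\<tau>. \<phi> (x, \<tau>)) t)"

text \<open>The integral below is real-valued, because the imaginary part of its integrand is odd in
  \<open>\<xi>\<close>; \<open>Re\<close> only changes the type.\<close>

definition heat_kernel :: "real \<Rightarrow> real \<Rightarrow> 'a::euclidean_space \<Rightarrow> real" where
  "heat_kernel s t z =
     Re (1 / (2 * of_real pi) ^ DIM('a) *
       (LINT \<xi>|lebesgue.
          exp (\<i> * of_real (z \<bullet> \<xi>) - of_real (t * ((norm \<xi>)\<^sup>2 + norm \<xi> powr (2 * s))))))"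

section \<open>Function spaces\<close>

text \<open>The functions in the spaces below are not identified up to null sets.\<close>

definition Linf :: "'b measure \<Rightarrow> ('b \<Rightarrow> real) set" where
  "Linf M = {f \<in> borel_measurable M. \<exists>C. AE x in M. \<bar>f x\<bar> \<le> C}"

definition Lp_loc :: "real \<Rightarrow> 'b::euclidean_space set \<Rightarrow> ('b \<Rightarrow> real) set" where
  "Lp_loc p A = {f \<in> borel_measurable (lebesgue_on A).
     \<forall>K. compact K \<and> K \<subseteq> A \<longrightarrow> set_integrable lebesgue K (\<lambda>z. \<bar>f z\<bar> powr p)}"

definition tail_weighted :: "real \<Rightarrow> ('a::euclidean_space \<Rightarrow> real) \<Rightarrow> 'a \<Rightarrow> real" where
  "tail_weighted s f x = \<bar>f x\<bar> / (1 + norm x powr (real DIM('a) + 2 * s))"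

definition tail_space :: "real \<Rightarrow> ('a::euclidean_space \<Rightarrow> real) set" where
  "tail_space s = {f \<in> borel_measurable lebesgue. integrable lebesgue (tail_weighted s f)}"

definition tail_norm :: "real \<Rightarrow> ('a::euclidean_space \<Rightarrow> real) \<Rightarrow> real" where
  "tail_norm s f = (LINT x|lebesgue. tail_weighted s f x)"

text \<open>The space \<open>L\<^sup>\<infinity>((0,T); L\<^sub>s)\<close>; as usual for such spaces, \<open>u(\<cdot>,t) \<in> L\<^sub>s\<close> is required for
  almost every \<open>t\<close>.\<close>

definition Linf_tail :: "real \<Rightarrow> real \<Rightarrow> ('a::euclidean_space \<times> real \<Rightarrow> real) set" where
  "Linf_tail s T = {u.
     (AE t in lebesgue_on {0<..<T}. (\<lambda>x. u (x, t)) \<in> tail_space s) \<and>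
     (\<lambda>t. tail_norm s (\<lambda>x. u (x, t))) \<in> Linf (lebesgue_on {0<..<T})}"

section \<open>Test functions and very weak solutions\<close>

text \<open>\<open>C\<^sup>k\<close> regularity by derivatives relative to \<open>A\<close>. These are unique if \<open>A\<close> is convex with nonempty
  interior; for \<open>A = closed_half_space\<close> they are one-sided in time at \<open>t = 0\<close>, so \<open>smooth_on closed_half_space\<close> is smoothness
  up to the boundary.\<close>

primrec Ck_on :: "nat \<Rightarrow> 'b::euclidean_space set \<Rightarrow> ('b \<Rightarrow> real) \<Rightarrow> bool" where
  "Ck_on 0 A f \<longleftrightarrow> continuous_on A f"
| "Ck_on (Suc k) A f \<longleftrightarrow>
     (\<exists>f'. (\<forall>z\<in>A. (f has_derivative f' z) (at z within A)) \<and> (\<forall>h. Ck_on k A (\<lambda>z. f' z h)))"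

definition smooth_on :: "'b::euclidean_space set \<Rightarrow> ('b \<Rightarrow> real) \<Rightarrow> bool" where
  "smooth_on A f \<longleftrightarrow> (\<forall>k. Ck_on k A f)"

definition test_functions :: "('a::euclidean_space \<times> real \<Rightarrow> real) set" where
  "test_functions = {\<phi>. smooth_on closed_half_space \<phi> \<and>
     (\<exists>r>0. \<exists>T>0. \<forall>z \<in> closed_half_space - ball 0 r \<times> {0..<T}. \<phi> z = 0)}"

definition very_weak_solution ::
  "real \<Rightarrow> real \<Rightarrow> ('a::euclidean_space \<Rightarrow> real) \<Rightarrow> ('a \<times> real \<Rightarrow> real) \<Rightarrow> bool" where
  "very_weak_solution s p u0 u \<longleftrightarrow>
     (\<forall>z\<in>closed_half_space. 0 \<le> u z) \<and>
     u \<in> Lp_loc p closed_half_space \<and>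
     (\<forall>T>0. u \<in> Linf_tail s T) \<and>
     (\<forall>\<phi>\<in>test_functions.
        (LINT z:open_half_space|lebesgue. u z * (- time_deriv \<phi> z + mixed_op s \<phi> z))
          - (LINT x|lebesgue. u0 x * \<phi> (x, 0))
        = (LINT z:open_half_space|lebesgue. u z powr p * \<phi> z))"

end

theory Submission
  imports Defs "HOL-Probability.Probability"
begin

text \<open>
  The operator \<open>- \<Delta> + (- \<Delta>)\<^sup>s\<close> has the Fourier symbol \<open>|\<xi>|\<^sup>2 + \<kappa> |\<xi>| powr (2 * s)\<close> with some \<open>\<kappa> > 0\<close>. Its heat kernel is
  nonnegative because \<open>|\<xi>| powr (2 * s)\<close> is a mixture of the functions \<open>1 - exp (- |\<xi>|\<^sup>2 / \<mu>)\<close>, so that the exponential of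
  its negative is a limit of mixtures of Gaussians; and the kernel decays like \<open>t powr (- N / (2 * s))\<close> as
  the fractional part dominates at low frequencies.

  For \<open>p > 1 + 2 * s / N\<close> this decay makes \<open>V powr (p - 1)\<close> integrable in time, uniformly in space, for the heat flow \<open>V\<close> of a small
  integrable bounded datum, so \<open>2 * V\<close> is a supersolution of the integral equation and Picard
  iteration converges to a mild solution. It is a very weak solution by Fubini's theorem, since the
  heat kernel integrates \<open>- \<partial>\<^sub>t \<phi> + (- \<Delta> + (- \<Delta>)\<^sup>s) \<phi>\<close> to \<open>\<phi>\<close>.

  For \<open>p \<le> 1 + 2 * s / N\<close> the equation is tested with \<open>\<phi> = \<psi>\<^sup>k\<close>, where \<open>\<psi>\<close> is a smooth cut-off to a cylinder of radius \<open>\<rho>\<close>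
  and height \<open>\<rho> powr (2 * s)\<close>. By convexity the operator applied to \<open>\<phi>\<close> is at most \<open>k * \<psi> ^ (k - 1)\<close> times the operator applied to \<open>\<psi>\<close>,
  and Young's inequality absorbs \<open>u\<close> into \<open>u\<^sup>p \<phi>\<close>; the remainder is bounded by the exponent condition. Hence
  \<open>u\<^sup>p\<close> is integrable over the half space, and a second pass with cylinders of different proportions
  shows that \<open>u0\<close> vanishes.
\<close>

section \<open>Gaussian integrals\<close>

text \<open>Both halves meet at one exponent because the fractional part governs large scales. The
  decay \<open>t powr (- N / (2 * s))\<close>, raised to the power \<open>p - 1\<close>, is
  integrable at infinity iff \<open>p > 1 + 2 * s / N\<close>. A cut-off to radius
  \<open>\<rho>\<close> and height \<open>\<rho> powr (2 * s)\<close> leaves a remainder of order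
  \<open>\<rho> powr (N + 2 * s - 2 * s * q)\<close> with \<open>q = p / (p - 1)\<close>, bounded
  for large \<open>\<rho>\<close> iff \<open>p \<le> 1 + 2 * s / N\<close>. At equality it is
  bounded but does not decay, so a single scaling is not enough and radius and height must be
  decoupled.

  For existence the obstacle is that a test function is smooth only up to \<open>t = 0\<close> and
  that its fractional Laplacian is not compactly supported. Both operators are therefore reduced to
  symmetric second differences, on which the Fourier variable acts through translations. All symbols
  are even, so cosines suffice and every quantity stays real. Nonnegativity of the kernel serves
  twice: it gives Fourier inversion without an a priori integrability of the kernel, and it lets the
  iteration run in extended nonnegative integrals.\<close>

lemma distr_lborel_translate: "distr lborel borel (\<lambda>x. t + x) = (lborel :: 'a::euclidean_space measure)"
  using lborel_distr_plus[of t] by simp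

lemma distr_lborel_reflect: "distr lborel borel (\<lambda>x. t - x) = (lborel :: 'a::euclidean_space measure)"
  by (subst (2) lborel_affine[of "-1" t]) (auto simp: density_1)

lemma nn_integral_lborel_affine:
  fixes f :: "'a::euclidean_space \<Rightarrow> ennreal"
  assumes [measurable]: "f \<in> borel_measurable borel" and c: "c \<noteq> 0"
  shows "(\<integral>\<^sup>+x. f x \<partial>lborel) = ennreal (\<bar>c\<bar> ^ DIM('a)) * (\<integral>\<^sup>+x. f (t + c *\<^sub>R x) \<partial>lborel)"
  by (subst lborel_affine[OF c, of t])
     (simp add: nn_integral_density nn_integral_distr nn_integral_cmult)

lemma integral_lborel_affine:
  fixes f :: "'a::euclidean_space \<Rightarrow> real"
  assumes [measurable]: "f \<in> borel_measurable borel" and c: "c \<noteq> 0"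
  shows "(\<integral>x. f x \<partial>lborel) = \<bar>c\<bar> ^ DIM('a) * (\<integral>x. f (t + c *\<^sub>R x) \<partial>lborel)"
  by (subst lborel_affine[OF c, of t]) (simp add: integral_density integral_distr)

lemma nn_integral_lborel_translate:
  fixes f :: "'a::euclidean_space \<Rightarrow> ennreal"
  assumes [measurable]: "f \<in> borel_measurable borel"
  shows "(\<integral>\<^sup>+x. f (t + x) \<partial>lborel) = (\<integral>\<^sup>+x. f x \<partial>lborel)"
  using nn_integral_lborel_affine[of f 1 t] by simp

lemma nn_integral_lborel_reflect:
  fixes f :: "'a::euclidean_space \<Rightarrow> ennreal"
  assumes [measurable]: "f \<in> borel_measurable borel"
  shows "(\<integral>\<^sup>+x. f (t - x) \<partial>lborel) = (\<integral>\<^sup>+x. f x \<partial>lborel)"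
  using nn_integral_lborel_affine[of f "-1" t] by simp

lemma integral_lborel_translate:
  fixes f :: "'a::euclidean_space \<Rightarrow> real"
  assumes [measurable]: "f \<in> borel_measurable borel"
  shows "(\<integral>x. f (t + x) \<partial>lborel) = (\<integral>x. f x \<partial>lborel)"
    and "integrable lborel (\<lambda>x. f (t + x)) \<longleftrightarrow> integrable lborel f"
  using integral_distr[of "\<lambda>x. t + x" lborel borel f] integrable_distr_eq[of "\<lambda>x. t + x" lborel borel f]
  by (simp_all add: distr_lborel_translate)

lemma integral_lborel_reflect:
  fixes f :: "'a::euclidean_space \<Rightarrow> real"
  assumes [measurable]: "f \<in> borel_measurable borel"
  shows "(\<integral>x. f (t - x) \<partial>lborel) = (\<integral>x. f x \<partial>lborel)"
    and "integrable lborel (\<lambda>x. f (t - x)) \<longleftrightarrow> integrable lborel f"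
  using integral_distr[of "\<lambda>x. t - x" lborel borel f] integrable_distr_eq[of "\<lambda>x. t - x" lborel borel f]
  by (simp_all add: distr_lborel_reflect)

lemma integral_odd_lborel:
  fixes f :: "'a::euclidean_space \<Rightarrow> real"
  assumes [measurable]: "f \<in> borel_measurable borel" and "\<And>x. f (- x) = - f x"
  shows "(\<integral>x. f x \<partial>lborel) = 0"
  using integral_lborel_reflect(1)[OF assms(1), of 0] assms(2) by simp

text \<open>Scaling by \<open>sqrt (2 * a)\<close> reduces this to the characteristic function of
  the standard normal distribution.\<close>

lemma gaussian_fourier_real:
  fixes a y :: real
  assumes a: "a > 0"
  shows "integrable lborel (\<lambda>x. iexp (x * y) * complex_of_real (exp (- a * x\<^sup>2)))"
    and "(\<integral>x. iexp (x * y) * complex_of_real (exp (- a * x\<^sup>2)) \<partial>lborel)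
           = complex_of_real (sqrt (pi / a) * exp (- y\<^sup>2 / (4 * a)))"
proof -
  let ?c = "sqrt (2 * a)"
  have c: "?c > 0" using a by simp
  define f where "f = (\<lambda>x. iexp (x * (y / ?c)) * complex_of_real (std_normal_density x))"
  have fi: "integrable lborel f"
    unfolding f_def
    by (rule Bochner_Integration.integrable_bound[where f="std_normal_density"])
       (auto simp: norm_mult)
  have "char std_normal_distribution (y / ?c) = (\<integral>x. f x \<partial>lborel)"
    unfolding char_def f_def
    by (subst integral_density) (auto simp: scaleR_conv_of_real mult_ac intro!: Bochner_Integration.integral_cong)
  then have I: "(\<integral>x. f x \<partial>lborel) = complex_of_real (exp (- (y / ?c)\<^sup>2 / 2))"
    using char_std_normal_distribution by (metis)
  have hb: "has_bochner_integral lborel f (complex_of_real (exp (- (y / ?c)\<^sup>2 / 2)))"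
    using fi I by (simp add: has_bochner_integral_iff)
  then have "has_bochner_integral lborel (\<lambda>x. f (0 + ?c * x)) (complex_of_real (exp (- (y / ?c)\<^sup>2 / 2)) /\<^sub>R \<bar>?c\<bar>)"
    using lborel_has_bochner_integral_real_affine_iff[of ?c f _ 0] c by simp
  then have "has_bochner_integral lborel (\<lambda>x. complex_of_real (sqrt (2 * pi)) * f (0 + ?c * x))
     (complex_of_real (sqrt (2 * pi)) * (complex_of_real (exp (- (y / ?c)\<^sup>2 / 2)) /\<^sub>R \<bar>?c\<bar>))"
    by (intro has_bochner_integral_mult_right)
  moreover have "complex_of_real (sqrt (2 * pi)) * f (0 + ?c * x) = iexp (x * y) * complex_of_real (exp (- a * x\<^sup>2))" for x
    using a by (simp add: f_def std_normal_density_def field_simps)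
  moreover have "(complex_of_real (sqrt (2 * pi)) * (complex_of_real (exp (- (y / ?c)\<^sup>2 / 2)) /\<^sub>R \<bar>?c\<bar>))
     = complex_of_real (sqrt (pi / a) * exp (- y\<^sup>2 / (4 * a)))"
    using a by (simp add: scaleR_conv_of_real real_sqrt_mult real_sqrt_divide power_divide field_simps)
  ultimately have "has_bochner_integral lborel (\<lambda>x. iexp (x * y) * complex_of_real (exp (- a * x\<^sup>2)))
     (complex_of_real (sqrt (pi / a) * exp (- y\<^sup>2 / (4 * a))))" by simp
  then show "integrable lborel (\<lambda>x. iexp (x * y) * complex_of_real (exp (- a * x\<^sup>2)))"
    and "(\<integral>x. iexp (x * y) * complex_of_real (exp (- a * x\<^sup>2)) \<partial>lborel)
           = complex_of_real (sqrt (pi / a) * exp (- y\<^sup>2 / (4 * a)))"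
    by (simp_all add: has_bochner_integral_iff)
qed

text \<open>Integrand and Lebesgue measure are both products over the orthonormal basis, so the
  one-dimensional formulas multiply.\<close>

lemma gaussian_fourier_complex:
  fixes \<xi> :: "'a::euclidean_space" and a :: real
  assumes a: "a > 0"
  shows "integrable lborel (\<lambda>x::'a. iexp (x \<bullet> \<xi>) * complex_of_real (exp (- a * (norm x)\<^sup>2)))"
    and "(\<integral>x. iexp (x \<bullet> \<xi>) * complex_of_real (exp (- a * (norm x)\<^sup>2)) \<partial>lborel)
           = complex_of_real (sqrt (pi / a) ^ DIM('a) * exp (- (norm \<xi>)\<^sup>2 / (4 * a)))"
proof -
  define g where "g = (\<lambda>(b::'a) (x::real). iexp (x * (\<xi> \<bullet> b)) * complex_of_real (exp (- a * x\<^sup>2)))"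
  interpret product_sigma_finite "\<lambda>b::'a. lborel :: real measure" ..
  have n2: "(norm x)\<^sup>2 = (\<Sum>b\<in>Basis. (x \<bullet> b)\<^sup>2)" for x :: 'a
    by (simp add: norm_eq_sqrt_inner euclidean_inner[of x x] power2_eq_square sum_nonneg)
  have eq: "iexp (x \<bullet> \<xi>) * complex_of_real (exp (- a * (norm x)\<^sup>2)) = (\<Prod>b\<in>Basis. g b (x \<bullet> b))" for x :: 'a
  proof -
    have "(\<Prod>b\<in>Basis. g b (x \<bullet> b)) = exp (\<Sum>b\<in>Basis. \<i> * complex_of_real ((x \<bullet> b) * (\<xi> \<bullet> b)) + complex_of_real (- a * (x \<bullet> b)\<^sup>2))"
      unfolding g_def by (subst exp_sum) (auto simp only: exp_add exp_of_real finite_Basis intro!: prod.cong)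
    also have "(\<Sum>b\<in>Basis. \<i> * complex_of_real ((x \<bullet> b) * (\<xi> \<bullet> b)) + complex_of_real (- a * (x \<bullet> b)\<^sup>2))
       = \<i> * complex_of_real (x \<bullet> \<xi>) + complex_of_real (- a * (norm x)\<^sup>2)"
      unfolding n2 euclidean_inner[of x \<xi>] by (simp add: sum_subtractf sum_distrib_left sum_negf)
    finally show ?thesis by (simp only: exp_add exp_of_real)
  qed
  have gi: "integrable lborel (g b)" for b unfolding g_def using gaussian_fourier_real(1)[OF a] .
  have gm[measurable]: "(\<lambda>x::'a. (\<Prod>b\<in>Basis. g b (x \<bullet> b))) \<in> borel_measurable borel" unfolding g_def by measurable
  have repr: "(\<Prod>b\<in>Basis. g b ((\<Sum>c\<in>Basis. f c *\<^sub>R c) \<bullet> b)) = (\<Prod>b\<in>Basis. g b (f b))" for f :: "'a \<Rightarrow> real"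
    by (intro prod.cong) auto
  have T[measurable]: "(\<lambda>f. \<Sum>b\<in>Basis. f b *\<^sub>R b) \<in> (\<Pi>\<^sub>M b\<in>(Basis::'a set). lborel) \<rightarrow>\<^sub>M (borel :: 'a measure)"
    by measurable
  have "integrable (\<Pi>\<^sub>M b\<in>(Basis::'a set). lborel) (\<lambda>f. \<Prod>b\<in>Basis. g b (f b))"
    by (intro product_integrable_prod gi) auto
  then show "integrable lborel (\<lambda>x::'a. iexp (x \<bullet> \<xi>) * complex_of_real (exp (- a * (norm x)\<^sup>2)))"
    unfolding eq by (subst lborel_eq, subst integrable_distr_eq) (auto simp: repr)
  have "(\<integral>x. (\<Prod>b\<in>Basis. g b (x \<bullet> b)) \<partial>(lborel :: 'a measure)) = (\<Prod>b\<in>Basis. integral\<^sup>L lborel (g b))"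
    by (subst lborel_eq, subst integral_distr) (auto simp: repr product_integral_prod gi)
  also have "\<dots> = (\<Prod>b\<in>(Basis::'a set). complex_of_real (sqrt (pi / a) * exp (- (\<xi> \<bullet> b)\<^sup>2 / (4 * a))))"
    unfolding g_def by (intro prod.cong refl) (rule gaussian_fourier_real(2)[OF a])
  also have "\<dots> = complex_of_real (sqrt (pi / a) ^ DIM('a) * exp (- (norm \<xi>)\<^sup>2 / (4 * a)))"
    unfolding n2 by (simp add: prod.distrib exp_sum[symmetric] sum_divide_distrib[symmetric] sum_negf flip: of_real_prod)
  finally show "(\<integral>x. iexp (x \<bullet> \<xi>) * complex_of_real (exp (- a * (norm x)\<^sup>2)) \<partial>lborel)
           = complex_of_real (sqrt (pi / a) ^ DIM('a) * exp (- (norm \<xi>)\<^sup>2 / (4 * a)))"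
    unfolding eq .
qed

lemma gaussian_cos:
  fixes \<xi> :: "'a::euclidean_space" and a :: real
  assumes a: "a > 0"
  shows "integrable lborel (\<lambda>x::'a. cos (x \<bullet> \<xi>) * exp (- a * (norm x)\<^sup>2))"
    and "(\<integral>x. cos (x \<bullet> \<xi>) * exp (- a * (norm x)\<^sup>2) \<partial>lborel)
           = sqrt (pi / a) ^ DIM('a) * exp (- (norm \<xi>)\<^sup>2 / (4 * a))"
proof -
  have eq: "Re (iexp (x \<bullet> \<xi>) * complex_of_real (exp (- a * (norm x)\<^sup>2))) = cos (x \<bullet> \<xi>) * exp (- a * (norm x)\<^sup>2)" for x :: 'a
    by (simp add: Re_exp)
  show "integrable lborel (\<lambda>x::'a. cos (x \<bullet> \<xi>) * exp (- a * (norm x)\<^sup>2))"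
    using integrable_Re[OF gaussian_fourier_complex(1)[OF a, of \<xi>]] unfolding eq .
  show "(\<integral>x. cos (x \<bullet> \<xi>) * exp (- a * (norm x)\<^sup>2) \<partial>lborel)
           = sqrt (pi / a) ^ DIM('a) * exp (- (norm \<xi>)\<^sup>2 / (4 * a))"
    using integral_Re[OF gaussian_fourier_complex(1)[OF a, of \<xi>]]
    unfolding gaussian_fourier_complex(2)[OF a] eq by simp
qed

lemma gaussian_integral:
  fixes a :: real
  assumes a: "a > 0"
  shows "integrable lborel (\<lambda>x::'a::euclidean_space. exp (- a * (norm x)\<^sup>2))"
    and "(\<integral>x. exp (- a * (norm (x::'a))\<^sup>2) \<partial>lborel) = sqrt (pi / a) ^ DIM('a)"
  using gaussian_cos[OF a, of "0::'a"] by simp_all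

section \<open>Subordination and the Levy integral\<close>

text \<open>Homogeneity of the measure with density \<open>\<mu> powr (a - 1)\<close>. It serves two
  mixtures: that of Gaussians giving \<open>levy\<close>, and that of the functions
  \<open>1 - exp (- A / \<mu>)\<close> giving powers of \<open>A\<close>.\<close>

lemma nn_integral_powr_scale:
  fixes A a :: real
  assumes A: "A > 0" and [measurable]: "f \<in> borel_measurable borel"
  shows "(\<integral>\<^sup>+\<mu>\<in>{0<..}. ennreal (\<mu> powr (a - 1) * f (A * \<mu>)) \<partial>lborel)
       = ennreal (A powr (- a)) * (\<integral>\<^sup>+\<mu>\<in>{0<..}. ennreal (\<mu> powr (a - 1) * f \<mu>) \<partial>lborel)"
proof -
  let ?I = "\<integral>\<^sup>+\<mu>\<in>{0<..}. ennreal (\<mu> powr (a - 1) * f (A * \<mu>)) \<partial>lborel"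
  have *: "ennreal ((0 + A * \<mu>) powr (a - 1) * f (0 + A * \<mu>)) * indicator {0<..} (0 + A * \<mu>)
      = ennreal (A powr (a - 1)) * (ennreal (\<mu> powr (a - 1) * f (A * \<mu>)) * indicator {0<..} \<mu>)" for \<mu>
    using A by (cases "\<mu> > 0") (auto simp: powr_mult ennreal_mult'[symmetric] mult_ac zero_less_mult_iff)
  have "(\<integral>\<^sup>+\<mu>\<in>{0<..}. ennreal (\<mu> powr (a - 1) * f \<mu>) \<partial>lborel) = ennreal A * (ennreal (A powr (a - 1)) * ?I)"
    using A by (subst nn_integral_real_affine[where c=A and t=0]) (simp_all only: * , auto simp: nn_integral_cmult)
  also have "\<dots> = ennreal (A powr a) * ?I"
    using A by (simp add: mult.assoc[symmetric] ennreal_mult'[symmetric] powr_diff)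
  finally show ?thesis
    using A by (simp add: mult.assoc[symmetric] ennreal_mult'[symmetric] powr_minus)
qed

lemma nn_integral_Gamma:
  fixes a :: real
  assumes "a > 0"
  shows "(\<integral>\<^sup>+\<mu>\<in>{0<..}. ennreal (\<mu> powr (a - 1) * exp (- \<mu>)) \<partial>lborel) = ennreal (Gamma a)"
proof -
  have "integral\<^sup>N lborel (\<lambda>x. indicator {0..} x * (x powr (a - 1) / exp x)) = ennreal (Gamma a)"
    using nn_integral_has_integral_lebesgue[OF _ Gamma_integral_real[OF assms]] by simp
  moreover have "(\<integral>\<^sup>+\<mu>\<in>{0<..}. ennreal (\<mu> powr (a - 1) * exp (- \<mu>)) \<partial>lborel)
     = integral\<^sup>N lborel (\<lambda>x. indicator {0..} x * (x powr (a - 1) / exp x))"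
    by (intro nn_integral_cong) (auto simp: exp_minus field_simps split: split_indicator)
  ultimately show ?thesis by simp
qed

text \<open>Substituting \<open>\<mu> \<mapsto> \<mu> / A\<close> represents \<open>A powr s\<close>, up to this constant, as a mixture of the functions
  \<open>1 - exp (- A / \<mu>)\<close> of \<open>A\<close>.\<close>

definition subord_mass :: "real \<Rightarrow> ennreal" where
  "subord_mass s = (\<integral>\<^sup>+\<mu>\<in>{0<..}. ennreal (\<mu> powr (s - 1) * (1 - exp (- (1 / \<mu>)))) \<partial>lborel)"

text \<open>Near 0 the integrand is at most \<open>\<mu> powr (s - 1)\<close>; beyond 1 the bound
  \<open>1 - exp (- 1 / \<mu>) \<le> 1 / \<mu>\<close> leaves \<open>\<mu> powr (s - 2)\<close>.
  Both are integrable as \<open>0 < s < 1\<close>.\<close>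

lemma subord_mass_finite:
  assumes s: "0 < s" "s < 1"
  shows "subord_mass s < \<infinity>"
proof -
  have a: "integral\<^sup>N lborel (\<lambda>x. ennreal (indicator {0..1} x * x powr (s - 1))) < \<infinity>"
    using nn_integral_has_integral_lebesgue[OF _ has_integral_powr_from_0[of "s - 1" 1]] s by simp
  have b: "integral\<^sup>N lborel (\<lambda>x. ennreal (indicator {1..} x * x powr (s - 2))) < \<infinity>"
    using nn_integral_has_integral_lebesgue[OF _ has_integral_powr_to_inf[of "s - 2" 1]] s by simp
  have "subord_mass s \<le> (\<integral>\<^sup>+x. ennreal (indicator {0..1} x * x powr (s - 1)) + ennreal (indicator {1..} x * x powr (s - 2)) \<partial>lborel)"
    unfolding subord_mass_def
  proof (intro nn_integral_mono)
    fix x :: real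
    show "ennreal (x powr (s - 1) * (1 - exp (- (1 / x)))) * indicator {0<..} x
      \<le> ennreal (indicator {0..1} x * x powr (s - 1)) + ennreal (indicator {1..} x * x powr (s - 2))"
    proof (cases "x > 0")
      case True
      have e: "1 - exp (- (1 / x)) \<le> 1 / x" using exp_ge_add_one_self[of "- (1/x)"] by simp
      have "x powr (s - 1) * (1 - exp (- (1 / x))) \<le> indicator {0..1} x * x powr (s - 1) + indicator {1..} x * x powr (s - 2)"
      proof (cases "x < 1")
        case True
        then show ?thesis using \<open>x > 0\<close> by (simp add: mult_left_le)
      next
        case False
        have "x powr (s - 1) * (1 - exp (- (1 / x))) \<le> x powr (s - 1) * (1 / x)"
          by (intro mult_left_mono e) auto
        also have "\<dots> = x powr (s - 2)" using True by (simp add: powr_diff power2_eq_square)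
        finally show ?thesis using False exp_gt_zero[of "-1::real"] by (auto simp: indicator_def simp del: exp_gt_zero)
      qed
      then show ?thesis using True by (simp add: ennreal_plus[symmetric] ennreal_leI del: ennreal_plus)
    qed simp
  qed
  also have "\<dots> < \<infinity>" using a b by (subst nn_integral_add) auto
  finally show ?thesis .
qed

lemma subord_mass_pos: "subord_mass s > 0"
proof (rule ccontr)
  assume "\<not> subord_mass s > 0"
  then have "subord_mass s = 0" by simp
  then have "AE x in lborel. ennreal (x powr (s - 1) * (1 - exp (- (1 / x)))) * indicator {0<..} x = 0"
    unfolding subord_mass_def by (subst (asm) nn_integral_0_iff_AE) measurable
  then have "AE x in lborel. \<not> (x::real) \<in> {0<..<1}"
    by (rule AE_mp) (auto intro!: AE_I2 simp: mult_le_0_iff not_le)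
  then have "emeasure lborel {0<..<1::real} = 0"
    by (subst (asm) AE_iff_measurable[where N="{0<..<1}"]) (auto simp: set_eq_iff)
  then show False by simp
qed

lemma subord_scale:
  assumes A: "A \<ge> 0" and s: "s > 0"
  shows "(\<integral>\<^sup>+\<mu>\<in>{0<..}. ennreal (\<mu> powr (s - 1) * (1 - exp (- (A / \<mu>)))) \<partial>lborel) = ennreal (A powr s) * subord_mass s"
proof (cases "A = 0")
  case False
  with A have "A > 0" by simp
  then show ?thesis
    using nn_integral_powr_scale[of "1 / A" "\<lambda>\<mu>. 1 - exp (- (1 / \<mu>))" s]
    unfolding subord_mass_def by (simp add: powr_divide powr_minus_divide)
qed simp

definition levy :: "real \<Rightarrow> 'a::euclidean_space \<Rightarrow> real" where
  "levy s z = 1 / norm z powr (real DIM('a) + 2 * s)"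

lemma levy_nonneg [simp]: "levy s z \<ge> 0" by (simp add: levy_def)

lemma levy_minus [simp]: "levy s (- z) = levy s z" by (simp add: levy_def)

lemma borel_measurable_levy [measurable]: "levy s \<in> borel_measurable borel"
  unfolding levy_def by measurable

text \<open>The constant arises from writing \<open>levy s z\<close> as a mixture of the Gaussians \<open>exp (- \<mu> |z|\<^sup>2)\<close>.\<close>

definition levy_const :: "nat \<Rightarrow> real \<Rightarrow> real" where
  "levy_const N s = pi powr (real N / 2) * (1 / 4) powr s * enn2real (subord_mass s) / Gamma (real N / 2 + s)"

lemma levy_const_pos: "0 < s \<Longrightarrow> s < 1 \<Longrightarrow> levy_const N s > 0"
  unfolding levy_const_def using subord_mass_pos[of s] subord_mass_finite[of s]
  by (auto simp: enn2real_positive_iff intro!: divide_pos_pos mult_pos_pos Gamma_real_pos add_nonneg_pos)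

text \<open>The Levy-Khintchine formula for \<open>norm \<xi> powr (2 * s)\<close>. A Gamma integral
  writes \<open>levy\<close> as a mixture of Gaussians, whose integral in \<open>z\<close> is
  explicit; what remains in \<open>\<mu>\<close> is \<open>subord_scale\<close> with
  \<open>A = (norm \<xi>)\<^sup>2 / 4\<close>. All integrands are nonnegative, so the integrals may
  be exchanged before convergence is known.\<close>

lemma nn_integral_levy_cos:
  fixes \<xi> :: "'a::euclidean_space"
  assumes s: "0 < s" "s < 1"
  shows "(\<integral>\<^sup>+z. ennreal ((1 - cos (z \<bullet> \<xi>)) * levy s z) \<partial>lborel) = ennreal (levy_const DIM('a) s * norm \<xi> powr (2 * s))"
proof -
  define a where "a = real DIM('a) / 2 + s"
  have a: "a > 0" using s by (simp add: a_def add_nonneg_pos)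
  have G: "Gamma a > 0" using a by (rule Gamma_real_pos)
  have lev: "ennreal (Gamma a) * ennreal ((1 - cos (z \<bullet> \<xi>)) * levy s z) =
     (\<integral>\<^sup>+\<mu>\<in>{0<..}. ennreal ((1 - cos (z \<bullet> \<xi>)) * (\<mu> powr (a - 1) * exp (- \<mu> * (norm z)\<^sup>2))) \<partial>lborel)" for z
  \<comment> \<open>At the singularity the factor \<open>1 - cos (z \<bullet> \<xi>)\<close>
    vanishes, so both sides are 0.\<close>
  proof (cases "z = 0")
    case False
    have "(\<integral>\<^sup>+\<mu>\<in>{0<..}. ennreal (\<mu> powr (a - 1) * exp (- \<mu> * (norm z)\<^sup>2)) \<partial>lborel) = ennreal (((norm z)\<^sup>2) powr (- a)) * ennreal (Gamma a)"
      using nn_integral_powr_scale[of "(norm z)\<^sup>2" "\<lambda>\<mu>. exp (- \<mu>)" a] False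
      by (simp add: nn_integral_Gamma[OF a, simplified] mult.commute[of _ "(norm z)\<^sup>2"])
    also have "((norm z)\<^sup>2) powr (- a) = levy s z"
    proof -
      have "((norm z)\<^sup>2) powr (- a) = (norm z powr 2) powr (- a)" using False by (simp add: powr_numeral)
      also have "\<dots> = norm z powr (2 * - a)" by (simp only: powr_powr)
      also have "2 * - a = - (real DIM('a) + 2 * s)" by (simp add: a_def)
      also have "norm z powr - (real DIM('a) + 2 * s) = 1 / norm z powr (real DIM('a) + 2 * s)" by (rule powr_minus_divide)
      finally show ?thesis unfolding levy_def .
    qed
    finally have *: "(\<integral>\<^sup>+\<mu>\<in>{0<..}. ennreal (\<mu> powr (a - 1) * exp (- \<mu> * (norm z)\<^sup>2)) \<partial>lborel) = ennreal (levy s z) * ennreal (Gamma a)" .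
    have "(\<integral>\<^sup>+\<mu>\<in>{0<..}. ennreal ((1 - cos (z \<bullet> \<xi>)) * (\<mu> powr (a - 1) * exp (- \<mu> * (norm z)\<^sup>2))) \<partial>lborel)
      = (\<integral>\<^sup>+\<mu>. ennreal (1 - cos (z \<bullet> \<xi>)) * (ennreal (\<mu> powr (a - 1) * exp (- \<mu> * (norm z)\<^sup>2)) * indicator {0<..} \<mu>) \<partial>lborel)"
      by (intro nn_integral_cong) (simp add: ennreal_mult mult_ac)
    also have "\<dots> = ennreal (1 - cos (z \<bullet> \<xi>)) * (ennreal (levy s z) * ennreal (Gamma a))"
      unfolding *[symmetric] by (rule nn_integral_cmult) measurable
    finally show ?thesis using G by (simp add: ennreal_mult mult_ac)
  qed simp
  \<comment> \<open>The Gaussian normalisation \<open>sqrt (pi / \<mu>) ^ N\<close> lowers the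
    exponent \<open>a - 1\<close> to \<open>s - 1\<close>, because
    \<open>a = N / 2 + s\<close>.\<close>
  have inner: "(\<integral>\<^sup>+z. ennreal ((1 - cos (z \<bullet> \<xi>)) * (\<mu> powr (a - 1) * exp (- \<mu> * (norm z)\<^sup>2))) * indicator {0<..} \<mu> \<partial>lborel)
     = ennreal (pi powr (real DIM('a) / 2)) * (ennreal (\<mu> powr (s - 1) * (1 - exp (- (((norm \<xi>)\<^sup>2 / 4) / \<mu>)))) * indicator {0<..} \<mu>)" for \<mu> :: real
  proof (cases "\<mu> > 0")
    case True
    have i: "integrable lborel (\<lambda>z::'a. exp (- \<mu> * (norm z)\<^sup>2) - cos (z \<bullet> \<xi>) * exp (- \<mu> * (norm z)\<^sup>2))"
      by (intro Bochner_Integration.integrable_diff gaussian_cos gaussian_integral True)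
    have i2: "integrable lborel (\<lambda>z::'a. \<mu> powr (a - 1) * (exp (- \<mu> * (norm z)\<^sup>2) - cos (z \<bullet> \<xi>) * exp (- \<mu> * (norm z)\<^sup>2)))"
      using i by simp
    have "sqrt (pi / \<mu>) ^ DIM('a) = pi powr (real DIM('a) / 2) / \<mu> powr (real DIM('a) / 2)"
    proof -
      have "sqrt (pi / \<mu>) ^ DIM('a) = ((pi / \<mu>) powr (1/2)) powr (real DIM('a))"
        using True by (simp add: powr_half_sqrt powr_realpow)
      also have "\<dots> = pi powr (real DIM('a) / 2) / \<mu> powr (real DIM('a) / 2)"
        using True by (simp add: powr_powr powr_divide)
      finally show ?thesis .
    qed
    then have "\<mu> powr (a - 1) * sqrt (pi / \<mu>) ^ DIM('a) = pi powr (real DIM('a) / 2) * (\<mu> powr (a - 1) / \<mu> powr (real DIM('a) / 2))"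
      by simp
    also have "\<mu> powr (a - 1) / \<mu> powr (real DIM('a) / 2) = \<mu> powr (s - 1)"
      unfolding powr_diff[symmetric] by (simp add: a_def)
    finally have sq: "\<mu> powr (a - 1) * sqrt (pi / \<mu>) ^ DIM('a) = pi powr (real DIM('a) / 2) * \<mu> powr (s - 1)" .
    have "(\<integral>\<^sup>+z. ennreal ((1 - cos (z \<bullet> \<xi>)) * (\<mu> powr (a - 1) * exp (- \<mu> * (norm z)\<^sup>2))) \<partial>lborel)
       = (\<integral>\<^sup>+z. ennreal (\<mu> powr (a - 1) * (exp (- \<mu> * (norm z)\<^sup>2) - cos (z \<bullet> \<xi>) * exp (- \<mu> * (norm z)\<^sup>2))) \<partial>lborel)"
      by (intro nn_integral_cong) (simp add: algebra_simps)
    also have "\<dots> = ennreal (\<integral>z. \<mu> powr (a - 1) * (exp (- \<mu> * (norm z)\<^sup>2) - cos (z \<bullet> \<xi>) * exp (- \<mu> * (norm z)\<^sup>2)) \<partial>lborel)"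
      by (intro nn_integral_eq_integral[OF i2] AE_I2 mult_nonneg_nonneg) (auto simp: mult_left_le_one_le)
    also have "(\<integral>z. \<mu> powr (a - 1) * (exp (- \<mu> * (norm z)\<^sup>2) - cos (z \<bullet> \<xi>) * exp (- \<mu> * (norm z)\<^sup>2)) \<partial>lborel)
       = \<mu> powr (a - 1) * sqrt (pi / \<mu>) ^ DIM('a) * (1 - exp (- (((norm \<xi>)\<^sup>2 / 4) / \<mu>)))"
    proof -
      have "(\<integral>z. exp (- \<mu> * (norm z)\<^sup>2) - cos (z \<bullet> \<xi>) * exp (- \<mu> * (norm z)\<^sup>2) \<partial>lborel)
          = sqrt (pi / \<mu>) ^ DIM('a) - sqrt (pi / \<mu>) ^ DIM('a) * exp (- (norm \<xi>)\<^sup>2 / (4 * \<mu>))"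
        by (subst Bochner_Integration.integral_diff[OF gaussian_integral(1)[OF True] gaussian_cos(1)[OF True]])
           (simp only: gaussian_integral(2)[OF True] gaussian_cos(2)[OF True])
      then show ?thesis by (subst integral_mult_right_zero, simp only:) (simp add: algebra_simps)
    qed
    finally show ?thesis using True by (simp add: sq ennreal_mult' mult.assoc)
  qed simp
  have "ennreal (Gamma a) * (\<integral>\<^sup>+z. ennreal ((1 - cos (z \<bullet> \<xi>)) * levy s z) \<partial>lborel)
     = (\<integral>\<^sup>+z. (\<integral>\<^sup>+\<mu>\<in>{0<..}. ennreal ((1 - cos (z \<bullet> \<xi>)) * (\<mu> powr (a - 1) * exp (- \<mu> * (norm z)\<^sup>2))) \<partial>lborel) \<partial>lborel)"
    by (subst nn_integral_cmult[symmetric]) (auto simp: lev)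
  also have "\<dots> = (\<integral>\<^sup>+\<mu>. \<integral>\<^sup>+z. ennreal ((1 - cos (z \<bullet> \<xi>)) * (\<mu> powr (a - 1) * exp (- \<mu> * (norm z)\<^sup>2))) * indicator {0<..} \<mu> \<partial>lborel \<partial>lborel)"
    by (rule lborel_pair.Fubini') measurable
  also have "\<dots> = ennreal (pi powr (real DIM('a) / 2)) * (\<integral>\<^sup>+\<mu>\<in>{0<..}. ennreal (\<mu> powr (s - 1) * (1 - exp (- (((norm \<xi>)\<^sup>2 / 4) / \<mu>)))) \<partial>lborel)"
    unfolding inner by (rule nn_integral_cmult) measurable
  also have "\<dots> = ennreal (pi powr (real DIM('a) / 2)) * (ennreal (((norm \<xi>)\<^sup>2 / 4) powr s) * subord_mass s)"
    by (subst subord_scale[OF _ s(1)]) auto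
  also have "\<dots> = ennreal (Gamma a) * ennreal (levy_const DIM('a) s * norm \<xi> powr (2 * s))"
  proof -
    have e: "((norm \<xi>)\<^sup>2 / 4) powr s = (1/4) powr s * norm \<xi> powr (2 * s)"
    proof (cases "\<xi> = 0")
      case False
      then have "norm \<xi> powr (2 * s) = ((norm \<xi>)\<^sup>2) powr s" by (subst powr_powr[symmetric]) (simp add: powr_numeral)
      then show ?thesis by (simp add: powr_divide)
    qed simp
    have m: "subord_mass s = ennreal (enn2real (subord_mass s))"
      using subord_mass_finite[OF s] by simp
    show ?thesis unfolding e levy_const_def a_def[symmetric] using G
      by (subst m) (simp add: ennreal_mult[symmetric] mult_ac)
  qed
  finally show ?thesis
    using G by (simp add: ennreal_mult_cancel_left)
qed

text \<open>From \<open>exp (- r) \<le> 1 / (1 + r)\<close> the right-hand side is at least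
  \<open>2 * r / (1 + r)\<close>, which dominates \<open>min 1 r\<close>.\<close>

lemma min_le_exp: "r \<ge> 0 \<Longrightarrow> min 1 r \<le> 2 * (1 - exp (- r :: real))"
proof -
  assume r: "r \<ge> 0"
  have "exp (- r) \<le> 1 / (1 + r)"
    using exp_ge_add_one_self[of r] r by (simp add: exp_minus divide_inverse le_imp_inverse_le)
  then have "2 * (1 - exp (- r)) \<ge> 2 * (1 - 1 / (1 + r))" by simp
  also have "2 * (1 - 1 / (1 + r)) \<ge> min 1 r"
  proof (cases "r \<le> 1")
    case True
    then have "r * r \<le> r" using r by (simp add: mult_left_le)
    with True r show ?thesis by (simp add: field_simps)
  next
    case False
    then show ?thesis by (simp add: field_simps)
  qed
  finally show ?thesis .
qed

lemma powr_le_exp_square: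
  assumes "0 < s" "s < 1"
  shows "norm x powr (2 * s) \<le> 1 + (norm x)\<^sup>2"
proof (cases "norm x \<le> 1")
  case True
  then have "norm x powr (2 * s) \<le> 1" using assms by (intro powr_le1) auto
  then show ?thesis by (simp add: add_increasing2)
next
  case False
  then have "norm x powr (2 * s) \<le> norm x powr 2" using assms by (intro powr_mono) auto
  then show ?thesis using False by (simp add: powr_numeral)
qed

text \<open>Integrating \<open>nn_integral_levy_cos\<close> over \<open>\<xi>\<close> against a
  Gaussian avoids polar coordinates: the Gaussian average of
  \<open>1 - cos (z \<bullet> \<xi>)\<close> is a multiple of
  \<open>1 - exp (- (norm z)\<^sup>2)\<close>, which dominates
  \<open>min 1 ((norm z)\<^sup>2)\<close> by \<open>min_le_exp\<close>.\<close>

lemma integrable_levy_min: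
  assumes s: "0 < s" "s < 1"
  shows "integrable lborel (\<lambda>z::'a::euclidean_space. min 1 ((norm z)\<^sup>2) * levy s z)"
proof -
  define c where "c = sqrt (4 * pi) ^ DIM('a)"
  have c: "c > 0" unfolding c_def by simp
  have gi: "integrable lborel (\<lambda>\<xi>::'a. exp (- (1/4) * (norm \<xi>)\<^sup>2) - cos (\<xi> \<bullet> z) * exp (- (1/4) * (norm \<xi>)\<^sup>2))" for z
    by (intro Bochner_Integration.integrable_diff gaussian_cos gaussian_integral) auto
  have rep: "ennreal (c * (1 - exp (- (norm z)\<^sup>2))) = (\<integral>\<^sup>+\<xi>. ennreal (exp (- (1/4) * (norm \<xi>)\<^sup>2) * (1 - cos (z \<bullet> \<xi>))) \<partial>lborel)" for z :: 'a
  proof -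
    have "(\<integral>\<^sup>+\<xi>. ennreal (exp (- (1/4) * (norm \<xi>)\<^sup>2) * (1 - cos (z \<bullet> \<xi>))) \<partial>lborel)
      = (\<integral>\<^sup>+\<xi>. ennreal (exp (- (1/4) * (norm \<xi>)\<^sup>2) - cos (\<xi> \<bullet> z) * exp (- (1/4) * (norm \<xi>)\<^sup>2)) \<partial>lborel)"
      by (intro nn_integral_cong) (simp add: algebra_simps inner_commute)
    also have "\<dots> = ennreal (\<integral>\<xi>. exp (- (1/4) * (norm \<xi>)\<^sup>2) - cos (\<xi> \<bullet> z) * exp (- (1/4) * (norm \<xi>)\<^sup>2) \<partial>lborel)"
      by (intro nn_integral_eq_integral[OF gi] AE_I2) (auto simp: mult_left_le_one_le)
    also have "(\<integral>\<xi>. exp (- (1/4) * (norm \<xi>)\<^sup>2) - cos (\<xi> \<bullet> z) * exp (- (1/4) * (norm \<xi>)\<^sup>2) \<partial>lborel) = c * (1 - exp (- (norm z)\<^sup>2))"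
      by (subst Bochner_Integration.integral_diff[OF gaussian_integral(1) gaussian_cos(1)])
         (auto simp only: gaussian_integral(2) gaussian_cos(2), auto simp: c_def algebra_simps)
    finally show ?thesis ..
  qed
  have fin: "(\<integral>\<^sup>+\<xi>. ennreal (exp (- (1/4) * (norm (\<xi>::'a))\<^sup>2) * (levy_const DIM('a) s * norm \<xi> powr (2 * s))) \<partial>lborel) < \<infinity>"
  proof -
    \<comment> \<open>Half of the Gaussian exponent 1/4 is spent on the growth of the symbol, via
      \<open>1 + r / 8 \<le> exp (r / 8)\<close>; the other half keeps the bound integrable.\<close>
    have b: "exp (- (1/4) * (norm \<xi>)\<^sup>2) * (levy_const DIM('a) s * norm \<xi> powr (2 * s)) \<le> 8 * levy_const DIM('a) s * exp (- (1/8) * (norm \<xi>)\<^sup>2)" for \<xi> :: 'a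
    proof -
      have "norm \<xi> powr (2 * s) \<le> 8 * (1 + (norm \<xi>)\<^sup>2 / 8)" using powr_le_exp_square[OF s, of \<xi>] by simp
      also have "\<dots> \<le> 8 * exp ((norm \<xi>)\<^sup>2 / 8)" by (intro mult_left_mono exp_ge_add_one_self) auto
      finally have "exp (- (1/4) * (norm \<xi>)\<^sup>2) * norm \<xi> powr (2 * s) \<le> exp (- (1/4) * (norm \<xi>)\<^sup>2) * (8 * exp ((norm \<xi>)\<^sup>2 / 8))"
        by (intro mult_left_mono) auto
      also have "\<dots> = 8 * exp (- (1/8) * (norm \<xi>)\<^sup>2)" by (simp add: exp_add[symmetric] field_simps)
      finally have "levy_const DIM('a) s * (exp (- (1/4) * (norm \<xi>)\<^sup>2) * norm \<xi> powr (2 * s)) \<le> levy_const DIM('a) s * (8 * exp (- (1/8) * (norm \<xi>)\<^sup>2))"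
        using levy_const_pos[OF s, of "DIM('a)"] by (intro mult_left_mono) auto
      then show ?thesis by (simp add: mult_ac)
    qed
    have "integrable lborel (\<lambda>\<xi>::'a. 8 * levy_const DIM('a) s * exp (- (1/8) * (norm \<xi>)\<^sup>2))"
      by (intro integrable_mult_right gaussian_integral) auto
    then have "(\<integral>\<^sup>+\<xi>. ennreal (8 * levy_const DIM('a) s * exp (- (1/8) * (norm (\<xi>::'a))\<^sup>2)) \<partial>lborel) < \<infinity>"
      using levy_const_pos[OF s, of "DIM('a)"]
      by (subst nn_integral_eq_integral) (auto simp: less_imp_le)
    then show ?thesis by (rule le_less_trans[rotated]) (intro nn_integral_mono ennreal_leI b)
  qed
  have "(\<integral>\<^sup>+z. ennreal (c * (1 - exp (- (norm z)\<^sup>2)) * levy s z) \<partial>(lborel :: 'a measure))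
     = (\<integral>\<^sup>+z. \<integral>\<^sup>+\<xi>. ennreal (exp (- (1/4) * (norm \<xi>)\<^sup>2) * (1 - cos (z \<bullet> \<xi>)) * levy s z) \<partial>lborel \<partial>(lborel :: 'a measure))"
    by (intro nn_integral_cong) (simp add: ennreal_mult'' rep nn_integral_multc)
  also have "\<dots> = (\<integral>\<^sup>+\<xi>. \<integral>\<^sup>+z. ennreal (exp (- (1/4) * (norm (\<xi>::'a))\<^sup>2) * (1 - cos (z \<bullet> \<xi>)) * levy s z) \<partial>lborel \<partial>lborel)"
    by (rule lborel_pair.Fubini') measurable
  also have "\<dots> = (\<integral>\<^sup>+\<xi>. ennreal (exp (- (1/4) * (norm (\<xi>::'a))\<^sup>2) * (levy_const DIM('a) s * norm \<xi> powr (2 * s))) \<partial>lborel)"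
  proof (intro nn_integral_cong)
    fix \<xi> :: 'a
    have "(\<integral>\<^sup>+z. ennreal (exp (- (1/4) * (norm \<xi>)\<^sup>2) * (1 - cos (z \<bullet> \<xi>)) * levy s z) \<partial>lborel)
      = ennreal (exp (- (1/4) * (norm \<xi>)\<^sup>2)) * (\<integral>\<^sup>+z. ennreal ((1 - cos (z \<bullet> \<xi>)) * levy s z) \<partial>lborel)"
      by (subst nn_integral_cmult[symmetric]) (auto simp only: ennreal_mult'[symmetric] mult.assoc exp_ge_zero, measurable)
    then show "(\<integral>\<^sup>+z. ennreal (exp (- (1/4) * (norm \<xi>)\<^sup>2) * (1 - cos (z \<bullet> \<xi>)) * levy s z) \<partial>lborel)
      = ennreal (exp (- (1/4) * (norm \<xi>)\<^sup>2) * (levy_const DIM('a) s * norm \<xi> powr (2 * s)))"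
      by (simp only: nn_integral_levy_cos[OF s] ennreal_mult' exp_ge_zero)
  qed
  finally have 1: "(\<integral>\<^sup>+z. ennreal (c * (1 - exp (- (norm z)\<^sup>2)) * levy s z) \<partial>(lborel :: 'a measure)) < \<infinity>"
    using fin by simp
  have I: "integrable lborel (\<lambda>z::'a. c * (1 - exp (- (norm z)\<^sup>2)) * levy s z)"
    using 1 c by (intro integrableI_nonneg) auto
  have "integrable lborel (\<lambda>z::'a. 2 / c * (c * (1 - exp (- (norm z)\<^sup>2)) * levy s z))"
    using I by (intro integrable_mult_right)
  then show ?thesis
  proof (rule Bochner_Integration.integrable_bound)
    show "AE z in lborel. norm (min 1 ((norm z)\<^sup>2) * levy s (z::'a)) \<le> norm (2 / c * (c * (1 - exp (- (norm z)\<^sup>2)) * levy s z))"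
    proof (rule AE_I2)
      fix z :: 'a
      have "min 1 ((norm z)\<^sup>2) * levy s z \<le> 2 * (1 - exp (- (norm z)\<^sup>2)) * levy s z"
        by (intro mult_right_mono min_le_exp) auto
      also have "\<dots> = 2 / c * (c * (1 - exp (- (norm z)\<^sup>2)) * levy s z)" using c by simp
      finally show "norm (min 1 ((norm z)\<^sup>2) * levy s z) \<le> norm (2 / c * (c * (1 - exp (- (norm z)\<^sup>2)) * levy s z))"
        by (simp add: abs_mult)
    qed
  qed measurable
qed

lemma integral_levy_cos:
  fixes \<xi> :: "'a::euclidean_space"
  assumes s: "0 < s" "s < 1"
  shows "integrable lborel (\<lambda>z. (1 - cos (z \<bullet> \<xi>)) * levy s z)"
    and "(\<integral>z. (1 - cos (z \<bullet> \<xi>)) * levy s z \<partial>lborel) = levy_const DIM('a) s * norm \<xi> powr (2 * s)"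
proof -
  show "integrable lborel (\<lambda>z. (1 - cos (z \<bullet> \<xi>)) * levy s z)"
    by (rule integrableI_nonneg) (auto simp: nn_integral_levy_cos[OF s])
  show "(\<integral>z. (1 - cos (z \<bullet> \<xi>)) * levy s z \<partial>lborel) = levy_const DIM('a) s * norm \<xi> powr (2 * s)"
    using levy_const_pos[OF s, of "DIM('a)"]
    by (subst integral_eq_nn_integral) (auto simp: nn_integral_levy_cos[OF s] less_imp_le)
qed

section \<open>Fourier inversion and positive definite functions\<close>

lemma integrable_pair_dominated:
  fixes f :: "'a::euclidean_space \<Rightarrow> real" and g :: "'b::euclidean_space \<Rightarrow> real" and h :: "'a \<Rightarrow> 'b \<Rightarrow> real"
  assumes f: "integrable lborel f" and g: "integrable lborel g"
    and [measurable]: "(\<lambda>(x, y). h x y) \<in> borel_measurable (lborel \<Otimes>\<^sub>M lborel)"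
    and b: "\<And>x y. \<bar>h x y\<bar> \<le> f x * g y"
  shows "integrable (lborel \<Otimes>\<^sub>M lborel) (\<lambda>(x, y). h x y)"
proof (rule Bochner_Integration.integrable_bound)
  have [measurable]: "f \<in> borel_measurable borel" "g \<in> borel_measurable borel"
    using f g by (auto dest: borel_measurable_integrable)
  show "integrable (lborel \<Otimes>\<^sub>M lborel) (\<lambda>(x, y). f x * g y)"
  proof (rule lborel_pair.Fubini_integrable)
    show "AE x in lborel. integrable lborel (\<lambda>y. case (x, y) of (x, y) \<Rightarrow> f x * g y)"
      using g by simp
    have "integrable lborel (\<lambda>x. \<bar>f x\<bar> * (\<integral>y. \<bar>g y\<bar> \<partial>lborel))"
      using f by (intro integrable_mult_left integrable_abs)
    then show "integrable lborel (\<lambda>x. LBINT y. norm (case (x, y) of (x, y) \<Rightarrow> f x * g y))"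
      by (simp add: abs_mult)
  qed measurable
  show "AE x in lborel \<Otimes>\<^sub>M lborel. norm (case x of (x, y) \<Rightarrow> h x y) \<le> norm (case x of (x, y) \<Rightarrow> f x * g y)"
    using b by (intro AE_I2) (auto intro: order_trans[OF _ abs_ge_self])
qed measurable

text \<open>The inverse Fourier transform of an even function.\<close>

definition rker :: "('a::euclidean_space \<Rightarrow> real) \<Rightarrow> 'a \<Rightarrow> real" where
  "rker r z = (\<integral>\<xi>. cos (z \<bullet> \<xi>) * r \<xi> \<partial>lborel) / (2 * pi) ^ DIM('a)"

lemma borel_measurable_rker [measurable]:
  assumes [measurable]: "r \<in> borel_measurable borel"
  shows "rker r \<in> borel_measurable borel"
  unfolding rker_def by measurable

lemma integrable_cos_mult:
  fixes r :: "'a::euclidean_space \<Rightarrow> real"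
  assumes "integrable lborel r"
  shows "integrable lborel (\<lambda>\<xi>. cos (z \<bullet> \<xi>) * r \<xi>)"
proof (rule Bochner_Integration.integrable_bound[OF assms])
  have [measurable]: "r \<in> borel_measurable borel" using assms by auto
  show "(\<lambda>\<xi>. cos (z \<bullet> \<xi>) * r \<xi>) \<in> borel_measurable lborel" by measurable
qed (auto simp: abs_mult intro!: mult_left_le_one_le)

lemma integrable_sin_mult:
  fixes r :: "'a::euclidean_space \<Rightarrow> real"
  assumes "integrable lborel r"
  shows "integrable lborel (\<lambda>\<xi>. sin (z \<bullet> \<xi>) * r \<xi>)"
proof (rule Bochner_Integration.integrable_bound[OF assms])
  have [measurable]: "r \<in> borel_measurable borel" using assms by auto
  show "(\<lambda>\<xi>. sin (z \<bullet> \<xi>) * r \<xi>) \<in> borel_measurable lborel" by measurable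
qed (auto simp: abs_mult intro!: mult_left_le_one_le)

lemma abs_rker_le:
  fixes r :: "'a::euclidean_space \<Rightarrow> real"
  assumes "integrable lborel r"
  shows "\<bar>rker r z\<bar> \<le> (\<integral>\<xi>. \<bar>r \<xi>\<bar> \<partial>lborel) / (2 * pi) ^ DIM('a)"
proof -
  have "\<bar>\<integral>\<xi>. cos (z \<bullet> \<xi>) * r \<xi> \<partial>lborel\<bar> \<le> (\<integral>\<xi>. \<bar>r \<xi>\<bar> \<partial>lborel)"
    using assms by (intro integral_abs_bound[THEN order_trans] integral_mono integrable_abs integrable_cos_mult)
       (auto simp: abs_mult intro!: mult_left_le_one_le)
  then show ?thesis unfolding rker_def by (simp add: divide_right_mono abs_divide)
qed

lemma rker_minus: "rker r (- z) = rker r z"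
  by (simp add: rker_def)

text \<open>A regularised Parseval identity: Fubini moves the transform from \<open>r\<close> to the
  Gaussian, which becomes an approximate identity centred at \<open>\<xi>\<close>. The weight is
  present because \<open>rker r\<close> is not yet known to be integrable.\<close>

lemma rker_gaussian_dual:
  fixes r :: "'a::euclidean_space \<Rightarrow> real"
  assumes r: "integrable lborel r" and even: "\<And>\<xi>. r (- \<xi>) = r \<xi>" and e: "e > 0"
  shows "(\<integral>z. cos (z \<bullet> \<xi>) * exp (- e\<^sup>2 * (norm z)\<^sup>2) * rker r z \<partial>lborel)
       = (\<integral>\<zeta>. exp (- (norm \<zeta>)\<^sup>2) * r (\<xi> - (2 * e) *\<^sub>R \<zeta>) \<partial>lborel) / sqrt pi ^ DIM('a)"
proof -
  have e2: "e\<^sup>2 > 0" using e by simp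
  have [measurable]: "r \<in> borel_measurable borel" using r by auto
  let ?G = "\<lambda>z::'a. exp (- e\<^sup>2 * (norm z)\<^sup>2)"
  let ?S = "sqrt (pi / e\<^sup>2) ^ DIM('a)"
  have int: "integrable (lborel \<Otimes>\<^sub>M lborel) (\<lambda>(z, \<eta>). cos (z \<bullet> \<xi>) * ?G z * (cos (z \<bullet> \<eta>) * r \<eta>))"
  proof (rule integrable_pair_dominated[OF gaussian_integral(1)[OF e2] integrable_abs[OF r]])
    fix z \<eta> :: 'a
    have "\<bar>cos (z \<bullet> \<xi>) * ?G z * (cos (z \<bullet> \<eta>) * r \<eta>)\<bar> = (\<bar>cos (z \<bullet> \<xi>)\<bar> * \<bar>cos (z \<bullet> \<eta>)\<bar>) * (?G z * \<bar>r \<eta>\<bar>)"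
      by (simp add: abs_mult)
    also have "\<dots> \<le> 1 * (?G z * \<bar>r \<eta>\<bar>)"
      by (intro mult_right_mono mult_le_one) auto
    finally show "\<bar>cos (z \<bullet> \<xi>) * ?G z * (cos (z \<bullet> \<eta>) * r \<eta>)\<bar> \<le> ?G z * \<bar>r \<eta>\<bar>" by simp
  qed measurable
  have inner: "(\<integral>z. cos (z \<bullet> \<xi>) * ?G z * (cos (z \<bullet> \<eta>) * r \<eta>) \<partial>lborel)
     = ?S / 2 * (r \<eta> * exp (- (norm (\<xi> - \<eta>))\<^sup>2 / (4 * e\<^sup>2)) + r \<eta> * exp (- (norm (\<xi> + \<eta>))\<^sup>2 / (4 * e\<^sup>2)))" for \<eta>
  proof -
    have peq: "cos (z \<bullet> \<xi>) * ?G z * (cos (z \<bullet> \<eta>) * r \<eta>)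
       = r \<eta> / 2 * (cos (z \<bullet> (\<xi> - \<eta>)) * ?G z + cos (z \<bullet> (\<xi> + \<eta>)) * ?G z)" for z
    proof -
      have "cos (z \<bullet> \<xi>) * cos (z \<bullet> \<eta>) = (cos (z \<bullet> (\<xi> - \<eta>)) + cos (z \<bullet> (\<xi> + \<eta>))) / 2"
        by (simp add: cos_times_cos inner_simps)
      then have "cos (z \<bullet> \<xi>) * ?G z * (cos (z \<bullet> \<eta>) * r \<eta>)
         = (cos (z \<bullet> (\<xi> - \<eta>)) + cos (z \<bullet> (\<xi> + \<eta>))) / 2 * (?G z * r \<eta>)"
        by (metis (no_types, opaque_lifting) mult.assoc mult.left_commute)
      then show ?thesis by (simp only:) (simp add: field_simps)
    qed
    have "(\<integral>z. cos (z \<bullet> \<xi>) * ?G z * (cos (z \<bullet> \<eta>) * r \<eta>) \<partial>lborel)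
      = r \<eta> / 2 * (\<integral>z. cos (z \<bullet> (\<xi> - \<eta>)) * ?G z + cos (z \<bullet> (\<xi> + \<eta>)) * ?G z \<partial>lborel)" unfolding peq by (rule integral_mult_right_zero)
    also have "(\<integral>z. cos (z \<bullet> (\<xi> - \<eta>)) * ?G z + cos (z \<bullet> (\<xi> + \<eta>)) * ?G z \<partial>lborel)
      = ?S * exp (- (norm (\<xi> - \<eta>))\<^sup>2 / (4 * e\<^sup>2)) + ?S * exp (- (norm (\<xi> + \<eta>))\<^sup>2 / (4 * e\<^sup>2))"
      by (subst Bochner_Integration.integral_add[OF gaussian_cos(1)[OF e2] gaussian_cos(1)[OF e2]])
         (simp only: gaussian_cos(2)[OF e2])
    finally show ?thesis by (simp add: algebra_simps)
  qed
  let ?E = "\<lambda>v::'a. exp (- (norm v)\<^sup>2 / (4 * e\<^sup>2))"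
  have ri: "integrable lborel (\<lambda>\<eta>. r \<eta> * ?E (\<xi> - \<eta>))" "integrable lborel (\<lambda>\<eta>. r \<eta> * ?E (\<xi> + \<eta>))"
    by (rule Bochner_Integration.integrable_bound[OF r]; auto simp: abs_mult intro!: mult_left_le)+
  \<comment> \<open>The product formula for cosines produces terms in \<open>\<xi> + \<eta>\<close>
    and \<open>\<xi> - \<eta>\<close>; evenness of \<open>r\<close> makes their integrals
    equal.\<close>
  have flip: "(\<integral>\<eta>. r \<eta> * ?E (\<xi> + \<eta>) \<partial>lborel) = (\<integral>\<eta>. r \<eta> * ?E (\<xi> - \<eta>) \<partial>lborel)"
    using integral_lborel_reflect(1)[of "\<lambda>\<eta>. r \<eta> * ?E (\<xi> - \<eta>)" 0] by (simp add: even)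
  have aff: "(\<integral>\<eta>. r \<eta> * ?E (\<xi> - \<eta>) \<partial>lborel) = (2 * e) ^ DIM('a) * (\<integral>\<zeta>. exp (- (norm \<zeta>)\<^sup>2) * r (\<xi> - (2 * e) *\<^sub>R \<zeta>) \<partial>lborel)"
    using e by (subst integral_lborel_affine[where c="- (2 * e)" and t=\<xi>])
       (auto simp: power_mult_distrib mult.commute)
  have "(2 * pi) ^ DIM('a) * (\<integral>z. cos (z \<bullet> \<xi>) * ?G z * rker r z \<partial>lborel)
     = (\<integral>z. \<integral>\<eta>. cos (z \<bullet> \<xi>) * ?G z * (cos (z \<bullet> \<eta>) * r \<eta>) \<partial>lborel \<partial>lborel)"
    by (simp only: integral_mult_right_zero rker_def times_divide_eq_right integral_divide_zero) simp
  also have "\<dots> = (\<integral>\<eta>. \<integral>z. cos (z \<bullet> \<xi>) * ?G z * (cos (z \<bullet> \<eta>) * r \<eta>) \<partial>lborel \<partial>lborel)"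
    using lborel_pair.Fubini_integral[OF int] by simp
  also have "\<dots> = ?S / 2 * ((\<integral>\<eta>. r \<eta> * ?E (\<xi> - \<eta>) \<partial>lborel) + (\<integral>\<eta>. r \<eta> * ?E (\<xi> + \<eta>) \<partial>lborel))"
    unfolding inner by (subst integral_mult_right_zero, subst Bochner_Integration.integral_add[OF ri]) simp
  also have "\<dots> = (?S * (2 * e) ^ DIM('a)) * (\<integral>\<zeta>. exp (- (norm \<zeta>)\<^sup>2) * r (\<xi> - (2 * e) *\<^sub>R \<zeta>) \<partial>lborel)"
    unfolding flip aff by simp
  also have "?S * (2 * e) ^ DIM('a) = (2 * sqrt pi) ^ DIM('a)"
  proof -
    have "sqrt (pi / e\<^sup>2) * (2 * e) = 2 * sqrt pi" using e by (simp add: real_sqrt_divide)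
    then show ?thesis by (subst power_mult_distrib[symmetric]) (simp only:)
  qed
  finally have "(\<integral>z. cos (z \<bullet> \<xi>) * ?G z * rker r z \<partial>lborel)
     = (2 * sqrt pi) ^ DIM('a) / (2 * pi) ^ DIM('a) * (\<integral>\<zeta>. exp (- (norm \<zeta>)\<^sup>2) * r (\<xi> - (2 * e) *\<^sub>R \<zeta>) \<partial>lborel)"
    by (simp add: field_simps)
  also have "(2 * sqrt pi) ^ DIM('a) / (2 * pi) ^ DIM('a) = 1 / sqrt pi ^ DIM('a)"
  proof -
    have "2 * sqrt pi / (2 * pi) = 1 / sqrt pi" by (subst frac_eq_eq) auto
    then show ?thesis by (subst power_divide[symmetric]) (simp only: power_one_over)
  qed
  finally show ?thesis by simp
qed

text \<open>Nonnegativity of \<open>rker r\<close> takes the place of an integrability hypothesis.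
  At \<open>\<xi> = 0\<close> the regularised integrals of \<open>rker_gaussian_dual\<close> tend to
  \<open>r 0\<close>, so Fatou's lemma bounds the integral of \<open>rker r\<close>; with this
  majorant dominated convergence removes the Gaussian at every \<open>\<xi>\<close>.\<close>

lemma rker_inverse:
  fixes r :: "'a::euclidean_space \<Rightarrow> real"
  assumes r: "integrable lborel r" and even: "\<And>\<xi>. r (- \<xi>) = r \<xi>"
    and cont: "continuous_on UNIV r" and bdd: "\<And>\<xi>. \<bar>r \<xi>\<bar> \<le> B" and pos: "\<And>z. rker r z \<ge> 0"
  shows "integrable lborel (rker r)"
    and "(\<integral>z. cos (z \<bullet> \<xi>) * rker r z \<partial>lborel) = r \<xi>"
proof -
  have [measurable]: "r \<in> borel_measurable borel" using r by auto
  define e where "e n = 1 / (real n + 1)" for n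
  have e: "e n > 0" for n unfolding e_def by simp
  have e0: "e \<longlonglongrightarrow> 0" unfolding e_def by real_asymp
  let ?I = "\<lambda>\<xi> n. \<integral>z. cos (z \<bullet> \<xi>) * exp (- (e n)\<^sup>2 * (norm z)\<^sup>2) * rker r z \<partial>lborel"
  have lim: "?I \<xi> \<longlonglongrightarrow> r \<xi>" for \<xi>
  proof -
    have "(\<lambda>n. \<integral>\<zeta>. exp (- (norm \<zeta>)\<^sup>2) * r (\<xi> - (2 * e n) *\<^sub>R \<zeta>) \<partial>lborel) \<longlonglongrightarrow> (\<integral>\<zeta>. exp (- (norm (\<zeta>::'a))\<^sup>2) * r \<xi> \<partial>lborel)"
    proof (rule integral_dominated_convergence[where w="\<lambda>\<zeta>::'a. exp (- (norm \<zeta>)\<^sup>2) * B"])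
      show "integrable lborel (\<lambda>\<zeta>::'a. exp (- (norm \<zeta>)\<^sup>2) * B)"
        using gaussian_integral(1)[of 1, where ?'a='a] by simp
      show "AE \<zeta> in lborel. (\<lambda>n. exp (- (norm \<zeta>)\<^sup>2) * r (\<xi> - (2 * e n) *\<^sub>R \<zeta>)) \<longlonglongrightarrow> exp (- (norm \<zeta>)\<^sup>2) * r \<xi>"
      proof (rule AE_I2)
        fix \<zeta> :: 'a
        have "(\<lambda>n. \<xi> - (2 * e n) *\<^sub>R \<zeta>) \<longlonglongrightarrow> \<xi> - (2 * 0) *\<^sub>R \<zeta>" by (intro tendsto_intros e0)
        then have "(\<lambda>n. r (\<xi> - (2 * e n) *\<^sub>R \<zeta>)) \<longlonglongrightarrow> r \<xi>"
          by (intro continuous_on_tendsto_compose[OF cont]) auto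
        then show "(\<lambda>n. exp (- (norm \<zeta>)\<^sup>2) * r (\<xi> - (2 * e n) *\<^sub>R \<zeta>)) \<longlonglongrightarrow> exp (- (norm \<zeta>)\<^sup>2) * r \<xi>"
          by (intro tendsto_intros)
      qed
    qed (use bdd in \<open>auto simp: abs_mult\<close>)
    also have "(\<integral>\<zeta>. exp (- (norm (\<zeta>::'a))\<^sup>2) * r \<xi> \<partial>lborel) = sqrt pi ^ DIM('a) * r \<xi>"
      using gaussian_integral(2)[of 1, where ?'a='a] by simp
    finally have "(\<lambda>n. (\<integral>\<zeta>. exp (- (norm \<zeta>)\<^sup>2) * r (\<xi> - (2 * e n) *\<^sub>R \<zeta>) \<partial>lborel) / sqrt pi ^ DIM('a))
        \<longlonglongrightarrow> sqrt pi ^ DIM('a) * r \<xi> / sqrt pi ^ DIM('a)"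
      by (intro tendsto_divide tendsto_const) auto
    then show ?thesis unfolding rker_gaussian_dual[OF r even e] by simp
  qed
  have gi: "integrable lborel (\<lambda>z. exp (- (e n)\<^sup>2 * (norm z)\<^sup>2) * rker r z)" for n
  proof (rule Bochner_Integration.integrable_bound)
    show "integrable lborel (\<lambda>z::'a. exp (- (e n)\<^sup>2 * (norm z)\<^sup>2) * ((\<integral>\<xi>. \<bar>r \<xi>\<bar> \<partial>lborel) / (2 * pi) ^ DIM('a)))"
      using gaussian_integral(1)[of "(e n)\<^sup>2", where ?'a='a] e[of n] by (intro integrable_mult_left) simp
    show "AE z in lborel. norm (exp (- (e n)\<^sup>2 * (norm z)\<^sup>2) * rker r z) \<le> norm (exp (- (e n)\<^sup>2 * (norm z)\<^sup>2) * ((\<integral>\<xi>. \<bar>r \<xi>\<bar> \<partial>lborel) / (2 * pi) ^ DIM('a)))"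
      unfolding real_norm_def abs_mult
      by (intro AE_I2 mult_left_mono order_trans[OF abs_rker_le[OF r]] abs_ge_self) auto
  qed measurable
  have tl: "(\<lambda>n. exp (- (e n)\<^sup>2 * (norm z)\<^sup>2) * rker r z) \<longlonglongrightarrow> rker r z" for z
  proof -
    have "(\<lambda>n. exp (- (e n)\<^sup>2 * (norm z)\<^sup>2) * rker r z) \<longlonglongrightarrow> exp (- 0\<^sup>2 * (norm z)\<^sup>2) * rker r z"
      by (intro tendsto_intros e0)
    then show ?thesis by simp
  qed
  have "(\<integral>\<^sup>+z. ennreal (rker r z) \<partial>lborel) = (\<integral>\<^sup>+z. liminf (\<lambda>n. ennreal (exp (- (e n)\<^sup>2 * (norm z)\<^sup>2) * rker r z)) \<partial>lborel)"
    by (intro nn_integral_cong lim_imp_Liminf[symmetric] tendsto_ennrealI tl) auto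
  also have "\<dots> \<le> liminf (\<lambda>n. \<integral>\<^sup>+z. ennreal (exp (- (e n)\<^sup>2 * (norm z)\<^sup>2) * rker r z) \<partial>lborel)"
    by (intro nn_integral_liminf) measurable
  also have "(\<lambda>n. \<integral>\<^sup>+z. ennreal (exp (- (e n)\<^sup>2 * (norm z)\<^sup>2) * rker r z) \<partial>lborel) = (\<lambda>n. ennreal (?I 0 n))"
    by (intro ext, subst nn_integral_eq_integral[OF gi]) (auto simp: pos)
  also have "liminf (\<lambda>n. ennreal (?I 0 n)) = ennreal (r 0)"
    by (intro lim_imp_Liminf tendsto_ennrealI lim) auto
  finally have "(\<integral>\<^sup>+z. ennreal (rker r z) \<partial>lborel) < \<infinity>" by (simp add: le_less_trans)
  then show int: "integrable lborel (rker r)"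
    by (intro integrableI_nonneg) (auto simp: pos)
  have "?I \<xi> \<longlonglongrightarrow> (\<integral>z. cos (z \<bullet> \<xi>) * rker r z \<partial>lborel)"
  proof (rule integral_dominated_convergence[OF _ _ int])
    show "AE z in lborel. (\<lambda>n. cos (z \<bullet> \<xi>) * exp (- (e n)\<^sup>2 * (norm z)\<^sup>2) * rker r z) \<longlonglongrightarrow> cos (z \<bullet> \<xi>) * rker r z"
      using tl by (auto intro!: AE_I2 tendsto_mult_left simp: mult.assoc)
    fix n
    show "AE z in lborel. norm (cos (z \<bullet> \<xi>) * exp (- (e n)\<^sup>2 * (norm z)\<^sup>2) * rker r z) \<le> rker r z"
      using pos by (auto intro!: AE_I2 mult_left_le_one_le mult_le_one simp: abs_mult)
  qed measurable
  with lim[of \<xi>] show "(\<integral>z. cos (z \<bullet> \<xi>) * rker r z \<partial>lborel) = r \<xi>"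
    using LIMSEQ_unique by blast
qed

text \<open>The Gaussian factor makes the integral converge for every bounded \<open>r\<close>; in the symbol of the heat
  kernel it is supplied by the Laplacian.\<close>

definition posdef :: "('a::euclidean_space \<Rightarrow> real) \<Rightarrow> bool" where
  "posdef r \<longleftrightarrow> r \<in> borel_measurable borel \<and> (\<exists>B. \<forall>\<xi>. \<bar>r \<xi>\<bar> \<le> B) \<and>
     (\<forall>t>0. \<forall>z. 0 \<le> (\<integral>\<xi>. cos (z \<bullet> \<xi>) * (exp (- t * (norm \<xi>)\<^sup>2) * r \<xi>) \<partial>lborel))"

lemma integrable_gaussian_mult:
  fixes r :: "'a::euclidean_space \<Rightarrow> real"
  assumes [measurable]: "r \<in> borel_measurable borel" and B: "\<And>\<xi>. \<bar>r \<xi>\<bar> \<le> B" and t: "t > 0"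
  shows "integrable lborel (\<lambda>\<xi>. exp (- t * (norm \<xi>)\<^sup>2) * r \<xi>)"
proof (rule Bochner_Integration.integrable_bound)
  show "integrable lborel (\<lambda>\<xi>::'a. exp (- t * (norm \<xi>)\<^sup>2) * B)"
    by (intro integrable_mult_left gaussian_integral(1) t)
  show "AE \<xi> in lborel. norm (exp (- t * (norm \<xi>)\<^sup>2) * r \<xi>) \<le> norm (exp (- t * (norm \<xi>)\<^sup>2) * B)"
    unfolding real_norm_def abs_mult
    by (intro AE_I2 mult_left_mono order_trans[OF B]) auto
qed measurable

lemma posdef_integrable:
  assumes "posdef r" "t > 0"
  shows "integrable lborel (\<lambda>\<xi>. cos (z \<bullet> \<xi>) * (exp (- t * (norm \<xi>)\<^sup>2) * r \<xi>))"
proof -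
  obtain B where "\<And>\<xi>. \<bar>r \<xi>\<bar> \<le> B" and "r \<in> borel_measurable borel" using assms unfolding posdef_def by auto
  then show ?thesis using assms(2) by (intro integrable_cos_mult integrable_gaussian_mult)
qed

lemma posdef_one: "posdef (\<lambda>_::'a::euclidean_space. 1)"
  unfolding posdef_def
proof (intro conjI allI impI)
  fix t :: real and z :: 'a assume t: "t > 0"
  have "(\<integral>\<xi>. cos (\<xi> \<bullet> z) * exp (- t * (norm \<xi>)\<^sup>2) \<partial>lborel) \<ge> 0"
    unfolding gaussian_cos(2)[OF t] using t by simp
  then show "0 \<le> (\<integral>\<xi>. cos (z \<bullet> \<xi>) * (exp (- t * (norm \<xi>)\<^sup>2) * 1) \<partial>lborel)" by (simp add: inner_commute)
qed auto

lemma posdef_add: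
  assumes f: "posdef f" and g: "posdef g" shows "posdef (\<lambda>\<xi>. f \<xi> + g \<xi>)"
  unfolding posdef_def
proof (intro conjI allI impI)
  show "(\<lambda>\<xi>. f \<xi> + g \<xi>) \<in> borel_measurable borel" using f g unfolding posdef_def by auto
  obtain A B where "\<And>\<xi>. \<bar>f \<xi>\<bar> \<le> A" "\<And>\<xi>. \<bar>g \<xi>\<bar> \<le> B" using f g unfolding posdef_def by auto
  then have "\<bar>f \<xi> + g \<xi>\<bar> \<le> A + B" for \<xi> by (meson abs_triangle_ineq add_mono order_trans)
  then show "\<exists>B. \<forall>\<xi>. \<bar>f \<xi> + g \<xi>\<bar> \<le> B" by blast
  fix t z assume t: "(t::real) > 0"
  have "(\<integral>\<xi>. cos (z \<bullet> \<xi>) * (exp (- t * (norm \<xi>)\<^sup>2) * (f \<xi> + g \<xi>)) \<partial>lborel)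
     = (\<integral>\<xi>. cos (z \<bullet> \<xi>) * (exp (- t * (norm \<xi>)\<^sup>2) * f \<xi>) + cos (z \<bullet> \<xi>) * (exp (- t * (norm \<xi>)\<^sup>2) * g \<xi>) \<partial>lborel)"
    by (simp add: distrib_left)
  also have "\<dots> = (\<integral>\<xi>. cos (z \<bullet> \<xi>) * (exp (- t * (norm \<xi>)\<^sup>2) * f \<xi>) \<partial>lborel) + (\<integral>\<xi>. cos (z \<bullet> \<xi>) * (exp (- t * (norm \<xi>)\<^sup>2) * g \<xi>) \<partial>lborel)"
    by (intro Bochner_Integration.integral_add posdef_integrable f g t)
  also have "\<dots> \<ge> 0" using f g t unfolding posdef_def by (intro add_nonneg_nonneg) auto
  finally show "0 \<le> (\<integral>\<xi>. cos (z \<bullet> \<xi>) * (exp (- t * (norm \<xi>)\<^sup>2) * (f \<xi> + g \<xi>)) \<partial>lborel)" .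
qed

lemma posdef_cmult:
  assumes f: "posdef f" and c: "c \<ge> 0" shows "posdef (\<lambda>\<xi>. c * f \<xi>)"
  unfolding posdef_def
proof (intro conjI allI impI)
  show "(\<lambda>\<xi>. c * f \<xi>) \<in> borel_measurable borel" using f unfolding posdef_def by auto
  obtain A where "\<And>\<xi>. \<bar>f \<xi>\<bar> \<le> A" using f unfolding posdef_def by auto
  then have "\<bar>c * f \<xi>\<bar> \<le> c * A" for \<xi> using c by (simp add: abs_mult mult_left_mono)
  then show "\<exists>B. \<forall>\<xi>. \<bar>c * f \<xi>\<bar> \<le> B" by blast
  fix t z assume t: "(t::real) > 0"
  have "(\<integral>\<xi>. cos (z \<bullet> \<xi>) * (exp (- t * (norm \<xi>)\<^sup>2) * (c * f \<xi>)) \<partial>lborel)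
     = c * (\<integral>\<xi>. cos (z \<bullet> \<xi>) * (exp (- t * (norm \<xi>)\<^sup>2) * f \<xi>) \<partial>lborel)"
    by (subst integral_mult_right_zero[symmetric]) (simp add: mult_ac)
  also have "\<dots> \<ge> 0" using f t c unfolding posdef_def by (intro mult_nonneg_nonneg) auto
  finally show "0 \<le> (\<integral>\<xi>. cos (z \<bullet> \<xi>) * (exp (- t * (norm \<xi>)\<^sup>2) * (c * f \<xi>)) \<partial>lborel)" .
qed

text \<open>The uniform bound makes a multiple of the Gaussian factor a common majorant. It closes
  the class under the two limits taken below: the exponential series and the removal of a
  truncation.\<close>

lemma posdef_limit:
  assumes f: "\<And>n. posdef (f n)" and B: "\<And>n \<xi>. \<bar>f n \<xi>\<bar> \<le> B" and lim: "\<And>\<xi>. (\<lambda>n. f n \<xi>) \<longlonglongrightarrow> g \<xi>"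
  shows "posdef g"
  unfolding posdef_def
proof (intro conjI allI impI)
  have [measurable]: "f n \<in> borel_measurable borel" for n using f unfolding posdef_def by auto
  show [measurable]: "g \<in> borel_measurable borel" by (rule borel_measurable_LIMSEQ_metric[OF _ lim]) simp
  have "\<bar>g \<xi>\<bar> \<le> B" for \<xi> using lim[of \<xi>] B by (intro LIMSEQ_le_const2[OF tendsto_rabs]) auto
  then show "\<exists>B. \<forall>\<xi>. \<bar>g \<xi>\<bar> \<le> B" by blast
  fix t z assume t: "(t::real) > 0"
  have "(\<lambda>n. \<integral>\<xi>. cos (z \<bullet> \<xi>) * (exp (- t * (norm \<xi>)\<^sup>2) * f n \<xi>) \<partial>lborel) \<longlonglongrightarrow> (\<integral>\<xi>. cos (z \<bullet> \<xi>) * (exp (- t * (norm \<xi>)\<^sup>2) * g \<xi>) \<partial>lborel)"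
  proof (rule integral_dominated_convergence)
    show "integrable lborel (\<lambda>\<xi>. exp (- t * (norm \<xi>)\<^sup>2) * B)" by (intro integrable_mult_left gaussian_integral(1) t)
    show "AE \<xi> in lborel. norm (cos (z \<bullet> \<xi>) * (exp (- t * (norm \<xi>)\<^sup>2) * f n \<xi>)) \<le> exp (- t * (norm \<xi>)\<^sup>2) * B" for n
    proof (rule AE_I2)
      fix \<xi>
      have "norm (cos (z \<bullet> \<xi>) * (exp (- t * (norm \<xi>)\<^sup>2) * f n \<xi>)) \<le> exp (- t * (norm \<xi>)\<^sup>2) * \<bar>f n \<xi>\<bar>"
        by (auto simp: abs_mult intro!: mult_left_le_one_le)
      also have "\<dots> \<le> exp (- t * (norm \<xi>)\<^sup>2) * B" by (intro mult_left_mono B) auto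
      finally show "norm (cos (z \<bullet> \<xi>) * (exp (- t * (norm \<xi>)\<^sup>2) * f n \<xi>)) \<le> exp (- t * (norm \<xi>)\<^sup>2) * B" .
    qed
  qed (auto intro!: AE_I2 tendsto_intros lim)
  then show "0 \<le> (\<integral>\<xi>. cos (z \<bullet> \<xi>) * (exp (- t * (norm \<xi>)\<^sup>2) * g \<xi>) \<partial>lborel)"
    using f t unfolding posdef_def by (intro LIMSEQ_le_const) auto
qed

text \<open>Since \<open>posdef\<close> quantifies over all \<open>t > 0\<close>, multiplication by
  \<open>exp (- v \<mu> * (norm \<xi>)\<^sup>2)\<close> merely replaces \<open>t\<close> by
  \<open>t + v \<mu>\<close>, and a nonnegative weight preserves the sign. This yields products with
  mixtures of Gaussians without any convolution.\<close>

lemma posdef_mix: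
  fixes r :: "'a::euclidean_space \<Rightarrow> real" and w v :: "real \<Rightarrow> real"
  assumes r: "posdef r" and w: "integrable lborel w" "\<And>\<mu>. w \<mu> \<ge> 0"
    and [measurable]: "v \<in> borel_measurable borel" and v: "\<And>\<mu>. v \<mu> \<ge> 0"
  shows "posdef (\<lambda>\<xi>. r \<xi> * (\<integral>\<mu>. w \<mu> * exp (- v \<mu> * (norm \<xi>)\<^sup>2) \<partial>lborel))"
  unfolding posdef_def
proof (intro conjI allI impI)
  have [measurable]: "r \<in> borel_measurable borel" "w \<in> borel_measurable borel" using r w unfolding posdef_def by auto
  show "(\<lambda>\<xi>. r \<xi> * (\<integral>\<mu>. w \<mu> * exp (- v \<mu> * (norm \<xi>)\<^sup>2) \<partial>lborel)) \<in> borel_measurable borel" by measurable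
  obtain B where B: "\<And>\<xi>. \<bar>r \<xi>\<bar> \<le> B" using r unfolding posdef_def by auto
  have B0: "B \<ge> 0" using B[of 0] by linarith
  have e1: "exp (- v \<mu> * (norm \<xi>)\<^sup>2) \<le> 1" for \<mu> and \<xi> :: 'a using v[of \<mu>] by simp
  have wi: "integrable lborel (\<lambda>\<mu>. w \<mu> * exp (- v \<mu> * (norm \<xi>)\<^sup>2))" for \<xi> :: 'a
    by (rule Bochner_Integration.integrable_bound[OF w(1)]) (use v w(2) in \<open>auto simp: abs_mult intro!: mult_left_le\<close>)
  have m: "0 \<le> (\<integral>\<mu>. w \<mu> * exp (- v \<mu> * (norm \<xi>)\<^sup>2) \<partial>lborel)" "(\<integral>\<mu>. w \<mu> * exp (- v \<mu> * (norm \<xi>)\<^sup>2) \<partial>lborel) \<le> integral\<^sup>L lborel w" for \<xi> :: 'a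
    by (intro Bochner_Integration.integral_nonneg mult_nonneg_nonneg w(2) exp_ge_zero)
       (intro integral_mono wi w(1) mult_left_le e1 w(2))
  have "\<bar>r \<xi> * (\<integral>\<mu>. w \<mu> * exp (- v \<mu> * (norm \<xi>)\<^sup>2) \<partial>lborel)\<bar> \<le> B * integral\<^sup>L lborel w" for \<xi>
    unfolding abs_mult using m[of \<xi>] by (intro mult_mono B) (auto simp: B0)
  then show "\<exists>B. \<forall>\<xi>. \<bar>r \<xi> * (\<integral>\<mu>. w \<mu> * exp (- v \<mu> * (norm \<xi>)\<^sup>2) \<partial>lborel)\<bar> \<le> B" by blast
  fix t and z :: 'a assume t: "(t::real) > 0"
  have int: "integrable (lborel \<Otimes>\<^sub>M lborel) (\<lambda>(\<xi>, \<mu>). cos (z \<bullet> \<xi>) * (exp (- t * (norm \<xi>)\<^sup>2) * (r \<xi> * (w \<mu> * exp (- v \<mu> * (norm \<xi>)\<^sup>2)))))"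
  proof (rule integrable_pair_dominated[OF integrable_mult_left[OF gaussian_integral(1)[OF t], of B] w(1)])
    fix \<xi> :: 'a and \<mu>
    have "\<bar>cos (z \<bullet> \<xi>) * (exp (- t * (norm \<xi>)\<^sup>2) * (r \<xi> * (w \<mu> * exp (- v \<mu> * (norm \<xi>)\<^sup>2))))\<bar>
      = (\<bar>cos (z \<bullet> \<xi>)\<bar> * exp (- v \<mu> * (norm \<xi>)\<^sup>2)) * (exp (- t * (norm \<xi>)\<^sup>2) * \<bar>r \<xi>\<bar> * w \<mu>)"
      using w(2) by (simp add: abs_mult)
    also have "\<dots> \<le> 1 * (exp (- t * (norm \<xi>)\<^sup>2) * B * w \<mu>)"
      using w(2) B B0 e1 by (intro mult_mono mult_le_one mult_nonneg_nonneg mult_left_mono) auto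
    finally show "\<bar>cos (z \<bullet> \<xi>) * (exp (- t * (norm \<xi>)\<^sup>2) * (r \<xi> * (w \<mu> * exp (- v \<mu> * (norm \<xi>)\<^sup>2))))\<bar> \<le> exp (- t * (norm \<xi>)\<^sup>2) * B * w \<mu>"
      by simp
  qed measurable
  have "(\<integral>\<xi>. cos (z \<bullet> \<xi>) * (exp (- t * (norm \<xi>)\<^sup>2) * (r \<xi> * (\<integral>\<mu>. w \<mu> * exp (- v \<mu> * (norm \<xi>)\<^sup>2) \<partial>lborel))) \<partial>lborel)
    = (\<integral>\<xi>. \<integral>\<mu>. cos (z \<bullet> \<xi>) * (exp (- t * (norm \<xi>)\<^sup>2) * (r \<xi> * (w \<mu> * exp (- v \<mu> * (norm \<xi>)\<^sup>2)))) \<partial>lborel \<partial>lborel)"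
    by (simp only: integral_mult_right_zero)
  also have "\<dots> = (\<integral>\<mu>. \<integral>\<xi>. cos (z \<bullet> \<xi>) * (exp (- t * (norm \<xi>)\<^sup>2) * (r \<xi> * (w \<mu> * exp (- v \<mu> * (norm \<xi>)\<^sup>2)))) \<partial>lborel \<partial>lborel)"
    using lborel_pair.Fubini_integral[OF int] by simp
  also have "\<dots> \<ge> 0"
  proof (rule Bochner_Integration.integral_nonneg)
    fix \<mu>
    have "(\<integral>\<xi>. cos (z \<bullet> \<xi>) * (exp (- t * (norm \<xi>)\<^sup>2) * (r \<xi> * (w \<mu> * exp (- v \<mu> * (norm \<xi>)\<^sup>2)))) \<partial>lborel)
      = w \<mu> * (\<integral>\<xi>. cos (z \<bullet> \<xi>) * (exp (- (t + v \<mu>) * (norm \<xi>)\<^sup>2) * r \<xi>) \<partial>lborel)"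
    proof -
      have "exp (- (t + v \<mu>) * (norm \<xi>)\<^sup>2) = exp (- t * (norm \<xi>)\<^sup>2) * exp (- v \<mu> * (norm \<xi>)\<^sup>2)" for \<xi> :: 'a
        by (simp add: exp_add[symmetric] algebra_simps)
      then show ?thesis by (subst integral_mult_right_zero[symmetric]) (simp only: mult_ac)
    qed
    also have "\<dots> \<ge> 0"
    proof (rule mult_nonneg_nonneg[OF w(2)])
      have "t + v \<mu> > 0" using t v[of \<mu>] by linarith
      then show "0 \<le> (\<integral>\<xi>. cos (z \<bullet> \<xi>) * (exp (- (t + v \<mu>) * (norm \<xi>)\<^sup>2) * r \<xi>) \<partial>lborel)"
        using r unfolding posdef_def by blast
    qed
    finally show "0 \<le> (\<integral>\<xi>. cos (z \<bullet> \<xi>) * (exp (- t * (norm \<xi>)\<^sup>2) * (r \<xi> * (w \<mu> * exp (- v \<mu> * (norm \<xi>)\<^sup>2)))) \<partial>lborel)" .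
  qed
  finally show "0 \<le> (\<integral>\<xi>. cos (z \<bullet> \<xi>) * (exp (- t * (norm \<xi>)\<^sup>2) * (r \<xi> * (\<integral>\<mu>. w \<mu> * exp (- v \<mu> * (norm \<xi>)\<^sup>2) \<partial>lborel))) \<partial>lborel)" .
qed

text \<open>Powers of the mixture are positive definite by iterating \<open>posdef_mix\<close>; the
  exponential series has nonnegative coefficients, and its partial sums are bounded by the
  exponential of the total weight.\<close>

lemma posdef_exp_mix:
  fixes w v :: "real \<Rightarrow> real"
  assumes w: "integrable lborel w" "\<And>\<mu>. w \<mu> \<ge> 0"
    and [measurable]: "v \<in> borel_measurable borel" and v: "\<And>\<mu>. v \<mu> \<ge> 0" and c: "c \<ge> 0"
  shows "posdef (\<lambda>\<xi>::'a::euclidean_space. exp (c * (\<integral>\<mu>. w \<mu> * exp (- v \<mu> * (norm \<xi>)\<^sup>2) \<partial>lborel)))"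
proof -
  define m where "m \<xi> = (\<integral>\<mu>. w \<mu> * exp (- v \<mu> * (norm \<xi>)\<^sup>2) \<partial>lborel)" for \<xi> :: 'a
  have pow: "posdef (\<lambda>\<xi>. m \<xi> ^ k)" for k
  proof (induction k)
    case (Suc k)
    from posdef_mix[OF Suc w _ v] show ?case by (simp add: m_def mult.commute)
  qed (simp add: posdef_one)
  have sum: "posdef (\<lambda>\<xi>. \<Sum>k<n. c ^ k / fact k * m \<xi> ^ k)" for n
  proof (induction n)
    case 0
    show ?case using posdef_cmult[OF posdef_one, of 0] by simp
  next
    case (Suc n)
    then show ?case using posdef_add[OF Suc posdef_cmult[OF pow, of "c ^ n / fact n" n]] c by simp
  qed
  have [measurable]: "w \<in> borel_measurable borel" using w by auto
  have e1: "exp (- v \<mu> * (norm \<xi>)\<^sup>2) \<le> 1" for \<mu> and \<xi> :: 'a using v[of \<mu>] by simp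
  have wi: "integrable lborel (\<lambda>\<mu>. w \<mu> * exp (- v \<mu> * (norm \<xi>)\<^sup>2))" for \<xi> :: 'a
    by (rule Bochner_Integration.integrable_bound[OF w(1)]) (use v w(2) in \<open>auto simp: abs_mult intro!: mult_left_le\<close>)
  have m: "0 \<le> m \<xi>" "m \<xi> \<le> integral\<^sup>L lborel w" for \<xi> :: 'a
    unfolding m_def
    by (intro Bochner_Integration.integral_nonneg mult_nonneg_nonneg w(2) exp_ge_zero)
       (intro integral_mono wi w(1) mult_left_le e1 w(2))
  have conv: "(\<lambda>k. c ^ k / fact k * m \<xi> ^ k) sums exp (c * m \<xi>)" for \<xi>
    using exp_converges[of "c * m \<xi>"] by (simp add: power_mult_distrib divide_inverse mult_ac)
  have bd: "\<bar>\<Sum>k<n. c ^ k / fact k * m \<xi> ^ k\<bar> \<le> exp (c * integral\<^sup>L lborel w)" for n \<xi>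
  proof -
    have nn: "0 \<le> c ^ k / fact k * m \<xi> ^ k" for k using c m by simp
    then have "\<bar>\<Sum>k<n. c ^ k / fact k * m \<xi> ^ k\<bar> = (\<Sum>k<n. c ^ k / fact k * m \<xi> ^ k)"
      by (intro abs_of_nonneg sum_nonneg)
    also have "\<dots> \<le> (\<Sum>k. c ^ k / fact k * m \<xi> ^ k)"
      using conv[of \<xi>] nn by (intro sum_le_suminf) (auto simp: sums_iff)
    also have "\<dots> = exp (c * m \<xi>)" using conv[of \<xi>] by (simp add: sums_iff)
    also have "\<dots> \<le> exp (c * integral\<^sup>L lborel w)" using c m by (simp add: mult_left_mono)
    finally show ?thesis .
  qed
  have "posdef (\<lambda>\<xi>. exp (c * m \<xi>))"
    by (rule posdef_limit[OF sum bd]) (use conv in \<open>simp add: sums_def\<close>)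
  then show ?thesis unfolding m_def .
qed

text \<open>The weight \<open>\<mu> powr (s - 1)\<close> representing the symbol has infinite mass
  at infinity. Cut off at \<open>n\<close> it is integrable, so the constant part of
  \<open>1 - exp (- v \<mu> * (norm \<xi>)\<^sup>2)\<close> factors out and leaves the exponential
  of a mixture with a positive sign.\<close>

lemma posdef_stable:
  assumes s: "0 < s" "s < 1" and c: "c \<ge> 0"
  shows "posdef (\<lambda>\<xi>::'a::euclidean_space. exp (- c * norm \<xi> powr (2 * s)))"
proof -
  define m0 where "m0 = enn2real (subord_mass s)"
  have m0: "m0 > 0" "subord_mass s = ennreal m0"
    using subord_mass_pos[of s] subord_mass_finite[OF s] by (auto simp: m0_def enn2real_positive_iff)
  \<comment> \<open>The factors \<open>4 powr s\<close> and \<open>1 / m0\<close> undo the scale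
    \<open>A = (norm \<xi>)\<^sup>2 / 4\<close> and the mass in \<open>subord_scale\<close>.\<close>
  define c' where "c' = c * 4 powr s / m0"
  have c': "c' \<ge> 0" using c m0 by (simp add: c'_def)
  define w where "w n \<mu> = indicator {0<..real n} \<mu> * \<mu> powr (s - 1)" for n \<mu>
  \<comment> \<open>The absolute value makes \<open>v\<close> nonnegative on the whole line; on the
    support of \<open>w n\<close> it is just \<open>1 / (4 * \<mu>)\<close>.\<close>
  define v where "v \<mu> = \<bar>1 / (4 * \<mu>)\<bar>" for \<mu> :: real
  have [measurable]: "v \<in> borel_measurable borel" "w n \<in> borel_measurable borel" for n unfolding v_def w_def by measurable
  have w: "integrable lborel (w n)" for n
  proof (rule integrableI_nonneg)
    have "(\<integral>\<^sup>+x. ennreal (w n x) \<partial>lborel) \<le> (\<integral>\<^sup>+x. ennreal (indicator {0..real n} x * x powr (s - 1)) \<partial>lborel)"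
      by (intro nn_integral_mono ennreal_leI) (auto simp: w_def split: split_indicator)
    also have "\<dots> < \<infinity>"
      using nn_integral_has_integral_lebesgue[OF _ has_integral_powr_from_0[of "s - 1" "real n"]] s by simp
    finally show "(\<integral>\<^sup>+x. ennreal (w n x) \<partial>lborel) < \<infinity>" .
  qed (auto simp: w_def)
  have wn: "w n \<mu> \<ge> 0" for n \<mu> by (simp add: w_def)
  have vn: "v \<mu> \<ge> 0" for \<mu> by (simp add: v_def)
  let ?d = "\<lambda>n \<xi>. \<integral>\<mu>. w n \<mu> * (1 - exp (- v \<mu> * (norm \<xi>)\<^sup>2)) \<partial>lborel"
  have wi: "integrable lborel (\<lambda>\<mu>. w n \<mu> * exp (- v \<mu> * (norm \<xi>)\<^sup>2))" for n and \<xi> :: 'a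
    by (rule Bochner_Integration.integrable_bound[OF w[of n]]) (use vn wn in \<open>auto simp: abs_mult intro!: mult_left_le\<close>)
  have d: "?d n \<xi> = integral\<^sup>L lborel (w n) - (\<integral>\<mu>. w n \<mu> * exp (- v \<mu> * (norm \<xi>)\<^sup>2) \<partial>lborel)" for n and \<xi> :: 'a
    by (subst Bochner_Integration.integral_diff[symmetric, OF w wi]) (simp add: algebra_simps)
  have pd: "posdef (\<lambda>\<xi>::'a. exp (- c' * ?d n \<xi>))" for n
  proof -
    have "exp (- c' * ?d n \<xi>) = exp (- c' * integral\<^sup>L lborel (w n)) * exp (c' * (\<integral>\<mu>. w n \<mu> * exp (- v \<mu> * (norm \<xi>)\<^sup>2) \<partial>lborel))" for \<xi> :: 'a
      unfolding d by (simp add: exp_add[symmetric] algebra_simps)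
    then show ?thesis
      using posdef_cmult[OF posdef_exp_mix[where w="w n" and v=v, OF w wn _ vn c'], of "exp (- c' * integral\<^sup>L lborel (w n))"] by simp
  qed
  show ?thesis
  proof (rule posdef_limit[OF pd])
    fix n and \<xi> :: 'a
    have "?d n \<xi> \<ge> 0" using wn vn by (intro Bochner_Integration.integral_nonneg mult_nonneg_nonneg) auto
    then show "\<bar>exp (- c' * ?d n \<xi>)\<bar> \<le> 1" using c' by simp
  next
    fix \<xi> :: 'a
    let ?A = "(norm \<xi>)\<^sup>2 / 4"
    let ?f = "\<lambda>\<mu>. indicator {0<..} \<mu> * (\<mu> powr (s - 1) * (1 - exp (- (?A / \<mu>))))"
    have fnn: "?f \<mu> \<ge> 0" for \<mu> by (auto split: split_indicator)
    have nnf: "(\<integral>\<^sup>+\<mu>. ennreal (?f \<mu>) \<partial>lborel) = ennreal (?A powr s * m0)"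
    proof -
      have "(\<integral>\<^sup>+\<mu>. ennreal (?f \<mu>) \<partial>lborel) = (\<integral>\<^sup>+\<mu>\<in>{0<..}. ennreal (\<mu> powr (s - 1) * (1 - exp (- (?A / \<mu>)))) \<partial>lborel)"
        by (intro nn_integral_cong) (auto split: split_indicator)
      also have "\<dots> = ennreal (?A powr s) * subord_mass s" by (rule subord_scale) (use s in auto)
      finally show ?thesis using m0 by (simp add: ennreal_mult)
    qed
    have fi: "integrable lborel ?f" by (rule integrableI_nonneg) (use nnf fnn in auto)
    have If: "integral\<^sup>L lborel ?f = ?A powr s * m0"
    proof -
      have "integral\<^sup>L lborel ?f = enn2real (\<integral>\<^sup>+\<mu>. ennreal (?f \<mu>) \<partial>lborel)"
        by (rule integral_eq_nn_integral) (measurable, use fnn in blast)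
      then show ?thesis unfolding nnf using m0 by simp
    qed
    have "(\<lambda>n. ?d n \<xi>) \<longlonglongrightarrow> integral\<^sup>L lborel ?f"
    proof (rule integral_dominated_convergence[OF _ _ fi])
      show "AE \<mu> in lborel. norm (w n \<mu> * (1 - exp (- v \<mu> * (norm \<xi>)\<^sup>2))) \<le> ?f \<mu>" for n
        by (intro AE_I2) (auto simp: w_def v_def abs_mult split: split_indicator)
      show "AE \<mu> in lborel. (\<lambda>n. w n \<mu> * (1 - exp (- v \<mu> * (norm \<xi>)\<^sup>2))) \<longlonglongrightarrow> ?f \<mu>"
      proof (rule AE_I2)
        fix \<mu> :: real
        obtain N where N: "\<mu> \<le> real N" using real_arch_simple by blast
        have "w n \<mu> * (1 - exp (- v \<mu> * (norm \<xi>)\<^sup>2)) = ?f \<mu>" if "n \<ge> N" for n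
          using N that by (auto simp: w_def v_def split: split_indicator)
        then show "(\<lambda>n. w n \<mu> * (1 - exp (- v \<mu> * (norm \<xi>)\<^sup>2))) \<longlonglongrightarrow> ?f \<mu>"
          by (intro tendsto_eventually eventually_sequentiallyI[of N])
      qed
    qed measurable
    then have "(\<lambda>n. exp (- c' * ?d n \<xi>)) \<longlonglongrightarrow> exp (- c' * (?A powr s * m0))"
      unfolding If by (intro tendsto_intros)
    moreover have "c' * (?A powr s * m0) = c * norm \<xi> powr (2 * s)"
    proof -
      have "norm \<xi> powr (2 * s) = ((norm \<xi>)\<^sup>2) powr s"
        by (cases "\<xi> = 0") (simp_all add: powr_powr[symmetric, of _ 2 s] powr_numeral)
      then show ?thesis using m0 by (simp add: c'_def powr_divide)
    qed
    ultimately show "(\<lambda>n. exp (- c' * ?d n \<xi>)) \<longlonglongrightarrow> exp (- c * norm \<xi> powr (2 * s))" by simp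
  qed
qed

section \<open>The heat kernel\<close>

definition fsym :: "real \<Rightarrow> real \<Rightarrow> 'a::euclidean_space \<Rightarrow> real" where
  "fsym s \<kappa> \<xi> = (norm \<xi>)\<^sup>2 + \<kappa> * norm \<xi> powr (2 * s)"

definition hk :: "real \<Rightarrow> real \<Rightarrow> real \<Rightarrow> 'a::euclidean_space \<Rightarrow> real" where
  "hk s \<kappa> t z = rker (\<lambda>\<xi>. exp (- t * fsym s \<kappa> \<xi>)) z"

lemma power_le_fact_exp:
  fixes x :: real assumes "x \<ge> 0" shows "x ^ m \<le> fact m * exp x"
proof -
  have c: "(\<lambda>k. x ^ k / fact k) sums exp x"
    using exp_converges[of x] by (simp add: divide_inverse mult_ac)
  have "(\<Sum>k\<in>{m}. x ^ k / fact k) \<le> (\<Sum>k. x ^ k / fact k)"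
    using c assms by (intro sum_le_suminf) (auto simp: sums_iff)
  then show ?thesis using c by (simp add: sums_iff field_simps)
qed

text \<open>The coefficient stays free because two kernels occur: \<open>\<kappa> = 1\<close> is the
  kernel majorising the datum, while the principal value operator has its own coefficient.\<close>

locale frac_heat =
  fixes s \<kappa> :: real
  assumes s: "0 < s" "s < 1" and \<kappa>: "\<kappa> > 0"
begin

lemma fsym_nonneg: "fsym s \<kappa> \<xi> \<ge> 0"
  using \<kappa> by (simp add: fsym_def)

lemma fsym_minus: "fsym s \<kappa> (- \<xi>) = fsym s \<kappa> \<xi>"
  by (simp add: fsym_def)

lemma continuous_fsym: "continuous_on UNIV (fsym s \<kappa> :: 'a::euclidean_space \<Rightarrow> real)"
  unfolding fsym_def[abs_def] using s by (intro continuous_intros continuous_on_powr') auto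

lemma borel_measurable_fsym [measurable]: "fsym s \<kappa> \<in> borel_measurable borel"
  by (rule borel_measurable_continuous_onI[OF continuous_fsym])

lemma integrable_exp_fsym:
  assumes t: "t > 0"
  shows "integrable lborel (\<lambda>\<xi>::'a::euclidean_space. exp (- t * fsym s \<kappa> \<xi>))"
proof (rule Bochner_Integration.integrable_bound[OF gaussian_integral(1)[OF t]])
  show "AE \<xi> in lborel. norm (exp (- t * fsym s \<kappa> \<xi>)) \<le> norm (exp (- t * (norm (\<xi>::'a))\<^sup>2))"
    using t \<kappa> by (intro AE_I2) (simp add: fsym_def)
qed measurable

text \<open>Half of the exponential pays for the polynomial factor, as
  \<open>y \<le> 2 / t * exp (t / 2 * y)\<close>. This is the majorant for differentiating the
  exponential in time.\<close>

lemma integrable_fsym_exp: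
  assumes t: "t > 0"
  shows "integrable lborel (\<lambda>\<xi>::'a::euclidean_space. fsym s \<kappa> \<xi> * exp (- t * fsym s \<kappa> \<xi>))"
proof (rule Bochner_Integration.integrable_bound[OF integrable_mult_right[OF integrable_exp_fsym[of "t/2"], of "2/t"]])
  show "AE \<xi> in lborel. norm (fsym s \<kappa> \<xi> * exp (- t * fsym s \<kappa> \<xi>)) \<le> norm (2 / t * exp (- (t/2) * fsym s \<kappa> (\<xi>::'a)))"
  proof (rule AE_I2)
    fix \<xi> :: 'a
    let ?y = "fsym s \<kappa> \<xi>"
    have "t / 2 * ?y \<le> exp (t / 2 * ?y)" using exp_ge_add_one_self[of "t / 2 * ?y"] by linarith
    then have "?y \<le> 2 / t * exp (t / 2 * ?y)" using t by (simp add: field_simps)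
    then have "?y * exp (- t * ?y) \<le> 2 / t * exp (t / 2 * ?y) * exp (- t * ?y)"
      by (intro mult_right_mono) auto
    also have "\<dots> = 2 / t * exp (- (t/2) * ?y)" by (simp add: exp_add[symmetric] mult.assoc)
    finally show "norm (?y * exp (- t * ?y)) \<le> norm (2 / t * exp (- (t/2) * ?y))"
      using fsym_nonneg[of \<xi>] t by (simp add: abs_mult)
  qed
qed (use t in auto)

lemma borel_measurable_hk [measurable]: "hk s \<kappa> t \<in> borel_measurable borel"
  unfolding hk_def[abs_def] by measurable

lemma borel_measurable_hk_pair [measurable (raw)]:
  assumes [measurable]: "f \<in> borel_measurable M" "g \<in> borel_measurable M"
  shows "(\<lambda>x. hk s \<kappa> (f x) (g x :: 'a::euclidean_space)) \<in> borel_measurable M"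
  unfolding hk_def rker_def by measurable

lemma hk_minus: "hk s \<kappa> t (- z) = hk s \<kappa> t z"
  unfolding hk_def by (rule rker_minus)

text \<open>The Laplacian part of the symbol is the Gaussian factor in \<open>posdef\<close>; the
  fractional part is \<open>posdef_stable\<close>.\<close>

lemma hk_nonneg:
  assumes t: "t > 0" shows "hk s \<kappa> t (z::'a::euclidean_space) \<ge> 0"
proof -
  have "posdef (\<lambda>\<xi>::'a. exp (- (t * \<kappa>) * norm \<xi> powr (2 * s)))"
    using s \<kappa> t by (intro posdef_stable) auto
  then have "0 \<le> (\<integral>\<xi>. cos (z \<bullet> \<xi>) * (exp (- t * (norm \<xi>)\<^sup>2) * exp (- (t * \<kappa>) * norm \<xi> powr (2 * s))) \<partial>lborel)"
    using t unfolding posdef_def by blast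
  moreover have "exp (- t * (norm \<xi>)\<^sup>2) * exp (- (t * \<kappa>) * norm \<xi> powr (2 * s)) = exp (- t * fsym s \<kappa> \<xi>)" for \<xi> :: 'a
    by (simp add: fsym_def exp_add[symmetric] algebra_simps)
  ultimately have "0 \<le> (\<integral>\<xi>. cos (z \<bullet> \<xi>) * exp (- t * fsym s \<kappa> \<xi>) \<partial>lborel)" by (simp only:)
  then show ?thesis unfolding hk_def rker_def by (intro divide_nonneg_nonneg) auto
qed

lemma hk_fourier:
  assumes t: "t > 0"
  shows integrable_hk: "integrable lborel (hk s \<kappa> t :: 'a::euclidean_space \<Rightarrow> real)"
    and hk_cos: "(\<integral>z. cos (z \<bullet> \<xi>) * hk s \<kappa> t z \<partial>lborel) = exp (- t * fsym s \<kappa> (\<xi>::'a))"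
proof -
  let ?r = "\<lambda>\<xi>::'a. exp (- t * fsym s \<kappa> \<xi>)"
  have c: "continuous_on UNIV ?r" by (intro continuous_intros continuous_fsym)
  have b: "\<bar>?r \<xi>\<bar> \<le> 1" for \<xi> using t fsym_nonneg[of \<xi>] by simp
  have e: "?r (- \<xi>) = ?r \<xi>" for \<xi> by (simp add: fsym_minus)
  have p: "rker ?r z \<ge> 0" for z using hk_nonneg[OF t] unfolding hk_def .
  show "integrable lborel (hk s \<kappa> t :: 'a \<Rightarrow> real)"
    unfolding hk_def[abs_def] by (rule rker_inverse(1)[OF integrable_exp_fsym[OF t] e c b p])
  show "(\<integral>z. cos (z \<bullet> \<xi>) * hk s \<kappa> t z \<partial>lborel) = exp (- t * fsym s \<kappa> \<xi>)"
    unfolding hk_def by (rule rker_inverse(2)[OF integrable_exp_fsym[OF t] e c b p])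
qed

lemma hk_integral: "t > 0 \<Longrightarrow> (\<integral>z. hk s \<kappa> t (z::'a::euclidean_space) \<partial>lborel) = 1"
  using hk_cos[of t "0::'a"] s by (simp add: fsym_def)

lemma nn_integral_hk: "t > 0 \<Longrightarrow> (\<integral>\<^sup>+z. ennreal (hk s \<kappa> t (z::'a::euclidean_space)) \<partial>lborel) = 1"
  using hk_nonneg[of t] by (subst nn_integral_eq_integral[OF integrable_hk]) (auto simp: hk_integral)

lemma nn_integral_hk_diff:
  "t > 0 \<Longrightarrow> (\<integral>\<^sup>+x. ennreal (hk s \<kappa> t (x - y :: 'a::euclidean_space)) \<partial>lborel) = 1"
  using nn_integral_lborel_translate[of "\<lambda>x. ennreal (hk s \<kappa> t x)" "- y"] nn_integral_hk[of t, where ?'a='a] by simp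

lemma nn_integral_hk_diff':
  "t > 0 \<Longrightarrow> (\<integral>\<^sup>+y. ennreal (hk s \<kappa> t (x - y :: 'a::euclidean_space)) \<partial>lborel) = 1"
  using nn_integral_lborel_reflect[of "\<lambda>x. ennreal (hk s \<kappa> t x)" "x"] nn_integral_hk[of t, where ?'a='a] by simp

lemma hk_sin: "(\<integral>z. sin (z \<bullet> \<xi>) * hk s \<kappa> t (z::'a::euclidean_space) \<partial>lborel) = 0"
  by (rule integral_odd_lborel) (auto simp: hk_minus)

text \<open>Outside the unit ball the function is compared with \<open>levy s\<close>, whose
  integrability there is contained in \<open>integrable_levy_min\<close>.\<close>

lemma integrable_exp_frac:
  "integrable lborel (\<lambda>\<xi>::'a::euclidean_space. exp (- \<kappa> * norm \<xi> powr (2 * s)))"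
proof -
  \<comment> \<open>With this \<open>m\<close> the \<open>m\<close>-th term of the exponential
    series grows at least like \<open>norm \<xi> powr (N + 2 * s)\<close>, the reciprocal of
    \<open>levy\<close>.\<close>
  obtain m :: nat where m: "(real DIM('a) + 2 * s) / (2 * s) \<le> real m" using real_arch_simple by blast
  then have m2: "real DIM('a) + 2 * s \<le> 2 * s * real m" using s by (simp add: field_simps)
  define C where "C = fact m / \<kappa> ^ m"
  have C: "C > 0" using \<kappa> by (simp add: C_def)
  show ?thesis
  proof (rule Bochner_Integration.integrable_bound)
    show "integrable lborel (\<lambda>\<xi>::'a. indicator (cball 0 1) \<xi> + C * (min 1 ((norm \<xi>)\<^sup>2) * levy s \<xi>))"
      by (intro Bochner_Integration.integrable_add integrable_mult_right integrable_levy_min s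
          integrable_real_indicator) (use emeasure_lborel_cball_finite[of "0::'a" 1] in auto)
    show "AE \<xi> in lborel. norm (exp (- \<kappa> * norm (\<xi>::'a) powr (2 * s))) \<le> norm (indicator (cball 0 1) \<xi> + C * (min 1 ((norm \<xi>)\<^sup>2) * levy s \<xi>))"
    proof (rule AE_I2)
      fix \<xi> :: 'a
      have r: "0 \<le> C * (min 1 ((norm \<xi>)\<^sup>2) * levy s \<xi>)" using C by (intro mult_nonneg_nonneg) auto
      have "exp (- \<kappa> * norm \<xi> powr (2 * s)) \<le> indicator (cball 0 1) \<xi> + C * (min 1 ((norm \<xi>)\<^sup>2) * levy s \<xi>)"
      proof (cases "norm \<xi> \<le> 1")
        case True
        have "exp (- \<kappa> * norm \<xi> powr (2 * s)) \<le> 1" using \<kappa> by simp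
        with True r show ?thesis by (simp add: add_increasing2)
      next
        case False
        then have n0: "\<xi> \<noteq> 0" by auto
        let ?y = "norm \<xi> powr (2 * s)"
        have "norm \<xi> powr (real DIM('a) + 2 * s) \<le> norm \<xi> powr (2 * s * real m)" using False m2 by (intro powr_mono) auto
        also have "\<dots> = ?y ^ m" using n0 by (subst powr_powr[symmetric], intro powr_realpow) auto
        finally have "\<kappa> ^ m * norm \<xi> powr (real DIM('a) + 2 * s) \<le> (\<kappa> * ?y) ^ m"
          using \<kappa> by (simp add: power_mult_distrib)
        also have "\<dots> \<le> fact m * exp (\<kappa> * ?y)" using \<kappa> by (intro power_le_fact_exp) auto
        finally have *: "\<kappa> ^ m * norm \<xi> powr (real DIM('a) + 2 * s) \<le> fact m * exp (\<kappa> * ?y)" .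
        have p: "norm \<xi> powr (real DIM('a) + 2 * s) > 0" using n0 by simp
        have "1 / exp (\<kappa> * ?y) \<le> fact m / (\<kappa> ^ m * norm \<xi> powr (real DIM('a) + 2 * s))"
          using * p \<kappa> by (simp add: divide_simps mult.commute)
        then have "exp (- \<kappa> * ?y) \<le> C * levy s \<xi>"
          by (simp add: C_def levy_def exp_minus divide_inverse)
        moreover have "min 1 ((norm \<xi>)\<^sup>2) = 1" using False by (simp add: min_def)
        ultimately show ?thesis using False by simp
      qed
      then show "norm (exp (- \<kappa> * norm \<xi> powr (2 * s))) \<le> norm (indicator (cball 0 1) \<xi> + C * (min 1 ((norm \<xi>)\<^sup>2) * levy s \<xi>))"
        by simp
    qed
  qed measurable
qed

text \<open>Dropping the Gaussian factor and scaling \<open>\<xi>\<close> by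
  \<open>t powr (- 1 / (2 * s))\<close> leaves an integral independent of \<open>t\<close>. The
  bound is meant for large times, where low frequencies dominate.\<close>

lemma hk_decay:
  obtains M where "M > 0" "\<And>t z. t > 0 \<Longrightarrow> hk s \<kappa> t (z::'a::euclidean_space) \<le> M * t powr (- real DIM('a) / (2 * s))"
proof -
  let ?J = "\<integral>\<xi>. exp (- \<kappa> * norm (\<xi>::'a) powr (2 * s)) \<partial>lborel"
  define M where "M = ?J / (2 * pi) ^ DIM('a) + 1"
  have J: "?J \<ge> 0" by (intro Bochner_Integration.integral_nonneg) auto
  have "M > 0" using J by (simp add: M_def add_nonneg_pos)
  moreover have "hk s \<kappa> t (z::'a) \<le> M * t powr (- real DIM('a) / (2 * s))" if t: "t > 0" for t z
  proof -
    let ?c = "t powr (- 1 / (2 * s))"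
    have c: "?c > 0" using t by simp
    have sc: "t * (?c * r) powr (2 * s) = r powr (2 * s)" if "r \<ge> 0" for r
    proof -
      have "(?c * r) powr (2 * s) = ?c powr (2 * s) * r powr (2 * s)" by (rule powr_mult)
      also have "?c powr (2 * s) = t powr (- 1)" using s by (simp add: powr_powr)
      finally show ?thesis using t by (simp add: powr_minus)
    qed
    have eq: "exp (- t * \<kappa> * norm (0 + ?c *\<^sub>R \<xi>) powr (2 * s)) = exp (- \<kappa> * norm \<xi> powr (2 * s))" for \<xi> :: 'a
    proof -
      have "norm (0 + ?c *\<^sub>R \<xi>) = ?c * norm \<xi>" using c by simp
      then have "- t * \<kappa> * norm (0 + ?c *\<^sub>R \<xi>) powr (2 * s) = - \<kappa> * (t * (?c * norm \<xi>) powr (2 * s))" by simp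
      then show ?thesis unfolding sc[OF norm_ge_zero] by simp
    qed
    have i: "integrable lborel (\<lambda>\<xi>::'a. exp (- t * \<kappa> * norm \<xi> powr (2 * s)))"
    proof (rule integrableI_nonneg)
      have "(\<integral>\<^sup>+\<xi>. ennreal (exp (- t * \<kappa> * norm (\<xi>::'a) powr (2 * s))) \<partial>lborel)
        = ennreal (\<bar>?c\<bar> ^ DIM('a)) * (\<integral>\<^sup>+\<xi>. ennreal (exp (- \<kappa> * norm (\<xi>::'a) powr (2 * s))) \<partial>lborel)"
        using c by (subst nn_integral_lborel_affine[where c="?c" and t=0]) (simp_all only: eq, auto)
      also have "\<dots> < \<infinity>"
        using integrable_exp_frac[where ?'a='a] by (subst nn_integral_eq_integral) (auto simp: ennreal_mult_less_top)
      finally show "(\<integral>\<^sup>+\<xi>. ennreal (exp (- t * \<kappa> * norm (\<xi>::'a) powr (2 * s))) \<partial>lborel) < \<infinity>" .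
    qed auto
    have cN: "?c ^ DIM('a) = t powr (- real DIM('a) / (2 * s))"
      using t s by (simp add: powr_realpow[symmetric] powr_powr)
    have "hk s \<kappa> t z \<le> \<bar>hk s \<kappa> t z\<bar>" by simp
    also have "\<dots> \<le> (\<integral>\<xi>. \<bar>exp (- t * fsym s \<kappa> (\<xi>::'a))\<bar> \<partial>lborel) / (2 * pi) ^ DIM('a)"
      unfolding hk_def by (rule abs_rker_le[OF integrable_exp_fsym[OF t]])
    also have "\<dots> \<le> (\<integral>\<xi>. exp (- t * \<kappa> * norm (\<xi>::'a) powr (2 * s)) \<partial>lborel) / (2 * pi) ^ DIM('a)"
      using t by (intro divide_right_mono integral_mono integrable_abs integrable_exp_fsym i) (auto simp: fsym_def algebra_simps)
    also have "(\<integral>\<xi>. exp (- t * \<kappa> * norm (\<xi>::'a) powr (2 * s)) \<partial>lborel) = t powr (- real DIM('a) / (2 * s)) * ?J"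
      using c unfolding cN[symmetric] by (subst integral_lborel_affine[where c="?c" and t=0]) (simp_all only: eq, auto)
    also have "t powr (- real DIM('a) / (2 * s)) * ?J / (2 * pi) ^ DIM('a) \<le> M * t powr (- real DIM('a) / (2 * s))"
      by (simp add: M_def field_simps)
    finally show ?thesis .
  qed
  ultimately show thesis by (rule that)
qed

text \<open>One kernel is written as its Fourier integral and Fubini puts the cosine on the other;
  the sine part vanishes because the kernel is even.\<close>

lemma hk_semigroup:
  fixes x :: "'a::euclidean_space"
  assumes t: "t > 0" and u: "u > 0"
  shows "(\<integral>y. hk s \<kappa> t (x - y) * hk s \<kappa> u y \<partial>lborel) = hk s \<kappa> (t + u) x"
proof -
  let ?E = "\<lambda>\<xi>::'a. exp (- t * fsym s \<kappa> \<xi>)"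
  have int: "integrable (lborel \<Otimes>\<^sub>M lborel) (\<lambda>(y, \<xi>). cos ((x - y) \<bullet> \<xi>) * ?E \<xi> * hk s \<kappa> u y)"
  proof (rule integrable_pair_dominated[OF integrable_hk[OF u] integrable_exp_fsym[OF t]])
    fix y \<xi> :: 'a
    have "\<bar>cos ((x - y) \<bullet> \<xi>) * ?E \<xi> * hk s \<kappa> u y\<bar> = \<bar>cos ((x - y) \<bullet> \<xi>)\<bar> * (hk s \<kappa> u y * ?E \<xi>)"
      using hk_nonneg[OF u, of y] by (simp add: abs_mult)
    also have "\<dots> \<le> 1 * (hk s \<kappa> u y * ?E \<xi>)"
      using hk_nonneg[OF u, of y] by (intro mult_right_mono) auto
    finally show "\<bar>cos ((x - y) \<bullet> \<xi>) * ?E \<xi> * hk s \<kappa> u y\<bar> \<le> hk s \<kappa> u y * ?E \<xi>" by simp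
  qed measurable
  have inner: "(\<integral>y. cos ((x - y) \<bullet> \<xi>) * ?E \<xi> * hk s \<kappa> u y \<partial>lborel) = cos (x \<bullet> \<xi>) * exp (- (t + u) * fsym s \<kappa> \<xi>)" for \<xi>
  proof -
    have "(\<integral>y. cos ((x - y) \<bullet> \<xi>) * ?E \<xi> * hk s \<kappa> u y \<partial>lborel)
      = (\<integral>y. (?E \<xi> * cos (x \<bullet> \<xi>)) * (cos (\<xi> \<bullet> y) * hk s \<kappa> u y) + (?E \<xi> * sin (x \<bullet> \<xi>)) * (sin (\<xi> \<bullet> y) * hk s \<kappa> u y) \<partial>lborel)"
      by (intro Bochner_Integration.integral_cong refl) (simp add: inner_diff_left cos_diff algebra_simps inner_commute)
    also have "\<dots> = (\<integral>y. (?E \<xi> * cos (x \<bullet> \<xi>)) * (cos (\<xi> \<bullet> y) * hk s \<kappa> u y) \<partial>lborel) + (\<integral>y. (?E \<xi> * sin (x \<bullet> \<xi>)) * (sin (\<xi> \<bullet> y) * hk s \<kappa> u y) \<partial>lborel)"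
      by (intro Bochner_Integration.integral_add integrable_mult_right integrable_cos_mult integrable_sin_mult integrable_hk u)
    also have "\<dots> = ?E \<xi> * cos (x \<bullet> \<xi>) * exp (- u * fsym s \<kappa> \<xi>)"
      using hk_cos[OF u, of \<xi>] hk_sin[of \<xi> u] by (simp add: inner_commute)
    finally show ?thesis by (simp add: exp_add[symmetric] algebra_simps)
  qed
  have "(\<integral>y. hk s \<kappa> t (x - y) * hk s \<kappa> u y \<partial>lborel)
    = (\<integral>y. (\<integral>\<xi>. cos ((x - y) \<bullet> \<xi>) * ?E \<xi> * hk s \<kappa> u y \<partial>lborel) / (2 * pi) ^ DIM('a) \<partial>lborel)"
    unfolding hk_def[of s \<kappa> t] rker_def by (simp only: integral_mult_left_zero times_divide_eq_left)
  also have "\<dots> = (\<integral>y. \<integral>\<xi>. cos ((x - y) \<bullet> \<xi>) * ?E \<xi> * hk s \<kappa> u y \<partial>lborel \<partial>lborel) / (2 * pi) ^ DIM('a)"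
    by (rule integral_divide_zero)
  also have "(\<integral>y. \<integral>\<xi>. cos ((x - y) \<bullet> \<xi>) * ?E \<xi> * hk s \<kappa> u y \<partial>lborel \<partial>lborel)
     = (\<integral>\<xi>. \<integral>y. cos ((x - y) \<bullet> \<xi>) * ?E \<xi> * hk s \<kappa> u y \<partial>lborel \<partial>lborel)"
    using lborel_pair.Fubini_integral[OF int] by simp
  finally show ?thesis unfolding inner hk_def[of s \<kappa> "t + u"] rker_def[of "\<lambda>\<xi>. exp (- (t + u) * fsym s \<kappa> \<xi>)"] .
qed

lemma nn_hk_semigroup:
  fixes x z :: "'a::euclidean_space"
  assumes t: "t > 0" and u: "u > 0"
  shows "(\<integral>\<^sup>+y. ennreal (hk s \<kappa> t (x - y)) * ennreal (hk s \<kappa> u (y - z)) \<partial>lborel) = ennreal (hk s \<kappa> (t + u) (x - z))"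
proof -
  obtain M where M: "M > 0" "\<And>t z. t > 0 \<Longrightarrow> hk s \<kappa> t (z::'a::euclidean_space) \<le> M * t powr (- real DIM('a) / (2 * s))"
    using hk_decay by blast
  let ?x = "x - z"
  have i: "integrable lborel (\<lambda>y. hk s \<kappa> t (?x - y) * hk s \<kappa> u y)"
  proof (rule Bochner_Integration.integrable_bound[OF integrable_mult_right[OF integrable_hk[OF u], of "M * t powr (- real DIM('a) / (2 * s))"]])
    show "AE y in lborel. norm (hk s \<kappa> t (?x - y) * hk s \<kappa> u y) \<le> norm (M * t powr (- real DIM('a) / (2 * s)) * hk s \<kappa> u y)"
    proof (rule AE_I2)
      fix y
      have "\<bar>hk s \<kappa> t (?x - y)\<bar> \<le> \<bar>M * t powr (- real DIM('a) / (2 * s))\<bar>"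
        using hk_nonneg[OF t, of "?x - y"] M(2)[OF t, of "?x - y"] by linarith
      then show "norm (hk s \<kappa> t (?x - y) * hk s \<kappa> u y) \<le> norm (M * t powr (- real DIM('a) / (2 * s)) * hk s \<kappa> u y)"
        unfolding real_norm_def abs_mult by (intro mult_right_mono) auto
    qed
  qed measurable
  have "(\<integral>\<^sup>+y. ennreal (hk s \<kappa> t (x - y)) * ennreal (hk s \<kappa> u (y - z)) \<partial>lborel)
      = (\<integral>\<^sup>+y. ennreal (hk s \<kappa> t (x - (z + y))) * ennreal (hk s \<kappa> u ((z + y) - z)) \<partial>lborel)"
    by (subst nn_integral_lborel_translate[symmetric, where t=z]) auto
  also have "\<dots> = (\<integral>\<^sup>+y. ennreal (hk s \<kappa> t (?x - y) * hk s \<kappa> u y) \<partial>lborel)"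
    by (intro nn_integral_cong) (simp add: ennreal_mult diff_diff_eq hk_nonneg t u)
  also have "\<dots> = ennreal (hk s \<kappa> (t + u) ?x)"
    by (subst nn_integral_eq_integral[OF i]) (auto simp: hk_semigroup t u hk_nonneg)
  finally show ?thesis .
qed

text \<open>The bounded function \<open>1 - exp (- (norm z)\<^sup>2)\<close> stands in for the
  indicator of the complement of a ball. Its integral is computed on the Fourier side by
  \<open>rker_gaussian_dual\<close> with \<open>e = 1\<close>, so no tail estimate for the kernel is
  involved.\<close>

lemma hk_concentrates:
  assumes t: "\<And>n. t n > 0" and t0: "t \<longlonglongrightarrow> 0"
  shows "(\<lambda>n::nat. \<integral>z. (1 - exp (- (norm z)\<^sup>2)) * hk s \<kappa> (t n) (z::'a::euclidean_space) \<partial>lborel) \<longlonglongrightarrow> 0"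
proof -
  have gi: "integrable lborel (\<lambda>z::'a. exp (- (norm z)\<^sup>2) * hk s \<kappa> (t n) z)" for n
    by (rule Bochner_Integration.integrable_bound[OF integrable_hk[OF t[of n]]])
       (auto simp: abs_mult intro!: mult_left_le_one_le)
  have dual: "(\<integral>z. exp (- (norm z)\<^sup>2) * hk s \<kappa> (t n) (z::'a) \<partial>lborel)
     = (\<integral>\<zeta>. exp (- (norm (\<zeta>::'a))\<^sup>2) * exp (- t n * fsym s \<kappa> (- 2 *\<^sub>R \<zeta>)) \<partial>lborel) / sqrt pi ^ DIM('a)" for n
  proof -
    have ev: "exp (- t n * fsym s \<kappa> (- \<xi>)) = exp (- t n * fsym s \<kappa> \<xi>)" for \<xi> :: 'a by (simp add: fsym_minus)
    show ?thesis using rker_gaussian_dual[OF integrable_exp_fsym[OF t[of n]] ev, of 1 "0::'a"] by (simp add: hk_def)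
  qed
  have "(\<lambda>n. \<integral>\<zeta>. exp (- (norm (\<zeta>::'a))\<^sup>2) * exp (- t n * fsym s \<kappa> (- 2 *\<^sub>R \<zeta>)) \<partial>lborel) \<longlonglongrightarrow> (\<integral>\<zeta>. exp (- (norm (\<zeta>::'a))\<^sup>2) * exp (- 0 * fsym s \<kappa> (- 2 *\<^sub>R \<zeta>)) \<partial>lborel)"
  proof (rule integral_dominated_convergence)
    show "integrable lborel (\<lambda>\<zeta>::'a. exp (- (norm \<zeta>)\<^sup>2))" using gaussian_integral(1)[of 1, where ?'a='a] by simp
    show "AE \<zeta>::'a in lborel. norm (exp (- (norm \<zeta>)\<^sup>2) * exp (- t n * fsym s \<kappa> (- 2 *\<^sub>R \<zeta>))) \<le> exp (- (norm \<zeta>)\<^sup>2)" for n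
      using t[of n] by (intro AE_I2) (auto simp: fsym_nonneg less_imp_le)
    show "AE \<zeta>::'a in lborel. (\<lambda>n. exp (- (norm \<zeta>)\<^sup>2) * exp (- t n * fsym s \<kappa> (- 2 *\<^sub>R \<zeta>))) \<longlonglongrightarrow> exp (- (norm \<zeta>)\<^sup>2) * exp (- 0 * fsym s \<kappa> (- 2 *\<^sub>R \<zeta>))"
      by (intro AE_I2 tendsto_intros t0)
  qed measurable
  then have "(\<lambda>n. (\<integral>\<zeta>. exp (- (norm (\<zeta>::'a))\<^sup>2) * exp (- t n * fsym s \<kappa> (- 2 *\<^sub>R \<zeta>)) \<partial>lborel) / sqrt pi ^ DIM('a)) \<longlonglongrightarrow> sqrt pi ^ DIM('a) / sqrt pi ^ DIM('a)"
    using gaussian_integral(2)[of 1, where ?'a='a] by (intro tendsto_divide tendsto_const) auto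
  then have "(\<lambda>n. 1 - (\<integral>z. exp (- (norm z)\<^sup>2) * hk s \<kappa> (t n) (z::'a) \<partial>lborel)) \<longlonglongrightarrow> 1 - 1"
    unfolding dual by (intro tendsto_diff tendsto_const) simp
  moreover have "(\<integral>z. (1 - exp (- (norm z)\<^sup>2)) * hk s \<kappa> (t n) (z::'a) \<partial>lborel) = 1 - (\<integral>z. exp (- (norm z)\<^sup>2) * hk s \<kappa> (t n) (z::'a) \<partial>lborel)" for n
    by (subst hk_integral[OF t, symmetric, where ?'a='a, of n], subst Bochner_Integration.integral_diff[OF integrable_hk[OF t] gi, symmetric])
       (simp add: algebra_simps)
  ultimately show ?thesis by simp
qed

end

lemma heat_kernel_eq_hk:
  fixes z :: "'a::euclidean_space"
  assumes s: "0 < s" "s < 1" and t: "t > 0"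
  shows "heat_kernel s t z = hk s 1 t z"
proof -
  interpret frac_heat s 1 by standard (use s in auto)
  let ?f = "\<lambda>\<xi>. exp (\<i> * of_real (z \<bullet> \<xi>) - of_real (t * ((norm \<xi>)\<^sup>2 + norm \<xi> powr (2 * s)))) :: complex"
  have f: "?f \<xi> = iexp (z \<bullet> \<xi>) * complex_of_real (exp (- t * fsym s 1 \<xi>))" for \<xi>
    by (simp only: exp_diff exp_of_real fsym_def, simp add: exp_minus divide_inverse)
  have m: "?f \<in> borel_measurable borel" by measurable
  have i: "integrable lborel ?f"
    unfolding f by (rule Bochner_Integration.integrable_bound[OF integrable_exp_fsym[OF t]]) (auto simp: norm_mult)
  have "(LINT \<xi>|lebesgue. ?f \<xi>) = (\<integral>\<xi>. ?f \<xi> \<partial>lborel)" by (rule integral_completion) (use m in simp)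
  moreover have "Re (\<integral>\<xi>. ?f \<xi> \<partial>lborel) = (\<integral>\<xi>. cos (z \<bullet> \<xi>) * exp (- t * fsym s 1 \<xi>) \<partial>lborel)"
    unfolding f by (subst integral_Re[OF i[unfolded f], symmetric]) (simp add: Re_exp)
  moreover have "(1 / (2 * complex_of_real pi) ^ DIM('a)) = complex_of_real (1 / (2 * pi) ^ DIM('a))" by simp
  ultimately show ?thesis unfolding heat_kernel_def hk_def rker_def
    by (simp only: times_complex.sel Re_complex_of_real Im_complex_of_real) simp
qed

section \<open>Pairing with the Laplacian and the fractional Laplacian\<close>

text \<open>Taylor's formula for the even function \<open>f h + f (- h)\<close>, whose first
  derivative at 0 vanishes. One intermediate point thus serves both sides, and \<open>f''\<close>
  only has to exist.\<close>

lemma second_difference: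
  fixes f f' f'' :: "real \<Rightarrow> real"
  assumes f: "\<And>h. (f has_real_derivative f' h) (at h)" and f': "\<And>h. (f' has_real_derivative f'' h) (at h)"
    and h: "h > 0"
  obtains \<theta> where "0 < \<theta>" "\<theta> < h" "f h + f (- h) - 2 * f 0 = (f'' \<theta> + f'' (- \<theta>)) / 2 * h\<^sup>2"
proof -
  define G where "G m = (if m = 0 then (\<lambda>h. f h + f (- h)) else if m = 1 then (\<lambda>h. f' h - f' (- h)) else (\<lambda>h. f'' h + f'' (- h)))" for m :: nat
  have "\<exists>t. 0 < t \<and> t < h \<and> (\<lambda>h. f h + f (- h)) h = (\<Sum>m<2. G m 0 / fact m * h ^ m) + G 2 t / fact 2 * h ^ 2"
  proof (rule Maclaurin[OF h])
    have 1: "((\<lambda>h. f h + f (- h)) has_real_derivative f' t - f' (- t)) (at t)" for t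
      using DERIV_add[OF f[of t] DERIV_chain'[OF DERIV_minus[OF DERIV_ident] f, of t UNIV]] by simp
    have 2: "((\<lambda>h. f' h - f' (- h)) has_real_derivative f'' t + f'' (- t)) (at t)" for t
      using DERIV_diff[OF f'[of t] DERIV_chain'[OF DERIV_minus[OF DERIV_ident] f', of t UNIV]] by simp
    show "\<forall>m t. m < 2 \<and> 0 \<le> t \<and> t \<le> h \<longrightarrow> (G m has_real_derivative G (Suc m) t) (at t)"
    proof (intro allI impI)
      fix m t assume "m < (2::nat) \<and> 0 \<le> t \<and> t \<le> h"
      then have "m = 0 \<or> m = 1" by auto
      then show "(G m has_real_derivative G (Suc m) t) (at t)" using 1 2 by (auto simp: G_def)
    qed
  qed (auto simp: G_def)
  then obtain t where "0 < t" "t < h" "f h + f (- h) = (\<Sum>m<2. G m 0 / fact m * h ^ m) + G 2 t / fact 2 * h ^ 2" by blast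
  moreover have "(\<Sum>m<2. G m 0 / fact m * h ^ m) = 2 * f 0" by (simp add: G_def numeral_2_eq_2)
  ultimately show thesis using that[of t] by (simp add: G_def)
qed

lemma second_difference_limit:
  fixes f f' f'' :: "real \<Rightarrow> real"
  assumes f: "\<And>h. (f has_real_derivative f' h) (at h)" and f': "\<And>h. (f' has_real_derivative f'' h) (at h)"
    and c: "isCont f'' 0"
  shows "(\<lambda>n. (f (1 / (real n + 1)) + f (- (1 / (real n + 1))) - 2 * f 0) * (real n + 1)\<^sup>2) \<longlonglongrightarrow> f'' 0"
proof -
  have "\<exists>\<theta>. 0 < \<theta> \<and> \<theta> < 1 / (real n + 1) \<and> f (1 / (real n + 1)) + f (- (1 / (real n + 1))) - 2 * f 0 = (f'' \<theta> + f'' (- \<theta>)) / 2 * (1 / (real n + 1))\<^sup>2" for n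
    using second_difference[OF f f', of "1 / (real n + 1)"] by (metis add_pos_pos of_nat_0_le_iff add_nonneg_pos zero_less_one divide_pos_pos)
  then obtain \<theta> where \<theta>: "\<And>n. 0 < \<theta> n" "\<And>n. \<theta> n < 1 / (real n + 1)"
      "\<And>n. f (1 / (real n + 1)) + f (- (1 / (real n + 1))) - 2 * f 0 = (f'' (\<theta> n) + f'' (- \<theta> n)) / 2 * (1 / (real n + 1))\<^sup>2" by metis
  have a: "(\<lambda>n. 1 / (real n + 1)) \<longlonglongrightarrow> 0" by real_asymp
  have t0: "\<theta> \<longlonglongrightarrow> 0"
    by (rule tendsto_sandwich[where f="\<lambda>_. 0" and h="\<lambda>n. 1 / (real n + 1)"])
       (use \<theta> a in \<open>auto intro!: always_eventually simp: less_imp_le\<close>)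
  have "(\<lambda>n. (f'' (\<theta> n) + f'' (- \<theta> n)) / 2) \<longlonglongrightarrow> (f'' 0 + f'' 0) / 2"
    using isCont_tendsto_compose[OF c t0] isCont_tendsto_compose[OF c, of "\<lambda>n. - \<theta> n"] tendsto_minus[OF t0]
    by (intro tendsto_intros) auto
  moreover have "(f (1 / (real n + 1)) + f (- (1 / (real n + 1))) - 2 * f 0) * (real n + 1)\<^sup>2 = (f'' (\<theta> n) + f'' (- \<theta> n)) / 2" for n
    unfolding \<theta>(3) by (simp add: power_divide add_nonneg_eq_0_iff)
  moreover have "(f'' 0 + f'' 0) / 2 = f'' 0" by simp
  ultimately show ?thesis by (simp only:)
qed

text \<open>The discrete Laplacian with mesh \<open>1 / (n + 1)\<close>. Being built from
  translations, it hands measurability, bounds, support and the Fourier multiplier on to the limit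
  without integration by parts.\<close>

definition dsum :: "nat \<Rightarrow> ('a::euclidean_space \<Rightarrow> real) \<Rightarrow> 'a \<Rightarrow> real" where
  "dsum n v x = (\<Sum>b\<in>Basis. (v (x + (1 / (real n + 1)) *\<^sub>R b) + v (x - (1 / (real n + 1)) *\<^sub>R b) - 2 * v x) * (real n + 1)\<^sup>2)"

text \<open>The bound on second differences makes the Levy integral of \<open>v\<close> absolutely convergent.\<close>

locale bump =
  fixes v :: "'a::euclidean_space \<Rightarrow> real" and r K :: real
  assumes meas [measurable]: "v \<in> borel_measurable borel"
    and r: "r > 0"
    and bound: "\<bar>v x\<bar> \<le> K"
    and supp: "norm x \<ge> r \<Longrightarrow> v x = 0"
    and diff2: "\<bar>v (x + z) + v (x - z) - 2 * v x\<bar> \<le> K * min 1 ((norm z)\<^sup>2)"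
    and lap: "(\<lambda>n. dsum n v x) \<longlonglongrightarrow> laplacian v x"
begin

lemma K: "K \<ge> 0" using bound[of 0] by linarith

lemma integrable_v: "integrable lborel v"
proof (rule Bochner_Integration.integrable_bound)
  show "integrable lborel (\<lambda>x::'a. K * indicator (cball 0 r) x)"
    by (intro integrable_mult_right integrable_real_indicator) (use emeasure_lborel_cball_finite[of "0::'a" r] in auto)
  show "AE x in lborel. norm (v x) \<le> norm (K * indicator (cball 0 r) x)"
    using bound supp K by (intro AE_I2) (auto split: split_indicator)
qed measurable

lemma integral_abs_v: "(\<integral>x. \<bar>v x\<bar> \<partial>lborel) \<ge> 0"
  by (rule Bochner_Integration.integral_nonneg) auto

lemma dsum_bound: "\<bar>dsum n v x\<bar> \<le> real DIM('a) * K"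
proof -
  have "\<bar>(v (x + (1 / (real n + 1)) *\<^sub>R b) + v (x - (1 / (real n + 1)) *\<^sub>R b) - 2 * v x) * (real n + 1)\<^sup>2\<bar> \<le> K" if "b \<in> Basis" for b
  proof -
    have "\<bar>v (x + (1 / (real n + 1)) *\<^sub>R b) + v (x - (1 / (real n + 1)) *\<^sub>R b) - 2 * v x\<bar> \<le> K * min 1 ((norm ((1 / (real n + 1)) *\<^sub>R b))\<^sup>2)"
      by (rule diff2)
    also have "\<dots> \<le> K * (norm ((1 / (real n + 1)) *\<^sub>R b))\<^sup>2" using K by (intro mult_left_mono) auto
    also have "(norm ((1 / (real n + 1)) *\<^sub>R b))\<^sup>2 = 1 / (real n + 1)\<^sup>2" using that by (simp add: power_divide)
    finally have "\<bar>v (x + (1 / (real n + 1)) *\<^sub>R b) + v (x - (1 / (real n + 1)) *\<^sub>R b) - 2 * v x\<bar> * (real n + 1)\<^sup>2 \<le> K * (1 / (real n + 1)\<^sup>2) * (real n + 1)\<^sup>2"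
      by (intro mult_right_mono) auto
    also have "\<dots> = K" by (simp add: add_nonneg_eq_0_iff)
    finally show ?thesis by (simp add: abs_mult)
  qed
  then have "\<bar>dsum n v x\<bar> \<le> (\<Sum>b\<in>(Basis::'a set). K)"
    unfolding dsum_def by (intro order_trans[OF sum_abs] sum_mono)
  then show ?thesis by simp
qed

lemma dsum_supp: "norm x \<ge> r + 1 \<Longrightarrow> dsum n v x = 0"
proof -
  assume x: "norm x \<ge> r + 1"
  have "v (x + (1 / (real n + 1)) *\<^sub>R b) = 0 \<and> v (x - (1 / (real n + 1)) *\<^sub>R b) = 0" if "b \<in> Basis" for b
  proof -
    have "norm ((1 / (real n + 1)) *\<^sub>R b) \<le> 1" using that by simp
    then have "norm (x + (1 / (real n + 1)) *\<^sub>R b) \<ge> r" "norm (x - (1 / (real n + 1)) *\<^sub>R b) \<ge> r"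
      using x norm_diff_ineq[of x "(1 / (real n + 1)) *\<^sub>R b"] norm_triangle_ineq2[of x "(1 / (real n + 1)) *\<^sub>R b"] by linarith+
    then show ?thesis by (simp add: supp)
  qed
  moreover have "v x = 0" using x by (intro supp) auto
  ultimately show ?thesis unfolding dsum_def by (intro sum.neutral) auto
qed

lemma borel_measurable_dsum [measurable]: "dsum n v \<in> borel_measurable borel"
  unfolding dsum_def[abs_def] by measurable

lemma borel_measurable_laplacian: "laplacian v \<in> borel_measurable borel"
  by (rule borel_measurable_LIMSEQ_metric[OF _ lap]) measurable

lemma laplacian_bound: "\<bar>laplacian v x\<bar> \<le> real DIM('a) * K"
  by (rule LIMSEQ_le_const2[OF tendsto_rabs[OF lap]]) (use dsum_bound in auto)

lemma laplacian_supp: "norm x \<ge> r + 1 \<Longrightarrow> laplacian v x = 0"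
  using lap[of x] dsum_supp[of x] by (simp add: LIMSEQ_const_iff)

lemma integrable_laplacian: "integrable lborel (laplacian v)"
proof (rule Bochner_Integration.integrable_bound)
  show "integrable lborel (\<lambda>x::'a. (real DIM('a) * K) * indicator (cball 0 (r + 1)) x)"
    by (intro integrable_mult_right integrable_real_indicator) (use emeasure_lborel_cball_finite[of "0::'a" "r + 1"] in auto)
  show "AE x in lborel. norm (laplacian v x) \<le> norm ((real DIM('a) * K) * indicator (cball 0 (r + 1)) x)"
    using laplacian_bound laplacian_supp K by (intro AE_I2) (auto split: split_indicator)
qed (use borel_measurable_laplacian in measurable)

lemma integrable_cos_v: "integrable lborel (\<lambda>x. cos ((x - y) \<bullet> \<xi>) * v x)"
  by (rule Bochner_Integration.integrable_bound[OF integrable_v])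
     (auto simp: abs_mult intro!: mult_left_le_one_le)

text \<open>A shift of \<open>v\<close> by \<open>z\<close> shifts the phase of the cosine. In the
  symmetric combination the sine terms cancel, leaving the multiplier
  \<open>- 2 * (1 - cos (z \<bullet> \<xi>))\<close> common to both operators.\<close>

lemma cos_shift:
  shows "integrable lborel (\<lambda>x. cos ((x - y) \<bullet> \<xi>) * v (x + z))" "integrable lborel (\<lambda>x. cos ((x - y) \<bullet> \<xi>) * v (x - z))"
    and "(\<integral>x. cos ((x - y) \<bullet> \<xi>) * (v (x + z) + v (x - z) - 2 * v x) \<partial>lborel)
     = - (2 * (1 - cos (z \<bullet> \<xi>))) * (\<integral>x. cos ((x - y) \<bullet> \<xi>) * v x \<partial>lborel)"
proof -
  have *: "(\<lambda>x. cos ((x - y) \<bullet> \<xi>) * v (x + w)) = (\<lambda>x. (\<lambda>x. cos ((x - (y + w)) \<bullet> \<xi>) * v x) (w + x))" for w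
    by (simp add: fun_eq_iff algebra_simps)
  have i: "integrable lborel (\<lambda>x. cos ((x - y) \<bullet> \<xi>) * v (x + w))" for w
    unfolding * by (subst integral_lborel_translate(2)) (auto intro: integrable_cos_v)
  have e: "(\<integral>x. cos ((x - y) \<bullet> \<xi>) * v (x + w) \<partial>lborel) = (\<integral>x. cos ((x - (y + w)) \<bullet> \<xi>) * v x \<partial>lborel)" for w
    unfolding * by (rule integral_lborel_translate(1)) measurable
  show i1: "integrable lborel (\<lambda>x. cos ((x - y) \<bullet> \<xi>) * v (x + z))" by (rule i)
  show i2: "integrable lborel (\<lambda>x. cos ((x - y) \<bullet> \<xi>) * v (x - z))" using i[of "- z"] by simp
  have "(\<integral>x. cos ((x - y) \<bullet> \<xi>) * (v (x + z) + v (x - z) - 2 * v x) \<partial>lborel)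
     = (\<integral>x. (cos ((x - y) \<bullet> \<xi>) * v (x + z) + cos ((x - y) \<bullet> \<xi>) * v (x - z)) - 2 * (cos ((x - y) \<bullet> \<xi>) * v x) \<partial>lborel)"
    by (intro Bochner_Integration.integral_cong refl) (simp add: algebra_simps)
  also have "\<dots> = (\<integral>x. cos ((x - y) \<bullet> \<xi>) * v (x + z) \<partial>lborel) + (\<integral>x. cos ((x - y) \<bullet> \<xi>) * v (x - z) \<partial>lborel)
     - 2 * (\<integral>x. cos ((x - y) \<bullet> \<xi>) * v x \<partial>lborel)"
    using i1 i2 integrable_cos_v by simp
  also have "(\<integral>x. cos ((x - y) \<bullet> \<xi>) * v (x + z) \<partial>lborel) + (\<integral>x. cos ((x - y) \<bullet> \<xi>) * v (x - z) \<partial>lborel)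
    = (\<integral>x. cos ((x - (y + z)) \<bullet> \<xi>) * v x + cos ((x - (y - z)) \<bullet> \<xi>) * v x \<partial>lborel)"
    using e[of z] e[of "- z"] integrable_cos_v[of "y + z" \<xi>] integrable_cos_v[of "y - z" \<xi>] by simp
  also have "\<dots> = (\<integral>x. 2 * cos (z \<bullet> \<xi>) * (cos ((x - y) \<bullet> \<xi>) * v x) \<partial>lborel)"
  proof (intro Bochner_Integration.integral_cong refl)
    fix x
    have "(x - (y + z)) \<bullet> \<xi> = (x - y) \<bullet> \<xi> - z \<bullet> \<xi>" "(x - (y - z)) \<bullet> \<xi> = (x - y) \<bullet> \<xi> + z \<bullet> \<xi>"
      by (simp_all add: inner_diff_left inner_add_left)
    then have "cos ((x - (y + z)) \<bullet> \<xi>) + cos ((x - (y - z)) \<bullet> \<xi>) = 2 * cos (z \<bullet> \<xi>) * cos ((x - y) \<bullet> \<xi>)"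
      by (simp add: cos_add cos_diff)
    then show "cos ((x - (y + z)) \<bullet> \<xi>) * v x + cos ((x - (y - z)) \<bullet> \<xi>) * v x = 2 * cos (z \<bullet> \<xi>) * (cos ((x - y) \<bullet> \<xi>) * v x)"
      by (metis distrib_right mult.assoc)
  qed
  also have "\<dots> = 2 * cos (z \<bullet> \<xi>) * (\<integral>x. cos ((x - y) \<bullet> \<xi>) * v x \<partial>lborel)" by (rule integral_mult_right_zero)
  finally show "(\<integral>x. cos ((x - y) \<bullet> \<xi>) * (v (x + z) + v (x - z) - 2 * v x) \<partial>lborel)
     = - (2 * (1 - cos (z \<bullet> \<xi>))) * (\<integral>x. cos ((x - y) \<bullet> \<xi>) * v x \<partial>lborel)"
    by (simp add: algebra_simps)
qed

text \<open>By \<open>cos_shift\<close> each \<open>dsum n\<close> acts as a multiplier, whose limit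
  is the second difference quotient of \<open>cos (a * h)\<close> at 0, summed over the
  basis.\<close>

lemma laplacian_pairing:
  "(\<integral>x. cos ((x - y) \<bullet> \<xi>) * laplacian v x \<partial>lborel) = - (norm \<xi>)\<^sup>2 * (\<integral>x. cos ((x - y) \<bullet> \<xi>) * v x \<partial>lborel)"
proof -
  let ?P = "\<integral>x. cos ((x - y) \<bullet> \<xi>) * v x \<partial>lborel"
  have L1: "(\<lambda>n. \<integral>x. cos ((x - y) \<bullet> \<xi>) * dsum n v x \<partial>lborel) \<longlonglongrightarrow> (\<integral>x. cos ((x - y) \<bullet> \<xi>) * laplacian v x \<partial>lborel)"
  proof (rule integral_dominated_convergence)
    show "integrable lborel (\<lambda>x::'a. (real DIM('a) * K) * indicator (cball 0 (r + 1)) x)"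
      by (intro integrable_mult_right integrable_real_indicator) (use emeasure_lborel_cball_finite[of "0::'a" "r + 1"] in auto)
    show "AE x in lborel. norm (cos ((x - y) \<bullet> \<xi>) * dsum n v x) \<le> (real DIM('a) * K) * indicator (cball 0 (r + 1)) x" for n
    proof (rule AE_I2)
      fix x :: 'a
      have "norm (cos ((x - y) \<bullet> \<xi>) * dsum n v x) \<le> \<bar>dsum n v x\<bar>"
        by (auto simp: abs_mult intro!: mult_left_le_one_le)
      also have "\<dots> \<le> (real DIM('a) * K) * indicator (cball 0 (r + 1)) x"
        using dsum_bound[of n x] dsum_supp[of x n] by (auto split: split_indicator)
      finally show "norm (cos ((x - y) \<bullet> \<xi>) * dsum n v x) \<le> (real DIM('a) * K) * indicator (cball 0 (r + 1)) x" .
    qed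
    show "(\<lambda>x. cos ((x - y) \<bullet> \<xi>) * laplacian v x) \<in> borel_measurable lborel"
      using borel_measurable_laplacian by measurable
  qed (auto intro!: AE_I2 tendsto_intros lap)
  have E: "(\<integral>x. cos ((x - y) \<bullet> \<xi>) * dsum n v x \<partial>lborel)
      = (\<Sum>b\<in>Basis. - (2 * (1 - cos ((1 / (real n + 1)) * (b \<bullet> \<xi>)))) * (real n + 1)\<^sup>2) * ?P" for n
  proof -
    let ?h = "1 / (real n + 1)"
    have i: "integrable lborel (\<lambda>x. cos ((x - y) \<bullet> \<xi>) * (v (x + ?h *\<^sub>R b) + v (x - ?h *\<^sub>R b) - 2 * v x))" for b
    proof -
      have "integrable lborel (\<lambda>x. cos ((x - y) \<bullet> \<xi>) * v (x + ?h *\<^sub>R b) + cos ((x - y) \<bullet> \<xi>) * v (x - ?h *\<^sub>R b) - 2 * (cos ((x - y) \<bullet> \<xi>) * v x))"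
        by (intro Bochner_Integration.integrable_diff Bochner_Integration.integrable_add integrable_mult_right cos_shift integrable_cos_v)
      then show ?thesis by (simp add: algebra_simps)
    qed
    have "(\<integral>x. cos ((x - y) \<bullet> \<xi>) * dsum n v x \<partial>lborel)
      = (\<integral>x. (\<Sum>b\<in>Basis. cos ((x - y) \<bullet> \<xi>) * (v (x + ?h *\<^sub>R b) + v (x - ?h *\<^sub>R b) - 2 * v x) * (real n + 1)\<^sup>2) \<partial>lborel)"
      unfolding dsum_def by (simp only: sum_distrib_left mult.assoc)
    also have "\<dots> = (\<Sum>b\<in>Basis. (\<integral>x. cos ((x - y) \<bullet> \<xi>) * (v (x + ?h *\<^sub>R b) + v (x - ?h *\<^sub>R b) - 2 * v x) * (real n + 1)\<^sup>2 \<partial>lborel))"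
      by (intro Bochner_Integration.integral_sum integrable_mult_left i)
    also have "\<dots> = (\<Sum>b\<in>Basis. - (2 * (1 - cos (?h * (b \<bullet> \<xi>)))) * ?P * (real n + 1)\<^sup>2)"
      by (intro sum.cong refl) (simp only: integral_mult_left_zero cos_shift(3) inner_scaleR_left)
    also have "\<dots> = (\<Sum>b\<in>Basis. - (2 * (1 - cos (?h * (b \<bullet> \<xi>)))) * (real n + 1)\<^sup>2) * ?P"
      unfolding sum_distrib_right by (intro sum.cong refl) (simp only: mult_ac)
    finally show ?thesis .
  qed
  have "(\<lambda>n. (\<Sum>b\<in>Basis. - (2 * (1 - cos ((1 / (real n + 1)) * (b \<bullet> \<xi>)))) * (real n + 1)\<^sup>2) * ?P)
     \<longlonglongrightarrow> (\<Sum>b\<in>Basis. - (b \<bullet> \<xi>)\<^sup>2) * ?P"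
  proof (intro tendsto_mult tendsto_const tendsto_sum)
    fix b :: 'a
    show "(\<lambda>n. - (2 * (1 - cos ((1 / (real n + 1)) * (b \<bullet> \<xi>)))) * (real n + 1)\<^sup>2) \<longlonglongrightarrow> - (b \<bullet> \<xi>)\<^sup>2"
    proof -
      define a where "a = b \<bullet> \<xi>"
      have "(\<lambda>n. (cos (a * (1 / (real n + 1))) + cos (a * (- (1 / (real n + 1)))) - 2 * cos (a * 0)) * (real n + 1)\<^sup>2) \<longlonglongrightarrow> - (a\<^sup>2 * cos (a * 0))"
        by (rule second_difference_limit[where f'="\<lambda>h. - a * sin (a * h)"])
           (auto intro!: derivative_eq_intros continuous_intros simp: power2_eq_square)
      then show ?thesis unfolding a_def[symmetric] by (simp add: algebra_simps)
    qed
  qed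
  then have "(\<integral>x. cos ((x - y) \<bullet> \<xi>) * laplacian v x \<partial>lborel) = (\<Sum>b\<in>Basis. - (b \<bullet> \<xi>)\<^sup>2) * ?P"
    by (rule LIMSEQ_unique[OF L1[unfolded E]])
  also have "(\<Sum>b\<in>Basis. - (b \<bullet> \<xi>)\<^sup>2) = - (norm \<xi>)\<^sup>2"
    by (simp add: sum_negf norm_eq_sqrt_inner euclidean_inner[of \<xi> \<xi>] power2_eq_square inner_commute sum_nonneg)
  finally show ?thesis .
qed

lemma integrable_diff2_levy:
  assumes s: "0 < s" "s < 1"
  shows "integrable lborel (\<lambda>z. (2 * v x - v (x + z) - v (x - z)) * levy s z)"
proof (rule Bochner_Integration.integrable_bound[OF integrable_mult_right[OF integrable_levy_min[OF s, where ?'a='a], of K]])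
  show "AE z in lborel. norm ((2 * v x - v (x + z) - v (x - z)) * levy s z) \<le> norm (K * (min 1 ((norm z)\<^sup>2) * levy s z))"
  proof (rule AE_I2)
    fix z
    have "\<bar>2 * v x - v (x + z) - v (x - z)\<bar> \<le> K * min 1 ((norm z)\<^sup>2)" using diff2[of x z] by linarith
    then have "\<bar>2 * v x - v (x + z) - v (x - z)\<bar> * levy s z \<le> K * min 1 ((norm z)\<^sup>2) * levy s z" by (intro mult_right_mono) auto
    then show "norm ((2 * v x - v (x + z) - v (x - z)) * levy s z) \<le> norm (K * (min 1 ((norm z)\<^sup>2) * levy s z))"
      using K by (simp add: abs_mult)
  qed
qed measurable

text \<open>Averaging the truncated integral with its reflection \<open>w \<mapsto> - w\<close>
  replaces the first difference by a second one, which is integrable against \<open>levy\<close>.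
  Dominated convergence then removes the truncation and shows that \<open>Lim\<close> is a genuine
  limit.\<close>

lemma frac_laplacian_eq:
  assumes s: "0 < s" "s < 1"
  shows "frac_laplacian s v x = frac_laplacian_const DIM('a) s / 2 * (\<integral>z. (2 * v x - v (x + z) - v (x - z)) * levy s z \<partial>lborel)"
proof -
  define D where "D z = (2 * v x - v (x + z) - v (x - z)) * levy s z" for z
  have Di: "integrable lborel D" unfolding D_def by (rule integrable_diff2_levy[OF s])
  have [measurable]: "D \<in> borel_measurable borel" unfolding D_def by measurable
  define F where "F e w = indicator {w. norm w \<ge> e} w * ((v x - v (x - w)) * levy s w)" for e and w :: 'a
  have Fm[measurable]: "F e \<in> borel_measurable borel" for e unfolding F_def by measurable
  have Fi: "integrable lborel (F e)" if e: "e > 0" for e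
  proof (rule Bochner_Integration.integrable_bound[OF integrable_mult_right[OF integrable_levy_min[OF s, where ?'a='a], of "2 * K / min 1 (e\<^sup>2)"]])
    show "AE w in lborel. norm (F e w) \<le> norm (2 * K / min 1 (e\<^sup>2) * (min 1 ((norm w)\<^sup>2) * levy s w))"
    proof (rule AE_I2)
      fix w :: 'a
      have m: "min 1 (e\<^sup>2) > 0" using e by simp
      show "norm (F e w) \<le> norm (2 * K / min 1 (e\<^sup>2) * (min 1 ((norm w)\<^sup>2) * levy s w))"
      proof (cases "norm w \<ge> e")
        case True
        then have "min 1 (e\<^sup>2) \<le> min 1 ((norm w)\<^sup>2)" using e by (intro min.mono power_mono) auto
        then have 1: "1 \<le> min 1 ((norm w)\<^sup>2) / min 1 (e\<^sup>2)" using m by simp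
        have "\<bar>v x - v (x - w)\<bar> \<le> 2 * K * 1" using bound[of x] bound[of "x - w"] by linarith
        also have "2 * K * 1 \<le> 2 * K * (min 1 ((norm w)\<^sup>2) / min 1 (e\<^sup>2))" using 1 K by (intro mult_left_mono) auto
        finally have "\<bar>v x - v (x - w)\<bar> * levy s w \<le> 2 * K * (min 1 ((norm w)\<^sup>2) / min 1 (e\<^sup>2)) * levy s w" by (intro mult_right_mono) auto
        then show ?thesis using K m True by (simp add: F_def abs_mult)
      qed (simp add: F_def)
    qed
  qed measurable
  have I: "(LINT y:{y. norm (x - y) \<ge> e}|lebesgue. (v x - v y) / norm (x - y) powr (real DIM('a) + 2 * s))
     = (\<integral>w. indicator {w. norm w \<ge> e} w * D w \<partial>lborel) / 2" if e: "e > 0" for e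
  proof -
    have "(LINT y:{y. norm (x - y) \<ge> e}|lebesgue. (v x - v y) / norm (x - y) powr (real DIM('a) + 2 * s)) = (LINT y|lebesgue. F e (x - y))"
      unfolding set_lebesgue_integral_def by (intro Bochner_Integration.integral_cong refl) (simp add: F_def levy_def indicator_def)
    also have "\<dots> = (\<integral>y. F e (x - y) \<partial>lborel)" by (rule integral_completion) measurable
    also have "\<dots> = (\<integral>w. F e w \<partial>lborel)" by (rule integral_lborel_reflect) measurable
    finally have 1: "(LINT y:{y. norm (x - y) \<ge> e}|lebesgue. (v x - v y) / norm (x - y) powr (real DIM('a) + 2 * s)) = (\<integral>w. F e w \<partial>lborel)" .
    have 2: "(\<integral>w. F e (0 - w) \<partial>lborel) = (\<integral>w. F e w \<partial>lborel)" by (rule integral_lborel_reflect) measurable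
    have 3: "integrable lborel (\<lambda>w. F e (0 - w))" by (subst integral_lborel_reflect(2)) (use Fi[OF e] in auto)
    have "(\<integral>w. F e w + F e (0 - w) \<partial>lborel) = 2 * (\<integral>w. F e w \<partial>lborel)"
      using Bochner_Integration.integral_add[OF Fi[OF e] 3] 2 by linarith
    moreover have "F e w + F e (0 - w) = indicator {w. norm w \<ge> e} w * D w" for w
      by (simp add: F_def D_def algebra_simps split: split_indicator)
    ultimately show ?thesis using 1 by simp
  qed
  have "((\<lambda>e. \<integral>w. indicator {w. norm w \<ge> e} w * D w \<partial>lborel) \<longlongrightarrow> (\<integral>w. D w \<partial>lborel)) (at_right 0)"
  proof (rule tendsto_at_right_sequentially[where b=1])
    fix S :: "nat \<Rightarrow> real" assume S: "\<And>n. 0 < S n" "S \<longlonglongrightarrow> 0"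
    show "(\<lambda>n. \<integral>w. indicator {w. norm w \<ge> S n} w * D w \<partial>lborel) \<longlonglongrightarrow> (\<integral>w. D w \<partial>lborel)"
    proof (rule integral_dominated_convergence[OF _ _ integrable_abs[OF Di]])
      show "AE w in lborel. (\<lambda>n. indicator {w. norm w \<ge> S n} w * D w) \<longlonglongrightarrow> D w"
      proof (rule AE_I2)
        fix w :: 'a
        show "(\<lambda>n. indicator {w. norm w \<ge> S n} w * D w) \<longlonglongrightarrow> D w"
        proof (cases "w = 0")
          case True
          have "D 0 = 0" by (simp add: D_def)
          then show ?thesis using True by simp
        next
          case False
          then have "eventually (\<lambda>n. S n < norm w) sequentially" using order_tendstoD(2)[OF S(2), of "norm w"] by simp
          then have "eventually (\<lambda>n. indicator {w. norm w \<ge> S n} w * D w = D w) sequentially"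
            by eventually_elim simp
          then show ?thesis by (rule tendsto_eventually)
        qed
      qed
      show "AE w in lborel. norm (indicator {w. norm w \<ge> S n} w * D w) \<le> \<bar>D w\<bar>" for n
        by (intro AE_I2) (auto split: split_indicator)
    qed measurable
  qed simp
  then have "((\<lambda>e. (\<integral>w. indicator {w. norm w \<ge> e} w * D w \<partial>lborel) / 2) \<longlongrightarrow> (\<integral>w. D w \<partial>lborel) / 2) (at_right 0)"
    by (intro tendsto_divide tendsto_const) auto
  then have "((\<lambda>e. LINT y:{y. norm (x - y) \<ge> e}|lebesgue. (v x - v y) / norm (x - y) powr (real DIM('a) + 2 * s)) \<longlongrightarrow> (\<integral>w. D w \<partial>lborel) / 2) (at_right 0)"
    by (rule Lim_transform_eventually) (auto simp: eventually_at_right_less I intro!: eventually_mono[OF eventually_at_right_less])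
  then have "Lim (at_right 0) (\<lambda>e. LINT y:{y. norm (x - y) \<ge> e}|lebesgue. (v x - v y) / norm (x - y) powr (real DIM('a) + 2 * s)) = (\<integral>w. D w \<partial>lborel) / 2"
    by (intro tendsto_Lim) auto
  then show ?thesis unfolding frac_laplacian_def D_def by simp
qed

lemma frac_laplacian_bound:
  assumes s: "0 < s" "s < 1"
  shows "\<bar>frac_laplacian s v x\<bar> \<le> \<bar>frac_laplacian_const DIM('a) s\<bar> / 2 * (K * (\<integral>z. min 1 ((norm z)\<^sup>2) * levy s (z::'a) \<partial>lborel))"
proof -
  have "\<bar>\<integral>z. (2 * v x - v (x + z) - v (x - z)) * levy s z \<partial>lborel\<bar> \<le> (\<integral>z. \<bar>(2 * v x - v (x + z) - v (x - z)) * levy s z\<bar> \<partial>lborel)"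
    by (rule integral_abs_bound)
  also have "\<dots> \<le> (\<integral>z. K * (min 1 ((norm z)\<^sup>2) * levy s (z::'a)) \<partial>lborel)"
  proof (rule integral_mono)
    fix z
    have "\<bar>2 * v x - v (x + z) - v (x - z)\<bar> \<le> K * min 1 ((norm z)\<^sup>2)" using diff2[of x z] by linarith
    then have "\<bar>2 * v x - v (x + z) - v (x - z)\<bar> * levy s z \<le> K * min 1 ((norm z)\<^sup>2) * levy s z" by (intro mult_right_mono) auto
    then show "\<bar>(2 * v x - v (x + z) - v (x - z)) * levy s z\<bar> \<le> K * (min 1 ((norm z)\<^sup>2) * levy s z)" by (simp add: abs_mult)
  qed (intro integrable_abs integrable_diff2_levy[OF s] integrable_mult_right integrable_levy_min[OF s])+
  also have "\<dots> = K * (\<integral>z. min 1 ((norm z)\<^sup>2) * levy s (z::'a) \<partial>lborel)" by (rule integral_mult_right_zero)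
  finally show ?thesis unfolding frac_laplacian_eq[OF s] abs_mult by (intro mult_mono) auto
qed

text \<open>Two regimes: for \<open>norm z \<le> 1\<close> the second difference is of size
  \<open>(norm z)\<^sup>2\<close> and lives in the ball of radius \<open>r + 1\<close>; for larger
  \<open>z\<close> its integral in \<open>x\<close> is at most four times that of
  \<open>\<bar>v\<bar>\<close>. Together this is a multiple of
  \<open>min 1 ((norm z)\<^sup>2)\<close>.\<close>

lemma integrable_frac_pair:
  assumes s: "0 < s" "s < 1"
  shows "integrable (lborel \<Otimes>\<^sub>M lborel) (\<lambda>(z, x). cos ((x - y) \<bullet> \<xi>) * ((2 * v x - v (x + z) - v (x - z)) * levy s z))"
proof (rule lborel_pair.Fubini_integrable)
  let ?D = "\<lambda>z x. 2 * v x - v (x + z) - v (x - z)"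
  have iv: "integrable lborel (\<lambda>x. v (x + z))" for z
    using integral_lborel_translate(2)[of v z] integrable_v by (simp add: add.commute)
  have Di: "integrable lborel (?D z)" for z
    using iv[of z] iv[of "- z"] integrable_v by simp
  have ci: "integrable lborel (\<lambda>x. cos ((x - y) \<bullet> \<xi>) * (?D z x * levy s z))" for z
    by (rule Bochner_Integration.integrable_bound[OF integrable_mult_left[OF Di[of z], of "levy s z"]])
       (auto simp: abs_mult intro!: mult_left_le_one_le)
  then show "AE z in lborel. integrable lborel (\<lambda>x. case (z, x) of (z, x) \<Rightarrow> cos ((x - y) \<bullet> \<xi>) * (?D z x * levy s z))"
    by simp
  let ?V = "measure lborel (cball (0::'a) (r + 1))"
  let ?C = "K * ?V + 4 * (\<integral>x. \<bar>v x\<bar> \<partial>lborel)"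
  have vi: "integrable lborel (\<lambda>x::'a. K * c * indicator (cball 0 (r + 1)) x)" for c
    by (intro integrable_mult_right integrable_real_indicator) (use emeasure_lborel_cball_finite[of "0::'a" "r + 1"] in auto)
  have Db: "(\<integral>x. \<bar>?D z x\<bar> \<partial>lborel) \<le> ?C * min 1 ((norm z)\<^sup>2)" for z
  proof (cases "norm z \<le> 1")
    case True
    then have m: "min 1 ((norm z)\<^sup>2) = (norm z)\<^sup>2" by (intro min_absorb2) (simp add: power_le_one)
    have "(\<integral>x. \<bar>?D z x\<bar> \<partial>lborel) \<le> (\<integral>x. K * (norm z)\<^sup>2 * indicator (cball (0::'a) (r + 1)) x \<partial>lborel)"
    proof (intro integral_mono integrable_abs Di vi)
      fix x :: 'a
      show "\<bar>?D z x\<bar> \<le> K * (norm z)\<^sup>2 * indicator (cball 0 (r + 1)) x"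
      proof (cases "norm x \<le> r + 1")
        case True
        then show ?thesis using diff2[of x z] m by simp
      next
        case False
        then have "norm (x + z) \<ge> r" "norm (x - z) \<ge> r" "norm x \<ge> r"
          using True norm_diff_ineq[of x z] norm_triangle_ineq2[of x z] by linarith+
        then show ?thesis using K by (simp add: supp)
      qed
    qed
    also have "\<dots> = K * ?V * min 1 ((norm z)\<^sup>2)" by (simp add: m)
    also have "\<dots> \<le> ?C * min 1 ((norm z)\<^sup>2)" using integral_abs_v by (intro mult_right_mono) auto
    finally show ?thesis .
  next
    case False
    then have m: "min 1 ((norm z)\<^sup>2) = 1" by (simp add: min_def)
    have "(\<integral>x. \<bar>?D z x\<bar> \<partial>lborel) \<le> (\<integral>x. 2 * \<bar>v x\<bar> + \<bar>v (x + z)\<bar> + \<bar>v (x - z)\<bar> \<partial>lborel)"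
      using iv[of z] iv[of "- z"] integrable_v by (intro integral_mono integrable_abs Di Bochner_Integration.integrable_add integrable_mult_right) auto
    also have "\<dots> = 2 * (\<integral>x. \<bar>v x\<bar> \<partial>lborel) + (\<integral>x. \<bar>v (x + z)\<bar> \<partial>lborel) + (\<integral>x. \<bar>v (x - z)\<bar> \<partial>lborel)"
      using iv[of z] iv[of "- z"] integrable_v by simp
    also have "(\<integral>x. \<bar>v (x + z)\<bar> \<partial>lborel) = (\<integral>x. \<bar>v x\<bar> \<partial>lborel)"
      using integral_lborel_translate(1)[of "\<lambda>x. \<bar>v x\<bar>" z] by (simp add: add.commute)
    also have "(\<integral>x. \<bar>v (x - z)\<bar> \<partial>lborel) = (\<integral>x. \<bar>v x\<bar> \<partial>lborel)"
      using integral_lborel_translate(1)[of "\<lambda>x. \<bar>v x\<bar>" "- z"] by simp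
    finally show ?thesis using K m by (simp add: add_increasing)
  qed
  have "integrable lborel (\<lambda>z::'a. ?C * (min 1 ((norm z)\<^sup>2) * levy s z))"
    by (intro integrable_mult_right integrable_levy_min s)
  then show "integrable lborel (\<lambda>z. LBINT x. norm (case (z, x) of (z, x) \<Rightarrow> cos ((x - y) \<bullet> \<xi>) * (?D z x * levy s z)))"
  proof (rule Bochner_Integration.integrable_bound)
    show "AE z in lborel. norm (LBINT x. norm (case (z, x) of (z, x) \<Rightarrow> cos ((x - y) \<bullet> \<xi>) * (?D z x * levy s z))) \<le> norm (?C * (min 1 ((norm z)\<^sup>2) * levy s z))"
    proof (rule AE_I2)
      fix z :: 'a
      have "(LBINT x. \<bar>cos ((x - y) \<bullet> \<xi>) * (?D z x * levy s z)\<bar>) \<le> (LBINT x. \<bar>?D z x\<bar> * levy s z)"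
        by (intro integral_mono integrable_abs ci integrable_mult_left Di) (auto simp: abs_mult intro!: mult_left_le_one_le)
      also have "\<dots> = (\<integral>x. \<bar>?D z x\<bar> \<partial>lborel) * levy s z" by (rule integral_mult_left_zero)
      also have "\<dots> \<le> ?C * min 1 ((norm z)\<^sup>2) * levy s z" by (intro mult_right_mono Db) auto
      finally show "norm (LBINT x. norm (case (z, x) of (z, x) \<Rightarrow> cos ((x - y) \<bullet> \<xi>) * (?D z x * levy s z))) \<le> norm (?C * (min 1 ((norm z)\<^sup>2) * levy s z))"
        by (simp add: mult.assoc)
    qed
  qed measurable
qed measurable

text \<open>After Fubini, \<open>cos_shift\<close> evaluates the \<open>x\<close>-integral for each
  \<open>z\<close>, and the remaining \<open>z\<close>-integral is
  \<open>integral_levy_cos\<close>.\<close>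

lemma frac_laplacian_pairing:
  assumes s: "0 < s" "s < 1"
  shows "integrable lborel (\<lambda>x. cos ((x - y) \<bullet> \<xi>) * frac_laplacian s v x)"
    and "(\<integral>x. cos ((x - y) \<bullet> \<xi>) * frac_laplacian s v x \<partial>lborel)
     = frac_laplacian_const DIM('a) s * levy_const DIM('a) s * norm \<xi> powr (2 * s) * (\<integral>x. cos ((x - y) \<bullet> \<xi>) * v x \<partial>lborel)"
proof -
  let ?D = "\<lambda>z x. 2 * v x - v (x + z) - v (x - z)"
  let ?P = "\<integral>x. cos ((x - y) \<bullet> \<xi>) * v x \<partial>lborel"
  let ?c = "frac_laplacian_const DIM('a) s / 2"
  note int = integrable_frac_pair[OF s, of y \<xi>]
  have eq: "cos ((x - y) \<bullet> \<xi>) * frac_laplacian s v x = ?c * (\<integral>z. cos ((x - y) \<bullet> \<xi>) * (?D z x * levy s z) \<partial>lborel)" for x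
    unfolding frac_laplacian_eq[OF s] by simp
  have "integrable lborel (\<lambda>x. \<integral>z. cos ((x - y) \<bullet> \<xi>) * (?D z x * levy s z) \<partial>lborel)"
    using lborel_pair.integrable_snd[OF int] by simp
  then show "integrable lborel (\<lambda>x. cos ((x - y) \<bullet> \<xi>) * frac_laplacian s v x)"
    unfolding eq by (rule integrable_mult_right)
  have inner: "(\<integral>x. cos ((x - y) \<bullet> \<xi>) * (?D z x * levy s z) \<partial>lborel) = 2 * ?P * ((1 - cos (z \<bullet> \<xi>)) * levy s z)" for z
  proof -
    have "(\<integral>x. cos ((x - y) \<bullet> \<xi>) * (?D z x * levy s z) \<partial>lborel)
      = (\<integral>x. (cos ((x - y) \<bullet> \<xi>) * (v (x + z) + v (x - z) - 2 * v x)) * (- levy s z) \<partial>lborel)"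
      by (intro Bochner_Integration.integral_cong refl) (simp add: algebra_simps)
    also have "\<dots> = - (2 * (1 - cos (z \<bullet> \<xi>))) * ?P * (- levy s z)"
      by (simp only: integral_mult_left_zero cos_shift(3))
    finally show ?thesis by (simp only:) (simp add: algebra_simps)
  qed
  have "(\<integral>x. cos ((x - y) \<bullet> \<xi>) * frac_laplacian s v x \<partial>lborel)
     = ?c * (\<integral>x. \<integral>z. cos ((x - y) \<bullet> \<xi>) * (?D z x * levy s z) \<partial>lborel \<partial>lborel)"
    unfolding eq by (rule integral_mult_right_zero)
  also have "(\<integral>x. \<integral>z. cos ((x - y) \<bullet> \<xi>) * (?D z x * levy s z) \<partial>lborel \<partial>lborel)
      = (\<integral>z. \<integral>x. cos ((x - y) \<bullet> \<xi>) * (?D z x * levy s z) \<partial>lborel \<partial>lborel)"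
    using lborel_pair.Fubini_integral[OF int] by simp
  also have "\<dots> = 2 * ?P * (levy_const DIM('a) s * norm \<xi> powr (2 * s))"
    unfolding inner by (simp only: integral_mult_right_zero integral_levy_cos(2)[OF s])
  finally show "(\<integral>x. cos ((x - y) \<bullet> \<xi>) * frac_laplacian s v x \<partial>lborel)
     = frac_laplacian_const DIM('a) s * levy_const DIM('a) s * norm \<xi> powr (2 * s) * ?P"
    by simp
qed

end

section \<open>Duality between the heat kernel and test functions\<close>

text \<open>One constant \<open>K\<close> controls all time slices and the time derivative.
  Statements on \<open>time_deriv\<close> are restricted to \<open>t > 0\<close>, since it is a
  two-sided derivative and the values at negative times are arbitrary. At \<open>t = T\<close> the
  function vanishes but need not vanish nearby, hence \<open>t > T\<close> in
  \<open>dt_supp\<close>.\<close>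

locale test_fn =
  fixes \<phi> :: "'a::euclidean_space \<times> real \<Rightarrow> real" and r T K :: real
  assumes T: "T > 0"
    and supp: "t \<ge> 0 \<Longrightarrow> norm x \<ge> r \<or> t \<ge> T \<Longrightarrow> \<phi> (x, t) = 0"
    and cont: "continuous_on closed_half_space \<phi>"
    and bump: "t \<ge> 0 \<Longrightarrow> bump (\<lambda>x. \<phi> (x, t)) r K"
    and dt: "t > 0 \<Longrightarrow> ((\<lambda>\<tau>. \<phi> (x, \<tau>)) has_real_derivative time_deriv \<phi> (x, t)) (at t)"
    and dt_bound: "t > 0 \<Longrightarrow> \<bar>time_deriv \<phi> (x, t)\<bar> \<le> K"
    and dt_supp: "t > 0 \<Longrightarrow> norm x \<ge> r \<or> t > T \<Longrightarrow> time_deriv \<phi> (x, t) = 0"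
    and dt_cont: "continuous_on open_half_space (time_deriv \<phi>)"

text \<open>Two derivatives suffice: they are continuous up to the boundary, hence bounded on a
  compact cylinder around the support.\<close>

lemma test_functions_imp_test_fn:
  fixes \<phi> :: "'a::euclidean_space \<times> real \<Rightarrow> real"
  assumes "\<phi> \<in> test_functions"
  shows "\<exists>r T K. test_fn \<phi> r T K"
proof -
  let ?A = "closed_half_space :: ('a \<times> real) set"
  have memA: "(x, t) \<in> ?A \<longleftrightarrow> t \<ge> 0" for x t by (simp add: closed_half_space_def)
  from assms obtain r T where r: "r > 0" and T: "T > 0" and sm: "smooth_on ?A \<phi>"
    and z: "\<And>z. z \<in> ?A - ball 0 r \<times> {0..<T} \<Longrightarrow> \<phi> z = 0" unfolding test_functions_def by auto
  have supp: "\<phi> (x, t) = 0" if "t \<ge> 0" "norm x \<ge> r \<or> t \<ge> T" for x t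
    using that by (intro z) (auto simp: memA)
  have "Ck_on (Suc (Suc 0)) ?A \<phi>" using sm unfolding smooth_on_def by blast
  then obtain f1 where f1: "\<And>z. z \<in> ?A \<Longrightarrow> (\<phi> has_derivative f1 z) (at z within ?A)"
    and f1C: "\<And>h. Ck_on (Suc 0) ?A (\<lambda>z. f1 z h)" by auto
  from f1C have "\<forall>h. \<exists>f'. (\<forall>z\<in>?A. ((\<lambda>z. f1 z h) has_derivative f' z) (at z within ?A)) \<and> (\<forall>k. continuous_on ?A (\<lambda>z. f' z k))" by simp
  then obtain f2 where f2: "\<And>h z. z \<in> ?A \<Longrightarrow> ((\<lambda>z. f1 z h) has_derivative f2 h z) (at z within ?A)"
    and f2c: "\<And>h k. continuous_on ?A (\<lambda>z. f2 h z k)" by metis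
  have cont: "continuous_on ?A \<phi>"
    using f1 by (auto simp: continuous_on_eq_continuous_within intro: has_derivative_continuous)
  have f1c: "continuous_on ?A (\<lambda>z. f1 z h)" for h
    unfolding continuous_on_eq_continuous_within by (intro ballI has_derivative_continuous[OF f2])
  \<comment> \<open>A line in a spatial direction stays in the half space, so a derivative relative
    to the half space restricts to an ordinary one along it, even at \<open>t = 0\<close>.\<close>
  have line: "((\<lambda>h. F (x + h *\<^sub>R w, t)) has_real_derivative F' (w, 0)) (at h)"
    if F: "(F has_derivative F') (at (x + h *\<^sub>R w, t) within ?A)" and t: "t \<ge> 0" for F :: "'a \<times> real \<Rightarrow> real" and F' x h w t
  proof -
    have l: "((\<lambda>h. (x + h *\<^sub>R w, t)) has_derivative (\<lambda>k. (k *\<^sub>R w, 0))) (at h)"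
      by (auto intro!: derivative_eq_intros)
    have "(F has_derivative F') (at (x + h *\<^sub>R w, t) within range (\<lambda>h. (x + h *\<^sub>R w, t)))"
      using F by (rule has_derivative_subset) (auto simp: memA t)
    from has_derivative_in_compose[OF l this]
    have "((\<lambda>h. F (x + h *\<^sub>R w, t)) has_derivative (\<lambda>k. F' (k *\<^sub>R w, 0))) (at h)" by simp
    moreover have "(\<lambda>k. F' (k *\<^sub>R w, 0)) = (\<lambda>k. F' (w, 0) * k)"
    proof
      fix k :: real
      have "F' (k *\<^sub>R w, 0) = F' (k *\<^sub>R (w, 0))" by simp
      also have "\<dots> = k *\<^sub>R F' (w, 0)" by (rule linear_scale[OF bounded_linear.linear[OF has_derivative_bounded_linear[OF F]]])
      finally show "F' (k *\<^sub>R w, 0) = F' (w, 0) * k" by simp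
    qed
    ultimately show ?thesis by (simp add: has_field_derivative_def)
  qed
  have expand: "F' (w, 0) = (\<Sum>b\<in>Basis. (w \<bullet> b) * F' (b, 0))" if F': "bounded_linear F'" for F' :: "'a \<times> real \<Rightarrow> real" and w
  proof -
    have l: "linear (\<lambda>w. F' (w, 0))"
      using bounded_linear_compose[OF F' bounded_linear_Pair[OF bounded_linear_ident bounded_linear_zero]]
      by (simp add: bounded_linear.linear)
    have "F' (w, 0) = F' (\<Sum>b\<in>Basis. (w \<bullet> b) *\<^sub>R b, 0)" by (simp add: euclidean_representation)
    also have "\<dots> = (\<Sum>b\<in>Basis. (w \<bullet> b) *\<^sub>R F' (b, 0))"
      using linear_sum[OF l, of "\<lambda>b. (w \<bullet> b) *\<^sub>R b" Basis] by (simp add: linear_scale[OF l])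
    finally show ?thesis by simp
  qed
  \<comment> \<open>The radius \<open>r + 2\<close> accommodates base points of norm at most
    \<open>r + 1\<close> together with steps of norm at most 1.\<close>
  define Q where "Q = cball (0::'a) (r + 2) \<times> {0..T}"
  have Qc: "compact Q" unfolding Q_def by (intro compact_Times) auto
  have QA: "Q \<subseteq> ?A" by (auto simp: Q_def memA)
  have bdd: "\<exists>B\<ge>0. \<forall>z\<in>Q. \<bar>F z\<bar> \<le> B" if "continuous_on ?A F" for F :: "'a \<times> real \<Rightarrow> real"
  proof -
    have "compact (F ` Q)" using that QA Qc by (intro compact_continuous_image continuous_on_subset[OF that]) auto
    then have "bounded (F ` Q)" by (rule compact_imp_bounded)
    then obtain B where "\<forall>y\<in>F ` Q. norm y \<le> B" unfolding bounded_iff by blast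
    then show ?thesis by (intro exI[of _ "max B 0"]) auto
  qed
  obtain K0 where K0: "K0 \<ge> 0" "\<And>z. z \<in> Q \<Longrightarrow> \<bar>\<phi> z\<bar> \<le> K0" using bdd[OF cont] by blast
  obtain K1 where K1: "K1 \<ge> 0" "\<And>z. z \<in> Q \<Longrightarrow> \<bar>f1 z (0, 1)\<bar> \<le> K1" using bdd[OF f1c] by blast
  have "continuous_on ?A (\<lambda>z. \<Sum>b\<in>Basis. \<Sum>c\<in>Basis. \<bar>f2 (b, 0) z (c, 0)\<bar>)"
    by (intro continuous_intros f2c)
  from bdd[OF this] obtain K2 where K2: "K2 \<ge> 0" "\<And>z. z \<in> Q \<Longrightarrow> (\<Sum>b\<in>Basis. \<Sum>c\<in>Basis. \<bar>f2 (b, 0) z (c, 0)\<bar>) \<le> K2"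
    by (auto intro: order_trans[OF abs_ge_self])
  \<comment> \<open>\<open>4 * K0\<close> bounds second differences with large steps,
    \<open>K2\<close> those with small steps, and \<open>K1\<close> the time derivative.\<close>
  define K where "K = 4 * K0 + K1 + K2"
  have \<phi>b: "\<bar>\<phi> (x, t)\<bar> \<le> K0" if "t \<ge> 0" for x t
  proof (cases "norm x \<ge> r \<or> t \<ge> T")
    case True then show ?thesis using supp that K0 by simp
  next
    case False then show ?thesis using that by (intro K0) (auto simp: Q_def)
  qed
  define D2 where "D2 w z = (\<Sum>b\<in>Basis. \<Sum>c\<in>Basis. (w \<bullet> b) * (w \<bullet> c) * f2 (b, 0) z (c, 0))" for w :: 'a and z
  have d1: "((\<lambda>h. \<phi> (x + h *\<^sub>R w, t)) has_real_derivative f1 (x + h *\<^sub>R w, t) (w, 0)) (at h)" if "t \<ge> 0" for x w h t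
    using that by (intro line f1) (auto simp: memA)
  have d2: "((\<lambda>h. f1 (x + h *\<^sub>R w, t) (w, 0)) has_real_derivative D2 w (x + h *\<^sub>R w, t)) (at h)" if t: "t \<ge> 0" for x w h t
  proof -
    have "((\<lambda>h. \<Sum>b\<in>Basis. (w \<bullet> b) * f1 (x + h *\<^sub>R w, t) (b, 0)) has_real_derivative
       (\<Sum>b\<in>Basis. (w \<bullet> b) * f2 (b, 0) (x + h *\<^sub>R w, t) (w, 0))) (at h)"
      using t by (intro DERIV_sum DERIV_cmult line[where F="\<lambda>z. f1 z (b, 0)" for b] f2) (auto simp: memA)
    moreover have "(\<Sum>b\<in>Basis. (w \<bullet> b) * f2 (b, 0) (x + h *\<^sub>R w, t) (w, 0)) = D2 w (x + h *\<^sub>R w, t)"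
      unfolding D2_def
    proof (intro sum.cong refl)
      fix b :: 'a
      have "f2 (b, 0) (x + h *\<^sub>R w, t) (w, 0) = (\<Sum>c\<in>Basis. (w \<bullet> c) * f2 (b, 0) (x + h *\<^sub>R w, t) (c, 0))"
        using t by (intro expand has_derivative_bounded_linear[OF f2]) (auto simp: memA)
      then show "(w \<bullet> b) * f2 (b, 0) (x + h *\<^sub>R w, t) (w, 0) = (\<Sum>c\<in>Basis. (w \<bullet> b) * (w \<bullet> c) * f2 (b, 0) (x + h *\<^sub>R w, t) (c, 0))"
        by (simp add: sum_distrib_left mult.assoc)
    qed
    moreover have "(\<Sum>b\<in>Basis. (w \<bullet> b) * f1 (x + h *\<^sub>R w, t) (b, 0)) = f1 (x + h *\<^sub>R w, t) (w, 0)" for h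
      using t by (intro expand[symmetric] has_derivative_bounded_linear[OF f1]) (auto simp: memA)
    ultimately show ?thesis by simp
  qed
  have D2b: "\<bar>D2 w z\<bar> \<le> (norm w)\<^sup>2 * K2" if "z \<in> Q" for w z
  proof -
    have "\<bar>D2 w z\<bar> \<le> (\<Sum>b\<in>Basis. \<Sum>c\<in>Basis. \<bar>(w \<bullet> b) * (w \<bullet> c) * f2 (b, 0) z (c, 0)\<bar>)"
      unfolding D2_def by (intro order_trans[OF sum_abs] sum_mono order_refl)
    also have "\<dots> \<le> (\<Sum>b\<in>Basis. \<Sum>c\<in>Basis. (norm w)\<^sup>2 * \<bar>f2 (b, 0) z (c, 0)\<bar>)"
      unfolding abs_mult power2_eq_square by (intro sum_mono mult_right_mono mult_mono Basis_le_norm) auto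
    also have "\<dots> = (norm w)\<^sup>2 * (\<Sum>b\<in>Basis. \<Sum>c\<in>Basis. \<bar>f2 (b, 0) z (c, 0)\<bar>)" by (simp add: sum_distrib_left)
    also have "\<dots> \<le> (norm w)\<^sup>2 * K2" using K2 that by (intro mult_left_mono) auto
    finally show ?thesis .
  qed
  have diff2: "\<bar>\<phi> (x + w, t) + \<phi> (x - w, t) - 2 * \<phi> (x, t)\<bar> \<le> K * min 1 ((norm w)\<^sup>2)" if t: "t \<ge> 0" for x w t
  proof (cases "norm w \<le> 1")
    case False
    then have "min 1 ((norm w)\<^sup>2) = 1" by (simp add: min_def)
    moreover have "\<bar>\<phi> (x + w, t) + \<phi> (x - w, t) - 2 * \<phi> (x, t)\<bar> \<le> 4 * K0"
      using \<phi>b[OF t, of "x + w"] \<phi>b[OF t, of "x - w"] \<phi>b[OF t, of x] by linarith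
    ultimately show ?thesis using K1(1) K2(1) by (simp add: K_def)
  next
    case True
    then have m: "min 1 ((norm w)\<^sup>2) = (norm w)\<^sup>2" by (intro min_absorb2) (simp add: power_le_one)
    have Kn: "0 \<le> K * (norm w)\<^sup>2" using K0 K1 K2 by (simp add: K_def)
    show ?thesis
    proof (cases "norm x \<le> r + 1 \<and> t \<le> T")
      case False
      have "\<phi> (x + w, t) = 0 \<and> \<phi> (x - w, t) = 0 \<and> \<phi> (x, t) = 0"
      proof (cases "t \<le> T")
        case True
        with False have "norm x > r + 1" by auto
        then have "norm (x + w) \<ge> r" "norm (x - w) \<ge> r" "norm x \<ge> r"
          using \<open>norm w \<le> 1\<close> norm_diff_ineq[of x w] norm_triangle_ineq2[of x w] by linarith+
        then show ?thesis using t by (simp add: supp)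
      qed (use t in \<open>simp add: supp\<close>)
      then show ?thesis using Kn m by simp
    next
      case inQ: True
      obtain \<theta> where th: "0 < \<theta>" "\<theta> < 1" "\<phi> (x + 1 *\<^sub>R w, t) + \<phi> (x + (- 1) *\<^sub>R w, t) - 2 * \<phi> (x + 0 *\<^sub>R w, t)
          = (D2 w (x + \<theta> *\<^sub>R w, t) + D2 w (x + (- \<theta>) *\<^sub>R w, t)) / 2 * 1\<^sup>2"
        using second_difference[OF d1[OF t] d2[OF t], of 1 x w thesis] by simp
      have q: "(x + a *\<^sub>R w, t) \<in> Q" if "\<bar>a\<bar> \<le> 1" for a
      proof -
        have "norm (x + a *\<^sub>R w) \<le> norm x + \<bar>a\<bar> * norm w" using norm_triangle_ineq[of x "a *\<^sub>R w"] by simp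
        also have "\<bar>a\<bar> * norm w \<le> 1" using that True by (intro mult_le_one) auto
        finally show ?thesis using inQ t by (auto simp: Q_def)
      qed
      have "\<bar>D2 w (x + \<theta> *\<^sub>R w, t)\<bar> \<le> (norm w)\<^sup>2 * K2" "\<bar>D2 w (x + (- \<theta>) *\<^sub>R w, t)\<bar> \<le> (norm w)\<^sup>2 * K2"
        using th by (intro D2b q; simp)+
      then have "\<bar>\<phi> (x + w, t) + \<phi> (x - w, t) - 2 * \<phi> (x, t)\<bar> \<le> (norm w)\<^sup>2 * K2" using th(3) by simp
      also have "\<dots> \<le> K * (norm w)\<^sup>2" using K0 K1 by (subst mult.commute) (intro mult_right_mono, auto simp: K_def)
      finally show ?thesis using m by simp
    qed
  qed
  have lap: "(\<lambda>n. dsum n (\<lambda>x. \<phi> (x, t)) x) \<longlonglongrightarrow> laplacian (\<lambda>x. \<phi> (x, t)) x" if t: "t \<ge> 0" for x t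
    unfolding dsum_def laplacian_def
  proof (intro tendsto_sum)
    fix b :: 'a
    have dd: "deriv (\<lambda>h. \<phi> (x + h *\<^sub>R b, t)) = (\<lambda>h. f1 (x + h *\<^sub>R b, t) (b, 0))"
      by (intro ext DERIV_imp_deriv d1 t)
    have dd2: "(deriv ^^ 2) (\<lambda>h. \<phi> (x + h *\<^sub>R b, t)) 0 = D2 b (x + 0 *\<^sub>R b, t)"
      unfolding numeral_2_eq_2 funpow.simps comp_def id_apply dd by (intro DERIV_imp_deriv d2 t)
    have "isCont (\<lambda>h. D2 b (x + h *\<^sub>R b, t)) 0"
    proof -
      have "continuous_on UNIV (\<lambda>h. D2 b (x + h *\<^sub>R b, t))"
        unfolding D2_def
        by (intro continuous_intros continuous_on_compose2[OF f2c]) (auto simp: memA t)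
      then show ?thesis by (simp add: continuous_on_eq_continuous_at)
    qed
    from second_difference_limit[OF d1[OF t] d2[OF t] this]
    show "(\<lambda>n. (\<phi> (x + (1 / (real n + 1)) *\<^sub>R b, t) + \<phi> (x - (1 / (real n + 1)) *\<^sub>R b, t) - 2 * \<phi> (x, t)) * (real n + 1)\<^sup>2)
       \<longlonglongrightarrow> (deriv ^^ 2) (\<lambda>h. \<phi> (x + h *\<^sub>R b, t)) 0"
      unfolding dd2 by simp
  qed
  have bump: "bump (\<lambda>x. \<phi> (x, t)) r K" if t: "t \<ge> 0" for t
  proof
    show "(\<lambda>x. \<phi> (x, t)) \<in> borel_measurable borel"
      by (intro borel_measurable_continuous_onI continuous_on_compose2[OF cont] continuous_intros) (auto simp: memA t)
    fix x :: 'a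
    show "\<bar>\<phi> (x, t)\<bar> \<le> K" using \<phi>b[OF t, of x] K0 K1 K2 by (simp add: K_def)
  qed (use r supp t diff2 lap in auto)
  have td: "((\<lambda>\<tau>. \<phi> (x, \<tau>)) has_real_derivative f1 (x, t) (0, 1)) (at t)" if t: "t > 0" for x t
  proof -
    have l: "((\<lambda>\<tau>. (x, \<tau>)) has_derivative (\<lambda>k. (0, k))) (at t within {0<..})"
      by (auto intro!: derivative_eq_intros)
    have "(\<phi> has_derivative f1 (x, t)) (at (x, t) within (\<lambda>\<tau>. (x, \<tau>)) ` {0<..})"
      by (rule has_derivative_subset[OF f1]) (use t in \<open>auto simp: memA\<close>)
    from has_derivative_in_compose[OF l this]
    have "((\<lambda>\<tau>. \<phi> (x, \<tau>)) has_derivative (\<lambda>k. f1 (x, t) (0, k))) (at t)"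
      using t by (simp add: at_within_open[of t "{0<..}"])
    moreover have "(\<lambda>k. f1 (x, t) (0, k)) = (\<lambda>k. f1 (x, t) (0, 1) * k)"
    proof
      fix k :: real
      have bl: "bounded_linear (f1 (x, t))" using t by (intro has_derivative_bounded_linear[OF f1]) (auto simp: memA)
      have "f1 (x, t) (0, k) = f1 (x, t) (k *\<^sub>R (0, 1))" by simp
      also have "\<dots> = k *\<^sub>R f1 (x, t) (0, 1)" by (rule linear_scale[OF bounded_linear.linear[OF bl]])
      finally show "f1 (x, t) (0, k) = f1 (x, t) (0, 1) * k" by simp
    qed
    ultimately show ?thesis by (simp add: has_field_derivative_def)
  qed
  have tdv: "time_deriv \<phi> (x, t) = f1 (x, t) (0, 1)" if "t > 0" for x t
    unfolding time_deriv_def using DERIV_imp_deriv[OF td[OF that]] by simp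
  \<comment> \<open>The derivative vanishes because \<open>\<phi> (x, \<tau>)\<close> is 0 for all
    \<open>\<tau>\<close> near \<open>t\<close>; this is why \<open>t = T\<close> is excluded when
    \<open>x\<close> lies inside the ball.\<close>
  have tsupp: "time_deriv \<phi> (x, t) = 0" if t: "t > 0" and o: "norm x \<ge> r \<or> t > T" for x t
  proof -
    obtain e where e: "e > 0" "\<And>\<tau>. dist \<tau> t < e \<Longrightarrow> \<phi> (x, \<tau>) = 0"
    proof (cases "norm x \<ge> r")
      case True
      then show thesis using t supp by (intro that[of t]) (auto simp: dist_real_def)
    next
      case False
      then have "t > T" using o by simp
      show thesis
      proof (rule that[of "t - T"])
        fix \<tau> assume "dist \<tau> t < t - T"
        then have "\<tau> > T" by (simp add: dist_real_def abs_if split: if_splits)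
        then show "\<phi> (x, \<tau>) = 0" using T by (intro supp) auto
      qed (use \<open>t > T\<close> in simp)
    qed
    have "((\<lambda>\<tau>. \<phi> (x, \<tau>)) has_real_derivative 0) (at t)"
      by (rule has_field_derivative_transform_within[OF DERIV_const[of 0] e(1)]) (use e(2) in auto)
    then show ?thesis unfolding time_deriv_def using DERIV_imp_deriv by fastforce
  qed
  have "test_fn \<phi> r T K"
  proof (rule test_fn.intro)
    fix x :: 'a and t :: real assume t: "t > 0"
    show "((\<lambda>\<tau>. \<phi> (x, \<tau>)) has_real_derivative time_deriv \<phi> (x, t)) (at t)" using td[OF t] tdv[OF t] by simp
    show "\<bar>time_deriv \<phi> (x, t)\<bar> \<le> K"
    proof (cases "norm x \<ge> r \<or> t > T")
      case True
      then show ?thesis using tsupp[OF t True] K0 K1 K2 by (simp add: K_def)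
    next
      case False
      then have "(x, t) \<in> Q" using t by (auto simp: Q_def)
      then show ?thesis using K1(2) tdv[OF t] K0 K2 by (fastforce simp: K_def)
    qed
  next
    show "continuous_on open_half_space (time_deriv \<phi>)"
    proof (rule continuous_on_eq)
      show "continuous_on (open_half_space :: ('a \<times> real) set) (\<lambda>z. f1 z (0, 1))"
        by (rule continuous_on_subset[OF f1c]) (auto simp: open_half_space_def closed_half_space_def)
    qed (auto simp: open_half_space_def tdv)
  qed (use T supp cont bump tsupp in blast)+
  then show ?thesis by blast
qed

text \<open>The multiplier of \<open>frac_laplacian s\<close> is \<open>fkappa N s * |\<xi>| powr (2 * s)\<close>. The value of the constant is \<open>1\<close>, but
  only its positivity is used: the kernel \<open>heat_kernel\<close>, which is \<open>hk\<close> for \<open>\<kappa> = 1\<close>, enters the existence part only as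
  an integrable bounded majorant of the initial datum.\<close>

definition fkappa :: "nat \<Rightarrow> real \<Rightarrow> real" where
  "fkappa N s = frac_laplacian_const N s * levy_const N s"

lemma frac_laplacian_const_pos: "0 < s \<Longrightarrow> s < 1 \<Longrightarrow> frac_laplacian_const N s > 0"
  unfolding frac_laplacian_const_def
  by (intro divide_pos_pos mult_pos_pos Gamma_real_pos) (auto intro: add_nonneg_pos)

lemma fkappa_pos: "0 < s \<Longrightarrow> s < 1 \<Longrightarrow> fkappa N s > 0"
  unfolding fkappa_def by (intro mult_pos_pos frac_laplacian_const_pos levy_const_pos)

section \<open>The adjoint operator applied to a test function\<close>

locale heat_test = test_fn \<phi> r T K + frac_heat s "fkappa DIM('a) s"
  for \<phi> :: "'a::euclidean_space \<times> real \<Rightarrow> real" and r T K s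
begin

definition g :: "'a \<times> real \<Rightarrow> real" where "g z = - time_deriv \<phi> z + mixed_op s \<phi> z"

lemma g_eq: "g (x, t) = - time_deriv \<phi> (x, t) - laplacian (\<lambda>x. \<phi> (x, t)) x + frac_laplacian s (\<lambda>x. \<phi> (x, t)) x"
  by (simp add: g_def mixed_op_def)

lemma K_nonneg: "K \<ge> 0" using bump.K[OF bump[of 0]] by simp

lemma phi_bound: "t \<ge> 0 \<Longrightarrow> \<bar>\<phi> (x, t)\<bar> \<le> K" using bump.bound[OF bump] .

lemma borel_measurable_phi_slice: "t \<ge> 0 \<Longrightarrow> (\<lambda>x. \<phi> (x, t)) \<in> borel_measurable borel"
  using bump.meas[OF bump] .

lemma g_bound: obtains C where "C \<ge> 0" "\<And>x t. t > 0 \<Longrightarrow> \<bar>g (x, t)\<bar> \<le> C"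
proof -
  let ?I = "\<integral>z. min 1 ((norm z)\<^sup>2) * levy s (z::'a) \<partial>lborel"
  let ?C = "K + real DIM('a) * K + \<bar>frac_laplacian_const DIM('a) s\<bar> / 2 * (K * ?I)"
  have b: "\<bar>g (x, t)\<bar> \<le> ?C" if t: "t > 0" for x t
    unfolding g_eq using dt_bound[OF t, of x] bump.laplacian_bound[OF bump, of t x] bump.frac_laplacian_bound[OF bump s, of t x] t
    by linarith
  moreover have "?C \<ge> 0" using b[of 1 0] by (meson abs_ge_zero order_trans zero_less_one)
  ultimately show thesis by (rule that[rotated])
qed

lemma g_supp: assumes "t > T" shows "g (x, t) = 0"
proof -
  have z: "(\<lambda>x. \<phi> (x, t)) = (\<lambda>x. 0)" using assms T by (intro ext supp) auto
  have zz: "\<phi> (x, t) = 0" for x using assms T by (intro supp) auto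
  have t: "t \<ge> 0" "t > 0" using assms T by auto
  have "laplacian (\<lambda>x. \<phi> (x, t)) x = 0"
    using bump.lap[OF bump[OF t(1)], of x] unfolding z by (simp add: dsum_def LIMSEQ_const_iff)
  moreover have "frac_laplacian s (\<lambda>x. \<phi> (x, t)) x = 0"
    using bump.frac_laplacian_eq[OF bump[OF t(1)] s, of x] by (simp add: zz)
  ultimately show ?thesis unfolding g_eq using dt_supp[OF t(2)] assms by simp
qed

text \<open>At negative times \<open>\<phi>\<close> is an arbitrary function and may fail to be
  measurable; the extension by 0 is Borel.\<close>

definition \<phi>' :: "'a \<times> real \<Rightarrow> real" where "\<phi>' z = indicator closed_half_space z *\<^sub>R \<phi> z"

lemma borel_measurable_phi' [measurable]: "\<phi>' \<in> borel_measurable borel"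
  unfolding \<phi>'_def[abs_def]
  by (rule borel_measurable_continuous_on_indicator[OF _ cont])
     (auto simp: closed_half_space_def intro!: borel_closed closed_Times)

lemma borel_measurable_phi'_pair [measurable]: "\<phi>' \<in> borel_measurable (borel \<Otimes>\<^sub>M borel)"
  using borel_measurable_phi' by (simp add: borel_prod)

lemma phi'_eq: "t \<ge> 0 \<Longrightarrow> \<phi>' (x, t) = \<phi> (x, t)"
  by (simp add: \<phi>'_def closed_half_space_def)

definition gS :: "'a \<times> real \<Rightarrow> real" where "gS z = indicator open_half_space z * g z"

lemma open_half_space_borel [measurable]: "(open_half_space :: ('a \<times> real) set) \<in> sets borel"
  unfolding open_half_space_def by (intro borel_open open_Times) auto

lemma open_half_space_borel_pair [measurable]: "(open_half_space :: ('a \<times> real) set) \<in> sets (borel \<Otimes>\<^sub>M borel)"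
  by (subst borel_prod) (rule open_half_space_borel)

text \<open>Joint measurability in space and time: the Laplacian is a limit of \<open>dsum\<close>,
  the fractional Laplacian a parameter integral of second differences.\<close>

lemma borel_measurable_gS [measurable]: "gS \<in> borel_measurable borel"
proof -
  have 1: "(\<lambda>z. indicator open_half_space z *\<^sub>R time_deriv \<phi> z) \<in> borel_measurable borel"
    by (rule borel_measurable_continuous_on_indicator[OF _ dt_cont]) measurable
  have 2: "(\<lambda>z. indicator open_half_space z * laplacian (\<lambda>x. \<phi> (x, snd z)) (fst z)) \<in> borel_measurable borel"
  proof (rule borel_measurable_LIMSEQ_metric)
    show "(\<lambda>z. indicator open_half_space z * dsum n (\<lambda>x. \<phi>' (x, snd z)) (fst z)) \<in> borel_measurable borel" for n
      unfolding dsum_def borel_prod[symmetric] by measurable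
    fix z :: "'a \<times> real"
    show "(\<lambda>n. indicator open_half_space z * dsum n (\<lambda>x. \<phi>' (x, snd z)) (fst z)) \<longlonglongrightarrow> indicator open_half_space z * laplacian (\<lambda>x. \<phi> (x, snd z)) (fst z)"
    proof (cases "snd z > 0")
      case True
      then have "(\<lambda>x. \<phi>' (x, snd z)) = (\<lambda>x. \<phi> (x, snd z))" by (intro ext phi'_eq) auto
      then show ?thesis using bump.lap[OF bump[of "snd z"], of "fst z"] True by (auto intro!: tendsto_intros)
    next
      case False
      then have "z \<notin> open_half_space" by (auto simp: open_half_space_def)
      then show ?thesis by simp
    qed
  qed
  have 3: "(\<lambda>z. indicator open_half_space z * frac_laplacian s (\<lambda>x. \<phi> (x, snd z)) (fst z)) \<in> borel_measurable borel"
  proof -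
    have "indicator open_half_space z * frac_laplacian s (\<lambda>x. \<phi> (x, snd z)) (fst z)
      = indicator open_half_space z * (frac_laplacian_const DIM('a) s / 2 *
        (\<integral>w. (2 * \<phi>' (fst z, snd z) - \<phi>' (fst z + w, snd z) - \<phi>' (fst z - w, snd z)) * levy s w \<partial>lborel))" for z :: "'a \<times> real"
    proof (cases "snd z > 0")
      case True
      then show ?thesis using bump.frac_laplacian_eq[OF bump s, of "snd z" "fst z"] by (cases z) (simp add: phi'_eq)
    next
      case False
      then have "z \<notin> open_half_space" by (auto simp: open_half_space_def)
      then show ?thesis by simp
    qed
    moreover have "(\<lambda>z. indicator open_half_space z * (frac_laplacian_const DIM('a) s / 2 *
        (\<integral>w. (2 * \<phi>' (fst z, snd z) - \<phi>' (fst z + w, snd z) - \<phi>' (fst z - w, snd z)) * levy s w \<partial>lborel))) \<in> borel_measurable borel"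
      unfolding borel_prod[symmetric] by measurable
    ultimately show ?thesis by (simp only:)
  qed
  have "gS z = - (indicator open_half_space z *\<^sub>R time_deriv \<phi> z) - indicator open_half_space z * laplacian (\<lambda>x. \<phi> (x, snd z)) (fst z)
     + indicator open_half_space z * frac_laplacian s (\<lambda>x. \<phi> (x, snd z)) (fst z)" for z
    unfolding gS_def by (cases z) (simp add: g_eq algebra_simps)
  then have "gS = (\<lambda>z. - (indicator open_half_space z *\<^sub>R time_deriv \<phi> z) - indicator open_half_space z * laplacian (\<lambda>x. \<phi> (x, snd z)) (fst z)
     + indicator open_half_space z * frac_laplacian s (\<lambda>x. \<phi> (x, snd z)) (fst z))" by (rule ext)
  then show ?thesis using 1 2 3 by (simp only: borel_measurable_add borel_measurable_diff borel_measurable_uminus)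
qed

lemma gS_bound: obtains C where "C \<ge> 0" "\<And>z. \<bar>gS z\<bar> \<le> C"
proof -
  obtain C where C: "C \<ge> 0" "\<And>x t. t > 0 \<Longrightarrow> \<bar>g (x, t)\<bar> \<le> C" using g_bound by blast
  have "\<bar>gS z\<bar> \<le> C" for z using C by (cases z) (auto simp: gS_def open_half_space_def split: split_indicator)
  then show thesis using C(1) that by blast
qed

lemma gS_eq: "t > 0 \<Longrightarrow> gS (x, t) = g (x, t)"
  by (simp add: gS_def open_half_space_def)

lemma gS_supp: "t \<le> 0 \<or> t > T \<Longrightarrow> gS (x, t) = 0"
  by (auto simp: gS_def open_half_space_def g_supp)

lemma integrable_dt:
  assumes t: "t > 0" shows "integrable lborel (\<lambda>x. time_deriv \<phi> (x, t))"
proof (rule Bochner_Integration.integrable_bound)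
  show "integrable lborel (\<lambda>x::'a. K * indicator (cball 0 r) x)"
    by (intro integrable_mult_right integrable_real_indicator) (use emeasure_lborel_cball_finite[of "0::'a" r] in auto)
  show "AE x in lborel. norm (time_deriv \<phi> (x, t)) \<le> norm (K * indicator (cball 0 r) x)"
    using dt_bound[OF t] dt_supp[OF t] K_nonneg by (intro AE_I2) (auto split: split_indicator)
  have "(\<lambda>x. time_deriv \<phi> (x, t)) \<in> borel_measurable borel"
    by (intro borel_measurable_continuous_onI continuous_on_compose2[OF dt_cont] continuous_intros) (use t in \<open>auto simp: open_half_space_def\<close>)
  then show "(\<lambda>x. time_deriv \<phi> (x, t)) \<in> borel_measurable lborel" by simp
qed

lemma integrable_cos_left:
  fixes f :: "'a \<Rightarrow> real" assumes "integrable lborel f"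
  shows "integrable lborel (\<lambda>x. cos ((x - y) \<bullet> \<xi>) * f x)"
proof (rule Bochner_Integration.integrable_bound[OF assms])
  have [measurable]: "f \<in> borel_measurable borel" using assms by auto
  show "(\<lambda>x. cos ((x - y) \<bullet> \<xi>) * f x) \<in> borel_measurable lborel" by measurable
qed (auto simp: abs_mult intro!: mult_left_le_one_le)

text \<open>Only the spatial operators pass to the Fourier side. The time derivative is left in
  place, to be integrated later by the fundamental theorem of calculus.\<close>

lemma g_pairing:
  assumes t: "t > 0"
  shows "integrable lborel (\<lambda>x. cos ((x - y) \<bullet> \<xi>) * g (x, t))"
    and "(\<integral>x. cos ((x - y) \<bullet> \<xi>) * g (x, t) \<partial>lborel)
       = (\<integral>x. cos ((x - y) \<bullet> \<xi>) * (- time_deriv \<phi> (x, t) + fsym s (fkappa DIM('a) s) \<xi> * \<phi> (x, t)) \<partial>lborel)"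
proof -
  interpret B: bump "\<lambda>x. \<phi> (x, t)" r K using bump t by simp
  let ?c = "\<lambda>x. cos ((x - y) \<bullet> \<xi>)"
  have i1: "integrable lborel (\<lambda>x. ?c x * time_deriv \<phi> (x, t))" by (intro integrable_cos_left integrable_dt t)
  have i2: "integrable lborel (\<lambda>x. ?c x * laplacian (\<lambda>x. \<phi> (x, t)) x)" by (intro integrable_cos_left B.integrable_laplacian)
  have i3: "integrable lborel (\<lambda>x. ?c x * frac_laplacian s (\<lambda>x. \<phi> (x, t)) x)" by (rule B.frac_laplacian_pairing(1)[OF s])
  have i4: "integrable lborel (\<lambda>x. ?c x * \<phi> (x, t))" by (rule B.integrable_cos_v)
  have eq: "(\<lambda>x. ?c x * g (x, t)) = (\<lambda>x. - (?c x * time_deriv \<phi> (x, t)) - ?c x * laplacian (\<lambda>x. \<phi> (x, t)) x + ?c x * frac_laplacian s (\<lambda>x. \<phi> (x, t)) x)"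
    by (simp add: fun_eq_iff g_eq algebra_simps)
  show "integrable lborel (\<lambda>x. ?c x * g (x, t))" unfolding eq
    by (intro Bochner_Integration.integrable_add Bochner_Integration.integrable_diff integrable_minus i1 i2 i3)
  have "(\<integral>x. ?c x * g (x, t) \<partial>lborel) = - (\<integral>x. ?c x * time_deriv \<phi> (x, t) \<partial>lborel) - (\<integral>x. ?c x * laplacian (\<lambda>x. \<phi> (x, t)) x \<partial>lborel)
     + (\<integral>x. ?c x * frac_laplacian s (\<lambda>x. \<phi> (x, t)) x \<partial>lborel)"
    unfolding eq using i1 i2 i3 by simp
  also have "\<dots> = - (\<integral>x. ?c x * time_deriv \<phi> (x, t) \<partial>lborel) + fsym s (fkappa DIM('a) s) \<xi> * (\<integral>x. ?c x * \<phi> (x, t) \<partial>lborel)"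
    unfolding B.laplacian_pairing B.frac_laplacian_pairing(2)[OF s] by (simp add: fsym_def fkappa_def algebra_simps)
  also have "\<dots> = (\<integral>x. - (?c x * time_deriv \<phi> (x, t)) + fsym s (fkappa DIM('a) s) \<xi> * (?c x * \<phi> (x, t)) \<partial>lborel)"
    using i1 i4 by simp
  also have "\<dots> = (\<integral>x. ?c x * (- time_deriv \<phi> (x, t) + fsym s (fkappa DIM('a) s) \<xi> * \<phi> (x, t)) \<partial>lborel)"
    by (intro Bochner_Integration.integral_cong refl) (simp add: algebra_simps)
  finally show "(\<integral>x. ?c x * g (x, t) \<partial>lborel) = (\<integral>x. ?c x * (- time_deriv \<phi> (x, t) + fsym s (fkappa DIM('a) s) \<xi> * \<phi> (x, t)) \<partial>lborel)" .
qed

lemma hk_pairing: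
  fixes h :: "'a \<Rightarrow> real"
  assumes h: "integrable lborel h" and t: "t > 0"
  shows "(\<integral>x. hk s (fkappa DIM('a) s) t (x - y) * h x \<partial>lborel)
    = (\<integral>\<xi>. exp (- t * fsym s (fkappa DIM('a) s) \<xi>) * (\<integral>x. cos ((x - y) \<bullet> \<xi>) * h x \<partial>lborel) \<partial>lborel) / (2 * pi) ^ DIM('a)"
proof -
  have [measurable]: "h \<in> borel_measurable borel" using h by auto
  have int: "integrable (lborel \<Otimes>\<^sub>M lborel) (\<lambda>(\<xi>, x). exp (- t * fsym s (fkappa DIM('a) s) \<xi>) * (cos ((x - y) \<bullet> \<xi>) * h x))"
    by (rule integrable_pair_dominated[OF integrable_exp_fsym[OF t] integrable_abs[OF h]])
       (measurable, auto simp: abs_mult intro!: mult_left_mono mult_left_le_one_le)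
  have "(2 * pi) ^ DIM('a) * (\<integral>x. hk s (fkappa DIM('a) s) t (x - y) * h x \<partial>lborel)
    = (\<integral>x. (\<integral>\<xi>. exp (- t * fsym s (fkappa DIM('a) s) \<xi>) * (cos ((x - y) \<bullet> \<xi>) * h x) \<partial>lborel) \<partial>lborel)"
  proof (subst integral_mult_right_zero[symmetric], intro Bochner_Integration.integral_cong refl)
    fix x
    have "(2 * pi) ^ DIM('a) * hk s (fkappa DIM('a) s) t (x - y) = (\<integral>\<xi>. cos ((x - y) \<bullet> \<xi>) * exp (- t * fsym s (fkappa DIM('a) s) \<xi>) \<partial>lborel)"
      by (simp add: hk_def rker_def)
    then have "(2 * pi) ^ DIM('a) * (hk s (fkappa DIM('a) s) t (x - y) * h x) = (\<integral>\<xi>. cos ((x - y) \<bullet> \<xi>) * exp (- t * fsym s (fkappa DIM('a) s) \<xi>) \<partial>lborel) * h x"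
      by (simp only: mult.assoc[symmetric])
    also have "\<dots> = (\<integral>\<xi>. cos ((x - y) \<bullet> \<xi>) * exp (- t * fsym s (fkappa DIM('a) s) \<xi>) * h x \<partial>lborel)" by (rule integral_mult_left_zero[symmetric])
    finally show "(2 * pi) ^ DIM('a) * (hk s (fkappa DIM('a) s) t (x - y) * h x) = (\<integral>\<xi>. exp (- t * fsym s (fkappa DIM('a) s) \<xi>) * (cos ((x - y) \<bullet> \<xi>) * h x) \<partial>lborel)"
      by (simp only: mult_ac)
  qed
  also have "\<dots> = (\<integral>\<xi>. (\<integral>x. exp (- t * fsym s (fkappa DIM('a) s) \<xi>) * (cos ((x - y) \<bullet> \<xi>) * h x) \<partial>lborel) \<partial>lborel)"
    using lborel_pair.Fubini_integral[OF int] by simp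
  also have "\<dots> = (\<integral>\<xi>. exp (- t * fsym s (fkappa DIM('a) s) \<xi>) * (\<integral>x. cos ((x - y) \<bullet> \<xi>) * h x \<partial>lborel) \<partial>lborel)"
    by (simp only: integral_mult_right_zero)
  finally show ?thesis by (simp add: field_simps)
qed

end

text \<open>Extended by \<open>0\<close> to times before \<open>\<tau>\<close>, so that Duhamel integrals run over all times.\<close>

definition Hk :: "real \<Rightarrow> real \<Rightarrow> 'a::euclidean_space \<Rightarrow> real \<Rightarrow> 'a \<times> real \<Rightarrow> real" where
  "Hk s \<kappa> y \<tau> z = (if \<tau> < snd z then hk s \<kappa> (snd z - \<tau>) (fst z - y) else 0)"

context frac_heat
begin

lemma borel_measurable_Hk [measurable (raw)]:
  assumes [measurable]: "f \<in> borel_measurable M" "h \<in> borel_measurable M" "x \<in> borel_measurable M" "t \<in> borel_measurable M"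
  shows "(\<lambda>w. Hk s \<kappa> (f w :: 'a::euclidean_space) (h w) (x w, t w)) \<in> borel_measurable M"
  unfolding Hk_def fst_conv snd_conv
proof (rule measurable_If)
  show "(\<lambda>w. hk s \<kappa> (t w - h w) (x w - f w)) \<in> borel_measurable M"
    by (rule borel_measurable_hk_pair) measurable
qed measurable

lemma borel_measurable_Hk_z: "Hk s \<kappa> y \<tau> \<in> borel_measurable borel"
proof -
  have "(\<lambda>w. Hk s \<kappa> y \<tau> (fst w, snd w)) \<in> borel_measurable (borel \<Otimes>\<^sub>M borel)" by measurable
  then show ?thesis by (simp add: borel_prod)
qed

lemma Hk_nonneg [simp]: "Hk s \<kappa> y \<tau> z \<ge> 0"
  unfolding Hk_def by (cases "snd z > \<tau>") (auto simp: hk_nonneg)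

text \<open>Conservation of mass at each time after \<open>\<tau>\<close> reduces the space-time
  integral to one in time.\<close>

lemma nn_integral_Hk:
  fixes y :: "'a::euclidean_space"
  assumes [measurable]: "h \<in> borel_measurable borel"
  shows "(\<integral>\<^sup>+z. ennreal (Hk s \<kappa> y \<tau> z) * h (snd z) \<partial>lborel) = (\<integral>\<^sup>+t\<in>{\<tau><..}. h t \<partial>lborel)"
proof -
  have "(\<integral>\<^sup>+z. ennreal (Hk s \<kappa> y \<tau> z) * h (snd z) \<partial>lborel) = (\<integral>\<^sup>+z. ennreal (Hk s \<kappa> y \<tau> (fst z, snd z)) * h (snd z) \<partial>(lborel \<Otimes>\<^sub>M lborel))"
    by (simp add: lborel_prod)
  also have "\<dots> = (\<integral>\<^sup>+t. \<integral>\<^sup>+x. ennreal (Hk s \<kappa> y \<tau> (x, t)) * h t \<partial>lborel \<partial>lborel)"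
  proof -
    have m1: "(\<lambda>z::'a \<times> real. Hk s \<kappa> y \<tau> (fst z, snd z)) \<in> borel_measurable (lborel \<Otimes>\<^sub>M lborel)"
      by (rule borel_measurable_Hk) measurable
    have m2: "(\<lambda>z::'a \<times> real. h (snd z)) \<in> borel_measurable (lborel \<Otimes>\<^sub>M lborel)" by measurable
    have "(\<lambda>z. ennreal (Hk s \<kappa> y \<tau> (fst z, snd z)) * h (snd z)) \<in> borel_measurable (lborel \<Otimes>\<^sub>M lborel)"
      by (intro borel_measurable_times_ennreal measurable_compose[OF m1 measurable_ennreal] m2)
    from lborel_pair.nn_integral_snd[OF this] show ?thesis by simp
  qed
  also have "\<dots> = (\<integral>\<^sup>+t\<in>{\<tau><..}. h t \<partial>lborel)"
  proof (intro nn_integral_cong)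
    fix t :: real
    have "(\<integral>\<^sup>+x. ennreal (Hk s \<kappa> y \<tau> (x, t)) * h t \<partial>lborel) = (\<integral>\<^sup>+x. ennreal (Hk s \<kappa> y \<tau> (x, t)) \<partial>lborel) * h t"
      by (rule nn_integral_multc) measurable
    also have "(\<integral>\<^sup>+x. ennreal (Hk s \<kappa> y \<tau> (x, t)) \<partial>lborel) = indicator {\<tau><..} t"
      using nn_integral_hk_diff[of "t - \<tau>" y] by (auto simp: Hk_def split: split_indicator)
    finally show "(\<integral>\<^sup>+x. ennreal (Hk s \<kappa> y \<tau> (x, t)) * h t \<partial>lborel) = h t * indicator {\<tau><..} t" by (simp add: mult.commute)
  qed
  finally show ?thesis .
qed

end

section \<open>Integrating the adjoint operator against the heat kernel\<close>

context heat_test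
begin

lemma integrable_g: "t > 0 \<Longrightarrow> integrable lborel (\<lambda>x. g (x, t))"
  using g_pairing(1)[of t 0 0] by simp

definition td' :: "'a \<times> real \<Rightarrow> real" where "td' z = indicator open_half_space z *\<^sub>R time_deriv \<phi> z"

lemma borel_measurable_td' [measurable]: "td' \<in> borel_measurable (borel \<Otimes>\<^sub>M borel)"
  unfolding td'_def[abs_def] borel_prod
  by (rule borel_measurable_continuous_on_indicator[OF _ dt_cont]) measurable

lemma td'_eq: "t > 0 \<Longrightarrow> td' (x, t) = time_deriv \<phi> (x, t)"
  by (simp add: td'_def open_half_space_def)

text \<open>For fixed \<open>\<xi>\<close> and \<open>x\<close> the integrand is an exact derivative
  in \<open>t\<close>, so only the boundary term at \<open>\<tau> + \<epsilon>\<close> survives; at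
  \<open>T + 1\<close> the test function is 0. Starting at \<open>\<tau> + \<epsilon>\<close> keeps
  the factor \<open>exp (- \<epsilon> * \<psi>)\<close>, with \<open>\<psi>\<close> the symbol,
  without which the \<open>\<xi>\<close>-integral need not converge absolutely.\<close>

lemma duality_eps:
  assumes \<epsilon>: "0 < \<epsilon>" "\<epsilon> \<le> 1" and \<tau>: "0 \<le> \<tau>" "\<tau> < T"
  shows "(\<integral>t. indicator {\<tau>+\<epsilon>..T+1} t * (\<integral>x. hk s (fkappa DIM('a) s) (t - \<tau>) (x - y) * g (x, t) \<partial>lborel) \<partial>lborel)
     = (\<integral>x. hk s (fkappa DIM('a) s) \<epsilon> (x - y) * \<phi> (x, \<tau> + \<epsilon>) \<partial>lborel)"
proof -
  let ?\<psi> = "fsym s (fkappa DIM('a) s) :: 'a \<Rightarrow> real"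
  let ?c = "(2 * pi) ^ DIM('a) :: real"
  let ?I = "indicator {\<tau>+\<epsilon>..T+1} :: real \<Rightarrow> real"
  define q where "q t p = exp (- (t - \<tau>) * ?\<psi> (fst p)) * (cos ((snd p - y) \<bullet> fst p) * (- td' (snd p, t) + ?\<psi> (fst p) * \<phi>' (snd p, t)))" for t and p :: "'a \<times> 'a"
  \<comment> \<open>A majorant of \<open>q\<close> independent of \<open>t\<close>; the factor
    \<open>1 + fsym\<close> accounts for the time derivative and for the symbol.\<close>
  define G where "G p = exp (- \<epsilon> * ?\<psi> (fst p)) * (1 + ?\<psi> (fst p)) * (K * indicator (cball 0 r) (snd p))" for p :: "'a \<times> 'a"
  have ball: "integrable lborel (\<lambda>x::'a. K * indicator (cball 0 r) x)"
    by (intro integrable_mult_right integrable_real_indicator) (use emeasure_lborel_cball_finite[of "0::'a" r] in auto)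
  have qm: "(\<lambda>(t, p). q t p) \<in> borel_measurable (lborel \<Otimes>\<^sub>M (lborel \<Otimes>\<^sub>M lborel))"
    unfolding q_def by measurable
  have e1: "integrable lborel (\<lambda>\<xi>::'a. exp (- \<epsilon> * ?\<psi> \<xi>) * (1 + ?\<psi> \<xi>))"
    using Bochner_Integration.integrable_add[OF integrable_exp_fsym[OF \<epsilon>(1), where ?'a='a] integrable_fsym_exp[OF \<epsilon>(1), where ?'a='a]]
    by (simp add: algebra_simps)
  have G2: "integrable (lborel \<Otimes>\<^sub>M lborel) G"
  proof -
    have p1: "\<bar>1 + ?\<psi> \<xi>\<bar> = 1 + ?\<psi> \<xi>" for \<xi> using fsym_nonneg[of \<xi>] by simp
    have "integrable (lborel \<Otimes>\<^sub>M lborel) (\<lambda>(\<xi>, x). exp (- \<epsilon> * ?\<psi> \<xi>) * (1 + ?\<psi> \<xi>) * (K * indicator (cball (0::'a) r) x))"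
      by (rule integrable_pair_dominated[OF e1 ball]) (measurable, use K_nonneg in \<open>auto simp: abs_mult p1\<close>)
    then show ?thesis unfolding G_def by (simp add: case_prod_beta')
  qed
  then have Gi: "integrable lborel G" by (simp add: lborel_prod)
  have qb: "\<bar>q t p\<bar> \<le> G p" if t: "t \<ge> \<tau> + \<epsilon>" for t p
  proof -
    have t0: "t > 0" using t \<epsilon> \<tau> by linarith
    obtain \<xi> x where p: "p = (\<xi>, x)" by (cases p)
    have E: "exp (- (t - \<tau>) * ?\<psi> \<xi>) \<le> exp (- \<epsilon> * ?\<psi> \<xi>)" unfolding exp_le_cancel_iff using t by (intro mult_right_mono fsym_nonneg) auto
    have a: "\<bar>td' (x, t)\<bar> \<le> K * indicator (cball 0 r) x"
      using dt_bound[OF t0, of x] dt_supp[OF t0, of x] K_nonneg by (auto simp: td'_eq[OF t0] split: split_indicator)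
    have b: "\<bar>\<phi>' (x, t)\<bar> \<le> K * indicator (cball 0 r) x"
      using phi_bound[of t x] supp[of t x] t0 by (auto simp: phi'_eq split: split_indicator)
    have "\<bar>- td' (x, t) + ?\<psi> \<xi> * \<phi>' (x, t)\<bar> \<le> \<bar>td' (x, t)\<bar> + ?\<psi> \<xi> * \<bar>\<phi>' (x, t)\<bar>"
      using abs_triangle_ineq[of "- td' (x, t)" "?\<psi> \<xi> * \<phi>' (x, t)"] fsym_nonneg[of \<xi>] by (simp add: abs_mult)
    also have "\<dots> \<le> K * indicator (cball 0 r) x + ?\<psi> \<xi> * (K * indicator (cball 0 r) x)"
      by (intro add_mono mult_left_mono a b fsym_nonneg)
    also have "\<dots> = (1 + ?\<psi> \<xi>) * (K * indicator (cball 0 r) x)" by (simp add: algebra_simps)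
    finally have c: "\<bar>- td' (x, t) + ?\<psi> \<xi> * \<phi>' (x, t)\<bar> \<le> (1 + ?\<psi> \<xi>) * (K * indicator (cball 0 r) x)" .
    have "\<bar>cos ((x - y) \<bullet> \<xi>) * (- td' (x, t) + ?\<psi> \<xi> * \<phi>' (x, t))\<bar> \<le> \<bar>- td' (x, t) + ?\<psi> \<xi> * \<phi>' (x, t)\<bar>"
      unfolding abs_mult by (intro mult_left_le_one_le) auto
    then have "\<bar>q t p\<bar> \<le> exp (- \<epsilon> * ?\<psi> \<xi>) * ((1 + ?\<psi> \<xi>) * (K * indicator (cball 0 r) x))"
      unfolding p q_def fst_conv snd_conv abs_mult[of "exp _"] abs_exp_cancel using E c
      by (intro mult_mono) auto
    then show ?thesis unfolding p G_def by (simp add: mult.assoc)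
  qed
  have Ii: "integrable lborel ?I" by (intro integrable_real_indicator) (auto simp: emeasure_lborel_Icc_eq)
  have "(\<lambda>(t, p). ?I t * q t p) \<in> borel_measurable (lborel \<Otimes>\<^sub>M (lborel \<Otimes>\<^sub>M lborel))" using qm by measurable
  then have Qm: "(\<lambda>(t, p). ?I t * q t p) \<in> borel_measurable (lborel \<Otimes>\<^sub>M lborel)" by (simp add: lborel_prod)
  have Qi: "integrable (lborel \<Otimes>\<^sub>M lborel) (\<lambda>(t, p). ?I t * q t p)"
    by (rule integrable_pair_dominated[OF Ii Gi Qm]) (use qb in \<open>auto simp: abs_mult split: split_indicator\<close>)
  have qi: "integrable (lborel \<Otimes>\<^sub>M lborel) (\<lambda>(\<xi>, x). q t (\<xi>, x))" if t: "t \<ge> \<tau> + \<epsilon>" for t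
  proof (rule Bochner_Integration.integrable_bound[OF G2])
    show "(\<lambda>(\<xi>, x). q t (\<xi>, x)) \<in> borel_measurable (lborel \<Otimes>\<^sub>M lborel)" unfolding q_def by measurable
  qed (use qb[OF t] in \<open>auto intro!: AE_I2 order_trans[OF _ abs_ge_self]\<close>)
  have 1: "?I t * (\<integral>x. hk s (fkappa DIM('a) s) (t - \<tau>) (x - y) * g (x, t) \<partial>lborel) = (\<integral>p. ?I t * q t p \<partial>lborel) / ?c" for t
  proof (cases "t \<in> {\<tau>+\<epsilon>..T+1}")
    case True
    then have t: "t \<ge> \<tau> + \<epsilon>" "t > 0" "t - \<tau> > 0" using \<epsilon> \<tau> by auto
    have "(\<integral>x. hk s (fkappa DIM('a) s) (t - \<tau>) (x - y) * g (x, t) \<partial>lborel)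
      = (\<integral>\<xi>. exp (- (t - \<tau>) * ?\<psi> \<xi>) * (\<integral>x. cos ((x - y) \<bullet> \<xi>) * g (x, t) \<partial>lborel) \<partial>lborel) / ?c"
      by (rule hk_pairing[OF integrable_g[OF t(2)] t(3)])
    also have "(\<lambda>\<xi>. exp (- (t - \<tau>) * ?\<psi> \<xi>) * (\<integral>x. cos ((x - y) \<bullet> \<xi>) * g (x, t) \<partial>lborel)) = (\<lambda>\<xi>. \<integral>x. q t (\<xi>, x) \<partial>lborel)"
      unfolding g_pairing(2)[OF t(2)] q_def fst_conv snd_conv using t(2)
      by (simp add: td'_eq phi'_eq integral_mult_right_zero)
    also have "(\<integral>\<xi>. \<integral>x. q t (\<xi>, x) \<partial>lborel \<partial>lborel) = (\<integral>p. q t p \<partial>lborel)"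
      using lborel_pair.integral_fst[OF qi[OF t(1)]] by (simp add: lborel_prod)
    finally show ?thesis using True by simp
  qed simp
  have 2: "(\<integral>t. ?I t * q t p \<partial>lborel) = exp (- \<epsilon> * ?\<psi> (fst p)) * (cos ((snd p - y) \<bullet> fst p) * \<phi> (snd p, \<tau> + \<epsilon>))" for p
  proof -
    obtain \<xi> x where p: "p = (\<xi>, x)" by (cases p)
    let ?C = "cos ((x - y) \<bullet> \<xi>)"
    \<comment> \<open>The primitive of \<open>q\<close> in time: differentiating the exponential
      produces the symbol, differentiating \<open>\<phi>\<close> the time derivative.\<close>
    define F where "F t = - (exp (- (t - \<tau>) * ?\<psi> \<xi>) * (?C * \<phi> (x, t)))" for t
    have "(\<integral>t. ?I t *\<^sub>R q t p \<partial>lborel) = F (T + 1) - F (\<tau> + \<epsilon>)"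
    proof (rule integral_FTC_atLeastAtMost)
      show "\<tau> + \<epsilon> \<le> T + 1" using \<epsilon> \<tau> by simp
      fix t assume t: "\<tau> + \<epsilon> \<le> t" "t \<le> T + 1"
      then have t0: "t > 0" using \<epsilon> \<tau> by linarith
      have "(F has_real_derivative q t p) (at t)"
        unfolding F_def q_def p fst_conv snd_conv
        using t0 by (auto intro!: derivative_eq_intros dt simp: td'_eq phi'_eq algebra_simps)
      then show "(F has_vector_derivative q t p) (at t within {\<tau> + \<epsilon>..T + 1})"
        by (simp add: has_real_derivative_iff_has_vector_derivative has_vector_derivative_at_within)
    next
      have c1: "continuous_on {\<tau> + \<epsilon>..T + 1} (\<lambda>t. time_deriv \<phi> (x, t))"
        by (intro continuous_on_compose2[OF dt_cont] continuous_intros) (use \<epsilon> \<tau> in \<open>auto simp: open_half_space_def\<close>)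
      have c2: "continuous_on {\<tau> + \<epsilon>..T + 1} (\<lambda>t. \<phi> (x, t))"
        by (intro continuous_on_compose2[OF cont] continuous_intros) (use \<epsilon> \<tau> in \<open>auto simp: closed_half_space_def\<close>)
      show "continuous_on {\<tau> + \<epsilon>..T + 1} (\<lambda>t. q t p)"
      proof (rule continuous_on_eq)
        show "continuous_on {\<tau> + \<epsilon>..T + 1} (\<lambda>t. exp (- (t - \<tau>) * ?\<psi> \<xi>) * (?C * (- time_deriv \<phi> (x, t) + ?\<psi> \<xi> * \<phi> (x, t))))"
          by (intro continuous_intros c1 c2)
      qed (use \<epsilon> \<tau> in \<open>auto simp: q_def p td'_eq phi'_eq\<close>)
    qed
    moreover have "F (T + 1) = 0" using supp[of "T + 1" x] T by (simp add: F_def)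
    ultimately show ?thesis by (simp add: F_def p)
  qed
  have pi: "integrable lborel (\<lambda>x. \<phi> (x, \<tau> + \<epsilon>))" using bump.integrable_v[OF bump] \<tau> \<epsilon> by simp
  have Ji: "integrable (lborel \<Otimes>\<^sub>M lborel) (\<lambda>(\<xi>, x). exp (- \<epsilon> * ?\<psi> \<xi>) * (cos ((x - y) \<bullet> \<xi>) * \<phi> (x, \<tau> + \<epsilon>)))"
  proof (rule integrable_pair_dominated[OF integrable_exp_fsym[OF \<epsilon>(1)] integrable_abs[OF pi]])
    have [measurable]: "(\<lambda>x. \<phi> (x, \<tau> + \<epsilon>)) \<in> borel_measurable borel" using pi by auto
    show "(\<lambda>(\<xi>, x). exp (- \<epsilon> * ?\<psi> \<xi>) * (cos ((x - y) \<bullet> \<xi>) * \<phi> (x, \<tau> + \<epsilon>))) \<in> borel_measurable (lborel \<Otimes>\<^sub>M lborel)" by measurable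
  qed (auto simp: abs_mult intro!: mult_left_mono mult_left_le_one_le)
  have "(\<integral>t. ?I t * (\<integral>x. hk s (fkappa DIM('a) s) (t - \<tau>) (x - y) * g (x, t) \<partial>lborel) \<partial>lborel)
     = (\<integral>t. \<integral>p. ?I t * q t p \<partial>lborel \<partial>lborel) / ?c"
    unfolding 1 by (rule integral_divide_zero)
  also have "(\<integral>t. \<integral>p. ?I t * q t p \<partial>lborel \<partial>lborel) = (\<integral>p. \<integral>t. ?I t * q t p \<partial>lborel \<partial>lborel)"
    using lborel_pair.Fubini_integral[OF Qi] by simp
  also have "\<dots> = (\<integral>\<xi>. exp (- \<epsilon> * ?\<psi> \<xi>) * (\<integral>x. cos ((x - y) \<bullet> \<xi>) * \<phi> (x, \<tau> + \<epsilon>) \<partial>lborel) \<partial>lborel)"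
    unfolding 2 using lborel_pair.integral_fst[OF Ji] by (simp add: lborel_prod case_prod_beta')
  finally show ?thesis unfolding hk_pairing[OF pi \<epsilon>(1)] .
qed

text \<open>An approximate identity applied to a function that moves with it. Continuity in space
  and time handles \<open>z\<close> near 0; elsewhere the difference is at most \<open>2 * K\<close>
  and is charged to \<open>hk_concentrates\<close>.\<close>

lemma hk_phi_limit:
  assumes \<tau>: "\<tau> \<ge> 0"
  shows "(\<lambda>n. \<integral>x. hk s (fkappa DIM('a) s) (1 / (real n + 1)) (x - y) * \<phi> (x, \<tau> + 1 / (real n + 1)) \<partial>lborel) \<longlonglongrightarrow> \<phi> (y, \<tau>)"
proof (rule LIMSEQ_I)
  let ?h = "hk s (fkappa DIM('a) s) :: real \<Rightarrow> 'a \<Rightarrow> real"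
  let ?e = "\<lambda>n. 1 / (real n + 1)"
  have e: "?e n > 0" for n by simp
  have e0: "?e \<longlonglongrightarrow> 0" by real_asymp
  fix \<eta> :: real assume \<eta>: "\<eta> > 0"
  have "continuous (at (y, \<tau>) within closed_half_space) \<phi>"
    using cont \<tau> by (auto simp: continuous_on_eq_continuous_within closed_half_space_def)
  then obtain d where d: "d > 0" "\<And>z. z \<in> closed_half_space \<Longrightarrow> dist z (y, \<tau>) < d \<Longrightarrow> dist (\<phi> z) (\<phi> (y, \<tau>)) < \<eta> / 2"
    using \<eta> unfolding continuous_within_eps_delta by (meson half_gt_zero)
  \<comment> \<open>\<open>m\<close> is the least value of
    \<open>1 - exp (- (norm z)\<^sup>2)\<close> for \<open>norm z \<ge> d / 2\<close>, and
    \<open>L * m = 2 * K\<close> turns the crude bound into a multiple of that function.\<close>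
  define m where "m = 1 - exp (- (d / 2)\<^sup>2)"
  have m: "m > 0" using d by (simp add: m_def)
  define L where "L = 2 * K / m"
  have L: "L \<ge> 0" using m K_nonneg by (simp add: L_def)
  have diff: "\<bar>\<phi> (y + z, \<tau> + ?e n) - \<phi> (y, \<tau>)\<bar> \<le> \<eta> / 2 + L * (1 - exp (- (norm z)\<^sup>2))" if n: "?e n < d / 2" for n and z :: 'a
  proof (cases "norm z < d / 2")
    case True
    have "dist (y + z, \<tau> + ?e n) (y, \<tau>) \<le> norm z + ?e n"
      using norm_Pair_le[of z "?e n"] by (simp add: dist_norm)
    also have "\<dots> < d" using True n by linarith
    finally have "dist (\<phi> (y + z, \<tau> + ?e n)) (\<phi> (y, \<tau>)) < \<eta> / 2"
      using \<tau> by (intro d) (auto simp: closed_half_space_def add_nonneg_nonneg)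
    moreover have "0 \<le> L * (1 - exp (- (norm z)\<^sup>2))" using L by simp
    ultimately show ?thesis by (simp add: dist_real_def)
  next
    case False
    then have "(d / 2)\<^sup>2 \<le> (norm z)\<^sup>2" using d by (intro power_mono) auto
    then have "m \<le> 1 - exp (- (norm z)\<^sup>2)" by (simp add: m_def)
    then have "L * m \<le> L * (1 - exp (- (norm z)\<^sup>2))" using L by (rule mult_left_mono)
    moreover have "L * m = 2 * K" using m by (simp add: L_def)
    moreover have "\<bar>\<phi> (y + z, \<tau> + ?e n)\<bar> \<le> K" "\<bar>\<phi> (y, \<tau>)\<bar> \<le> K" using \<tau> by (auto intro!: phi_bound)
    ultimately show ?thesis using \<eta> by linarith
  qed
  have "eventually (\<lambda>n. ?e n < d / 2) sequentially" using order_tendstoD(2)[OF e0, of "d/2"] d by simp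
  moreover have "(\<lambda>n. L * (\<integral>z. (1 - exp (- (norm z)\<^sup>2)) * ?h (?e n) z \<partial>lborel)) \<longlonglongrightarrow> L * 0"
    by (intro tendsto_mult_left hk_concentrates e e0)
  then have "eventually (\<lambda>n. L * (\<integral>z. (1 - exp (- (norm z)\<^sup>2)) * ?h (?e n) z \<partial>lborel) < \<eta> / 2) sequentially"
    using order_tendstoD(2)[of _ "L * 0" sequentially "\<eta> / 2"] \<eta> by simp
  ultimately have "eventually (\<lambda>n. norm ((\<integral>x. ?h (?e n) (x - y) * \<phi> (x, \<tau> + ?e n) \<partial>lborel) - \<phi> (y, \<tau>)) < \<eta>) sequentially"
  proof eventually_elim
    case (elim n)
    let ?p = "\<lambda>z. \<phi> (y + z, \<tau> + ?e n)"
    have te: "\<tau> + ?e n \<ge> 0" using \<tau> by simp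
    have [measurable]: "(\<lambda>x. \<phi> (x, \<tau> + ?e n)) \<in> borel_measurable borel" by (rule borel_measurable_phi_slice[OF te])
    have hi: "integrable lborel (?h (?e n))" by (rule integrable_hk[OF e])
    have i1: "integrable lborel (\<lambda>z. ?h (?e n) z * ?p z)"
    proof (rule Bochner_Integration.integrable_bound[OF integrable_mult_left[OF hi, of K]])
      show "AE z in lborel. norm (?h (?e n) z * ?p z) \<le> norm (?h (?e n) z * K)"
        using phi_bound[OF te] K_nonneg by (intro AE_I2) (auto simp: abs_mult intro!: mult_left_mono)
    qed measurable
    have i2: "integrable lborel (\<lambda>z. (1 - exp (- (norm z)\<^sup>2)) * ?h (?e n) z)"
      by (rule Bochner_Integration.integrable_bound[OF hi]) (auto simp: abs_mult intro!: mult_left_le_one_le)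
    have "(\<integral>x. ?h (?e n) (x - y) * \<phi> (x, \<tau> + ?e n) \<partial>lborel) = (\<integral>z. ?h (?e n) z * ?p z \<partial>lborel)"
      using integral_lborel_translate(1)[of "\<lambda>x. ?h (?e n) (x - y) * \<phi> (x, \<tau> + ?e n)" y] by simp
    then have "(\<integral>x. ?h (?e n) (x - y) * \<phi> (x, \<tau> + ?e n) \<partial>lborel) - \<phi> (y, \<tau>) = (\<integral>z. ?h (?e n) z * ?p z \<partial>lborel) - (\<integral>z. ?h (?e n) z * \<phi> (y, \<tau>) \<partial>lborel)"
      using hk_integral[OF e, of n, where ?'a='a] by simp
    also have "\<dots> = (\<integral>z. ?h (?e n) z * ?p z - ?h (?e n) z * \<phi> (y, \<tau>) \<partial>lborel)"
      by (intro Bochner_Integration.integral_diff[symmetric] i1 integrable_mult_left hi)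
    also have "\<dots> = (\<integral>z. ?h (?e n) z * (?p z - \<phi> (y, \<tau>)) \<partial>lborel)" by (simp add: right_diff_distrib)
    finally have eq: "(\<integral>x. ?h (?e n) (x - y) * \<phi> (x, \<tau> + ?e n) \<partial>lborel) - \<phi> (y, \<tau>) = (\<integral>z. ?h (?e n) z * (?p z - \<phi> (y, \<tau>)) \<partial>lborel)" .
    have i3: "integrable lborel (\<lambda>z. ?h (?e n) z * (?p z - \<phi> (y, \<tau>)))"
      using Bochner_Integration.integrable_diff[OF i1 integrable_mult_left[OF hi, of "\<phi> (y, \<tau>)"]] by (simp add: right_diff_distrib)
    have "\<bar>\<integral>z. ?h (?e n) z * (?p z - \<phi> (y, \<tau>)) \<partial>lborel\<bar> \<le> (\<integral>z. \<bar>?h (?e n) z * (?p z - \<phi> (y, \<tau>))\<bar> \<partial>lborel)" by (rule integral_abs_bound)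
    also have "\<dots> \<le> (\<integral>z. \<eta> / 2 * ?h (?e n) z + L * ((1 - exp (- (norm z)\<^sup>2)) * ?h (?e n) z) \<partial>lborel)"
    proof (intro integral_mono integrable_abs i3 Bochner_Integration.integrable_add integrable_mult_right hi i2)
      fix z :: 'a
      have "?h (?e n) z * \<bar>?p z - \<phi> (y, \<tau>)\<bar> \<le> ?h (?e n) z * (\<eta> / 2 + L * (1 - exp (- (norm z)\<^sup>2)))"
        by (intro mult_left_mono diff elim(1) hk_nonneg e)
      also have "?h (?e n) z * (\<eta> / 2 + L * (1 - exp (- (norm z)\<^sup>2))) = \<eta> / 2 * ?h (?e n) z + L * ((1 - exp (- (norm z)\<^sup>2)) * ?h (?e n) z)"
        by (simp add: algebra_simps)
      finally show "\<bar>?h (?e n) z * (?p z - \<phi> (y, \<tau>))\<bar> \<le> \<eta> / 2 * ?h (?e n) z + L * ((1 - exp (- (norm z)\<^sup>2)) * ?h (?e n) z)"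
        unfolding abs_mult[of "?h (?e n) z"] abs_of_nonneg[OF hk_nonneg[OF e]] .
    qed
    also have "\<dots> = \<eta> / 2 * (\<integral>z. ?h (?e n) z \<partial>lborel) + L * (\<integral>z. (1 - exp (- (norm z)\<^sup>2)) * ?h (?e n) z \<partial>lborel)"
      using hi i2 by simp
    also have "\<dots> < \<eta>" using elim(2) hk_integral[OF e, of n, where ?'a='a] by simp
    finally show ?case unfolding eq by simp
  qed
  then show "\<exists>no. \<forall>n\<ge>no. norm ((\<integral>x. ?h (?e n) (x - y) * \<phi> (x, \<tau> + ?e n) \<partial>lborel) - \<phi> (y, \<tau>)) < \<eta>"
    unfolding eventually_sequentially .
qed

text \<open>The second bound is uniform in the source point \<open>y\<close>, which makes Fubini
  applicable over all sources; its indicator records that sources after time \<open>T\<close>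
  contribute nothing.\<close>

lemma integrable_Hk_gS:
  assumes "\<tau> \<ge> 0"
  shows "integrable lborel (\<lambda>z. Hk s (fkappa DIM('a) s) y \<tau> z * gS z)"
    and "\<And>C. (\<And>z. \<bar>gS z\<bar> \<le> C) \<Longrightarrow> C \<ge> 0 \<Longrightarrow>
      (\<integral>\<^sup>+z. ennreal \<bar>Hk s (fkappa DIM('a) s) y \<tau> z * gS z\<bar> \<partial>lborel) \<le> ennreal (C * T) * indicator {..<T} \<tau>"
proof -
  have *: "(\<integral>\<^sup>+z. ennreal \<bar>Hk s (fkappa DIM('a) s) y \<tau> z * gS z\<bar> \<partial>lborel) \<le> ennreal (C * T) * indicator {..<T} \<tau>"
    if C: "\<And>z. \<bar>gS z\<bar> \<le> C" "C \<ge> 0" for C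
  proof -
    have "(\<integral>\<^sup>+z. ennreal \<bar>Hk s (fkappa DIM('a) s) y \<tau> z * gS z\<bar> \<partial>lborel)
      \<le> (\<integral>\<^sup>+z. ennreal (Hk s (fkappa DIM('a) s) y \<tau> z) * (ennreal C * indicator {..T} (snd z)) \<partial>lborel)"
    proof (rule nn_integral_mono)
      fix z :: "'a \<times> real"
      show "ennreal \<bar>Hk s (fkappa DIM('a) s) y \<tau> z * gS z\<bar> \<le> ennreal (Hk s (fkappa DIM('a) s) y \<tau> z) * (ennreal C * indicator {..T} (snd z))"
      proof (cases "snd z \<le> T")
        case True
        then show ?thesis using C(1)[of z] C(2)
          by (simp add: abs_mult ennreal_mult[symmetric] ennreal_leI mult_left_mono)
      next
        case False
        then have "gS z = 0" using gS_supp[of "snd z" "fst z"] by simp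
        then show ?thesis by simp
      qed
    qed
    also have "\<dots> = (\<integral>\<^sup>+t\<in>{\<tau><..}. ennreal C * indicator {..T} t \<partial>lborel)"
      by (rule nn_integral_Hk) measurable
    also have "\<dots> = (\<integral>\<^sup>+t. ennreal C * indicator {\<tau><..T} t \<partial>lborel)"
      by (intro nn_integral_cong) (auto split: split_indicator)
    also have "\<dots> = ennreal C * emeasure lborel {\<tau><..T}"
      by (subst nn_integral_cmult_indicator) auto
    also have "\<dots> \<le> ennreal (C * T) * indicator {..<T} \<tau>"
    proof (cases "\<tau> < T")
      case True
      then have "ennreal C * emeasure lborel {\<tau><..T} = ennreal (C * (T - \<tau>))" using C by (simp add: ennreal_mult)
      also have "\<dots> \<le> ennreal (C * T)" using assms C by (intro ennreal_leI mult_left_mono) auto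
      finally show ?thesis using True by simp
    qed simp
    finally show ?thesis .
  qed
  then show "\<And>C. (\<And>z. \<bar>gS z\<bar> \<le> C) \<Longrightarrow> C \<ge> 0 \<Longrightarrow>
      (\<integral>\<^sup>+z. ennreal \<bar>Hk s (fkappa DIM('a) s) y \<tau> z * gS z\<bar> \<partial>lborel) \<le> ennreal (C * T) * indicator {..<T} \<tau>" by blast
  obtain C where C: "C \<ge> 0" "\<And>z. \<bar>gS z\<bar> \<le> C" using gS_bound by blast
  have "(\<integral>\<^sup>+z. ennreal \<bar>Hk s (fkappa DIM('a) s) y \<tau> z * gS z\<bar> \<partial>lborel) < \<infinity>"
    by (rule le_less_trans[OF *[OF C(2) C(1)]]) (auto simp: ennreal_mult_less_top less_top[symmetric] split: split_indicator)
  then show "integrable lborel (\<lambda>z. Hk s (fkappa DIM('a) s) y \<tau> z * gS z)"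
    using borel_measurable_Hk_z[of y \<tau>] by (intro integrableI_bounded) auto
qed

text \<open>The kernel is a fundamental solution for the adjoint operator:
  \<open>duality_eps\<close> is passed to the limit \<open>\<epsilon> \<rightarrow> 0\<close>. For
  \<open>\<tau> \<ge> T\<close> both sides are 0, since the kernel lives after \<open>\<tau>\<close>
  and \<open>gS\<close> vanishes after \<open>T\<close>.\<close>

theorem duality:
  assumes \<tau>: "\<tau> \<ge> 0"
  shows "(\<integral>z. Hk s (fkappa DIM('a) s) y \<tau> z * gS z \<partial>lborel) = \<phi> (y, \<tau>)"
proof (cases "\<tau> < T")
  case False
  have "Hk s (fkappa DIM('a) s) y \<tau> z * gS z = 0" for z
    using False gS_supp[of "snd z" "fst z"] by (cases "snd z > T") (auto simp: Hk_def)
  then have "(\<integral>z. Hk s (fkappa DIM('a) s) y \<tau> z * gS z \<partial>lborel) = 0" by (simp only: integral_zero)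
  then show ?thesis using supp[of \<tau> y] False \<tau> by simp
next
  case True
  let ?F = "\<lambda>z. Hk s (fkappa DIM('a) s) y \<tau> z * gS z"
  let ?e = "\<lambda>n. 1 / (real n + 1)"
  let ?I = "\<lambda>n t. indicator {\<tau> + ?e n..T + 1} t :: real"
  have e0: "?e \<longlonglongrightarrow> 0" by real_asymp
  note Fi = integrable_Hk_gS(1)[OF \<tau>, of y]
  have "(\<lambda>n. \<integral>z. ?I n (snd z) * ?F z \<partial>lborel) \<longlonglongrightarrow> (\<integral>z. ?F z \<partial>lborel)"
  proof (rule integral_dominated_convergence[OF _ _ integrable_abs[OF Fi]])
    have "(\<lambda>z. ?I n (snd z) * ?F z) \<in> borel_measurable (borel :: ('a \<times> real) measure)" for n
      unfolding borel_prod[symmetric]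
      using borel_measurable_gS borel_measurable_Hk_z[of y \<tau>] unfolding borel_prod[symmetric] by measurable
    then show "(\<lambda>z. ?I n (snd z) * ?F z) \<in> borel_measurable lborel" for n by simp
    show "AE z in lborel. norm (?I n (snd z) * ?F z) \<le> \<bar>?F z\<bar>" for n
      by (intro AE_I2) (auto split: split_indicator)
    show "AE z in lborel. (\<lambda>n. ?I n (snd z) * ?F z) \<longlonglongrightarrow> ?F z"
    proof (rule AE_I2)
      fix z :: "'a \<times> real"
      show "(\<lambda>n. ?I n (snd z) * ?F z) \<longlonglongrightarrow> ?F z"
      proof (cases "\<tau> < snd z \<and> snd z \<le> T")
        case True
        then have "eventually (\<lambda>n. ?e n < snd z - \<tau>) sequentially" using order_tendstoD(2)[OF e0, of "snd z - \<tau>"] by simp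
        then have "eventually (\<lambda>n. ?I n (snd z) * ?F z = ?F z) sequentially"
          by eventually_elim (use True in auto)
        then show ?thesis by (rule tendsto_eventually)
      next
        case False
        then have "?F z = 0" using gS_supp[of "snd z" "fst z"] by (auto simp: Hk_def split: split_indicator)
        then show ?thesis by (simp only: mult_zero_right tendsto_const)
      qed
    qed
  qed (rule borel_measurable_integrable[OF Fi])
  moreover have "(\<integral>z. ?I n (snd z) * ?F z \<partial>lborel) = (\<integral>x. hk s (fkappa DIM('a) s) (?e n) (x - y) * \<phi> (x, \<tau> + ?e n) \<partial>lborel)" for n
  proof -
    have i: "integrable lborel (\<lambda>z. ?I n (snd z) * ?F z)"
    proof (rule Bochner_Integration.integrable_bound[OF Fi])
      have "(\<lambda>z. ?I n (snd z) * ?F z) \<in> borel_measurable (borel :: ('a \<times> real) measure)"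
        unfolding borel_prod[symmetric]
        using borel_measurable_gS borel_measurable_Hk_z[of y \<tau>] unfolding borel_prod[symmetric] by measurable
      then show "(\<lambda>z. ?I n (snd z) * ?F z) \<in> borel_measurable lborel" by simp
    qed (auto split: split_indicator)
    then have i2: "integrable (lborel \<Otimes>\<^sub>M lborel) (\<lambda>(x, t). ?I n t * ?F (x, t))" by (simp add: lborel_prod case_prod_beta')
    have "(\<integral>z. ?I n (snd z) * ?F z \<partial>lborel) = (\<integral>t. \<integral>x. ?I n t * ?F (x, t) \<partial>lborel \<partial>lborel)"
      using lborel_pair.integral_snd[OF i2] by (simp add: lborel_prod case_prod_beta')
    also have "\<dots> = (\<integral>t. ?I n t * (\<integral>x. hk s (fkappa DIM('a) s) (t - \<tau>) (x - y) * g (x, t) \<partial>lborel) \<partial>lborel)"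
    proof (intro Bochner_Integration.integral_cong refl)
      fix t :: real
      show "(\<integral>x. ?I n t * ?F (x, t) \<partial>lborel) = ?I n t * (\<integral>x. hk s (fkappa DIM('a) s) (t - \<tau>) (x - y) * g (x, t) \<partial>lborel)"
      proof (cases "t \<in> {\<tau> + ?e n..T + 1}")
        case True
        have "?e n > 0" by simp
        with True have "t > \<tau>" by (simp only: atLeastAtMost_iff) linarith
        then show ?thesis using True \<tau> by (simp add: Hk_def gS_eq)
      qed simp
    qed
    also have "\<dots> = (\<integral>x. hk s (fkappa DIM('a) s) (?e n) (x - y) * \<phi> (x, \<tau> + ?e n) \<partial>lborel)"
      by (rule duality_eps) (use \<tau> True in auto)
    finally show ?thesis .
  qed
  ultimately show ?thesis using LIMSEQ_unique hk_phi_limit[OF \<tau>, of y] by simp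
qed

end

section \<open>Global existence by Picard iteration\<close>

text \<open>Values in \<open>ennreal\<close> allow integrals to be exchanged by positivity alone;
  finiteness is established afterwards.\<close>

definition heatV :: "real \<Rightarrow> real \<Rightarrow> ('a::euclidean_space \<Rightarrow> real) \<Rightarrow> 'a \<times> real \<Rightarrow> ennreal" where
  "heatV s \<kappa> u0 z = (\<integral>\<^sup>+y. ennreal (Hk s \<kappa> y 0 z) * ennreal (u0 y) \<partial>lborel)"

text \<open>The kernel \<open>Hk\<close> does not vanish for negative source times, hence the
  indicator.\<close>

definition duhamel :: "real \<Rightarrow> real \<Rightarrow> real \<Rightarrow> ('a::euclidean_space \<times> real \<Rightarrow> real) \<Rightarrow> 'a \<times> real \<Rightarrow> ennreal" where
  "duhamel s \<kappa> p u z = (\<integral>\<^sup>+b. ennreal (Hk s \<kappa> (fst b) (snd b) z) * ennreal (indicator {0<..} (snd b) * u b powr p) \<partial>lborel)"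

text \<open>Starting from 0 makes the iterates increase. \<open>enn2real\<close> sends infinity to
  0; the bound in \<open>picard_limit\<close> excludes that case.\<close>

primrec picard :: "real \<Rightarrow> real \<Rightarrow> real \<Rightarrow> ('a::euclidean_space \<Rightarrow> real) \<Rightarrow> nat \<Rightarrow> 'a \<times> real \<Rightarrow> real" where
  "picard s \<kappa> p u0 0 = (\<lambda>z. 0)"
| "picard s \<kappa> p u0 (Suc n) = (\<lambda>z. enn2real (heatV s \<kappa> u0 z + duhamel s \<kappa> p (picard s \<kappa> p u0 n) z))"

context frac_heat
begin

lemma borel_measurable_heatV:
  fixes u0 :: "'a::euclidean_space \<Rightarrow> real"
  assumes [measurable]: "u0 \<in> borel_measurable borel"
  shows "heatV s \<kappa> u0 \<in> borel_measurable borel"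
proof -
  have [measurable]: "(\<lambda>w :: ('a \<times> real) \<times> 'a. Hk s \<kappa> (snd w) 0 (fst (fst w), snd (fst w))) \<in> borel_measurable ((borel \<Otimes>\<^sub>M borel) \<Otimes>\<^sub>M lborel)"
    by (rule borel_measurable_Hk) measurable
  have "(\<lambda>z. \<integral>\<^sup>+y. ennreal (Hk s \<kappa> y 0 (fst z, snd z)) * ennreal (u0 y) \<partial>lborel) \<in> borel_measurable (borel \<Otimes>\<^sub>M borel)"
  proof (rule lborel.borel_measurable_nn_integral)
    show "(\<lambda>(z :: 'a \<times> real, y). ennreal (Hk s \<kappa> y 0 (fst z, snd z)) * ennreal (u0 y)) \<in> borel_measurable ((borel \<Otimes>\<^sub>M borel) \<Otimes>\<^sub>M lborel)"
      unfolding case_prod_beta' by measurable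
  qed
  then show ?thesis unfolding heatV_def[abs_def] by (simp add: borel_prod)
qed

lemma borel_measurable_Hk_pair:
  "(\<lambda>w :: ('a \<times> real) \<times> ('a \<times> real). Hk s \<kappa> (fst (snd w)) (snd (snd w)) (fst w)) \<in> borel_measurable (lborel \<Otimes>\<^sub>M (lborel :: ('a::euclidean_space \<times> real) measure))"
proof -
  have "(\<lambda>w :: ('a \<times> real) \<times> ('a \<times> real). Hk s \<kappa> (fst (snd w)) (snd (snd w)) (fst (fst w), snd (fst w))) \<in> borel_measurable ((lborel \<Otimes>\<^sub>M lborel) \<Otimes>\<^sub>M (lborel \<Otimes>\<^sub>M lborel))"
    by (rule borel_measurable_Hk) measurable
  then show ?thesis by (simp add: lborel_prod)
qed

lemma borel_measurable_duhamel:
  fixes u :: "'a::euclidean_space \<times> real \<Rightarrow> real"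
  assumes u: "u \<in> borel_measurable borel"
  shows "duhamel s \<kappa> p u \<in> borel_measurable borel"
proof -
  have ind: "(\<lambda>b :: 'a \<times> real. indicator {0<..} (snd b) * u b powr p) \<in> borel_measurable lborel"
  proof -
    have [measurable]: "u \<in> borel_measurable (borel \<Otimes>\<^sub>M borel)" using u by (simp add: borel_prod)
    have "(\<lambda>b :: 'a \<times> real. indicator {0<..} (snd b) * u b powr p) \<in> borel_measurable (borel \<Otimes>\<^sub>M borel)" by measurable
    then show ?thesis by (simp add: borel_prod)
  qed
  note [measurable] = ind borel_measurable_Hk_pair
  have "(\<lambda>z. \<integral>\<^sup>+b. ennreal (Hk s \<kappa> (fst b) (snd b) z) * ennreal (indicator {0<..} (snd b) * u b powr p) \<partial>lborel) \<in> borel_measurable (lborel :: ('a \<times> real) measure)"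
  proof (rule lborel.borel_measurable_nn_integral)
    have "(\<lambda>w :: ('a \<times> real) \<times> ('a \<times> real). ennreal (indicator {0<..} (snd (snd w)) * u (snd w) powr p)) \<in> borel_measurable (lborel \<Otimes>\<^sub>M lborel)"
      by (rule measurable_compose[OF measurable_compose[OF measurable_snd ind] measurable_ennreal])
    then show "(\<lambda>(z, b). ennreal (Hk s \<kappa> (fst b) (snd b) z) * ennreal (indicator {0<..} (snd b) * u b powr p)) \<in> borel_measurable (lborel \<Otimes>\<^sub>M (lborel :: ('a \<times> real) measure))"
      unfolding case_prod_beta' by (intro borel_measurable_times_ennreal measurable_compose[OF borel_measurable_Hk_pair measurable_ennreal])
  qed
  then show ?thesis unfolding duhamel_def[abs_def] by simp
qed

lemma borel_measurable_picard:
  fixes u0 :: "'a::euclidean_space \<Rightarrow> real"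
  assumes "u0 \<in> borel_measurable borel"
  shows "picard s \<kappa> p u0 n \<in> borel_measurable borel"
proof (induction n)
  case (Suc n)
  note [measurable] = borel_measurable_heatV[OF assms] borel_measurable_duhamel[OF Suc, of p]
  show ?case by (simp del: picard.simps(1))
qed simp

lemma heatV_semigroup:
  fixes u0 :: "'a::euclidean_space \<Rightarrow> real"
  assumes [measurable]: "u0 \<in> borel_measurable borel" and \<tau>: "0 < \<tau>" "\<tau> < t"
  shows "(\<integral>\<^sup>+y. ennreal (Hk s \<kappa> y \<tau> (x, t)) * heatV s \<kappa> u0 (y, \<tau>) \<partial>lborel) = heatV s \<kappa> u0 (x, t)"
proof -
  have [measurable]: "(\<lambda>y. Hk s \<kappa> y \<tau> (x, t)) \<in> borel_measurable lborel" by (rule borel_measurable_Hk) measurable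
  have [measurable]: "(\<lambda>w::'a \<times> 'a. Hk s \<kappa> (snd w) 0 (fst w, \<tau>)) \<in> borel_measurable (lborel \<Otimes>\<^sub>M lborel)" by (rule borel_measurable_Hk) measurable
  have [measurable]: "(\<lambda>y. Hk s \<kappa> z 0 (y, \<tau>)) \<in> borel_measurable lborel" for z :: 'a by (rule borel_measurable_Hk) measurable
  have "(\<integral>\<^sup>+y. ennreal (Hk s \<kappa> y \<tau> (x, t)) * heatV s \<kappa> u0 (y, \<tau>) \<partial>lborel)
     = (\<integral>\<^sup>+y. \<integral>\<^sup>+z. ennreal (Hk s \<kappa> y \<tau> (x, t)) * (ennreal (Hk s \<kappa> z 0 (y, \<tau>)) * ennreal (u0 z)) \<partial>lborel \<partial>lborel)"
    unfolding heatV_def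
  proof (intro nn_integral_cong nn_integral_cmult[symmetric])
    fix y :: 'a
    have "(\<lambda>z. Hk s \<kappa> z 0 (y, \<tau>)) \<in> borel_measurable lborel" by (rule borel_measurable_Hk) measurable
    then show "(\<lambda>z. ennreal (Hk s \<kappa> z 0 (y, \<tau>)) * ennreal (u0 z)) \<in> borel_measurable lborel" by measurable
  qed
  also have "\<dots> = (\<integral>\<^sup>+z. \<integral>\<^sup>+y. ennreal (Hk s \<kappa> y \<tau> (x, t)) * (ennreal (Hk s \<kappa> z 0 (y, \<tau>)) * ennreal (u0 z)) \<partial>lborel \<partial>lborel)"
    by (rule lborel_pair.Fubini'[symmetric]) (unfold case_prod_beta', measurable)
  also have "\<dots> = heatV s \<kappa> u0 (x, t)"
    unfolding heatV_def
  proof (intro nn_integral_cong)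
    fix z :: 'a
    have "(\<integral>\<^sup>+y. ennreal (Hk s \<kappa> y \<tau> (x, t)) * (ennreal (Hk s \<kappa> z 0 (y, \<tau>)) * ennreal (u0 z)) \<partial>lborel)
      = (\<integral>\<^sup>+y. ennreal (hk s \<kappa> (t - \<tau>) (x - y)) * ennreal (hk s \<kappa> \<tau> (y - z)) * ennreal (u0 z) \<partial>lborel)"
      using \<tau> by (simp add: Hk_def mult.assoc)
    also have "\<dots> = (\<integral>\<^sup>+y. ennreal (hk s \<kappa> (t - \<tau>) (x - y)) * ennreal (hk s \<kappa> \<tau> (y - z)) \<partial>lborel) * ennreal (u0 z)"
      by (rule nn_integral_multc) measurable
    also have "(\<integral>\<^sup>+y. ennreal (hk s \<kappa> (t - \<tau>) (x - y)) * ennreal (hk s \<kappa> \<tau> (y - z)) \<partial>lborel) = ennreal (Hk s \<kappa> z 0 (x, t))"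
      using \<tau> by (subst nn_hk_semigroup) (auto simp: Hk_def)
    finally show "(\<integral>\<^sup>+y. ennreal (Hk s \<kappa> y \<tau> (x, t)) * (ennreal (Hk s \<kappa> z 0 (y, \<tau>)) * ennreal (u0 z)) \<partial>lborel) = ennreal (Hk s \<kappa> z 0 (x, t)) * ennreal (u0 z)" .
  qed
  finally show ?thesis .
qed

lemma nn_integral_heatV:
  fixes u0 :: "'a::euclidean_space \<Rightarrow> real"
  assumes [measurable]: "u0 \<in> borel_measurable borel" and t: "t > 0"
  shows "(\<integral>\<^sup>+x. heatV s \<kappa> u0 (x, t) \<partial>lborel) = (\<integral>\<^sup>+y. ennreal (u0 y) \<partial>lborel)"
proof -
  have [measurable]: "(\<lambda>w::'a \<times> 'a. Hk s \<kappa> (snd w) 0 (fst w, t)) \<in> borel_measurable (lborel \<Otimes>\<^sub>M lborel)" by (rule borel_measurable_Hk) measurable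
  have "(\<integral>\<^sup>+x. heatV s \<kappa> u0 (x, t) \<partial>lborel) = (\<integral>\<^sup>+y. \<integral>\<^sup>+x. ennreal (Hk s \<kappa> y 0 (x, t)) * ennreal (u0 y) \<partial>lborel \<partial>lborel)"
    unfolding heatV_def by (rule lborel_pair.Fubini'[symmetric]) (unfold case_prod_beta', measurable)
  also have "\<dots> = (\<integral>\<^sup>+y. ennreal (u0 y) \<partial>lborel)"
  proof (intro nn_integral_cong)
    fix y :: 'a
    have "(\<integral>\<^sup>+x. ennreal (Hk s \<kappa> y 0 (x, t)) * ennreal (u0 y) \<partial>lborel) = (\<integral>\<^sup>+x. ennreal (hk s \<kappa> t (x - y)) \<partial>lborel) * ennreal (u0 y)"
      using t by (subst nn_integral_multc[symmetric]) (auto simp: Hk_def)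
    then show "(\<integral>\<^sup>+x. ennreal (Hk s \<kappa> y 0 (x, t)) * ennreal (u0 y) \<partial>lborel) = ennreal (u0 y)"
      using nn_integral_hk_diff[OF t, of y] by simp
  qed
  finally show ?thesis .
qed

lemma heatV_nonpos: "t \<le> 0 \<Longrightarrow> heatV s \<kappa> u0 (x, t) = 0"
  by (simp add: heatV_def Hk_def)

text \<open>One of the \<open>p\<close> powers of \<open>u\<close> is kept as
  \<open>2 * heatV\<close> and propagated by the semigroup; the other \<open>p - 1\<close> are
  replaced by \<open>2 * m\<close>, which depends on time alone and comes out of the space
  integral.\<close>

lemma duhamel_le:
  fixes u0 :: "'a::euclidean_space \<Rightarrow> real"
  assumes p: "p > 1" and u0: "u0 \<in> borel_measurable borel" and m: "m \<in> borel_measurable borel" "\<And>t. m t \<ge> 0"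
    and Vm: "\<And>x t. t > 0 \<Longrightarrow> heatV s \<kappa> u0 (x, t) \<le> ennreal (m t)"
    and small: "(\<integral>\<^sup>+t\<in>{0<..}. ennreal (2 * (2 * m t) powr (p - 1)) \<partial>lborel) \<le> 1"
    and u: "\<And>z. u z \<ge> 0" "\<And>z. ennreal (u z) \<le> 2 * heatV s \<kappa> u0 z"
  shows "duhamel s \<kappa> p u z \<le> heatV s \<kappa> u0 z"
proof -
  obtain x t where z: "z = (x, t)" by (cases z)
  note [measurable] = m(1)
  have Vm': "heatV s \<kappa> u0 (x, t) \<le> ennreal (m t)" for x t
    using Vm[of t x] heatV_nonpos[of t u0 x] by (cases "t > 0") auto
  have um: "u (y, \<tau>) \<le> 2 * m \<tau>" for y \<tau>
  proof -
    have "ennreal (u (y, \<tau>)) \<le> 2 * ennreal (m \<tau>)" using u(2)[of "(y, \<tau>)"] Vm'[of y \<tau>] by (meson mult_left_mono order_trans zero_le)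
    also have "\<dots> = ennreal (2 * m \<tau>)" by (simp add: ennreal_mult')
    finally show ?thesis using m(2)[of \<tau>] by (simp add: ennreal_le_iff)
  qed
  have hm: "heatV s \<kappa> u0 \<in> borel_measurable (borel \<Otimes>\<^sub>M borel)" using borel_measurable_heatV[OF u0] by (simp add: borel_prod)
  have hm1: "(\<lambda>w::'a \<times> real. Hk s \<kappa> (fst w) (snd w) (x, t)) \<in> borel_measurable (lborel \<Otimes>\<^sub>M lborel)" by (rule borel_measurable_Hk) measurable
  let ?w = "\<lambda>\<tau>. ennreal ((2 * m \<tau>) powr (p - 1)) * indicator {0<..} \<tau>"
  have "duhamel s \<kappa> p u z \<le> (\<integral>\<^sup>+b. ennreal (Hk s \<kappa> (fst b) (snd b) (x, t)) * (?w (snd b) * (2 * heatV s \<kappa> u0 b)) \<partial>lborel)"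
    unfolding duhamel_def z
  proof (intro nn_integral_mono mult_left_mono)
    fix b :: "'a \<times> real"
    obtain y \<tau> where b: "b = (y, \<tau>)" by (cases b)
    show "ennreal (indicator {0<..} (snd b) * u b powr p) \<le> ?w (snd b) * (2 * heatV s \<kappa> u0 b)"
    proof (cases "\<tau> > 0")
      case True
      have "u b powr p = u b powr (p - 1) * u b" using u(1)[of b] by (cases "u b = 0") (simp_all add: powr_diff)
      also have "\<dots> \<le> (2 * m \<tau>) powr (p - 1) * u b"
        using um[of y \<tau>] u(1)[of b] p by (intro mult_right_mono powr_mono2) (auto simp: b)
      finally have "ennreal (u b powr p) \<le> ennreal ((2 * m \<tau>) powr (p - 1)) * ennreal (u b)"
        using u(1)[of b] by (simp add: ennreal_mult[symmetric] ennreal_leI)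
      also have "\<dots> \<le> ennreal ((2 * m \<tau>) powr (p - 1)) * (2 * heatV s \<kappa> u0 b)" by (intro mult_left_mono u) auto
      finally show ?thesis using True by (simp add: b)
    qed (simp add: b)
  qed auto
  also have "\<dots> = (\<integral>\<^sup>+b. ennreal (Hk s \<kappa> (fst b) (snd b) (x, t)) * (?w (snd b) * (2 * heatV s \<kappa> u0 b)) \<partial>(lborel \<Otimes>\<^sub>M lborel))"
    by (simp add: lborel_prod)
  also have "\<dots> = (\<integral>\<^sup>+\<tau>. \<integral>\<^sup>+y. ennreal (Hk s \<kappa> y \<tau> (x, t)) * (?w \<tau> * (2 * heatV s \<kappa> u0 (y, \<tau>))) \<partial>lborel \<partial>lborel)"
  proof -
    note [measurable] = hm1 hm
    have "(\<lambda>b. ennreal (Hk s \<kappa> (fst b) (snd b) (x, t)) * (?w (snd b) * (2 * heatV s \<kappa> u0 b))) \<in> borel_measurable (lborel \<Otimes>\<^sub>M (lborel :: real measure))"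
      by measurable
    from lborel_pair.nn_integral_snd[OF this] show ?thesis by simp
  qed
  also have "\<dots> \<le> (\<integral>\<^sup>+\<tau>. ennreal (2 * (2 * m \<tau>) powr (p - 1)) * indicator {0<..} \<tau> * heatV s \<kappa> u0 (x, t) \<partial>lborel)"
  proof (intro nn_integral_mono)
    fix \<tau> :: real
    show "(\<integral>\<^sup>+y. ennreal (Hk s \<kappa> y \<tau> (x, t)) * (?w \<tau> * (2 * heatV s \<kappa> u0 (y, \<tau>))) \<partial>lborel) \<le> ennreal (2 * (2 * m \<tau>) powr (p - 1)) * indicator {0<..} \<tau> * heatV s \<kappa> u0 (x, t)"
    proof (cases "0 < \<tau> \<and> \<tau> < t")
      case True
      have [measurable]: "(\<lambda>y. heatV s \<kappa> u0 (y, \<tau>)) \<in> borel_measurable lborel"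
        using measurable_compose[OF measurable_Pair2'[of \<tau> borel] hm] by simp
      have [measurable]: "(\<lambda>y. Hk s \<kappa> y \<tau> (x, t)) \<in> borel_measurable lborel" by (rule borel_measurable_Hk) measurable
      have "(\<integral>\<^sup>+y. ennreal (Hk s \<kappa> y \<tau> (x, t)) * (?w \<tau> * (2 * heatV s \<kappa> u0 (y, \<tau>))) \<partial>lborel)
        = (\<integral>\<^sup>+y. (?w \<tau> * 2) * (ennreal (Hk s \<kappa> y \<tau> (x, t)) * heatV s \<kappa> u0 (y, \<tau>)) \<partial>lborel)"
        by (intro nn_integral_cong) (simp only: mult_ac)
      also have "\<dots> = (?w \<tau> * 2) * heatV s \<kappa> u0 (x, t)"
        using True by (subst nn_integral_cmult) (measurable, simp add: heatV_semigroup[OF u0])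
      also have "?w \<tau> * 2 = ennreal (2 * (2 * m \<tau>) powr (p - 1)) * indicator {0<..} \<tau>"
        by (simp add: ennreal_mult' mult_ac)
      finally show ?thesis by simp
    next
      case False
      then have "ennreal (Hk s \<kappa> y \<tau> (x, t)) * (?w \<tau> * (2 * heatV s \<kappa> u0 (y, \<tau>))) = 0" for y
        by (auto simp: Hk_def)
      then show ?thesis by (simp only:) simp
    qed
  qed
  also have "\<dots> = (\<integral>\<^sup>+t\<in>{0<..}. ennreal (2 * (2 * m t) powr (p - 1)) \<partial>lborel) * heatV s \<kappa> u0 (x, t)"
    by (rule nn_integral_multc) measurable
  also have "\<dots> \<le> 1 * heatV s \<kappa> u0 (x, t)" by (intro mult_right_mono small) auto
  finally show ?thesis by (simp add: z)
qed

text \<open>The bound \<open>2 * heatV\<close> is preserved by the iteration, so every iterate is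
  finite and \<open>enn2real\<close> loses nothing. Monotone convergence passes to the limit in the
  Duhamel integral.\<close>

lemma picard_limit:
  fixes u0 :: "'a::euclidean_space \<Rightarrow> real"
  assumes p: "p > 1" and u0: "u0 \<in> borel_measurable borel" and m: "m \<in> borel_measurable borel" "\<And>t. m t \<ge> 0"
    and Vm: "\<And>x t. t > 0 \<Longrightarrow> heatV s \<kappa> u0 (x, t) \<le> ennreal (m t)"
    and small: "(\<integral>\<^sup>+t\<in>{0<..}. ennreal (2 * (2 * m t) powr (p - 1)) \<partial>lborel) \<le> 1"
  obtains U where "U \<in> borel_measurable borel" "\<And>z. U z \<ge> 0" "\<And>z. ennreal (U z) = heatV s \<kappa> u0 z + duhamel s \<kappa> p U z"
    "\<And>z. ennreal (U z) \<le> 2 * heatV s \<kappa> u0 z"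
proof -
  let ?V = "heatV s \<kappa> u0" and ?D = "duhamel s \<kappa> p" and ?u = "picard s \<kappa> p u0"
  have Vfin: "?V z < \<infinity>" for z
  proof -
    obtain x t where z: "z = (x, t)" by (cases z)
    show ?thesis using Vm[of t x] heatV_nonpos[of t u0 x] unfolding z by (cases "t > 0") (auto simp: le_less_trans)
  qed
  have unn: "?u n z \<ge> 0" for n z by (cases n) auto
  have ub: "ennreal (?u n z) \<le> 2 * ?V z" for n z
  proof (induction n arbitrary: z)
    case (Suc n)
    have "?D (?u n) z \<le> ?V z" by (rule duhamel_le[OF p u0 m Vm small unn Suc])
    then have le: "?V z + ?D (?u n) z \<le> 2 * ?V z" by (metis add_left_mono mult_2)
    also have "2 * ?V z < \<infinity>" using Vfin[of z] by (simp add: ennreal_mult_less_top)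
    finally show ?case using le by simp
  qed simp
  have ueq: "ennreal (?u (Suc n) z) = ?V z + ?D (?u n) z" for n z
  proof -
    have "?D (?u n) z \<le> ?V z" by (rule duhamel_le[OF p u0 m Vm small unn ub])
    then have "?V z + ?D (?u n) z < \<infinity>" using Vfin[of z] by (metis ennreal_add_eq_top infinity_ennreal_def less_top order.strict_trans1)
    then show ?thesis by simp
  qed
  have umono1: "?u n z \<le> ?u (Suc n) z" for n z
  proof (induction n arbitrary: z)
    case 0
    show ?case using unn[of "Suc 0" z] by simp
  next
    case (Suc n)
    have "?D (?u n) z \<le> ?D (?u (Suc n)) z"
      unfolding duhamel_def
    proof (intro nn_integral_mono mult_left_mono ennreal_leI)
      fix b :: "'a \<times> real"
      show "?u n b powr p \<le> ?u (Suc n) b powr p" using p by (intro powr_mono2 Suc unn) auto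
    qed auto
    then have "ennreal (?u (Suc n) z) \<le> ennreal (?u (Suc (Suc n)) z)" unfolding ueq by (intro add_left_mono)
    then show ?case using unn[of "Suc (Suc n)" z] by (simp only: ennreal_le_iff)
  qed
  then have inc: "incseq (\<lambda>n. ?u n z)" for z by (intro incseq_SucI)
  have bd: "?u n z \<le> enn2real (2 * ?V z)" for n z
    using ub[of n z] Vfin[of z] unn[of n z] by (metis ennreal_mult_less_top enn2real_ennreal enn2real_mono infinity_ennreal_def ennreal_numeral ennreal_less_top)
  define U where "U z = lim (\<lambda>n. ?u n z)" for z
  have lim: "(\<lambda>n. ?u n z) \<longlonglongrightarrow> U z" for z
  proof -
    have "convergent (\<lambda>n. ?u n z)"
      using incseq_convergent[OF inc[of z], of "enn2real (2 * ?V z)"] bd by (metis convergentI)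
    then show ?thesis unfolding U_def by (simp add: convergent_LIMSEQ_iff)
  qed
  have Um: "U \<in> borel_measurable borel"
    by (rule borel_measurable_LIMSEQ_metric[OF borel_measurable_picard[OF u0] lim])
  have Un: "U z \<ge> 0" for z using lim[of z] unn[of _ z] by (intro LIMSEQ_le_const) auto
  have UV: "ennreal (U z) \<le> 2 * ?V z" for z
    by (rule LIMSEQ_le_const2[OF tendsto_ennrealI[OF lim]]) (use ub in blast)
  have "(\<lambda>n. ?D (?u n) z) \<longlonglongrightarrow> ?D U z" for z
    unfolding duhamel_def
  proof (rule nn_integral_LIMSEQ)
    have mon: "?u i b \<le> ?u j b" if "i \<le> j" for i j b using inc[of b] that by (auto simp: incseq_def)
    show "incseq (\<lambda>n b. ennreal (Hk s \<kappa> (fst b) (snd b) z) * ennreal (indicator {0<..} (snd b) * ?u n b powr p))"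
      using p mon unn by (auto simp: incseq_def le_fun_def intro!: mult_left_mono ennreal_leI powr_mono2)
    show "(\<lambda>b. ennreal (Hk s \<kappa> (fst b) (snd b) z) * ennreal (indicator {0<..} (snd b) * ?u n b powr p)) \<in> borel_measurable lborel" for n
    proof -
      have [measurable]: "?u n \<in> borel_measurable (borel \<Otimes>\<^sub>M borel)" using borel_measurable_picard[OF u0] by (simp add: borel_prod)
      have [measurable]: "(\<lambda>w::'a \<times> real. Hk s \<kappa> (fst w) (snd w) (fst z, snd z)) \<in> borel_measurable (borel \<Otimes>\<^sub>M borel)" by (rule borel_measurable_Hk) measurable
      have "(\<lambda>b. ennreal (Hk s \<kappa> (fst b) (snd b) (fst z, snd z)) * ennreal (indicator {0<..} (snd b) * ?u n b powr p)) \<in> borel_measurable (borel \<Otimes>\<^sub>M borel)" by measurable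
      then show ?thesis by (simp add: borel_prod)
    qed
    fix b :: "'a \<times> real"
    have "(\<lambda>n. ?u n b powr p) \<longlonglongrightarrow> U b powr p"
      using p by (intro tendsto_powr' lim tendsto_const) (auto simp: unn)
    then show "(\<lambda>n. ennreal (Hk s \<kappa> (fst b) (snd b) z) * ennreal (indicator {0<..} (snd b) * ?u n b powr p))
       \<longlonglongrightarrow> ennreal (Hk s \<kappa> (fst b) (snd b) z) * ennreal (indicator {0<..} (snd b) * U b powr p)"
      by (intro tendsto_mult_ennreal tendsto_const tendsto_ennrealI tendsto_mult_left) auto
  qed
  then have "(\<lambda>n. ?V z + ?D (?u n) z) \<longlonglongrightarrow> ?V z + ?D U z" for z
    by (intro tendsto_add tendsto_const)
  moreover have "(\<lambda>n. ennreal (?u (Suc n) z)) \<longlonglongrightarrow> ennreal (U z)" for z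
    by (intro tendsto_ennrealI LIMSEQ_Suc lim)
  ultimately have "ennreal (U z) = ?V z + ?D U z" for z
    unfolding ueq using LIMSEQ_unique by blast
  then show thesis using that Um Un UV by blast
qed

end

text \<open>The bridge from mild to very weak solutions, used once for the initial datum and once
  for the nonlinear source: it moves the pairing with \<open>g\<close> from the solution onto the
  kernel, where \<open>duality\<close> evaluates it.\<close>

lemma fubini_dual:
  fixes k :: "'b::euclidean_space \<Rightarrow> 'c::euclidean_space \<Rightarrow> real" and h :: "'b \<Rightarrow> real" and g w :: "'c \<Rightarrow> real"
  assumes k [measurable]: "(\<lambda>(b, z). k b z) \<in> borel_measurable (lborel \<Otimes>\<^sub>M lborel)" and k0: "\<And>b z. k b z \<ge> 0"
    and h [measurable]: "h \<in> borel_measurable borel" and h0: "\<And>b. h b \<ge> 0" and g [measurable]: "g \<in> borel_measurable borel"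
    and fin: "(\<integral>\<^sup>+b. ennreal (h b) * (\<integral>\<^sup>+z. ennreal \<bar>k b z * g z\<bar> \<partial>lborel) \<partial>lborel) < \<infinity>"
    and w: "\<And>z. (\<integral>\<^sup>+b. ennreal (k b z) * ennreal (h b) \<partial>lborel) = ennreal (w z)" and w0: "\<And>z. w z \<ge> 0"
  shows "integrable lborel (\<lambda>z. w z * g z)" and "(\<integral>z. w z * g z \<partial>lborel) = (\<integral>b. h b * (\<integral>z. k b z * g z \<partial>lborel) \<partial>lborel)"
proof -
  have int: "integrable (lborel \<Otimes>\<^sub>M lborel) (\<lambda>(b, z). h b * (k b z * g z))"
  proof (rule integrableI_bounded)
    have "(\<integral>\<^sup>+x. ennreal (norm (case x of (b, z) \<Rightarrow> h b * (k b z * g z))) \<partial>(lborel \<Otimes>\<^sub>M lborel))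
      = (\<integral>\<^sup>+b. \<integral>\<^sup>+z. ennreal (norm (h b * (k b z * g z))) \<partial>lborel \<partial>lborel)"
      by (subst lborel.nn_integral_fst[symmetric]) auto
    also have "\<dots> = (\<integral>\<^sup>+b. ennreal (h b) * (\<integral>\<^sup>+z. ennreal \<bar>k b z * g z\<bar> \<partial>lborel) \<partial>lborel)"
      using h0 by (intro nn_integral_cong, subst nn_integral_cmult[symmetric]) (auto simp: abs_mult ennreal_mult)
    finally show "(\<integral>\<^sup>+x. ennreal (norm (case x of (b, z) \<Rightarrow> h b * (k b z * g z))) \<partial>(lborel \<Otimes>\<^sub>M lborel)) < \<infinity>" using fin by simp
  qed measurable
  have wi: "w z = (\<integral>b. k b z * h b \<partial>lborel)" for z
  proof -
    have "(\<integral>b. k b z * h b \<partial>lborel) = enn2real (\<integral>\<^sup>+b. ennreal (k b z * h b) \<partial>lborel)"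
      by (rule integral_eq_nn_integral) (use k0 h0 in auto)
    also have "(\<integral>\<^sup>+b. ennreal (k b z * h b) \<partial>lborel) = ennreal (w z)" using w[of z] k0 h0 by (simp add: ennreal_mult)
    finally show ?thesis using w0[of z] by simp
  qed
  have eq: "w z * g z = (\<integral>b. h b * (k b z * g z) \<partial>lborel)" for z
    unfolding wi by (subst integral_mult_left_zero[symmetric]) (simp only: mult_ac)
  show "integrable lborel (\<lambda>z. w z * g z)" unfolding eq using lborel_pair.integrable_snd[OF int] by simp
  show "(\<integral>z. w z * g z \<partial>lborel) = (\<integral>b. h b * (\<integral>z. k b z * g z \<partial>lborel) \<partial>lborel)"
    unfolding eq using lborel_pair.Fubini_integral[OF int] by simp
qed

lemma integral_lebesgue_eq_lborel:
  fixes f :: "'a::euclidean_space \<Rightarrow> real"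
  shows "f \<in> borel_measurable borel \<Longrightarrow> (LINT x|lebesgue. f x) = (\<integral>x. f x \<partial>lborel)"
  by (rule integral_completion) simp

text \<open>By the semigroup property, \<open>small\<close> says that the Duhamel term of \<open>2 * heatV u0\<close> is at most \<open>heatV u0\<close>.
  Thus \<open>2 * heatV u0\<close> is a supersolution and bounds the increasing Picard iteration.\<close>

lemma very_weak_solution_exists:
  fixes u0 v0 :: "'a::euclidean_space \<Rightarrow> real"
  assumes s: "0 < s" "s < 1" and p: "p > 1"
    and u0 [measurable]: "u0 \<in> borel_measurable borel" and u0n: "\<And>x. u0 x \<ge> 0" and u0i: "integrable lborel u0"
    and m: "m \<in> borel_measurable borel" "\<And>t. m t \<ge> 0" and mB: "\<And>t. m t \<le> B"
    and Vm: "\<And>x t. t > 0 \<Longrightarrow> heatV s (fkappa DIM('a) s) u0 (x, t) \<le> ennreal (m t)"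
    and small: "(\<integral>\<^sup>+t\<in>{0<..}. ennreal (2 * (2 * m t) powr (p - 1)) \<partial>lborel) \<le> 1"
    and v0: "AE x in lebesgue. v0 x = u0 x" "v0 \<in> borel_measurable lebesgue"
  shows "\<exists>u. very_weak_solution s p v0 u"
proof -
  interpret frac_heat s "fkappa DIM('a) s" by standard (use s fkappa_pos in auto)
  let ?\<kappa> = "fkappa DIM('a) s"
  let ?V = "heatV s ?\<kappa> u0" and ?D = "duhamel s ?\<kappa> p"
  obtain U where Um: "U \<in> borel_measurable borel" and Un: "\<And>z. U z \<ge> 0"
    and Ueq: "\<And>z. ennreal (U z) = ?V z + ?D U z" and UV: "\<And>z. ennreal (U z) \<le> 2 * ?V z"
    using picard_limit[OF p u0 m Vm small] by metis
  have B0: "B \<ge> 0" using m(2)[of 0] mB[of 0] by linarith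
  have Vm': "?V (x, t) \<le> ennreal (m t)" for x t
    using Vm[of t x] heatV_nonpos[of t u0 x] by (cases "t > 0") auto
  have UB: "U z \<le> 2 * B" for z
  proof -
    obtain x t where z: "z = (x, t)" by (cases z)
    have "ennreal (U z) \<le> 2 * ennreal (m t)" using UV[of z] Vm'[of x t] unfolding z by (meson mult_left_mono order_trans zero_le)
    also have "\<dots> = ennreal (2 * m t)" by (simp add: ennreal_mult')
    also have "\<dots> \<le> ennreal (2 * B)" using mB[of t] by (intro ennreal_leI) auto
    finally show ?thesis using B0 by (simp add: ennreal_le_iff)
  qed
  have Um2 [measurable]: "U \<in> borel_measurable (borel \<Otimes>\<^sub>M borel)" using Um by (simp add: borel_prod)
  have Ux [measurable]: "(\<lambda>x. U (x, t)) \<in> borel_measurable borel" for t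
    using measurable_compose[OF measurable_Pair2'[of t borel] Um2] by simp
  \<comment> \<open>The factor 2 comes from \<open>UV\<close>. The flow preserves the integral of
    \<open>u0\<close>, so \<open>A\<close> bounds the spatial integral of \<open>U\<close> at every
    time.\<close>
  define A where "A = 2 * (\<integral>x. u0 x \<partial>lborel)"
  have A0: "A \<ge> 0" unfolding A_def using u0n by (simp add: Bochner_Integration.integral_nonneg)
  have U1: "(\<integral>\<^sup>+x. ennreal (U (x, t)) \<partial>lborel) \<le> ennreal A" for t
  proof (cases "t > 0")
    case True
    have hm: "?V \<in> borel_measurable (borel \<Otimes>\<^sub>M borel)" using borel_measurable_heatV[OF u0] by (simp add: borel_prod)
    have [measurable]: "(\<lambda>x. ?V (x, t)) \<in> borel_measurable lborel"
      using measurable_compose[OF measurable_Pair2'[of t borel] hm] by simp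
    have "(\<integral>\<^sup>+x. ennreal (U (x, t)) \<partial>lborel) \<le> (\<integral>\<^sup>+x. 2 * ?V (x, t) \<partial>lborel)" by (intro nn_integral_mono UV)
    also have "\<dots> = 2 * (\<integral>\<^sup>+x. ?V (x, t) \<partial>lborel)" by (rule nn_integral_cmult) measurable
    also have "\<dots> = 2 * ennreal (\<integral>x. u0 x \<partial>lborel)"
      unfolding nn_integral_heatV[OF u0 True] using u0n by (subst nn_integral_eq_integral[OF u0i]) auto
    also have "\<dots> = ennreal A" by (simp add: A_def ennreal_mult')
    finally show ?thesis .
  next
    case False
    then have "U (x, t) = 0" for x using UV[of "(x, t)"] heatV_nonpos[of t u0 x] Un[of "(x, t)"] by simp
    then show ?thesis by simp
  qed
  have U1i: "integrable lborel (\<lambda>x. U (x, t))" for t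
    by (intro integrableI_nonneg) (auto simp: Un le_less_trans[OF U1])
  have U1I: "(\<integral>x. U (x, t) \<partial>lborel) \<le> A" for t
    using U1[of t] A0 by (subst (asm) nn_integral_eq_integral[OF U1i]) (auto simp: Un ennreal_le_iff)

  have weak: "(LINT z:open_half_space|lebesgue. U z * (- time_deriv \<phi> z + mixed_op s \<phi> z))
          - (LINT x|lebesgue. v0 x * \<phi> (x, 0))
        = (LINT z:open_half_space|lebesgue. U z powr p * \<phi> z)" if \<phi>: "\<phi> \<in> test_functions" for \<phi>
  proof -
    obtain r T K where "test_fn \<phi> r T K" using test_functions_imp_test_fn[OF \<phi>] by blast
    then interpret test_fn \<phi> r T K .
    interpret heat_test \<phi> r T K s ..
    obtain C where C: "C \<ge> 0" "\<And>z. \<bar>gS z\<bar> \<le> C" using gS_bound by blast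
    have gSm: "gS \<in> borel_measurable borel" by (rule borel_measurable_gS)
    have T0: "T > 0" by (rule T)
    define h where "h b = indicator {0<..} (snd b) * U b powr p" for b :: "'a \<times> real"
    have hm2: "h \<in> borel_measurable (borel \<Otimes>\<^sub>M borel)" unfolding h_def by measurable
    then have hm: "h \<in> borel_measurable borel" by (simp add: borel_prod)
    have h0: "h b \<ge> 0" for b by (simp add: h_def)
    define w1 where "w1 z = enn2real (?V z)" for z
    define w2 where "w2 z = enn2real (?D U z)" for z
    have w1n: "w1 z \<ge> 0" and w2n: "w2 z \<ge> 0" for z by (simp_all add: w1_def w2_def)
    have fin: "?V z < \<infinity>" "?D U z < \<infinity>" for z
      using Ueq[of z] by (metis ennreal_add_eq_top ennreal_neq_top infinity_ennreal_def less_top)+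
    have w1: "?V z = ennreal (w1 z)" and w2: "?D U z = ennreal (w2 z)" for z using fin[of z] by (simp_all add: w1_def w2_def)
    have Uw: "U z = w1 z + w2 z" for z
    proof -
      have "ennreal (U z) = ennreal (w1 z) + ennreal (w2 z)" using Ueq[of z] unfolding w1 w2 .
      also have "\<dots> = ennreal (w1 z + w2 z)" by (simp add: w1n w2n)
      finally show ?thesis using Un[of z] w1n[of z] w2n[of z] by (subst (asm) ennreal_inj) auto
    qed
    have bnd: "(\<integral>\<^sup>+z. ennreal \<bar>Hk s ?\<kappa> y \<tau> z * gS z\<bar> \<partial>lborel) \<le> ennreal (C * T) * indicator {..<T} \<tau>" if "\<tau> \<ge> 0" for y \<tau>
      by (rule integrable_Hk_gS(2)[OF that C(2) C(1)])
    have part1: "integrable lborel (\<lambda>z. w1 z * gS z)" "(\<integral>z. w1 z * gS z \<partial>lborel) = (\<integral>y. u0 y * (\<integral>z. Hk s ?\<kappa> y 0 z * gS z \<partial>lborel) \<partial>lborel)"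
    proof -
      have "(\<lambda>w. Hk s ?\<kappa> (fst w) 0 (fst (snd w), snd (snd w))) \<in> borel_measurable ((lborel :: 'a measure) \<Otimes>\<^sub>M (lborel \<Otimes>\<^sub>M lborel))"
        by (rule borel_measurable_Hk) measurable
      then have k: "(\<lambda>(y, z). Hk s ?\<kappa> y 0 z) \<in> borel_measurable ((lborel :: 'a measure) \<Otimes>\<^sub>M lborel)"
        by (simp add: lborel_prod case_prod_beta')
      have "(\<integral>\<^sup>+y. ennreal (u0 y) * (\<integral>\<^sup>+z. ennreal \<bar>Hk s ?\<kappa> y 0 z * gS z\<bar> \<partial>lborel) \<partial>lborel) \<le> (\<integral>\<^sup>+y. ennreal (u0 y) * ennreal (C * T) \<partial>lborel)"
        by (intro nn_integral_mono mult_left_mono order_trans[OF bnd]) (auto split: split_indicator)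
      also have "\<dots> = (\<integral>\<^sup>+y. ennreal (u0 y) \<partial>lborel) * ennreal (C * T)" by (rule nn_integral_multc) measurable
      also have "\<dots> < \<infinity>" using u0n by (subst nn_integral_eq_integral[OF u0i]) (auto simp: ennreal_mult_less_top)
      finally have f: "(\<integral>\<^sup>+y. ennreal (u0 y) * (\<integral>\<^sup>+z. ennreal \<bar>Hk s ?\<kappa> y 0 z * gS z\<bar> \<partial>lborel) \<partial>lborel) < \<infinity>" .
      have w: "(\<integral>\<^sup>+y. ennreal (Hk s ?\<kappa> y 0 z) * ennreal (u0 y) \<partial>lborel) = ennreal (w1 z)" for z
        using w1[of z] by (simp add: heatV_def)
      show "integrable lborel (\<lambda>z. w1 z * gS z)" "(\<integral>z. w1 z * gS z \<partial>lborel) = (\<integral>y. u0 y * (\<integral>z. Hk s ?\<kappa> y 0 z * gS z \<partial>lborel) \<partial>lborel)"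
        by (rule fubini_dual(1)[OF k Hk_nonneg u0 u0n gSm f w w1n], rule fubini_dual(2)[OF k Hk_nonneg u0 u0n gSm f w w1n])
    qed
    have part2: "integrable lborel (\<lambda>z. w2 z * gS z)" "(\<integral>z. w2 z * gS z \<partial>lborel) = (\<integral>b. h b * (\<integral>z. Hk s ?\<kappa> (fst b) (snd b) z * gS z \<partial>lborel) \<partial>lborel)"
    proof -
      have "(\<lambda>w :: ('a \<times> real) \<times> ('a \<times> real). Hk s ?\<kappa> (fst (fst w)) (snd (fst w)) (fst (snd w), snd (snd w))) \<in> borel_measurable ((lborel \<Otimes>\<^sub>M lborel) \<Otimes>\<^sub>M (lborel \<Otimes>\<^sub>M lborel))"
        by (rule borel_measurable_Hk) measurable
      then have k: "(\<lambda>(b, z). Hk s ?\<kappa> (fst b) (snd b) z) \<in> borel_measurable ((lborel :: ('a \<times> real) measure) \<Otimes>\<^sub>M lborel)"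
        by (simp add: lborel_prod case_prod_beta')
      \<comment> \<open>One power of \<open>U\<close> is kept for its spatial integral, the
        remaining \<open>p - 1\<close> are bounded by the supremum; this makes the source integrable
        up to time \<open>T\<close>.\<close>
      have hle: "h b \<le> (2 * B) powr (p - 1) * U b" for b
      proof -
        have "U b powr p = U b powr (p - 1) * U b" using Un[of b] by (cases "U b = 0") (simp_all add: powr_diff)
        also have "\<dots> \<le> (2 * B) powr (p - 1) * U b" using UB[of b] Un[of b] p by (intro mult_right_mono powr_mono2) auto
        finally show ?thesis using Un[of b] by (auto simp: h_def split: split_indicator)
      qed
      let ?M = "(2 * B) powr (p - 1)"
      have "(\<integral>\<^sup>+b. ennreal (h b) * (\<integral>\<^sup>+z. ennreal \<bar>Hk s ?\<kappa> (fst b) (snd b) z * gS z\<bar> \<partial>lborel) \<partial>lborel)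
         \<le> (\<integral>\<^sup>+b. ennreal (?M * U b) * (ennreal (C * T) * indicator {0..<T} (snd b)) \<partial>lborel)"
      proof (intro nn_integral_mono)
        fix b :: "'a \<times> real"
        show "ennreal (h b) * (\<integral>\<^sup>+z. ennreal \<bar>Hk s ?\<kappa> (fst b) (snd b) z * gS z\<bar> \<partial>lborel) \<le> ennreal (?M * U b) * (ennreal (C * T) * indicator {0..<T} (snd b))"
        proof (cases "snd b > 0")
          case True
          then show ?thesis using bnd[of "snd b" "fst b"] hle[of b]
            by (intro mult_mono ennreal_leI) (auto split: split_indicator)
        qed (simp add: h_def)
      qed
      also have "\<dots> = (\<integral>\<^sup>+b. ennreal (?M * U b) * (ennreal (C * T) * indicator {0..<T} (snd b)) \<partial>(lborel \<Otimes>\<^sub>M lborel))"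
        by (simp add: lborel_prod)
      also have "\<dots> = (\<integral>\<^sup>+t. \<integral>\<^sup>+x. ennreal (?M * U (x, t)) * (ennreal (C * T) * indicator {0..<T} t) \<partial>lborel \<partial>lborel)"
      proof -
        have "(\<lambda>b. ennreal (?M * U b) * (ennreal (C * T) * indicator {0..<T} (snd b))) \<in> borel_measurable (lborel \<Otimes>\<^sub>M (lborel :: real measure))"
          by measurable
        from lborel_pair.nn_integral_snd[OF this] show ?thesis by simp
      qed
      also have "\<dots> \<le> (\<integral>\<^sup>+t. (ennreal ?M * ennreal A * ennreal (C * T)) * indicator {0..<T} t \<partial>lborel)"
      proof (intro nn_integral_mono)
        fix t :: real
        have "(\<integral>\<^sup>+x. ennreal (?M * U (x, t)) * (ennreal (C * T) * indicator {0..<T} t) \<partial>lborel)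
          = ennreal ?M * (\<integral>\<^sup>+x. ennreal (U (x, t)) \<partial>lborel) * (ennreal (C * T) * indicator {0..<T} t)"
          by (simp add: nn_integral_multc nn_integral_cmult ennreal_mult Un)
        also have "\<dots> \<le> ennreal ?M * ennreal A * (ennreal (C * T) * indicator {0..<T} t)"
          by (intro mult_right_mono mult_left_mono U1) auto
        finally show "(\<integral>\<^sup>+x. ennreal (?M * U (x, t)) * (ennreal (C * T) * indicator {0..<T} t) \<partial>lborel) \<le> (ennreal ?M * ennreal A * ennreal (C * T)) * indicator {0..<T} t"
          by (simp only: mult.assoc)
      qed
      also have "\<dots> = (ennreal ?M * ennreal A * ennreal (C * T)) * emeasure lborel {0..<T}"
        by (rule nn_integral_cmult_indicator) simp
      also have "\<dots> < \<infinity>" using T0 by (simp add: ennreal_mult_less_top)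
      finally have f: "(\<integral>\<^sup>+b. ennreal (h b) * (\<integral>\<^sup>+z. ennreal \<bar>Hk s ?\<kappa> (fst b) (snd b) z * gS z\<bar> \<partial>lborel) \<partial>lborel) < \<infinity>" .
      have w: "(\<integral>\<^sup>+b. ennreal (Hk s ?\<kappa> (fst b) (snd b) z) * ennreal (h b) \<partial>lborel) = ennreal (w2 z)" for z
        using w2[of z] by (simp add: duhamel_def h_def)
      show "integrable lborel (\<lambda>z. w2 z * gS z)" "(\<integral>z. w2 z * gS z \<partial>lborel) = (\<integral>b. h b * (\<integral>z. Hk s ?\<kappa> (fst b) (snd b) z * gS z \<partial>lborel) \<partial>lborel)"
        by (rule fubini_dual(1)[OF k Hk_nonneg hm h0 gSm f w w2n], rule fubini_dual(2)[OF k Hk_nonneg hm h0 gSm f w w2n])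
    qed
    have I1: "(LINT z:open_half_space|lebesgue. U z * (- time_deriv \<phi> z + mixed_op s \<phi> z)) = (\<integral>z. U z * gS z \<partial>lborel)"
    proof -
      have "(LINT z:open_half_space|lebesgue. U z * (- time_deriv \<phi> z + mixed_op s \<phi> z)) = (LINT z|lebesgue. U z * gS z)"
        unfolding set_lebesgue_integral_def by (intro Bochner_Integration.integral_cong refl) (simp add: gS_def g_def)
      also have "\<dots> = (\<integral>z. U z * gS z \<partial>lborel)" by (rule integral_lebesgue_eq_lborel) (use Um gSm in \<open>rule borel_measurable_times\<close>)
      finally show ?thesis .
    qed
    have I2: "(LINT x|lebesgue. v0 x * \<phi> (x, 0)) = (\<integral>y. u0 y * \<phi> (y, 0) \<partial>lborel)"
    proof -
      have pm [measurable]: "(\<lambda>x. \<phi> (x, 0)) \<in> borel_measurable borel" by (rule borel_measurable_phi_slice) simp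
      have pm2: "(\<lambda>x. \<phi> (x, 0)) \<in> borel_measurable lebesgue" and u0m: "u0 \<in> borel_measurable lebesgue"
        using pm u0 by (auto intro!: measurable_completion)
      have "(LINT x|lebesgue. v0 x * \<phi> (x, 0)) = (LINT x|lebesgue. u0 x * \<phi> (x, 0))"
        using v0 by (intro integral_cong_AE borel_measurable_times pm2 u0m) auto
      also have "\<dots> = (\<integral>y. u0 y * \<phi> (y, 0) \<partial>lborel)" by (rule integral_lebesgue_eq_lborel) measurable
      finally show ?thesis .
    qed
    have I3: "(LINT z:open_half_space|lebesgue. U z powr p * \<phi> z) = (\<integral>b. h b * \<phi>' b \<partial>lborel)"
    proof -
      have "(LINT z:open_half_space|lebesgue. U z powr p * \<phi> z) = (LINT z|lebesgue. h z * \<phi>' z)"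
        unfolding set_lebesgue_integral_def
        by (intro Bochner_Integration.integral_cong refl) (auto simp: h_def \<phi>'_def open_half_space_def closed_half_space_def split: split_indicator)
      also have "\<dots> = (\<integral>b. h b * \<phi>' b \<partial>lborel)" by (rule integral_lebesgue_eq_lborel) (use hm borel_measurable_phi' in \<open>rule borel_measurable_times\<close>)
      finally show ?thesis .
    qed
    have "(\<integral>z. U z * gS z \<partial>lborel) = (\<integral>z. w1 z * gS z \<partial>lborel) + (\<integral>z. w2 z * gS z \<partial>lborel)"
      unfolding Uw distrib_right by (rule Bochner_Integration.integral_add[OF part1(1) part2(1)])
    also have "(\<integral>z. w1 z * gS z \<partial>lborel) = (\<integral>y. u0 y * \<phi> (y, 0) \<partial>lborel)"
      unfolding part1(2) by (simp add: duality)
    also have "(\<integral>z. w2 z * gS z \<partial>lborel) = (\<integral>b. h b * \<phi>' b \<partial>lborel)"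
      unfolding part2(2)
    proof (intro Bochner_Integration.integral_cong refl)
      fix b :: "'a \<times> real"
      show "h b * (\<integral>z. Hk s ?\<kappa> (fst b) (snd b) z * gS z \<partial>lborel) = h b * \<phi>' b"
      proof (cases "snd b > 0")
        case True
        then show ?thesis using duality[of "snd b" "fst b"] phi'_eq[of "snd b" "fst b"] by simp
      qed (simp add: h_def)
    qed
    finally show ?thesis unfolding I1 I2 I3 by simp
  qed

  have lp: "U \<in> Lp_loc p closed_half_space"
    unfolding Lp_loc_def
  proof (intro CollectI conjI allI impI)
    have "U \<in> borel_measurable lebesgue" using Um by (auto intro!: measurable_completion)
    then show "U \<in> borel_measurable (lebesgue_on closed_half_space)" by (rule measurable_restrict_space1)
    fix Q :: "('a \<times> real) set" assume Q: "compact Q \<and> Q \<subseteq> closed_half_space"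
    have Qs: "Q \<in> sets borel" using Q by (auto intro: borel_closed compact_imp_closed)
    have "(\<lambda>z. indicator Q z *\<^sub>R \<bar>U z\<bar> powr p) \<in> borel_measurable borel" using Um Qs by measurable
    then have m1: "(\<lambda>z. indicator Q z *\<^sub>R \<bar>U z\<bar> powr p) \<in> borel_measurable lborel" by simp
    have "integrable lborel (\<lambda>z. indicator Q z *\<^sub>R \<bar>U z\<bar> powr p)"
    proof (rule Bochner_Integration.integrable_bound[OF _ m1])
      show "integrable lborel (\<lambda>z. (2 * B) powr p * indicator Q z)"
        using emeasure_compact_finite[of Q] Q Qs by (intro integrable_mult_right integrable_real_indicator) auto
      show "AE z in lborel. norm (indicator Q z *\<^sub>R \<bar>U z\<bar> powr p) \<le> norm ((2 * B) powr p * indicator Q z)"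
        using UB Un p B0 by (intro AE_I2) (auto intro!: powr_mono2 split: split_indicator)
    qed
    then show "set_integrable lebesgue Q (\<lambda>z. \<bar>U z\<bar> powr p)"
      unfolding set_integrable_def using integrable_completion[OF m1] by simp
  qed
  \<comment> \<open>The weight in the tail norm is at most 1, so the uniform bound \<open>A\<close>
    on the spatial integral suffices.\<close>
  have tail: "U \<in> Linf_tail s T" for T
  proof -
    have twm: "(\<lambda>x. tail_weighted s (\<lambda>x. U (x, t)) x) \<in> borel_measurable borel" for t
      unfolding tail_weighted_def by measurable
    have twb: "\<bar>tail_weighted s (\<lambda>x. U (x, t)) x\<bar> \<le> U (x, t)" for x t
    proof -
      have "U (x, t) / (1 + norm x powr (real DIM('a) + 2 * s)) \<le> U (x, t) / 1"
        by (intro divide_left_mono Un) (auto intro: add_pos_nonneg)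
      then show ?thesis using Un[of "(x, t)"] by (simp add: tail_weighted_def abs_divide)
    qed
    have twi: "integrable lborel (\<lambda>x. tail_weighted s (\<lambda>x. U (x, t)) x)" for t
      by (rule Bochner_Integration.integrable_bound[OF U1i[of t]]) (use twm twb Un in auto)
    have tn: "tail_norm s (\<lambda>x. U (x, t)) = (\<integral>x. tail_weighted s (\<lambda>x. U (x, t)) x \<partial>lborel)" for t
      unfolding tail_norm_def by (rule integral_lebesgue_eq_lborel[OF twm])
    have ts: "(\<lambda>x. U (x, t)) \<in> tail_space s" for t
    proof -
      have "(\<lambda>x. U (x, t)) \<in> borel_measurable lebesgue" using Ux[of t] by (auto intro!: measurable_completion)
      moreover have "integrable lebesgue (tail_weighted s (\<lambda>x. U (x, t)))"
        using integrable_completion[of "tail_weighted s (\<lambda>x. U (x, t))" lborel] twm[of t] twi[of t] by simp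
      ultimately show ?thesis unfolding tail_space_def by simp
    qed
    have tb: "\<bar>tail_norm s (\<lambda>x. U (x, t))\<bar> \<le> A" for t
    proof -
      have "\<bar>tail_norm s (\<lambda>x. U (x, t))\<bar> \<le> (\<integral>x. U (x, t) \<partial>lborel)"
        unfolding tn by (rule integral_abs_bound_integral[OF twi U1i]) (rule twb)
      then show ?thesis using U1I[of t] by linarith
    qed
    have "(\<lambda>t. \<integral>x. tail_weighted s (\<lambda>x. U (x, t)) x \<partial>lborel) \<in> borel_measurable borel"
    proof (rule lborel.borel_measurable_lebesgue_integral)
      show "(\<lambda>(t, x). tail_weighted s (\<lambda>x. U (x, t)) x) \<in> borel_measurable (borel \<Otimes>\<^sub>M lborel)"
        unfolding tail_weighted_def case_prod_beta' by measurable
    qed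
    then have "(\<lambda>t. tail_norm s (\<lambda>x. U (x, t))) \<in> borel_measurable lebesgue"
      unfolding tn by (auto intro!: measurable_completion)
    then have "(\<lambda>t. tail_norm s (\<lambda>x. U (x, t))) \<in> borel_measurable (lebesgue_on {0<..<T})" by (rule measurable_restrict_space1)
    then show ?thesis unfolding Linf_tail_def Linf_def using ts tb by auto
  qed
  have "very_weak_solution s p v0 U"
    unfolding very_weak_solution_def using Un lp tail weak by blast
  then show ?thesis by blast
qed

section \<open>Choice of the smallness constants\<close>

lemma min_power_integral_finite:
  fixes \<beta> :: real
  assumes "\<beta> > 1"
  shows "(\<integral>\<^sup>+t\<in>{0<..}. ennreal (min 1 (t powr (- \<beta>))) \<partial>lborel) < \<infinity>"
proof -
  have b: "integral\<^sup>N lborel (\<lambda>x. ennreal (indicator {1..} x * x powr (- \<beta>))) < \<infinity>"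
    using nn_integral_has_integral_lebesgue[OF _ has_integral_powr_to_inf[of "- \<beta>" 1]] assms by simp
  have "(\<integral>\<^sup>+t\<in>{0<..}. ennreal (min 1 (t powr (- \<beta>))) \<partial>lborel) \<le> (\<integral>\<^sup>+t. indicator {0..1} t + ennreal (indicator {1..} t * t powr (- \<beta>)) \<partial>lborel)"
  proof (intro nn_integral_mono)
    fix t :: real
    show "ennreal (min 1 (t powr (- \<beta>))) * indicator {0<..} t \<le> indicator {0..1} t + ennreal (indicator {1..} t * t powr (- \<beta>))"
    proof (cases "t > 0")
      case True
      show ?thesis
      proof (cases "t \<le> 1")
        case t1: True
        have "ennreal (min 1 (t powr (- \<beta>))) \<le> 1" by (subst ennreal_1[symmetric], intro ennreal_leI) simp
        then show ?thesis using True t1 by (simp add: add_increasing2)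
      next
        case False
        then show ?thesis using True by (auto intro!: ennreal_leI)
      qed
    qed simp
  qed
  also have "\<dots> < \<infinity>" using b by (subst nn_integral_add) auto
  finally show ?thesis .
qed

text \<open>The profile \<open>m\<close> joins two bounds on the heat flow: the supremum of the
  datum for small times, and \<open>hk_decay\<close> times its integral for large times. The
  resulting integrand decays with exponent \<open>\<alpha> * (p - 1)\<close>, which exceeds 1
  precisely above the threshold. The majorising kernel is taken at time 1.\<close>

theorem global_existence:
  fixes s p :: real
  assumes s: "0 < s" "s < 1" and p: "p > 1" and pN: "p > 1 + 2 * s / real DIM('a::euclidean_space)"
  shows "\<exists>\<delta>\<^sub>0>0. \<exists>\<tau>\<^sub>0>0. \<forall>u0 :: 'a \<Rightarrow> real.
              u0 \<in> Linf lebesgue \<and> (AE x in lebesgue. 0 \<le> u0 x) \<and>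
              (AE x in lebesgue. u0 x < \<delta>\<^sub>0 * heat_kernel s \<tau>\<^sub>0 x) \<longrightarrow>
              (\<exists>u. very_weak_solution s p u0 u)"
proof -
  let ?\<kappa> = "fkappa DIM('a) s"
  interpret K: frac_heat s ?\<kappa> by standard (use s fkappa_pos in auto)
  interpret H: frac_heat s 1 by standard (use s in auto)
  define \<alpha> where "\<alpha> = real DIM('a) / (2 * s)"
  obtain M where M: "M > 0" "\<And>t z. t > 0 \<Longrightarrow> hk s ?\<kappa> t (z::'a) \<le> M * t powr (- real DIM('a) / (2 * s))"
    using K.hk_decay by blast
  obtain M1 where M1: "M1 > 0" "\<And>t z. t > 0 \<Longrightarrow> hk s 1 t (z::'a) \<le> M1 * t powr (- real DIM('a) / (2 * s))"
    using H.hk_decay by blast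
  \<comment> \<open>Two kernels enter, with \<open>\<kappa> = 1\<close> bounding the datum and
    \<open>\<kappa> = fkappa\<close> propagating it; \<open>A\<close> covers both decay
    constants.\<close>
  define A where "A = max M M1"
  have A: "A > 0" "M \<le> A" "M1 \<le> A" using M by (auto simp: A_def)
  have \<alpha>: "\<alpha> > 0" using s by (simp add: \<alpha>_def)
  have \<beta>: "\<alpha> * (p - 1) > 1"
  proof -
    have "p - 1 > 2 * s / real DIM('a)" using pN by linarith
    then have "\<alpha> * (p - 1) > \<alpha> * (2 * s / real DIM('a))" using \<alpha> by (rule mult_strict_left_mono)
    also have "\<alpha> * (2 * s / real DIM('a)) = 1" using s by (simp add: \<alpha>_def)
    finally show ?thesis by simp
  qed
  let ?J = "\<integral>\<^sup>+t\<in>{0<..}. ennreal (min 1 (t powr (- (\<alpha> * (p - 1))))) \<partial>lborel"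
  \<comment> \<open>Adding 1 keeps \<open>J\<close> positive, as it becomes a denominator.\<close>
  define J where "J = enn2real ?J + 1"
  have J: "J > 0" "?J \<le> ennreal J"
  proof -
    show "J > 0" by (simp add: J_def add_nonneg_pos)
    have "?J = ennreal (enn2real ?J)" using min_power_integral_finite[OF \<beta>] by simp
    also have "\<dots> \<le> ennreal J" by (intro ennreal_leI) (simp add: J_def)
    finally show "?J \<le> ennreal J" .
  qed
  \<comment> \<open>Solves \<open>2 * (2 * \<delta> * A) powr (p - 1) * J = 1\<close>, so that the
    time integral in \<open>small\<close> is at most 1.\<close>
  define \<delta> where "\<delta> = (1 / (2 * J)) powr (1 / (p - 1)) / (2 * A)"
  have \<delta>: "\<delta> > 0" using J A by (simp add: \<delta>_def)
  have \<delta>2: "(2 * (\<delta> * A)) powr (p - 1) = 1 / (2 * J)"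
  proof -
    have "2 * (\<delta> * A) = (1 / (2 * J)) powr (1 / (p - 1))" using A by (simp add: \<delta>_def)
    then show ?thesis using p J by (simp add: powr_powr)
  qed
  define m where "m t = \<delta> * A * min 1 (t powr (- \<alpha>))" for t
  have mm [measurable]: "m \<in> borel_measurable borel" unfolding m_def[abs_def] by measurable
  have m0: "m t \<ge> 0" for t using \<delta> A by (simp add: m_def)
  have mB: "m t \<le> \<delta> * A" for t using \<delta> A by (simp add: m_def mult_left_le)
  have small: "(\<integral>\<^sup>+t\<in>{0<..}. ennreal (2 * (2 * m t) powr (p - 1)) \<partial>lborel) \<le> 1"
  proof -
    have eq: "2 * (2 * m t) powr (p - 1) = (1 / J) * min 1 (t powr (- (\<alpha> * (p - 1))))" if "t > 0" for t
    proof -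
      have "(2 * m t) powr (p - 1) = (2 * (\<delta> * A)) powr (p - 1) * min 1 (t powr (- \<alpha>)) powr (p - 1)"
        unfolding m_def by (subst powr_mult[symmetric]) (simp add: mult.assoc)
      also have "min 1 (t powr (- \<alpha>)) powr (p - 1) = min 1 (t powr (- (\<alpha> * (p - 1))))"
      proof (cases "t powr (- \<alpha>) \<le> 1")
        case True
        then have "(t powr (- \<alpha>)) powr (p - 1) \<le> 1" using p by (intro powr_le1) auto
        then show ?thesis using True by (simp add: powr_powr min_absorb2)
      next
        case False
        then have "(t powr (- \<alpha>)) powr (p - 1) \<ge> 1" using p ge_one_powr_ge_zero[of "t powr (- \<alpha>)" "p - 1"] by linarith
        then show ?thesis using False by (simp add: powr_powr min_absorb1)
      qed
      finally show ?thesis unfolding \<delta>2 using J by simp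
    qed
    have "(\<integral>\<^sup>+t\<in>{0<..}. ennreal (2 * (2 * m t) powr (p - 1)) \<partial>lborel) = (\<integral>\<^sup>+t. ennreal (1 / J) * (ennreal (min 1 (t powr (- (\<alpha> * (p - 1))))) * indicator {0<..} t) \<partial>lborel)"
    proof (intro nn_integral_cong)
      fix t :: real
      show "ennreal (2 * (2 * m t) powr (p - 1)) * indicator {0<..} t = ennreal (1 / J) * (ennreal (min 1 (t powr (- (\<alpha> * (p - 1))))) * indicator {0<..} t)"
      proof (cases "t > 0")
        case True
        show ?thesis unfolding eq[OF True] using J True by (subst ennreal_mult') auto
      qed simp
    qed
    also have "\<dots> = ennreal (1 / J) * ?J" by (rule nn_integral_cmult) measurable
    also have "\<dots> \<le> ennreal (1 / J) * ennreal J" by (intro mult_left_mono J) auto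
    also have "\<dots> = 1" using J by (subst ennreal_mult[symmetric]) auto
    finally show ?thesis .
  qed
  have "\<exists>u. very_weak_solution s p v0 u"
    if v0: "v0 \<in> Linf lebesgue" "AE x in lebesgue. 0 \<le> v0 x" "AE x in lebesgue. v0 x < \<delta> * heat_kernel s 1 x" for v0 :: "'a \<Rightarrow> real"
  proof -
    have v0m: "v0 \<in> borel_measurable (completion lborel)" using v0(1) by (simp add: Linf_def)
    obtain v' where v': "v' \<in> borel_measurable lborel" "AE x in lborel. v0 x = v' x"
      using completion_ex_borel_measurable_real[OF v0m] by blast
    \<comment> \<open>Clipping a Borel representative between its bounds makes them hold everywhere
      instead of almost everywhere.\<close>
    define u0 where "u0 x = max 0 (min (v' x) (\<delta> * hk s 1 1 x))" for x
    have u0m [measurable]: "u0 \<in> borel_measurable borel" using v'(1) unfolding u0_def[abs_def] by measurable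
    have u0n: "u0 x \<ge> 0" for x by (simp add: u0_def)
    have u0le: "u0 x \<le> \<delta> * hk s 1 1 x" for x using \<delta> H.hk_nonneg[of 1 x] by (simp add: u0_def)
    have u0i: "integrable lborel u0"
      by (rule Bochner_Integration.integrable_bound[OF integrable_mult_right[OF H.integrable_hk[of 1], of \<delta>]])
         (use u0n u0le in \<open>auto intro!: AE_I2 order_trans[OF _ abs_ge_self]\<close>)
    have u0I: "(\<integral>\<^sup>+x. ennreal (u0 x) \<partial>lborel) \<le> ennreal \<delta>"
    proof -
      have "(\<integral>\<^sup>+x. ennreal (u0 x) \<partial>lborel) \<le> (\<integral>\<^sup>+x. ennreal \<delta> * ennreal (hk s 1 1 (x::'a)) \<partial>lborel)"
        using u0le \<delta> by (intro nn_integral_mono) (simp add: ennreal_mult'[symmetric] ennreal_leI)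
      also have "\<dots> = ennreal \<delta>" by (subst nn_integral_cmult) (auto simp: H.nn_integral_hk)
      finally show ?thesis .
    qed
    have u0B: "u0 x \<le> \<delta> * A" for x
      using u0le[of x] M1(2)[of 1 x] A(3) \<delta> by (auto intro: order_trans mult_left_mono)
    have Vm: "heatV s ?\<kappa> u0 (x, t) \<le> ennreal (m t)" if t: "t > 0" for x t
    proof -
      have Veq: "heatV s ?\<kappa> u0 (x, t) = (\<integral>\<^sup>+y. ennreal (hk s ?\<kappa> t (x - y)) * ennreal (u0 y) \<partial>lborel)"
        using t by (simp add: heatV_def Hk_def)
      have "heatV s ?\<kappa> u0 (x, t) \<le> (\<integral>\<^sup>+y. ennreal (hk s ?\<kappa> t (x - y)) * ennreal (\<delta> * A) \<partial>lborel)"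
        unfolding Veq by (intro nn_integral_mono mult_left_mono ennreal_leI u0B) auto
      also have "\<dots> = ennreal (\<delta> * A)" using K.nn_integral_hk_diff'[OF t, of x] by (subst nn_integral_multc) auto
      finally have 1: "heatV s ?\<kappa> u0 (x, t) \<le> ennreal (\<delta> * A)" .
      have "heatV s ?\<kappa> u0 (x, t) \<le> (\<integral>\<^sup>+y. ennreal (A * t powr (- \<alpha>)) * ennreal (u0 y) \<partial>lborel)"
        unfolding Veq
      proof (intro nn_integral_mono mult_right_mono ennreal_leI)
        fix y
        have "hk s ?\<kappa> t (x - y) \<le> M * t powr (- \<alpha>)" using M(2)[OF t, of "x - y"] by (simp add: \<alpha>_def)
        also have "\<dots> \<le> A * t powr (- \<alpha>)" using A by (intro mult_right_mono) auto
        finally show "hk s ?\<kappa> t (x - y) \<le> A * t powr (- \<alpha>)" .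
      qed auto
      also have "\<dots> = ennreal (A * t powr (- \<alpha>)) * (\<integral>\<^sup>+y. ennreal (u0 y) \<partial>lborel)" by (rule nn_integral_cmult) measurable
      also have "\<dots> \<le> ennreal (A * t powr (- \<alpha>)) * ennreal \<delta>" by (intro mult_left_mono u0I) auto
      also have "\<dots> = ennreal (\<delta> * A * t powr (- \<alpha>))" using A \<delta> by (simp add: ennreal_mult[symmetric] mult_ac)
      finally have 2: "heatV s ?\<kappa> u0 (x, t) \<le> ennreal (\<delta> * A * t powr (- \<alpha>))" .
      show ?thesis unfolding m_def using 1 2 by (cases "t powr (- \<alpha>) \<le> 1") (auto simp: min_def)
    qed
    have ae: "AE x in lebesgue. v0 x = u0 x"
      using v0(2,3) AE_completion[OF v'(2)]
    proof eventually_elim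
      case (elim x)
      then show ?case using heat_kernel_eq_hk[OF s, of 1 x] by (simp add: u0_def)
    qed
    show ?thesis
      by (rule very_weak_solution_exists[OF s p u0m u0n u0i mm m0 mB Vm small ae]) (use v0(1) in \<open>simp_all add: Linf_def\<close>)
  qed
  then show ?thesis using \<delta> by (intro exI[of _ \<delta>] conjI exI[of _ 1]) auto
qed

section \<open>Smooth cut-offs\<close>

text \<open>For \<open>l > 0\<close> the derivative of \<open>flat l n\<close> is a combination of \<open>flat l (n + 2)\<close> and \<open>flat l (n + 1)\<close>, so all
  these functions are smooth.\<close>

definition flat :: "real \<Rightarrow> nat \<Rightarrow> real \<Rightarrow> real" where
  "flat l n r = (if r > 0 then exp (- (l / r)) / r ^ n else 0)"

lemma flat_nonneg [simp]: "flat l n r \<ge> 0"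
  by (simp add: flat_def)

text \<open>The term of order \<open>n + k\<close> in the series of \<open>exp (l / r)\<close> beats
  \<open>r ^ n\<close> with \<open>r ^ k\<close> to spare. The case \<open>k = 2\<close> gives
  differentiability at 0, the case \<open>k = 0\<close> boundedness.\<close>

lemma flat_le_power:
  assumes l: "l > 0"
  shows "flat l n r \<le> fact (n + k) / l ^ (n + k) * \<bar>r\<bar> ^ k"
proof (cases "r > 0")
  case True
  have "(l / r) ^ (n + k) \<le> fact (n + k) * exp (l / r)" using l True by (intro power_le_fact_exp) auto
  then have "l ^ (n + k) \<le> fact (n + k) * exp (l / r) * (r ^ n * r ^ k)"
    using True by (simp add: power_divide power_add field_simps)
  then have "l ^ (n + k) * exp (- (l / r)) \<le> fact (n + k) * exp (l / r) * (r ^ n * r ^ k) * exp (- (l / r))"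
    by (intro mult_right_mono) auto
  also have "\<dots> = fact (n + k) * (r ^ n * r ^ k)" by (simp add: exp_minus field_simps)
  finally show ?thesis using True l by (simp add: flat_def field_simps)
next
  case False
  have "0 \<le> fact (n + k) / l ^ (n + k) * \<bar>r\<bar> ^ k" using l by (intro mult_nonneg_nonneg) auto
  then show ?thesis using False by (simp add: flat_def)
qed

lemma flat_deriv:
  assumes l: "l > 0"
  shows "(flat l n has_real_derivative - real n * flat l (n + 1) r + l * flat l (n + 2) r) (at r)"
proof (cases r "0::real" rule: linorder_cases)
  case less
  have "((\<lambda>_. 0) has_real_derivative 0) (at r)" by simp
  then have "(flat l n has_real_derivative 0) (at r)"
    by (rule has_field_derivative_transform_within_open[of _ _ _ "{..<0}"]) (use less in \<open>auto simp: flat_def\<close>)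
  then show ?thesis using less by (simp add: flat_def)
next
  \<comment> \<open>Flatness to second order makes the difference quotient of size
    \<open>\<bar>h\<bar>\<close>, so the derivative at 0 is 0.\<close>
  case equal
  have "((\<lambda>h. (flat l n (r + h) - flat l n r) / h) \<longlongrightarrow> 0) (at 0)"
  proof (rule tendsto_rabs_zero_cancel, rule tendsto_sandwich[where f="\<lambda>_. 0"])
    let ?C = "fact (n + 2) / l ^ (n + 2)"
    show "eventually (\<lambda>h. \<bar>(flat l n (r + h) - flat l n r) / h\<bar> \<le> ?C * \<bar>h\<bar>) (at 0)"
    proof (rule always_eventually, rule allI)
      fix h :: real
      show "\<bar>(flat l n (r + h) - flat l n r) / h\<bar> \<le> ?C * \<bar>h\<bar>"
      proof (cases "h = 0")
        case False
        have "\<bar>(flat l n (r + h) - flat l n r) / h\<bar> = flat l n h / \<bar>h\<bar>"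
          using equal by (simp add: flat_def abs_divide)
        also have "\<dots> \<le> ?C * \<bar>h\<bar>"
        proof -
          have "flat l n h \<le> ?C * \<bar>h\<bar> * \<bar>h\<bar>"
            using flat_le_power[OF l, of n h 2] by (simp only: power2_eq_square mult.assoc)
          then show ?thesis using False by (subst pos_divide_le_eq) auto
        qed
        finally show ?thesis .
      qed simp
    qed
    have "((\<lambda>h. ?C * \<bar>h\<bar>) \<longlongrightarrow> ?C * \<bar>0\<bar>) (at 0)" by (intro tendsto_intros)
    then show "((\<lambda>h. ?C * \<bar>h\<bar>) \<longlongrightarrow> 0) (at 0)" by simp
  qed auto
  then show ?thesis using equal by (simp add: has_field_derivative_iff flat_def)
next
  case greater
  have "((\<lambda>r. exp (- (l / r)) / r ^ n) has_real_derivative - real n * flat l (n + 1) r + l * flat l (n + 2) r) (at r)"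
    using greater by (auto intro!: derivative_eq_intros simp: flat_def field_simps power2_eq_square power_diff)
       (cases n; simp add: field_simps)
  then show ?thesis
    by (rule has_field_derivative_transform_within_open[of _ _ _ "{0<..}"]) (use greater in \<open>auto simp: flat_def\<close>)
qed

lemma flat_le_1: "l \<ge> 0 \<Longrightarrow> flat l 0 r \<le> 1"
  by (simp add: flat_def)

lemma flat_power: "k > 0 \<Longrightarrow> flat (real k) 0 r = flat 1 0 r ^ k"
  by (simp add: flat_def exp_of_nat_mult[symmetric])

text \<open>This exhibits the time derivative of a \<open>k\<close>-th power as the
  \<open>(k - 1)\<close>-st power times a bounded factor, the form that Young's inequality can
  absorb.\<close>

lemma flat_power2: "k > 0 \<Longrightarrow> flat (real k) 2 r = flat 1 0 r ^ (k - 1) * flat 1 2 r"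
proof -
  assume k: "k > 0"
  have "exp (- (real k / r)) = exp (- (1 / r)) ^ (k - 1) * exp (- (1 / r))"
    using k by (simp add: exp_of_nat_mult[symmetric] exp_add[symmetric] of_nat_diff field_simps add_divide_distrib[symmetric] diff_divide_distrib)
  then show ?thesis by (simp add: flat_def)
qed

section \<open>Smoothness of the cut-offs\<close>

lemma Ck_on_const: "Ck_on k A (\<lambda>z. c)"
proof (induction k arbitrary: c)
  case (Suc k)
  show ?case unfolding Ck_on.simps by (intro exI[of _ "\<lambda>z h. 0"]) (auto intro: Suc)
qed auto

lemma Ck_on_add: "Ck_on k A f \<Longrightarrow> Ck_on k A g \<Longrightarrow> Ck_on k A (\<lambda>z. f z + g z)"
proof (induction k arbitrary: f g)
  case 0
  then show ?case by (auto intro: continuous_intros)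
next
  case (Suc k)
  from Suc.prems obtain f' g' where f: "\<forall>z\<in>A. (f has_derivative f' z) (at z within A)" "\<forall>h. Ck_on k A (\<lambda>z. f' z h)"
    and g: "\<forall>z\<in>A. (g has_derivative g' z) (at z within A)" "\<forall>h. Ck_on k A (\<lambda>z. g' z h)" by auto
  show ?case unfolding Ck_on.simps
    by (intro exI[of _ "\<lambda>z h. f' z h + g' z h"]) (use f g Suc.IH in \<open>auto intro!: has_derivative_add\<close>)
qed

lemma Ck_on_Suc_imp: "Ck_on (Suc k) A f \<Longrightarrow> Ck_on k A f"
proof (induction k arbitrary: f)
  case 0
  then show ?case by (auto simp: continuous_on_eq_continuous_within intro: has_derivative_continuous)
next
  case (Suc k)
  from Suc.prems obtain f' where f: "\<forall>z\<in>A. (f has_derivative f' z) (at z within A)" "\<forall>h. Ck_on (Suc k) A (\<lambda>z. f' z h)"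
    unfolding Ck_on.simps(2)[of "Suc k"] by blast
  show ?case unfolding Ck_on.simps(2)[of k] using f Suc.IH by blast
qed

lemma Ck_on_mult: "Ck_on k A f \<Longrightarrow> Ck_on k A g \<Longrightarrow> Ck_on k A (\<lambda>z. f z * g z)"
proof (induction k arbitrary: f g)
  case 0
  then show ?case by (auto intro: continuous_intros)
next
  case (Suc k)
  from Suc.prems obtain f' g' where f: "\<forall>z\<in>A. (f has_derivative f' z) (at z within A)" "\<forall>h. Ck_on k A (\<lambda>z. f' z h)"
    and g: "\<forall>z\<in>A. (g has_derivative g' z) (at z within A)" "\<forall>h. Ck_on k A (\<lambda>z. g' z h)" by auto
  have fg: "Ck_on k A f" "Ck_on k A g" using Suc.prems Ck_on_Suc_imp by blast+
  show ?case unfolding Ck_on.simps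
  proof (intro exI[of _ "\<lambda>z h. f z * g' z h + f' z h * g z"] conjI ballI allI)
    show "((\<lambda>z. f z * g z) has_derivative (\<lambda>h. f z * g' z h + f' z h * g z)) (at z within A)" if "z \<in> A" for z
      using f g that by (intro has_derivative_mult) auto
    show "Ck_on k A (\<lambda>z. f z * g' z h + f' z h * g z)" for h
      using f(2) g(2) fg Suc.IH by (intro Ck_on_add) auto
  qed
qed

lemma Ck_on_bounded_linear: "bounded_linear f \<Longrightarrow> Ck_on k A f"
proof (cases k)
  case 0
  assume "bounded_linear f"
  then show ?thesis using 0 by (simp add: linear_continuous_on)
next
  case (Suc j)
  assume "bounded_linear f"
  then have "\<forall>z\<in>A. (f has_derivative f) (at z within A)" by (auto intro: bounded_linear_imp_has_derivative)
  then show ?thesis unfolding Suc Ck_on.simps by (intro exI[of _ "\<lambda>z h. f h"] conjI allI Ck_on_const)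
qed

text \<open>The induction covers all \<open>n\<close> at once, because each derivative raises
  \<open>n\<close>. \<open>L\<close> will be the projection to space or to time, and
  \<open>a\<close> the inverse square of radius or height.\<close>

lemma Ck_on_flat:
  fixes L :: "'b::euclidean_space \<Rightarrow> 'c::euclidean_space"
  assumes L: "bounded_linear L" and l: "l > 0"
  shows "Ck_on k A (\<lambda>z. flat l n (1 - a * (L z \<bullet> L z)))"
proof (induction k arbitrary: n)
  case 0
  have "continuous_on UNIV (flat l n)"
    using flat_deriv[OF l] by (intro continuous_at_imp_continuous_on ballI DERIV_isCont) auto
  moreover have "continuous_on A (\<lambda>z. 1 - a * (L z \<bullet> L z))"
    by (intro continuous_intros linear_continuous_on[OF L])
  ultimately show ?case unfolding Ck_on.simps by (rule continuous_on_compose2) auto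
next
  case (Suc k)
  let ?q = "\<lambda>z. 1 - a * (L z \<bullet> L z)"
  let ?d = "\<lambda>z. - real n * flat l (n + 1) (?q z) + l * flat l (n + 2) (?q z)"
  show ?case unfolding Ck_on.simps
  proof (intro exI[of _ "\<lambda>z h. ?d z * (- 2 * a * (L z \<bullet> L h))"] conjI ballI allI)
    fix z
    have q: "(?q has_derivative (\<lambda>h. - 2 * a * (L z \<bullet> L h))) (at z within A)"
      by (auto intro!: derivative_eq_intros bounded_linear.has_derivative[OF L] simp: inner_commute algebra_simps)
    have "(flat l n has_derivative (\<lambda>h. ?d z * h)) (at (?q z))"
      using flat_deriv[OF l, of n "?q z"] by (simp add: has_field_derivative_def)
    from has_derivative_compose[OF q this]
    show "((\<lambda>z. flat l n (?q z)) has_derivative (\<lambda>h. ?d z * (- 2 * a * (L z \<bullet> L h)))) (at z within A)" .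
  next
    fix h
    have "bounded_linear (\<lambda>z. - 2 * a * (L z \<bullet> L h))"
      by (intro bounded_linear_compose[OF bounded_linear_mult_right] bounded_linear_compose[OF bounded_linear_inner_left L])
    then show "Ck_on k A (\<lambda>z. ?d z * (- 2 * a * (L z \<bullet> L h)))"
      by (intro Ck_on_mult Ck_on_add Ck_on_const Suc Ck_on_bounded_linear)
  qed
qed

text \<open>A cut-off to \<open>|x| < \<rho>\<close>, \<open>|t| < T\<close>, and the \<open>k\<close>-th power of the one with exponent \<open>1\<close>.\<close>

definition tfun :: "nat \<Rightarrow> real \<Rightarrow> real \<Rightarrow> 'a::euclidean_space \<times> real \<Rightarrow> real" where
  "tfun k \<rho> T z = flat (real k) 0 (1 - (norm (fst z) / \<rho>)\<^sup>2) * flat (real k) 0 (1 - (snd z / T)\<^sup>2)"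

lemma tfun_test_function:
  assumes k: "k > 0" and \<rho>: "\<rho> > 0" and T: "T > 0"
  shows "(tfun k \<rho> T :: 'a::euclidean_space \<times> real \<Rightarrow> real) \<in> test_functions"
proof -
  have eq: "tfun k \<rho> T = (\<lambda>z::'a \<times> real. flat (real k) 0 (1 - (1 / \<rho>\<^sup>2) * (fst z \<bullet> fst z)) * flat (real k) 0 (1 - (1 / T\<^sup>2) * (snd z \<bullet> snd z)))"
  proof
    fix z :: "'a \<times> real"
    have "(norm (fst z) / \<rho>)\<^sup>2 = (1 / \<rho>\<^sup>2) * (fst z \<bullet> fst z)" by (simp add: power_divide power2_norm_eq_inner)
    moreover have "(snd z / T)\<^sup>2 = (1 / T\<^sup>2) * (snd z \<bullet> snd z)" by (simp add: power_divide power2_eq_square)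
    ultimately show "tfun k \<rho> T z = flat (real k) 0 (1 - (1 / \<rho>\<^sup>2) * (fst z \<bullet> fst z)) * flat (real k) 0 (1 - (1 / T\<^sup>2) * (snd z \<bullet> snd z))"
      by (simp only: tfun_def)
  qed
  have "smooth_on closed_half_space (tfun k \<rho> T :: 'a \<times> real \<Rightarrow> real)"
    unfolding smooth_on_def eq using k
    by (intro allI Ck_on_mult Ck_on_flat bounded_linear_fst bounded_linear_snd) auto
  moreover have "tfun k \<rho> T z = 0" if z: "z \<in> closed_half_space - ball 0 \<rho> \<times> {0..<T}" for z :: "'a \<times> real"
  proof -
    have "norm (fst z) \<ge> \<rho> \<or> snd z \<ge> T" using z by (cases z) (auto simp: closed_half_space_def)
    then show ?thesis
    proof
      assume "norm (fst z) \<ge> \<rho>"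
      then have "(norm (fst z) / \<rho>)\<^sup>2 \<ge> 1" using \<rho> by (simp add: one_le_power)
      then show ?thesis by (simp add: tfun_def flat_def)
    next
      assume "snd z \<ge> T"
      then have "(snd z / T)\<^sup>2 \<ge> 1" using T by (simp add: one_le_power)
      then show ?thesis by (simp add: tfun_def flat_def)
    qed
  qed
  ultimately show ?thesis unfolding test_functions_def using \<rho> T by blast
qed

text \<open>At time 0 the test function \<open>tfun 1 1 1\<close> is \<open>exp (-1)\<close> times
  this profile, so the bound on its second differences is already available.\<close>

lemma bump_second_diff:
  obtains K where "K \<ge> 0"
    "\<And>x z :: 'a::euclidean_space. \<bar>flat 1 0 (1 - (norm (x + z))\<^sup>2) + flat 1 0 (1 - (norm (x - z))\<^sup>2) - 2 * flat 1 0 (1 - (norm x)\<^sup>2)\<bar> \<le> K * min 1 ((norm z)\<^sup>2)"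
proof -
  have "(tfun 1 1 1 :: 'a \<times> real \<Rightarrow> real) \<in> test_functions" by (rule tfun_test_function) auto
  then obtain r T K where "test_fn (tfun 1 1 1 :: 'a \<times> real \<Rightarrow> real) r T K" using test_functions_imp_test_fn by blast
  then interpret test_fn "tfun 1 1 1 :: 'a \<times> real \<Rightarrow> real" r T K .
  let ?W = "\<lambda>x::'a. flat 1 0 (1 - (norm x)\<^sup>2)"
  let ?e = "exp (-1) :: real"
  have eq: "tfun 1 1 1 (x, 0) = ?e * ?W x" for x :: 'a by (simp add: tfun_def flat_def)
  have "\<bar>?W (x + z) + ?W (x - z) - 2 * ?W x\<bar> \<le> (K / ?e) * min 1 ((norm z)\<^sup>2)" for x z :: 'a
  proof -
    have "\<bar>?e * ?W (x + z) + ?e * ?W (x - z) - 2 * (?e * ?W x)\<bar> \<le> K * min 1 ((norm z)\<^sup>2)"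
      using bump.diff2[OF bump[of 0], of x z] unfolding eq by simp
    moreover have "?e * ?W (x + z) + ?e * ?W (x - z) - 2 * (?e * ?W x) = ?e * (?W (x + z) + ?W (x - z) - 2 * ?W x)"
      by (simp add: algebra_simps)
    ultimately have "?e * \<bar>?W (x + z) + ?W (x - z) - 2 * ?W x\<bar> \<le> K * min 1 ((norm z)\<^sup>2)" by (simp add: abs_mult)
    then show ?thesis by (simp add: field_simps)
  qed
  moreover have "K / ?e \<ge> 0" using bump.K[OF bump[of 0]] by simp
  ultimately show thesis using that by blast
qed

text \<open>Convexity: the graph of the power lies above its tangent at \<open>a\<close>, whichever
  of \<open>a\<close> and \<open>b\<close> is larger.\<close>

lemma power_diff_le:
  fixes a b :: real
  assumes "a \<ge> 0" "b \<ge> 0"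
  shows "a ^ k - b ^ k \<le> real k * a ^ (k - 1) * (a - b)"
proof (cases "a = b")
  case False
  show ?thesis
  proof (cases k)
    case (Suc j)
    have "a ^ Suc j - b ^ Suc j = (a - b) * (\<Sum>i<Suc j. a ^ i * b ^ (j - i))"
      by (subst power_diff_sumr2) (simp add: lessThan_Suc_atMost algebra_simps sum_distrib_left)
    also have "\<dots> \<le> (a - b) * (\<Sum>i<Suc j. a ^ j)"
    proof (cases "a \<ge> b")
      case True
      have "a ^ i * b ^ (j - i) \<le> a ^ j" if "i < Suc j" for i
      proof -
        have "a ^ i * b ^ (j - i) \<le> a ^ i * a ^ (j - i)" using assms True by (intro mult_left_mono power_mono) auto
        also have "\<dots> = a ^ j" using that by (simp add: power_add[symmetric])
        finally show ?thesis .
      qed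
      then show ?thesis using True by (intro mult_left_mono sum_mono) auto
    next
      case False
      have "a ^ j \<le> a ^ i * b ^ (j - i)" if "i < Suc j" for i
      proof -
        have "a ^ j = a ^ i * a ^ (j - i)" using that by (simp add: power_add[symmetric])
        also have "\<dots> \<le> a ^ i * b ^ (j - i)" using assms False by (intro mult_left_mono power_mono) auto
        finally show ?thesis .
      qed
      then show ?thesis using False by (intro mult_left_mono_neg sum_mono) auto
    qed
    also have "\<dots> = real (Suc j) * a ^ j * (a - b)" by simp
    finally show ?thesis using Suc by simp
  qed simp
qed simp

text \<open>\<open>levy\<close> is homogeneous of degree \<open>- (N + 2 * s)\<close> and the
  substitution contributes \<open>N\<close>; what remains is the scaling of the fractional
  Laplacian.\<close>

lemma levy_scaled:
  fixes s \<rho> :: real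
  assumes s: "0 < s" "s < 1" and \<rho>: "\<rho> > 0"
  shows "(\<integral>z. min 1 ((norm (z::'a::euclidean_space) / \<rho>)\<^sup>2) * levy s z \<partial>lborel) = \<rho> powr (- 2 * s) * (\<integral>z. min 1 ((norm (z::'a))\<^sup>2) * levy s z \<partial>lborel)"
proof -
  have l: "levy s (\<rho> *\<^sub>R z) = \<rho> powr (- (real DIM('a) + 2 * s)) * levy s z" for z :: 'a
  proof -
    have "levy s (\<rho> *\<^sub>R z) = 1 / \<rho> powr (real DIM('a) + 2 * s) * levy s z" using \<rho> by (simp add: levy_def powr_mult)
    then show ?thesis by (simp only: powr_minus_divide)
  qed
  have "(\<integral>z. min 1 ((norm (z::'a) / \<rho>)\<^sup>2) * levy s z \<partial>lborel) = \<bar>\<rho>\<bar> ^ DIM('a) * (\<integral>z. min 1 ((norm (0 + \<rho> *\<^sub>R z :: 'a) / \<rho>)\<^sup>2) * levy s (0 + \<rho> *\<^sub>R z) \<partial>lborel)"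
    using \<rho> by (intro integral_lborel_affine) auto
  also have "(\<integral>z. min 1 ((norm (0 + \<rho> *\<^sub>R z :: 'a) / \<rho>)\<^sup>2) * levy s (0 + \<rho> *\<^sub>R z) \<partial>lborel)
     = (\<integral>z. \<rho> powr (- (real DIM('a) + 2 * s)) * (min 1 ((norm (z::'a))\<^sup>2) * levy s z) \<partial>lborel)"
    using \<rho> by (intro Bochner_Integration.integral_cong refl) (simp add: l)
  also have "\<dots> = \<rho> powr (- (real DIM('a) + 2 * s)) * (\<integral>z. min 1 ((norm (z::'a))\<^sup>2) * levy s z \<partial>lborel)"
    by (rule integral_mult_right_zero)
  also have "\<bar>\<rho>\<bar> ^ DIM('a) = \<rho> powr (real DIM('a))" using \<rho> by (simp add: powr_realpow)
  also have "\<rho> powr (real DIM('a)) * (\<rho> powr (- (real DIM('a) + 2 * s)) * (\<integral>z. min 1 ((norm (z::'a))\<^sup>2) * levy s z \<partial>lborel))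
     = \<rho> powr (- 2 * s) * (\<integral>z. min 1 ((norm (z::'a))\<^sup>2) * levy s z \<partial>lborel)"
    by (simp only: mult.assoc[symmetric] powr_add[symmetric]) simp
  finally show ?thesis .
qed

text \<open>Convexity of \<open>t \<mapsto> t\<^sup>k\<close> bounds the operator on a \<open>k\<close>-th power from above, without nonlocal
  tails; since the solution is nonnegative, no lower bound is needed.\<close>

lemma tfun_operator_bound:
  fixes s :: real
  assumes s: "0 < s" "s < 1"
  obtains C where "C \<ge> 0" "\<And>k \<rho> T (x::'a::euclidean_space) t. k > 0 \<Longrightarrow> \<rho> \<ge> 1 \<Longrightarrow> T > 0 \<Longrightarrow> t > 0 \<Longrightarrow>
    - time_deriv (tfun k \<rho> T) (x, t) + mixed_op s (tfun k \<rho> T) (x, t)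
     \<le> real k * (flat 1 0 (1 - (norm x / \<rho>)\<^sup>2) * flat 1 0 (1 - (t / T)\<^sup>2)) ^ (k - 1) *
       (flat 1 2 (1 - (t / T)\<^sup>2) * (2 * t / T) / T + C * \<rho> powr (- 2 * s))"
proof -
  obtain K where K: "K \<ge> 0" "\<And>x z :: 'a. \<bar>flat 1 0 (1 - (norm (x + z))\<^sup>2) + flat 1 0 (1 - (norm (x - z))\<^sup>2) - 2 * flat 1 0 (1 - (norm x)\<^sup>2)\<bar> \<le> K * min 1 ((norm z)\<^sup>2)"
    using bump_second_diff[where ?'a='a] by blast
  let ?I = "\<integral>z. min 1 ((norm z)\<^sup>2) * levy s (z::'a) \<partial>lborel"
  let ?c = "frac_laplacian_const DIM('a) s"
  have c0: "?c > 0" by (rule frac_laplacian_const_pos[OF s])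
  have I0: "?I \<ge> 0" by (intro Bochner_Integration.integral_nonneg mult_nonneg_nonneg) auto
  define C where "C = K * (real DIM('a) + ?c / 2 * ?I)"
  have C: "C \<ge> 0" using K c0 I0 by (simp add: C_def)
  show thesis
  proof (rule that[OF C])
    fix k :: nat and \<rho> T t :: real and x :: 'a
    assume k: "k > 0" and \<rho>: "\<rho> \<ge> 1" and Tp: "T > 0" and t: "t > 0"
    let ?\<phi> = "tfun k \<rho> T :: 'a \<times> real \<Rightarrow> real"
    have "?\<phi> \<in> test_functions" using k \<rho> Tp by (intro tfun_test_function) auto
    then obtain r T' K' where "test_fn ?\<phi> r T' K'" using test_functions_imp_test_fn by blast
    then interpret test_fn ?\<phi> r T' K' .
    interpret B: bump "\<lambda>x. ?\<phi> (x, t)" r K' using bump t by simp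
    define W where "W y = flat 1 0 (1 - (norm y / \<rho>)\<^sup>2)" for y :: 'a
    define E where "E = flat 1 0 (1 - (t / T)\<^sup>2)"
    define P where "P = W x * E"
    have W: "0 \<le> W y" "W y \<le> 1" for y by (simp_all add: W_def flat_le_1)
    have E: "0 \<le> E" "E \<le> 1" by (simp_all add: E_def flat_le_1)
    have \<phi>: "?\<phi> (y, t) = W y ^ k * E ^ k" for y using flat_power[OF k] by (simp add: tfun_def W_def E_def)
    have Wd: "2 * W x - W (x + z) - W (x - z) \<le> K * min 1 ((norm z / \<rho>)\<^sup>2)" for z
    proof -
      have "norm y / \<rho> = norm (y /\<^sub>R \<rho>)" for y :: 'a using \<rho> by (simp add: divide_inverse mult.commute)
      then show ?thesis using K(2)[of "x /\<^sub>R \<rho>" "z /\<^sub>R \<rho>"] unfolding W_def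
        by (simp add: scaleR_add_right[symmetric] scaleR_diff_right[symmetric] abs_le_iff)
    qed
    \<comment> \<open>A surplus factor \<open>E \<le> 1\<close> is dropped so that the spatial and
      the time terms carry the same power of \<open>P\<close>.\<close>
    have EP: "W x ^ (k - 1) * E ^ k \<le> P ^ (k - 1)"
    proof -
      have "E ^ k \<le> E ^ (k - 1)" using E by (intro power_decreasing) auto
      then have "W x ^ (k - 1) * E ^ k \<le> W x ^ (k - 1) * E ^ (k - 1)" using W by (intro mult_left_mono) auto
      then show ?thesis by (simp add: P_def power_mult_distrib)
    qed
    \<comment> \<open>\<open>power_diff_le\<close> is used at \<open>x + z\<close> and at
      \<open>x - z\<close> with the same tangent slope, so the second difference of the power is
      bounded by that of \<open>W\<close>.\<close>
    have d2: "2 * ?\<phi> (x, t) - ?\<phi> (x + z, t) - ?\<phi> (x - z, t) \<le> real k * P ^ (k - 1) * K * min 1 ((norm z / \<rho>)\<^sup>2)" for z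
    proof -
      have "2 * W x ^ k - W (x + z) ^ k - W (x - z) ^ k \<le> real k * W x ^ (k - 1) * (W x - W (x + z)) + real k * W x ^ (k - 1) * (W x - W (x - z))"
        using power_diff_le[OF W(1)[of x] W(1)[of "x + z"], of k] power_diff_le[OF W(1)[of x] W(1)[of "x - z"], of k] by linarith
      also have "\<dots> = real k * W x ^ (k - 1) * (2 * W x - W (x + z) - W (x - z))" by (simp add: algebra_simps)
      also have "\<dots> \<le> real k * W x ^ (k - 1) * (K * min 1 ((norm z / \<rho>)\<^sup>2))" using W by (intro mult_left_mono Wd) auto
      finally have "(2 * W x ^ k - W (x + z) ^ k - W (x - z) ^ k) * E ^ k \<le> real k * W x ^ (k - 1) * (K * min 1 ((norm z / \<rho>)\<^sup>2)) * E ^ k"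
        using E by (intro mult_right_mono) auto
      also have "\<dots> = (W x ^ (k - 1) * E ^ k) * (real k * K * min 1 ((norm z / \<rho>)\<^sup>2))" by (simp only: mult_ac)
      also have "\<dots> \<le> P ^ (k - 1) * (real k * K * min 1 ((norm z / \<rho>)\<^sup>2))"
        using K by (intro mult_right_mono EP mult_nonneg_nonneg) auto
      finally show ?thesis unfolding \<phi> by (simp add: algebra_simps)
    qed
    have P0: "P \<ge> 0" using W E by (simp add: P_def)
    let ?Q = "real k * P ^ (k - 1) * K"
    have Q0: "?Q \<ge> 0" using P0 K by simp
    have lapb: "- laplacian (\<lambda>x. ?\<phi> (x, t)) x \<le> ?Q * real DIM('a) * \<rho> powr (- 2 * s)"
    proof (rule LIMSEQ_le_const2[OF tendsto_minus[OF B.lap]])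
      have "- dsum n (\<lambda>x. ?\<phi> (x, t)) x \<le> ?Q * real DIM('a) * \<rho> powr (- 2 * s)" for n
      proof -
        have "- dsum n (\<lambda>x. ?\<phi> (x, t)) x = (\<Sum>b\<in>Basis. (2 * ?\<phi> (x, t) - ?\<phi> (x + (1 / (real n + 1)) *\<^sub>R b, t) - ?\<phi> (x - (1 / (real n + 1)) *\<^sub>R b, t)) * (real n + 1)\<^sup>2)"
          unfolding dsum_def sum_negf[symmetric] by (intro sum.cong refl) (simp add: algebra_simps)
        also have "\<dots> \<le> (\<Sum>b\<in>(Basis::'a set). ?Q * \<rho> powr (- 2 * s))"
        proof (intro sum_mono)
          fix b :: 'a assume b: "b \<in> Basis"
          let ?z = "(1 / (real n + 1)) *\<^sub>R b"
          have "(2 * ?\<phi> (x, t) - ?\<phi> (x + ?z, t) - ?\<phi> (x - ?z, t)) * (real n + 1)\<^sup>2 \<le> ?Q * min 1 ((norm ?z / \<rho>)\<^sup>2) * (real n + 1)\<^sup>2"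
            by (intro mult_right_mono d2) auto
          also have "\<dots> \<le> ?Q * (norm ?z / \<rho>)\<^sup>2 * (real n + 1)\<^sup>2" using Q0 by (intro mult_right_mono mult_left_mono) auto
          also have "(norm ?z / \<rho>)\<^sup>2 = 1 / ((real n + 1)\<^sup>2 * \<rho>\<^sup>2)" using b by (simp add: power_divide power_mult_distrib)
          also have "?Q * (1 / ((real n + 1)\<^sup>2 * \<rho>\<^sup>2)) * (real n + 1)\<^sup>2 = ?Q * (1 / \<rho>\<^sup>2)" by (simp add: add_nonneg_eq_0_iff)
          \<comment> \<open>Here \<open>\<rho> \<ge> 1\<close> enters: at large scales the Laplacian
            is the weaker part and is absorbed into the fractional rate.\<close>
          also have "\<dots> \<le> ?Q * \<rho> powr (- 2 * s)"
          proof (intro mult_left_mono Q0)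
            have "1 / \<rho>\<^sup>2 = \<rho> powr (- 2)" using \<rho> by (simp add: powr_minus_divide powr_numeral)
            also have "\<dots> \<le> \<rho> powr (- 2 * s)" using \<rho> s by (intro powr_mono) auto
            finally show "1 / \<rho>\<^sup>2 \<le> \<rho> powr (- 2 * s)" .
          qed
          finally show "(2 * ?\<phi> (x, t) - ?\<phi> (x + ?z, t) - ?\<phi> (x - ?z, t)) * (real n + 1)\<^sup>2 \<le> ?Q * \<rho> powr (- 2 * s)" .
        qed
        also have "\<dots> = ?Q * real DIM('a) * \<rho> powr (- 2 * s)" by simp
        finally show ?thesis .
      qed
      then show "\<exists>N. \<forall>n\<ge>N. - dsum n (\<lambda>x. ?\<phi> (x, t)) x \<le> ?Q * real DIM('a) * \<rho> powr (- 2 * s)" by blast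
    qed
    have fracb: "frac_laplacian s (\<lambda>x. ?\<phi> (x, t)) x \<le> ?Q * (?c / 2 * ?I) * \<rho> powr (- 2 * s)"
    proof -
      have i: "integrable lborel (\<lambda>z::'a. min 1 ((norm z / \<rho>)\<^sup>2) * levy s z)"
      proof (rule Bochner_Integration.integrable_bound[OF integrable_levy_min[OF s, where ?'a='a]])
        show "AE z in lborel. norm (min 1 ((norm z / \<rho>)\<^sup>2) * levy s z) \<le> norm (min 1 ((norm (z::'a))\<^sup>2) * levy s z)"
        proof (rule AE_I2)
          fix z :: 'a
          have "norm z / \<rho> \<le> norm z" using \<rho> by (simp add: divide_le_eq mult_le_cancel_left1)
          then have "(norm z / \<rho>)\<^sup>2 \<le> (norm z)\<^sup>2" using \<rho> by (intro power_mono) auto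
          then show "norm (min 1 ((norm z / \<rho>)\<^sup>2) * levy s z) \<le> norm (min 1 ((norm z)\<^sup>2) * levy s z)"
            by (auto simp: abs_mult intro!: mult_right_mono)
        qed
      qed measurable
      have "(\<integral>z. (2 * ?\<phi> (x, t) - ?\<phi> (x + z, t) - ?\<phi> (x - z, t)) * levy s z \<partial>lborel) \<le> (\<integral>z. ?Q * (min 1 ((norm z / \<rho>)\<^sup>2) * levy s (z::'a)) \<partial>lborel)"
      proof (intro integral_mono B.integrable_diff2_levy[OF s] integrable_mult_right i)
        fix z :: 'a
        show "(2 * ?\<phi> (x, t) - ?\<phi> (x + z, t) - ?\<phi> (x - z, t)) * levy s z \<le> ?Q * (min 1 ((norm z / \<rho>)\<^sup>2) * levy s z)"
          using mult_right_mono[OF d2 levy_nonneg, of z s z] by (simp only: mult.assoc)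
      qed
      also have "\<dots> = ?Q * (\<rho> powr (- 2 * s) * ?I)"
        using \<rho> by (simp only: integral_mult_right_zero) (subst levy_scaled[OF s], auto)
      finally have "?c / 2 * (\<integral>z. (2 * ?\<phi> (x, t) - ?\<phi> (x + z, t) - ?\<phi> (x - z, t)) * levy s z \<partial>lborel) \<le> ?c / 2 * (?Q * (\<rho> powr (- 2 * s) * ?I))"
        using c0 by (intro mult_left_mono) auto
      then show ?thesis unfolding B.frac_laplacian_eq[OF s] by (simp only: mult_ac)
    qed
    have td: "time_deriv ?\<phi> (x, t) = W x ^ k * (real k * flat (real k) 2 (1 - (t / T)\<^sup>2) * (- (2 * t / T) / T))"
    proof -
      have "((\<lambda>\<tau>. 1 - (\<tau> / T)\<^sup>2) has_real_derivative - (2 * t / T) / T) (at t)"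
        using Tp by (auto intro!: derivative_eq_intros simp: field_simps power2_eq_square)
      moreover have "(flat (real k) 0 has_real_derivative real k * flat (real k) 2 (1 - (t / T)\<^sup>2)) (at (1 - (t / T)\<^sup>2))"
        using flat_deriv[of "real k" 0 "1 - (t / T)\<^sup>2"] k by (simp add: numeral_2_eq_2)
      ultimately have "((\<lambda>\<tau>. flat (real k) 0 (1 - (\<tau> / T)\<^sup>2)) has_real_derivative real k * flat (real k) 2 (1 - (t / T)\<^sup>2) * (- (2 * t / T) / T)) (at t)"
        by (rule DERIV_chain2[rotated])
      then have "((\<lambda>\<tau>. W x ^ k * flat (real k) 0 (1 - (\<tau> / T)\<^sup>2)) has_real_derivative W x ^ k * (real k * flat (real k) 2 (1 - (t / T)\<^sup>2) * (- (2 * t / T) / T))) (at t)"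
        by (rule DERIV_cmult)
      moreover have "(\<lambda>\<tau>. ?\<phi> (x, \<tau>)) = (\<lambda>\<tau>. W x ^ k * flat (real k) 0 (1 - (\<tau> / T)\<^sup>2))"
        using flat_power[OF k] by (simp add: fun_eq_iff tfun_def W_def)
      ultimately show ?thesis unfolding time_deriv_def using DERIV_imp_deriv by simp
    qed
    have tdb: "- time_deriv ?\<phi> (x, t) \<le> real k * P ^ (k - 1) * (flat 1 2 (1 - (t / T)\<^sup>2) * (2 * t / T) / T)"
    proof -
      have "- time_deriv ?\<phi> (x, t) = W x ^ k * (real k * (E ^ (k - 1) * (flat 1 2 (1 - (t / T)\<^sup>2) * (2 * t / T) / T)))"
        unfolding td flat_power2[OF k] E_def by (simp add: mult_ac)
      also have "\<dots> \<le> W x ^ (k - 1) * (real k * (E ^ (k - 1) * (flat 1 2 (1 - (t / T)\<^sup>2) * (2 * t / T) / T)))"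
        using W E t Tp by (intro mult_right_mono power_decreasing mult_nonneg_nonneg divide_nonneg_nonneg) auto
      also have "\<dots> = real k * P ^ (k - 1) * (flat 1 2 (1 - (t / T)\<^sup>2) * (2 * t / T) / T)"
        by (simp only: P_def power_mult_distrib mult_ac)
      finally show ?thesis .
    qed
    have "- time_deriv ?\<phi> (x, t) + mixed_op s ?\<phi> (x, t) \<le> real k * P ^ (k - 1) * (flat 1 2 (1 - (t / T)\<^sup>2) * (2 * t / T) / T)
       + (?Q * real DIM('a) * \<rho> powr (- 2 * s) + ?Q * (?c / 2 * ?I) * \<rho> powr (- 2 * s))"
      using tdb lapb fracb by (simp only: mixed_op_def prod.case)
    also have "\<dots> = real k * P ^ (k - 1) * (flat 1 2 (1 - (t / T)\<^sup>2) * (2 * t / T) / T + C * \<rho> powr (- 2 * s))"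
      by (simp add: C_def algebra_simps)
    finally show "- time_deriv ?\<phi> (x, t) + mixed_op s ?\<phi> (x, t)
     \<le> real k * (flat 1 0 (1 - (norm x / \<rho>)\<^sup>2) * flat 1 0 (1 - (t / T)\<^sup>2)) ^ (k - 1) *
       (flat 1 2 (1 - (t / T)\<^sup>2) * (2 * t / T) / T + C * \<rho> powr (- 2 * s))"
      unfolding P_def W_def E_def .
  qed
qed

section \<open>Nonexistence\<close>

text \<open>With constants 1, one of the two terms alone dominates the product: the first if
  \<open>y \<le> x powr (p - 1)\<close>, the second otherwise.\<close>

lemma young_simple:
  fixes x y p :: real
  assumes "x \<ge> 0" "y \<ge> 0" "p > 1"
  shows "x * y \<le> x powr p + y powr (p / (p - 1))"
proof (cases "y \<le> x powr (p - 1)")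
  case True
  then have "x * y \<le> x * x powr (p - 1)" using assms by (intro mult_left_mono) auto
  also have "\<dots> = x powr p" using assms by (cases "x = 0") (auto simp: powr_diff)
  finally show ?thesis by (simp add: add_increasing2)
next
  case False
  have "x = (x powr (p - 1)) powr (1 / (p - 1))" using assms by (simp add: powr_powr)
  also have "\<dots> \<le> y powr (1 / (p - 1))" using False assms by (intro powr_mono2) auto
  finally have "x * y \<le> y powr (1 / (p - 1)) * y powr 1" using assms by (simp add: mult_right_mono)
  also have "\<dots> = y powr (p / (p - 1))" unfolding powr_add[symmetric] using assms by (simp add: field_simps)
  finally show ?thesis by (simp add: add_increasing)
qed

text \<open>If \<open>f\<close> is not integrable, its integral is \<open>0\<close>; hence the hypothesis \<open>h \<ge> 0\<close>.\<close>

lemma integral_le_of_nonneg_bound: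
  fixes f h :: "'b \<Rightarrow> real"
  assumes "integrable M h" "\<And>x. f x \<le> h x" "\<And>x. h x \<ge> 0"
  shows "integral\<^sup>L M f \<le> integral\<^sup>L M h"
proof (cases "integrable M f")
  case True
  then show ?thesis using assms by (intro integral_mono) auto
next
  case False
  then show ?thesis using assms by (simp add: not_integrable_integral_eq Bochner_Integration.integral_nonneg)
qed

lemma tfun_le_1: "tfun k \<rho> T z \<le> 1"
  unfolding tfun_def by (intro mult_le_one flat_le_1) auto

lemma tfun_nonneg: "tfun k \<rho> T z \<ge> 0"
  unfolding tfun_def by simp

lemma tfun_eq_power: "k > 0 \<Longrightarrow> tfun k \<rho> T (x, t) = (flat 1 0 (1 - (norm x / \<rho>)\<^sup>2) * flat 1 0 (1 - (t / T)\<^sup>2)) ^ k"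
  by (simp add: tfun_def flat_power power_mult_distrib)

lemma isCont_flat: "l > 0 \<Longrightarrow> isCont (flat l n) r"
  using flat_deriv DERIV_isCont by blast

lemma borel_measurable_flat [measurable]: "l > 0 \<Longrightarrow> flat l n \<in> borel_measurable borel"
  by (intro borel_measurable_continuous_onI continuous_at_imp_continuous_on ballI isCont_flat)

lemma borel_measurable_tfun: "k > 0 \<Longrightarrow> (tfun k \<rho> T :: 'a::euclidean_space \<times> real \<Rightarrow> real) \<in> borel_measurable borel"
proof -
  assume k: "k > 0"
  then have [measurable]: "flat (real k) 0 \<in> borel_measurable borel" by (intro borel_measurable_flat) simp
  have "(tfun k \<rho> T :: 'a \<times> real \<Rightarrow> real) \<in> borel_measurable (borel \<Otimes>\<^sub>M borel)"
    unfolding tfun_def[abs_def] by measurable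
  then show ?thesis by (simp add: borel_prod)
qed

text \<open>The cut-offs are not normalised: \<open>flat k 0 1 = exp (- k)\<close>, once for space
  and once for time.\<close>

lemma tfun_limit:
  assumes k: "k > 0" and \<rho>: "filterlim \<rho> at_top sequentially" and T: "filterlim T at_top sequentially"
  shows "(\<lambda>n. tfun k (\<rho> n) (T n) z) \<longlonglongrightarrow> exp (- real k) * exp (- real k)"
proof -
  have c: "isCont (flat (real k) 0) 1" using k by (intro isCont_flat) simp
  have r0: "(\<lambda>n. c / \<rho> n) \<longlonglongrightarrow> 0" and t0: "(\<lambda>n. c / T n) \<longlonglongrightarrow> 0" for c
    by (intro tendsto_divide_0[OF tendsto_const] filterlim_at_top_imp_at_infinity \<rho> T)+
  have "(\<lambda>n. 1 - (norm (fst z) / \<rho> n)\<^sup>2) \<longlonglongrightarrow> 1 - 0\<^sup>2" by (intro tendsto_intros r0)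
  then have 1: "(\<lambda>n. flat (real k) 0 (1 - (norm (fst z) / \<rho> n)\<^sup>2)) \<longlonglongrightarrow> flat (real k) 0 1"
    by (intro isCont_tendsto_compose[OF c]) simp
  have "(\<lambda>n. 1 - (snd z / T n)\<^sup>2) \<longlonglongrightarrow> 1 - 0\<^sup>2" by (intro tendsto_intros t0)
  then have 2: "(\<lambda>n. flat (real k) 0 (1 - (snd z / T n)\<^sup>2)) \<longlonglongrightarrow> flat (real k) 0 1"
    by (intro isCont_tendsto_compose[OF c]) simp
  show ?thesis unfolding tfun_def using tendsto_mult[OF 1 2] by (simp add: flat_def)
qed

lemma cylinder_measure:
  fixes \<rho> T :: real
  assumes "\<rho> > 0" "T > 0"
  shows "integrable lebesgue (indicator (ball (0::'a::euclidean_space) \<rho> \<times> {0<..<T}) :: 'a \<times> real \<Rightarrow> real)"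
    and "(LINT z|lebesgue. indicator (ball (0::'a) \<rho> \<times> {0<..<T}) z) = unit_ball_vol (real DIM('a)) * \<rho> ^ DIM('a) * T"
proof -
  let ?S = "ball (0::'a) \<rho> \<times> {0<..<T}"
  have m: "?S \<in> sets lborel" by (auto intro!: borel_open open_Times)
  have e: "emeasure lborel ?S = ennreal (unit_ball_vol (real DIM('a)) * \<rho> ^ DIM('a) * T)"
  proof -
    have "emeasure lborel ?S = emeasure (lborel \<Otimes>\<^sub>M lborel) ?S" by (simp add: lborel_prod)
    also have "\<dots> = emeasure lborel (ball (0::'a) \<rho>) * emeasure lborel {0<..<T}"
      by (rule lborel.emeasure_pair_measure_Times) auto
    also have "\<dots> = ennreal (unit_ball_vol (real DIM('a)) * \<rho> ^ DIM('a)) * ennreal T"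
      using assms by (simp add: emeasure_ball)
    also have "\<dots> = ennreal (unit_ball_vol (real DIM('a)) * \<rho> ^ DIM('a) * T)"
      using assms by (subst ennreal_mult[symmetric]) auto
    finally show ?thesis .
  qed
  have i: "integrable lborel (indicator ?S :: 'a \<times> real \<Rightarrow> real)" using m e by (intro integrable_real_indicator) auto
  then have bm: "(indicator ?S :: 'a \<times> real \<Rightarrow> real) \<in> borel_measurable lborel" by (rule borel_measurable_integrable)
  show "integrable lebesgue (indicator ?S :: 'a \<times> real \<Rightarrow> real)" using integrable_completion[OF bm] i by simp
  have "(LINT z|lebesgue. indicator ?S z :: real) = (\<integral>z. indicator ?S z \<partial>lborel)" by (rule integral_completion[OF bm])
  also have "\<dots> = measure lborel ?S" using m by simp
  also have "\<dots> = unit_ball_vol (real DIM('a)) * \<rho> ^ DIM('a) * T" using assms by (simp add: measure_def e)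
  finally show "(LINT z|lebesgue. indicator ?S z) = unit_ball_vol (real DIM('a)) * \<rho> ^ DIM('a) * T" .
qed

theorem nonexistence:
  fixes s p :: real and u0 :: "'a::euclidean_space \<Rightarrow> real"
  assumes s: "0 < s" "s < 1" and p: "p > 1" and pN: "p \<le> 1 + 2 * s / real DIM('a)"
    and u0: "u0 \<in> Linf lebesgue" "AE x in lebesgue. 0 \<le> u0 x" and sol: "very_weak_solution s p u0 u"
  shows "AE x in lebesgue. u0 x = 0"
proof -
  define N where "N = real DIM('a)"
  have N: "N > 0" by (simp add: N_def)
  define q where "q = p / (p - 1)"
  have q: "q > 1" using p by (simp add: q_def)
  \<comment> \<open>The hypothesis on \<open>p\<close> in the form used for scaling: the volume of a
    cylinder contributes \<open>N + 2 * s\<close>, the dual power of the operator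
    \<open>- 2 * s * q\<close>. Equality is the critical case.\<close>
  have e: "N + 2 * s - 2 * s * q \<le> 0"
  proof -
    have "p - 1 \<le> 2 * s / N" using pN by (simp add: N_def)
    then have "(p - 1) * N \<le> 2 * s" using N by (simp add: field_simps)
    then have "N \<le> 2 * s / (p - 1)" using p by (simp add: field_simps)
    moreover have "2 * s - 2 * s * q = - (2 * s / (p - 1))" using p by (simp add: q_def field_simps)
    ultimately show ?thesis by linarith
  qed
  \<comment> \<open>\<open>k \<ge> q\<close> means \<open>k \<le> (k - 1) * p\<close>; as the
    cut-off is at most 1, the \<open>p\<close>-th power of its \<open>(k - 1)\<close>-st power is
    then below its \<open>k\<close>-th power.\<close>
  obtain k :: nat where kq: "q \<le> real k" using real_arch_simple by blast
  then have k: "k \<ge> 2" using q by linarith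
  have kp: "real k \<le> real (k - 1) * p"
  proof -
    have "p \<le> real k * (p - 1)" using kq p by (simp add: q_def field_simps)
    then show ?thesis using k by (simp add: of_nat_diff algebra_simps)
  qed
  obtain C where C: "C \<ge> 0" and Cb: "\<And>k \<rho> T (x::'a) t. k > 0 \<Longrightarrow> \<rho> \<ge> 1 \<Longrightarrow> T > 0 \<Longrightarrow> t > 0 \<Longrightarrow>
    - time_deriv (tfun k \<rho> T) (x, t) + mixed_op s (tfun k \<rho> T) (x, t)
     \<le> real k * (flat 1 0 (1 - (norm x / \<rho>)\<^sup>2) * flat 1 0 (1 - (t / T)\<^sup>2)) ^ (k - 1) *
       (flat 1 2 (1 - (t / T)\<^sup>2) * (2 * t / T) / T + C * \<rho> powr (- 2 * s))"
    using tfun_operator_bound[OF s, where ?'a='a] by blast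
  let ?S = "open_half_space :: ('a \<times> real) set"
  have un: "\<And>z. z \<in> closed_half_space \<Longrightarrow> u z \<ge> 0" and lp: "u \<in> Lp_loc p closed_half_space"
    and weak: "\<And>\<phi>. \<phi> \<in> test_functions \<Longrightarrow>
        (LINT z:?S|lebesgue. u z * (- time_deriv \<phi> z + mixed_op s \<phi> z)) - (LINT x|lebesgue. u0 x * \<phi> (x, 0))
        = (LINT z:?S|lebesgue. u z powr p * \<phi> z)"
    using sol unfolding very_weak_solution_def by blast+
  have SC: "z \<in> closed_half_space" if "z \<in> ?S" for z using that by (auto simp: open_half_space_def closed_half_space_def)
  \<comment> \<open>\<open>u\<close> is measurable only relative to the closed half space and
    unconstrained elsewhere; cutting off gives a function on the whole space.\<close>
  define up where "up z = indicator ?S z * u z powr p" for z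
  have up0: "up z \<ge> 0" for z by (simp add: up_def)
  have Cm: "(closed_half_space :: ('a \<times> real) set) \<in> sets lebesgue"
    unfolding closed_half_space_def by (intro sets_completionI_sets) (simp add: borel_closed closed_Times)
  have Sm: "?S \<in> sets lebesgue"
    unfolding open_half_space_def by (intro sets_completionI_sets) (simp add: borel_open open_Times)
  have upm [measurable]: "up \<in> borel_measurable lebesgue"
  proof -
    have "u \<in> borel_measurable (lebesgue_on closed_half_space)" using lp by (simp add: Lp_loc_def)
    then have [measurable]: "(\<lambda>z. indicator closed_half_space z *\<^sub>R u z) \<in> borel_measurable lebesgue"
      using Cm by (subst (asm) borel_measurable_restrict_space_iff) auto
    note [measurable] = Sm
    have "(\<lambda>z. indicator ?S z * (indicator closed_half_space z *\<^sub>R u z) powr p) \<in> borel_measurable lebesgue" by measurable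
    moreover have "up = (\<lambda>z. indicator ?S z * (indicator closed_half_space z *\<^sub>R u z) powr p)"
      using SC by (auto simp: up_def fun_eq_iff split: split_indicator)
    ultimately show ?thesis by (simp only:)
  qed
  have [measurable]: "(tfun k \<rho> T :: 'a \<times> real \<Rightarrow> real) \<in> borel_measurable lebesgue" for \<rho> T
    using borel_measurable_tfun[of k \<rho> T, where ?'a='a] k by (intro measurable_completion) simp
  \<comment> \<open>The compact cylinder reaches down to \<open>t = 0\<close>, so local
    integrability up to the boundary is what is used.\<close>
  have upi: "integrable lebesgue (\<lambda>z. up z * tfun k \<rho> T z)" if \<rho>: "\<rho> > 0" and T: "T > 0" for \<rho> T
  proof -
    let ?Q = "cball (0::'a) \<rho> \<times> {0..T}"
    have "compact ?Q" "?Q \<subseteq> closed_half_space" by (auto simp: closed_half_space_def intro!: compact_Times)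
    then have si: "integrable lebesgue (\<lambda>z. indicator ?Q z *\<^sub>R \<bar>u z\<bar> powr p)"
      using lp unfolding Lp_loc_def set_integrable_def by blast
    show ?thesis
    proof (rule Bochner_Integration.integrable_bound[OF si])
      show "AE z in lebesgue. norm (up z * tfun k \<rho> T z) \<le> norm (indicator ?Q z *\<^sub>R \<bar>u z\<bar> powr p)"
      proof (rule AE_I2)
        fix z :: "'a \<times> real"
        obtain x t where z: "z = (x, t)" by (cases z)
        show "norm (up z * tfun k \<rho> T z) \<le> norm (indicator ?Q z *\<^sub>R \<bar>u z\<bar> powr p)"
        proof (cases "z \<in> ?S \<and> z \<in> ?Q")
          case True
          then have "up z * tfun k \<rho> T z \<le> \<bar>u z\<bar> powr p * 1"
            using un[OF SC] by (intro mult_mono tfun_le_1 tfun_nonneg) (auto simp: up_def)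
          then show ?thesis using True up0[of z] tfun_nonneg[of k \<rho> T z] by simp
        next
          case False
          have "up z * tfun k \<rho> T z = 0"
          proof (cases "z \<in> ?S")
            case True
            then have "norm x > \<rho> \<or> t > T" using False by (auto simp: z open_half_space_def)
            then have "(norm x / \<rho>)\<^sup>2 \<ge> 1 \<or> (t / T)\<^sup>2 \<ge> 1" using \<rho> T by (auto intro!: one_le_power)
            then show ?thesis by (auto simp: z tfun_def flat_def)
          qed (simp add: up_def)
          then show ?thesis by (simp only: norm_zero norm_ge_zero)
        qed
      qed
    qed measurable
  qed

  \<comment> \<open>Young's inequality for the tested equation\<close>
  define V where "V = unit_ball_vol (real DIM('a))"
  have V0: "V \<ge> 0" by (simp add: V_def)
  let ?\<Omega> = "\<lambda>\<rho> T. ball (0::'a) \<rho> \<times> {0<..<T}"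
  let ?P = "\<lambda>\<rho> T z. flat 1 0 (1 - (norm (fst z :: 'a) / \<rho>)\<^sup>2) * flat 1 0 (1 - (snd z / T)\<^sup>2)"
  \<comment> \<open>The factor of the time derivative without \<open>1 / T\<close>. It is at most 4
    uniformly in \<open>T\<close>, and for fixed \<open>z\<close> it tends to 0 as \<open>T\<close>
    grows; the first pass uses the bound, the second also the limit.\<close>
  define a where "a T z = flat 1 2 (1 - (snd z / T)\<^sup>2) * (2 * snd z / T)" for T and z :: "'a \<times> real"
  have P01: "0 \<le> ?P \<rho> T z" "?P \<rho> T z \<le> 1" for \<rho> T z by (auto intro!: mult_le_one flat_le_1)
  have Pout: "?P \<rho> T z = 0" if "z \<in> ?S" "z \<notin> ?\<Omega> \<rho> T" "\<rho> > 0" "T > 0" for \<rho> T z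
  proof -
    obtain x t where z: "z = (x, t)" by (cases z)
    have "norm x \<ge> \<rho> \<or> t \<ge> T" using that by (auto simp: z open_half_space_def)
    then have "(norm x / \<rho>)\<^sup>2 \<ge> 1 \<or> (t / T)\<^sup>2 \<ge> 1" using that by (auto intro!: one_le_power)
    then show ?thesis by (auto simp: z flat_def)
  qed
  have Pp: "(?P \<rho> T z ^ (k - 1)) powr p \<le> tfun k \<rho> T z" for \<rho> T z
  proof -
    let ?w = "?P \<rho> T z"
    have "tfun k \<rho> T z = ?w ^ k" using tfun_eq_power[of k \<rho> T "fst z" "snd z"] k by simp
    moreover have "(?w ^ (k - 1)) powr p \<le> ?w ^ k"
    proof (cases "?w = 0")
      case True
      then show ?thesis using k by (simp only:) (simp add: power_0_left)
    next
      case False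
      then have w: "?w > 0" using P01(1)[of z \<rho> T] by linarith
      have "(?w ^ (k - 1)) powr p = ?w powr (real (k - 1) * p)" using w by (simp add: powr_realpow[symmetric] powr_powr del: of_nat_diff)
      also have "\<dots> \<le> ?w powr real k" using kp w P01(2)[of z \<rho> T] by (intro powr_mono') auto
      also have "\<dots> = ?w ^ k" using w by (rule powr_realpow)
      finally show ?thesis .
    qed
    ultimately show ?thesis by simp
  qed
  have a0: "a T z \<ge> 0" if "z \<in> ?S" "T > 0" for T z
    using that unfolding a_def by (intro mult_nonneg_nonneg) (auto simp: open_half_space_def)
  have a4: "a T z \<le> 4" if "z \<in> ?S" "T > 0" for T z
  proof (cases "snd z < T")
    case True
    have "flat 1 2 (1 - (snd z / T)\<^sup>2) \<le> 2" using flat_le_power[of 1 2 "1 - (snd z / T)\<^sup>2" 0] by simp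
    moreover have "2 * snd z / T \<le> 2" using True that by (simp add: divide_le_eq)
    ultimately have "a T z \<le> 2 * 2" unfolding a_def using that by (intro mult_mono) (auto simp: open_half_space_def)
    then show ?thesis by simp
  next
    case False
    then have "(snd z / T)\<^sup>2 \<ge> 1" using that by (auto intro!: one_le_power)
    then show ?thesis by (simp add: a_def flat_def)
  qed
  have gb: "u z * (- time_deriv (tfun k \<rho> T) z + mixed_op s (tfun k \<rho> T) z) \<le> u z * (real k * ?P \<rho> T z ^ (k - 1) * (a T z / T + C * \<rho> powr (- 2 * s)))"
    if "z \<in> ?S" "\<rho> \<ge> 1" "T > 0" for z \<rho> T
    using Cb[of k \<rho> T "snd z" "fst z"] that k un[OF SC[OF that(1)]]
    by (intro mult_left_mono) (auto simp: a_def open_half_space_def)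
  \<comment> \<open>Distributing \<open>2 powr (- 1 / p)\<close> and \<open>2 powr (1 / p)\<close>
    over the two factors gives the \<open>u powr p\<close> term the coefficient 1/2, so the
    left-hand side can absorb it.\<close>
  have y1: "u z * ?P \<rho> T z ^ (k - 1) * D \<le> (1/2) * (up z * tfun k \<rho> T z) + (2 powr (1 / p) * D) powr q * indicator (?\<Omega> \<rho> T) z"
    if z: "z \<in> ?S" and \<rho>: "\<rho> > 0" and T: "T > 0" and D: "D \<ge> 0" for z \<rho> T D
  proof (cases "z \<in> ?\<Omega> \<rho> T")
    case True
    let ?w = "?P \<rho> T z ^ (k - 1)"
    have uz: "u z \<ge> 0" by (rule un[OF SC[OF z]])
    have w0: "?w \<ge> 0" using P01 by simp
    have 2: "2 powr (- 1 / p) * 2 powr (1 / p) = (1::real)" unfolding powr_add[symmetric] by simp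
    have half: "(2 powr (- 1 / p)) powr p = (1/2::real)" unfolding powr_powr using p by (simp add: powr_minus_divide)
    have "u z * ?w * D = (2 powr (- 1 / p) * 2 powr (1 / p)) * (u z * ?w * D)" unfolding 2 by simp
    also have "\<dots> = (2 powr (- 1 / p) * (u z * ?w)) * (2 powr (1 / p) * D)" by (simp only: mult_ac)
    also have "\<dots> \<le> (2 powr (- 1 / p) * (u z * ?w)) powr p + (2 powr (1 / p) * D) powr (p / (p - 1))"
      using uz w0 D p by (intro young_simple mult_nonneg_nonneg) auto
    also have "(2 powr (- 1 / p) * (u z * ?w)) powr p = (1/2) * (u z powr p * ?w powr p)"
      by (simp only: powr_mult half)
    also have "\<dots> \<le> (1/2) * (u z powr p * tfun k \<rho> T z)" by (intro mult_left_mono Pp) auto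
    finally show ?thesis using True z by (simp add: up_def q_def)
  next
    case False
    have "?P \<rho> T z ^ (k - 1) = 0" using Pout[OF z False \<rho> T] k by (simp only:) (simp add: power_0_left)
    then have "u z * ?P \<rho> T z ^ (k - 1) * D = 0" by (simp only: mult_zero_left mult_zero_right)
    then show ?thesis using False up0[of z] tfun_nonneg[of k \<rho> T z] by (simp only:) simp
  qed
  \<comment> \<open>Here \<open>u powr p\<close> is not absorbed but kept together with
    \<open>a powr p\<close>, whose integral will tend to 0. The parameter \<open>\<mu>\<close> stays
    free to balance the two terms.\<close>
  have y2: "u z * ?P \<rho> T z ^ (k - 1) * (real k * a T z / T) \<le> \<mu> powr p * (up z * a T z powr p) + (real k / (\<mu> * T)) powr q * indicator (?\<Omega> \<rho> T) z"
    if z: "z \<in> ?S" and \<rho>: "\<rho> > 0" and T: "T > 0" and \<mu>: "\<mu> > 0" for z \<rho> T \<mu>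
  proof (cases "z \<in> ?\<Omega> \<rho> T")
    case True
    let ?w = "?P \<rho> T z ^ (k - 1)"
    have uz: "u z \<ge> 0" by (rule un[OF SC[OF z]])
    have w1: "0 \<le> ?w" "?w \<le> 1" using P01 by (auto intro: power_le_one)
    have az: "a T z \<ge> 0" by (rule a0[OF z T])
    have "u z * ?w * (real k * a T z / T) = ?w * (u z * (real k * a T z / T))" by (simp only: mult_ac)
    also have "\<dots> \<le> 1 * (u z * (real k * a T z / T))" using uz az T w1 by (intro mult_right_mono) auto
    also have "\<dots> = (\<mu> * (u z * a T z)) * (real k / (\<mu> * T))" using \<mu> by (simp add: field_simps)
    also have "\<dots> \<le> (\<mu> * (u z * a T z)) powr p + (real k / (\<mu> * T)) powr (p / (p - 1))"
      using uz az \<mu> T p by (intro young_simple mult_nonneg_nonneg divide_nonneg_nonneg) auto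
    also have "(\<mu> * (u z * a T z)) powr p = \<mu> powr p * (u z powr p * a T z powr p)"
      using uz az \<mu> by (simp add: powr_mult)
    finally show ?thesis using True z by (simp add: up_def q_def)
  next
    case False
    have "?P \<rho> T z ^ (k - 1) = 0" using Pout[OF z False \<rho> T] k by (simp only:) (simp add: power_0_left)
    then have "u z * ?P \<rho> T z ^ (k - 1) * (real k * a T z / T) = 0" by (simp only: mult_zero_left mult_zero_right)
    then show ?thesis using False up0[of z] by (simp only:) simp
  qed
  define I where "I \<rho> T = (LINT z|lebesgue. up z * tfun k \<rho> T z)" for \<rho> T
  define U where "U \<rho> T = (LINT x|lebesgue. u0 x * tfun k \<rho> T (x, 0))" for \<rho> T
  have I0: "I \<rho> T \<ge> 0" for \<rho> T unfolding I_def by (intro Bochner_Integration.integral_nonneg mult_nonneg_nonneg up0 tfun_nonneg)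
  have U0: "U \<rho> T \<ge> 0" for \<rho> T unfolding U_def
    using u0(2) by (intro integral_nonneg_AE) (auto simp: tfun_nonneg elim!: AE_mp)
  have vol: "integrable lebesgue (indicator (?\<Omega> \<rho> T) :: 'a \<times> real \<Rightarrow> real)" "(LINT z|lebesgue. indicator (?\<Omega> \<rho> T) z) = V * \<rho> powr N * T" if "\<rho> > 0" "T > 0" for \<rho> T
    using cylinder_measure[OF that, where ?'a='a] that by (auto simp: V_def N_def powr_realpow)
  \<comment> \<open>The tested equation with any nonnegative integrable majorant \<open>H\<close>.
    Only an upper bound on the open half space is required, which the sign of \<open>u\<close> makes
    available.\<close>
  have key: "I \<rho> T + U \<rho> T \<le> (LINT z|lebesgue. H z)"
    if \<rho>: "\<rho> \<ge> 1" and T: "T > 0" and H: "integrable lebesgue H" "\<And>z. H z \<ge> 0"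
      and Hb: "\<And>z. z \<in> ?S \<Longrightarrow> u z * (real k * ?P \<rho> T z ^ (k - 1) * (a T z / T + C * \<rho> powr (- 2 * s))) \<le> H z" for \<rho> T H
  proof -
    have tf: "(tfun k \<rho> T :: 'a \<times> real \<Rightarrow> real) \<in> test_functions" using k \<rho> T by (intro tfun_test_function) auto
    have "I \<rho> T = (LINT z:?S|lebesgue. u z powr p * tfun k \<rho> T z)"
      unfolding I_def set_lebesgue_integral_def by (intro Bochner_Integration.integral_cong refl) (simp add: up_def mult_ac)
    then have "I \<rho> T + U \<rho> T = (LINT z:?S|lebesgue. u z * (- time_deriv (tfun k \<rho> T) z + mixed_op s (tfun k \<rho> T) z))"
      using weak[OF tf] by (simp add: U_def)
    also have "\<dots> \<le> (LINT z|lebesgue. H z)"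
      unfolding set_lebesgue_integral_def
    proof (rule integral_le_of_nonneg_bound[OF H(1) _ H(2)])
      fix z
      show "indicator ?S z *\<^sub>R (u z * (- time_deriv (tfun k \<rho> T) z + mixed_op s (tfun k \<rho> T) z)) \<le> H z"
      proof (cases "z \<in> ?S")
        case True
        then show ?thesis using order_trans[OF gb[OF True \<rho> T] Hb[OF True]] by simp
      qed (simp add: H(2))
    qed
    finally show ?thesis .
  qed

  define c where "c = exp (- real k) * exp (- real k)"
  have c: "c > 0" by (simp add: c_def)
  text \<open>In this scaling all terms of \<open>key\<close> have the same size if \<open>p\<close> is the critical exponent.\<close>
  define T where "T n = real n powr (2 * s)" for n :: nat
  have Tn: "T n > 0" "T n \<ge> 1" if "n \<ge> 1" for n using that s by (auto simp: T_def intro!: ge_one_powr_ge_zero)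
  have Tlim: "filterlim T at_top sequentially"
    unfolding T_def[abs_def] using s by (intro filterlim_compose[OF _ filterlim_real_sequentially]) real_asymp
  \<comment> \<open>Volume times the dual power of \<open>n powr (- 2 * s)\<close>; by
    \<open>e\<close> the total exponent is at most 0.\<close>
  have scale: "real n powr N * T n * (real n powr (- 2 * s)) powr q \<le> 1" if n: "n \<ge> 1" for n
  proof -
    have "real n powr N * T n * (real n powr (- 2 * s)) powr q = real n powr (N + 2 * s - 2 * s * q)"
      unfolding T_def powr_powr powr_add[symmetric] by (simp add: algebra_simps)
    also have "\<dots> \<le> real n powr 0" using n e by (intro powr_mono) auto
    finally show ?thesis using n by simp
  qed

  \<comment> \<open>First pass: integrability of the nonlinearity\<close>
  define Q where "Q = 2 * ((2 powr (1 / p) * (real k * (4 + C))) powr q * V)"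
  have Q0: "Q \<ge> 0" using V0 by (simp add: Q_def)
  \<comment> \<open>The height \<open>n powr (2 * s)\<close> gives the time derivative the rate
    \<open>n powr (- 2 * s)\<close> of the spatial operator, so one application of \<open>y1\<close>
    covers both. Absorbing half of \<open>I\<close> accounts for the factor 2 in
    \<open>Q\<close>.\<close>
  have IQ: "I (real n) (T n) \<le> Q" if n: "n \<ge> 1" for n
  proof -
    let ?\<rho> = "real n"
    let ?D = "real k * ((4 + C) * ?\<rho> powr (- 2 * s))"
    let ?M = "(2 powr (1 / p) * ?D) powr q"
    have r: "?\<rho> \<ge> 1" "?\<rho> > 0" using n by auto
    have D0: "?D \<ge> 0" using C by simp
    let ?H = "\<lambda>z. (1/2) * (up z * tfun k ?\<rho> (T n) z) + ?M * indicator (?\<Omega> ?\<rho> (T n)) z"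
    have "I ?\<rho> (T n) + U ?\<rho> (T n) \<le> (LINT z|lebesgue. ?H z)"
    proof (rule key[OF r(1) Tn(1)[OF n]])
      show "integrable lebesgue ?H" using upi[OF r(2) Tn(1)[OF n]] vol(1)[OF r(2) Tn(1)[OF n]]
        by (intro Bochner_Integration.integrable_add integrable_mult_right)
      show "?H z \<ge> 0" for z by (intro add_nonneg_nonneg mult_nonneg_nonneg up0 tfun_nonneg) auto
      fix z assume z: "z \<in> ?S"
      have "a (T n) z / T n \<le> 4 * ?\<rho> powr (- 2 * s)"
        using a4[OF z Tn(1)[OF n]] n by (simp add: T_def powr_minus divide_inverse mult_right_mono)
      then have "a (T n) z / T n + C * ?\<rho> powr (- 2 * s) \<le> (4 + C) * ?\<rho> powr (- 2 * s)" by (simp add: algebra_simps)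
      then have "u z * (real k * ?P ?\<rho> (T n) z ^ (k - 1) * (a (T n) z / T n + C * ?\<rho> powr (- 2 * s))) \<le> u z * (real k * ?P ?\<rho> (T n) z ^ (k - 1) * ((4 + C) * ?\<rho> powr (- 2 * s)))"
        using un[OF SC[OF z]] P01 by (intro mult_left_mono) auto
      also have "\<dots> = u z * ?P ?\<rho> (T n) z ^ (k - 1) * ?D" by (simp only: mult_ac)
      also have "\<dots> \<le> ?H z" by (rule y1[OF z r(2) Tn(1)[OF n] D0])
      finally show "u z * (real k * ?P ?\<rho> (T n) z ^ (k - 1) * (a (T n) z / T n + C * ?\<rho> powr (- 2 * s))) \<le> ?H z" .
    qed
    also have "\<dots> = (1/2) * I ?\<rho> (T n) + ?M * (V * ?\<rho> powr N * T n)"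
      using upi[OF r(2) Tn(1)[OF n]] vol[OF r(2) Tn(1)[OF n]] by (simp add: I_def)
    finally have 1: "I ?\<rho> (T n) + U ?\<rho> (T n) \<le> (1/2) * I ?\<rho> (T n) + ?M * (V * ?\<rho> powr N * T n)" .
    have "?M * (V * ?\<rho> powr N * T n) = (2 powr (1 / p) * (real k * (4 + C))) powr q * V * (?\<rho> powr N * T n * (?\<rho> powr (- 2 * s)) powr q)"
    proof -
      have "?M = (2 powr (1 / p) * (real k * (4 + C)) * ?\<rho> powr (- 2 * s)) powr q" by (simp only: mult_ac)
      also have "\<dots> = (2 powr (1 / p) * (real k * (4 + C))) powr q * (?\<rho> powr (- 2 * s)) powr q" by (rule powr_mult)
      finally show ?thesis by (simp only: mult_ac)
    qed
    also have "\<dots> \<le> (2 powr (1 / p) * (real k * (4 + C))) powr q * V * 1"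
      using V0 by (intro mult_left_mono scale n) auto
    finally show ?thesis using 1 U0[of ?\<rho> "T n"] by (simp add: Q_def)
  qed
  \<comment> \<open>Fatou's lemma along the growing cylinders; the factor \<open>c\<close> is the
    limit of the cut-offs.\<close>
  have upfin: "(\<integral>\<^sup>+z. ennreal (up z * c) \<partial>lebesgue) \<le> ennreal Q"
  proof -
    have lim: "(\<lambda>n. up z * tfun k (real n) (T n) z) \<longlonglongrightarrow> up z * c" for z
      unfolding c_def using k by (intro tendsto_mult_left tfun_limit filterlim_real_sequentially Tlim) auto
    have "(\<integral>\<^sup>+z. ennreal (up z * c) \<partial>lebesgue) = (\<integral>\<^sup>+z. liminf (\<lambda>n. ennreal (up z * tfun k (real n) (T n) z)) \<partial>lebesgue)"
      by (intro nn_integral_cong lim_imp_Liminf[symmetric] tendsto_ennrealI lim) auto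
    also have "\<dots> \<le> liminf (\<lambda>n. \<integral>\<^sup>+z. ennreal (up z * tfun k (real n) (T n) z) \<partial>lebesgue)"
      by (rule nn_integral_liminf) measurable
    also have "\<dots> \<le> liminf (\<lambda>n. ennreal Q)"
    proof (rule Liminf_mono, rule eventually_sequentiallyI[of 1])
      fix n :: nat assume n: "1 \<le> n"
      have "(\<integral>\<^sup>+z. ennreal (up z * tfun k (real n) (T n) z) \<partial>lebesgue) = ennreal (I (real n) (T n))"
        unfolding I_def using n Tn[OF n] by (intro nn_integral_eq_integral upi) (auto simp: up0 tfun_nonneg)
      then show "(\<integral>\<^sup>+z. ennreal (up z * tfun k (real n) (T n) z) \<partial>lebesgue) \<le> ennreal Q" using IQ[OF n] by (simp add: ennreal_leI)
    qed
    also have "\<dots> = ennreal Q" by (simp add: Liminf_const)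
    finally show ?thesis .
  qed
  have upI: "integrable lebesgue up"
  proof -
    have "integrable lebesgue (\<lambda>z. up z * c)"
      by (rule integrableI_nonneg) (use upfin up0 c in \<open>auto simp: le_less_trans\<close>)
    then show ?thesis using c by simp
  qed

  \<comment> \<open>Second pass: radius and height decoupled\<close>
  define X where "X n = (LINT z|lebesgue. up z * a (T n) z powr p)" for n
  have am [measurable]: "a T \<in> borel_measurable lebesgue" for T
  proof -
    have "a T \<in> borel_measurable (borel \<Otimes>\<^sub>M borel)" unfolding a_def[abs_def] by measurable
    then have "a T \<in> borel_measurable lborel" by (simp add: borel_prod)
    then show ?thesis by (rule measurable_completion)
  qed
  have upa: "integrable lebesgue (\<lambda>z. up z * a (T n) z powr p)" if n: "n \<ge> 1" for n
  proof (rule Bochner_Integration.integrable_bound[OF integrable_mult_right[OF upI, of "4 powr p"]])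
    show "AE z in lebesgue. norm (up z * a (T n) z powr p) \<le> norm (4 powr p * up z)"
    proof (rule AE_I2)
      fix z
      show "norm (up z * a (T n) z powr p) \<le> norm (4 powr p * up z)"
      proof (cases "z \<in> ?S")
        case True
        then have "a (T n) z powr p \<le> 4 powr p" using a0[OF True Tn(1)[OF n]] a4[OF True Tn(1)[OF n]] p by (intro powr_mono2) auto
        then have "up z * a (T n) z powr p \<le> up z * 4 powr p" by (intro mult_left_mono up0)
        then show ?thesis using up0[of z] by (simp add: mult.commute)
      qed (simp add: up_def)
    qed
  qed measurable
  \<comment> \<open>\<open>a (T n)\<close> tends to 0 pointwise on the half space, and
    \<open>4 powr p * up\<close> is a majorant because the first pass made \<open>up\<close>
    integrable.\<close>
  have X0: "(\<lambda>n. X (Suc n)) \<longlonglongrightarrow> 0"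
  proof -
    have "(\<lambda>n. LINT z|lebesgue. up z * a (T (Suc n)) z powr p) \<longlonglongrightarrow> (LINT z|lebesgue. up z * 0)"
    proof (rule integral_dominated_convergence[OF _ _ integrable_mult_right[OF upI, of "4 powr p"]])
      show "AE z in lebesgue. (\<lambda>n. up z * a (T (Suc n)) z powr p) \<longlonglongrightarrow> up z * 0"
      proof (rule AE_I2)
        fix z :: "'a \<times> real"
        show "(\<lambda>n. up z * a (T (Suc n)) z powr p) \<longlonglongrightarrow> up z * 0"
        proof (cases "z \<in> ?S")
          case True
          have t0: "(\<lambda>n. snd z / T (Suc n)) \<longlonglongrightarrow> 0"
            by (intro tendsto_divide_0[OF tendsto_const] filterlim_at_top_imp_at_infinity filterlim_compose[OF Tlim filterlim_Suc])
          have "(\<lambda>n. 1 - (snd z / T (Suc n))\<^sup>2) \<longlonglongrightarrow> 1 - 0\<^sup>2" by (intro tendsto_intros t0)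
          then have "(\<lambda>n. flat 1 2 (1 - (snd z / T (Suc n))\<^sup>2)) \<longlonglongrightarrow> flat 1 2 1"
            by (intro isCont_tendsto_compose[OF isCont_flat]) auto
          then have "(\<lambda>n. flat 1 2 (1 - (snd z / T (Suc n))\<^sup>2) * (2 * (snd z / T (Suc n)))) \<longlonglongrightarrow> flat 1 2 1 * (2 * 0)"
            by (intro tendsto_mult tendsto_const t0)
          then have "(\<lambda>n. a (T (Suc n)) z) \<longlonglongrightarrow> 0" by (simp add: a_def)
          then have "(\<lambda>n. a (T (Suc n)) z powr p) \<longlonglongrightarrow> 0 powr p"
            using p a0[OF True Tn(1)] by (intro tendsto_powr' tendsto_const) (auto intro!: always_eventually)
          then show ?thesis by (intro tendsto_mult_left) simp
        qed (simp add: up_def)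
      qed
      fix n
      show "AE z in lebesgue. norm (up z * a (T (Suc n)) z powr p) \<le> 4 powr p * up z"
      proof (rule AE_I2)
        fix z
        show "norm (up z * a (T (Suc n)) z powr p) \<le> 4 powr p * up z"
        proof (cases "z \<in> ?S")
          case True
          then have "a (T (Suc n)) z powr p \<le> 4 powr p" using a0[OF True Tn(1)] a4[OF True Tn(1)] p by (intro powr_mono2) auto
          then have "up z * a (T (Suc n)) z powr p \<le> up z * 4 powr p" by (intro mult_left_mono up0)
          then show ?thesis using up0[of z] by (simp add: mult.commute)
        qed (simp add: up_def)
      qed
    qed measurable
    then show ?thesis by (simp add: X_def)
  qed

  text \<open>On cylinders of radius \<open>B * n\<close> and height \<open>n powr (2 * s)\<close> the contribution \<open>X n\<close> of the time derivative
    vanishes as \<open>n \<rightarrow> \<infinity>\<close>, because \<open>u powr p\<close> is integrable; that of the spatial operator is small for large \<open>B\<close>.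
    Letting first \<open>n\<close> and then \<open>B\<close> tend to infinity, with \<open>\<mu>\<close> a suitable power of \<open>B\<close>, gives \<open>u0 = 0\<close>
    also in the critical case.\<close>
  define C1 where "C1 = (2 powr (1 / p) * (real k * C)) powr q * V"
  have C1: "C1 \<ge> 0" using V0 by (simp add: C1_def)
  have Ub: "U (B * real n) (T n) \<le> C1 * B powr (N - 2 * s * q) + \<mu> powr p * X n + (real k / \<mu>) powr q * V * B powr N"
    if n: "n \<ge> 1" and B: "B \<ge> 1" and \<mu>: "\<mu> > 0" for n B \<mu>
  proof -
    let ?\<rho> = "B * real n"
    let ?D = "real k * (C * ?\<rho> powr (- 2 * s))"
    let ?M = "(2 powr (1 / p) * ?D) powr q"
    let ?L = "(real k / (\<mu> * T n)) powr q"
    have r: "?\<rho> \<ge> 1" "?\<rho> > 0" using n B mult_mono[of 1 B 1 "real n"] by auto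
    have D0: "?D \<ge> 0" using C by simp
    \<comment> \<open>The spatial operator is absorbed by \<open>y1\<close> as before, the time
      derivative goes through \<open>y2\<close>; this splits the two rates, which are no longer
      equal.\<close>
    let ?H = "\<lambda>z. ((1/2) * (up z * tfun k ?\<rho> (T n) z) + ?M * indicator (?\<Omega> ?\<rho> (T n)) z) + (\<mu> powr p * (up z * a (T n) z powr p) + ?L * indicator (?\<Omega> ?\<rho> (T n)) z)"
    note ii = upi[OF r(2) Tn(1)[OF n]] vol(1)[OF r(2) Tn(1)[OF n]] upa[OF n]
    have "I ?\<rho> (T n) + U ?\<rho> (T n) \<le> (LINT z|lebesgue. ?H z)"
    proof (rule key[OF r(1) Tn(1)[OF n]])
      show "integrable lebesgue ?H" by (intro Bochner_Integration.integrable_add integrable_mult_right ii)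
      show "?H z \<ge> 0" for z by (intro add_nonneg_nonneg mult_nonneg_nonneg up0 tfun_nonneg) auto
      fix z assume z: "z \<in> ?S"
      have "u z * (real k * ?P ?\<rho> (T n) z ^ (k - 1) * (a (T n) z / T n + C * ?\<rho> powr (- 2 * s)))
         = u z * ?P ?\<rho> (T n) z ^ (k - 1) * ?D + u z * ?P ?\<rho> (T n) z ^ (k - 1) * (real k * a (T n) z / T n)"
        by (simp add: algebra_simps)
      also have "\<dots> \<le> ?H z" by (intro add_mono y1[OF z r(2) Tn(1)[OF n] D0] y2[OF z r(2) Tn(1)[OF n] \<mu>])
      finally show "u z * (real k * ?P ?\<rho> (T n) z ^ (k - 1) * (a (T n) z / T n + C * ?\<rho> powr (- 2 * s))) \<le> ?H z" .
    qed
    also have "\<dots> = (1/2) * I ?\<rho> (T n) + ?M * (V * ?\<rho> powr N * T n) + (\<mu> powr p * X n + ?L * (V * ?\<rho> powr N * T n))"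
    proof -
      have "(LINT z|lebesgue. ?H z) = (LINT z|lebesgue. (1/2) * (up z * tfun k ?\<rho> (T n) z) + ?M * indicator (?\<Omega> ?\<rho> (T n)) z)
         + (LINT z|lebesgue. \<mu> powr p * (up z * a (T n) z powr p) + ?L * indicator (?\<Omega> ?\<rho> (T n)) z)"
        by (intro Bochner_Integration.integral_add Bochner_Integration.integrable_add integrable_mult_right ii)
      also have "(LINT z|lebesgue. (1/2) * (up z * tfun k ?\<rho> (T n) z) + ?M * indicator (?\<Omega> ?\<rho> (T n)) z) = (1/2) * I ?\<rho> (T n) + ?M * (V * ?\<rho> powr N * T n)"
        by (subst Bochner_Integration.integral_add) (intro integrable_mult_right ii | simp only: integral_mult_right_zero I_def vol(2)[OF r(2) Tn(1)[OF n]])+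
      also have "(LINT z|lebesgue. \<mu> powr p * (up z * a (T n) z powr p) + ?L * indicator (?\<Omega> ?\<rho> (T n)) z) = \<mu> powr p * X n + ?L * (V * ?\<rho> powr N * T n)"
        by (subst Bochner_Integration.integral_add) (intro integrable_mult_right ii | simp only: integral_mult_right_zero X_def vol(2)[OF r(2) Tn(1)[OF n]])+
      finally show ?thesis .
    qed
    finally have 1: "I ?\<rho> (T n) + U ?\<rho> (T n)
      \<le> (1/2) * I ?\<rho> (T n) + ?M * (V * ?\<rho> powr N * T n) + (\<mu> powr p * X n + ?L * (V * ?\<rho> powr N * T n))" .
    \<comment> \<open>Compared with \<open>scale\<close>, the extra factor \<open>B\<close> enters
      as \<open>N\<close> through the volume and as \<open>- 2 * s * q\<close> through the
      operator.\<close>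
    have 2: "?M * (V * ?\<rho> powr N * T n) \<le> C1 * B powr (N - 2 * s * q)"
    proof -
      have "?M = (2 powr (1 / p) * (real k * C) * (B powr (- 2 * s) * real n powr (- 2 * s))) powr q"
        unfolding powr_mult[of B "real n"] by (simp only: mult_ac)
      then have M: "?M = (2 powr (1 / p) * (real k * C)) powr q * ((B powr (- 2 * s)) powr q * (real n powr (- 2 * s)) powr q)"
        by (simp only: powr_mult)
      have "?M * (V * ?\<rho> powr N * T n) = C1 * ((B powr (- 2 * s)) powr q * B powr N) * (real n powr N * T n * (real n powr (- 2 * s)) powr q)"
        unfolding M C1_def powr_mult[of B "real n" N] by (simp only: mult_ac)
      also have "\<dots> \<le> C1 * ((B powr (- 2 * s)) powr q * B powr N) * 1"
        using C1 by (intro mult_left_mono scale n) auto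
      also have "(B powr (- 2 * s)) powr q * B powr N = B powr (N - 2 * s * q)"
        unfolding powr_powr powr_add[symmetric] by simp
      finally show ?thesis by simp
    qed
    \<comment> \<open>The time term sees \<open>B\<close> only through the volume, so it grows like
      \<open>B powr N\<close>, which \<open>\<mu>\<close> has to compensate.\<close>
    have 3: "?L * (V * ?\<rho> powr N * T n) \<le> (real k / \<mu>) powr q * V * B powr N"
    proof -
      have "T n = real n powr (2 * s)" by (simp add: T_def)
      then have Ti: "1 / T n = real n powr (- 2 * s)" by (simp add: powr_minus_divide[of _ "2 * s"])
      have "real k / (\<mu> * T n) = (real k / \<mu>) * (real n powr (- 2 * s))" unfolding Ti[symmetric] by simp
      then have L: "?L = (real k / \<mu>) powr q * (real n powr (- 2 * s)) powr q" by (simp only: powr_mult)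
      have "?L * (V * ?\<rho> powr N * T n) = (real k / \<mu>) powr q * V * B powr N * (real n powr N * T n * (real n powr (- 2 * s)) powr q)"
        unfolding L powr_mult[of B "real n" N] by (simp only: mult_ac)
      also have "\<dots> \<le> (real k / \<mu>) powr q * V * B powr N * 1"
        using V0 by (intro mult_left_mono scale n) auto
      finally show ?thesis by simp
    qed
    show ?thesis using 1 2 3 I0[of ?\<rho> "T n"] by linarith
  qed

  \<comment> \<open>Vanishing of the initial datum\<close>
  obtain C0 where C0: "AE x in lebesgue. \<bar>u0 x\<bar> \<le> C0" using u0(1) by (auto simp: Linf_def)
  have u0m [measurable]: "u0 \<in> borel_measurable lebesgue" using u0(1) by (simp add: Linf_def)
  have tx [measurable]: "(\<lambda>x. tfun k \<rho> T (x, 0)) \<in> borel_measurable (lebesgue :: 'a measure)" for \<rho> T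
  proof -
    have [measurable]: "flat (real k) 0 \<in> borel_measurable borel" using k by (intro borel_measurable_flat) simp
    have "(\<lambda>x::'a. tfun k \<rho> T (x, 0)) \<in> borel_measurable lborel" unfolding tfun_def fst_conv snd_conv by measurable
    then show ?thesis by (rule measurable_completion)
  qed
  have ui: "integrable lebesgue (\<lambda>x. u0 x * tfun k \<rho> T (x, 0))" if \<rho>: "\<rho> > 0" for \<rho> T
  proof (rule Bochner_Integration.integrable_bound)
    show "integrable lebesgue (\<lambda>x::'a. C0 * indicator (cball 0 \<rho>) x)"
      by (intro integrable_mult_right integrable_real_indicator) (use emeasure_lborel_cball_finite[of "0::'a" \<rho>] in auto)
    show "AE x in lebesgue. norm (u0 x * tfun k \<rho> T (x, 0)) \<le> norm (C0 * indicator (cball 0 \<rho>) x)"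
      using C0
    proof eventually_elim
      case (elim x)
      show ?case
      proof (cases "norm x \<le> \<rho>")
        case True
        have "\<bar>u0 x\<bar> * tfun k \<rho> T (x, 0) \<le> C0 * 1" using elim by (intro mult_mono tfun_le_1 tfun_nonneg) auto
        then show ?thesis using True elim tfun_nonneg[of k \<rho> T "(x, 0)"] by (simp add: abs_mult)
      next
        case False
        then have "(norm x / \<rho>)\<^sup>2 \<ge> 1" using \<rho> by (auto intro!: one_le_power)
        then have "tfun k \<rho> T (x, 0) = 0" by (simp add: tfun_def flat_def)
        then show ?thesis by simp
      qed
    qed
  qed measurable
  \<comment> \<open>For fixed \<open>B\<close> and \<open>\<mu>\<close> the term with
    \<open>X\<close> disappears as \<open>n\<close> grows, while Fatou's lemma passes to the limit
    on the left. The shift to \<open>Suc n\<close> keeps \<open>n \<ge> 1\<close>.\<close>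
  have bound: "(\<integral>\<^sup>+x. ennreal (u0 x * c) \<partial>lebesgue) \<le> ennreal (C1 * B powr (N - 2 * s * q) + (real k / \<mu>) powr q * V * B powr N)"
    if B: "B \<ge> 1" and \<mu>: "\<mu> > 0" for B \<mu>
  proof -
    let ?\<rho> = "\<lambda>n. B * real (Suc n)"
    let ?T = "\<lambda>n. T (Suc n)"
    let ?b = "\<lambda>n. C1 * B powr (N - 2 * s * q) + \<mu> powr p * X (Suc n) + (real k / \<mu>) powr q * V * B powr N"
    have rl: "filterlim ?\<rho> at_top sequentially"
      using B by (intro filterlim_tendsto_pos_mult_at_top[OF tendsto_const] filterlim_compose[OF filterlim_real_sequentially filterlim_Suc]) auto
    have lim: "(\<lambda>n. u0 x * tfun k (?\<rho> n) (?T n) (x, 0)) \<longlonglongrightarrow> u0 x * c" for x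
      unfolding c_def using k by (intro tendsto_mult_left tfun_limit rl filterlim_compose[OF Tlim filterlim_Suc]) auto
    have "(\<integral>\<^sup>+x. ennreal (u0 x * c) \<partial>lebesgue) = (\<integral>\<^sup>+x. liminf (\<lambda>n. ennreal (u0 x * tfun k (?\<rho> n) (?T n) (x, 0))) \<partial>lebesgue)"
      by (intro nn_integral_cong lim_imp_Liminf[symmetric] tendsto_ennrealI lim) auto
    also have "\<dots> \<le> liminf (\<lambda>n. \<integral>\<^sup>+x. ennreal (u0 x * tfun k (?\<rho> n) (?T n) (x, 0)) \<partial>lebesgue)"
      by (rule nn_integral_liminf) measurable
    also have "\<dots> \<le> liminf (\<lambda>n. ennreal (?b n))"
    proof (rule Liminf_mono, rule always_eventually, rule allI)
      fix n
      have "(\<integral>\<^sup>+x. ennreal (u0 x * tfun k (?\<rho> n) (?T n) (x, 0)) \<partial>lebesgue) = ennreal (U (?\<rho> n) (?T n))"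
        unfolding U_def using B u0(2) by (intro nn_integral_eq_integral ui) (auto simp: tfun_nonneg elim!: AE_mp)
      also have "\<dots> \<le> ennreal (?b n)" using B \<mu> by (intro ennreal_leI Ub) auto
      finally show "(\<integral>\<^sup>+x. ennreal (u0 x * tfun k (?\<rho> n) (?T n) (x, 0)) \<partial>lebesgue) \<le> ennreal (?b n)" .
    qed
    also have "liminf (\<lambda>n. ennreal (?b n)) = ennreal (C1 * B powr (N - 2 * s * q) + (real k / \<mu>) powr q * V * B powr N)"
    proof -
      have "?b \<longlonglongrightarrow> C1 * B powr (N - 2 * s * q) + \<mu> powr p * 0 + (real k / \<mu>) powr q * V * B powr N"
        by (intro tendsto_intros X0)
      then show ?thesis by (intro lim_imp_Liminf tendsto_ennrealI) auto
    qed
    finally show ?thesis .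
  qed
  have "(\<integral>\<^sup>+x. ennreal (u0 x * c) \<partial>lebesgue) \<le> ennreal (C1 * real (Suc n) powr (- 2 * s) + real k powr q * V * real (Suc n) powr (- 1))" for n
  proof -
    let ?B = "real (Suc n)"
    \<comment> \<open>With this \<open>\<mu>\<close> the growth \<open>B powr N\<close> of the time
      term becomes \<open>B powr (- 1)\<close>.\<close>
    let ?l = "?B powr ((N + 1) / q)"
    have "(real k / ?l) powr q = real k powr q / ?l powr q" by (rule powr_divide)
    also have "?l powr q = ?B powr (N + 1)" using q by (simp add: powr_powr)
    finally have "(real k / ?l) powr q * V * ?B powr N = real k powr q * V * (?B powr N / ?B powr (N + 1))" by simp
    also have "?B powr N / ?B powr (N + 1) = ?B powr (- 1)" unfolding powr_diff[symmetric] by simp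
    finally have l: "(real k / ?l) powr q * V * ?B powr N = real k powr q * V * ?B powr (- 1)" .
    \<comment> \<open>By \<open>e\<close> the exponent is at most \<open>- 2 * s\<close>, hence
      strictly negative even in the critical case.\<close>
    have "?B powr (N - 2 * s * q) \<le> ?B powr (- 2 * s)" using e by (intro powr_mono) auto
    then have "C1 * ?B powr (N - 2 * s * q) \<le> C1 * ?B powr (- 2 * s)" using C1 by (rule mult_left_mono)
    then have "ennreal (C1 * ?B powr (N - 2 * s * q) + (real k / ?l) powr q * V * ?B powr N) \<le> ennreal (C1 * ?B powr (- 2 * s) + real k powr q * V * ?B powr (- 1))"
      unfolding l by (intro ennreal_leI) simp
    then show ?thesis using bound[of ?B ?l] by (auto intro: order_trans)
  qed
  moreover have "(\<lambda>n. ennreal (C1 * real (Suc n) powr (- 2 * s) + real k powr q * V * real (Suc n) powr (- 1))) \<longlonglongrightarrow> ennreal (C1 * 0 + real k powr q * V * 0)"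
  proof (intro tendsto_ennrealI tendsto_intros)
    show "(\<lambda>n. real (Suc n) powr (- 2 * s)) \<longlonglongrightarrow> 0" using s by real_asymp
    show "(\<lambda>n. real (Suc n) powr (- 1)) \<longlonglongrightarrow> 0" by real_asymp
  qed
  ultimately have "(\<integral>\<^sup>+x. ennreal (u0 x * c) \<partial>lebesgue) \<le> ennreal (C1 * 0 + real k powr q * V * 0)"
    by (intro LIMSEQ_le_const) auto
  then have "(\<integral>\<^sup>+x. ennreal (u0 x * c) \<partial>lebesgue) = 0" by simp
  then have "AE x in lebesgue. ennreal (u0 x * c) = 0" by (subst (asm) nn_integral_0_iff_AE) auto
  with u0(2) show ?thesis
  proof eventually_elim
    case (elim x)
    then have "u0 x * c \<le> 0" by (simp add: ennreal_eq_0_iff)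
    then show ?case using elim(1) c by (simp add: mult_le_0_iff)
  qed
qed

theorem theorem3p3:
  fixes s p :: real
  assumes "0 < s" and "s < 1" and "1 < p"
  shows "(p \<le> 1 + 2 * s / real DIM('a::euclidean_space) \<longrightarrow>
           (\<forall>u0 :: 'a \<Rightarrow> real.
              u0 \<in> Linf lebesgue \<and> (AE x in lebesgue. 0 \<le> u0 x) \<and> \<not> (AE x in lebesgue. u0 x = 0) \<longrightarrow>
              \<not> (\<exists>u. very_weak_solution s p u0 u)))
       \<and> (p > 1 + 2 * s / real DIM('a) \<longrightarrow>
           (\<exists>\<delta>\<^sub>0>0. \<exists>\<tau>\<^sub>0>0. \<forall>u0 :: 'a \<Rightarrow> real.
              u0 \<in> Linf lebesgue \<and> (AE x in lebesgue. 0 \<le> u0 x) \<and>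
              (AE x in lebesgue. u0 x < \<delta>\<^sub>0 * heat_kernel s \<tau>\<^sub>0 x) \<longrightarrow>
              (\<exists>u. very_weak_solution s p u0 u)))"
  using nonexistence[OF assms(1,2,3)] global_existence[OF assms(1,2,3)] by blast

end
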